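(* There exist an infinite set $N$ of positive integers, an algorithm, and a function $\eta: N\to\mathbb{R}$ with $\eta(n)\to 0$ as $n\to\infty$ in $N$, such that for every $n\in N$ the algorithm, on input $n$, constructs a lattice $\Lambda\subset\mathbb{R}^n$ whose density satisfies $$\Delta(\Lambda)\geq \frac{0.89\, n\log\log n}{2^n},$$ using at most $\exp\big(1.5\, n\log n\,(1+\eta(n))\big)$ binary operations.
   Context: A lattice in a Euclidean space $E$ of dimension $n$ is a discrete free $\mathbb{Z}$-submodule of rank $n$. $\mathrm{Vol}(\Lambda)$ is the volume of a fundamental region of $\Lambda$, $\mu_\Lambda=\min\{\|x\| : x\in\Lambda\setminus\{0\}\}$ its minimum, $B(r)$ the closed ball of radius $r$ centered at $0$, and the (sphere packing) density of $\Lambda$ is $\Delta(\Lambda)=\frac{\mathrm{Vol}(B(\mu_\Lambda))}{2^n\,\mathrm{Vol}(\Lambda)}$. Constructing a lattice means outputting an exact finite description of it up to isometry, e.g. the Gram matrix of a $\mathbb{Z}$-basis, with exactly encoded entries. *)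

theory Defs
  imports "HOL-Analysis.Analysis" "Jordan_Normal_Form.Matrix"
begin

hide_const (open) Finite_Cartesian_Product.vec
unbundle no inner_syntax
unbundle no vec_syntax

section \<open>Lattices and their packing density\<close>

text \<open>
  The ambient space is \<open>carrier_vec n\<close>, with the dimension \<open>n\<close> a term, and the standard inner
  product \<open>scalar_prod\<close>.
\<close>

definition norm_vec :: "real vec \<Rightarrow> real" where
  "norm_vec x = sqrt (x \<bullet> x)"

text \<open>
  Lebesgue measure (on Borel sets): the product of \<open>n\<close> copies of \<open>lborel\<close>, transported along the
  bijection \<open>vec n\<close> from \<open>{..<n} \<rightarrow>\<^sub>E UNIV\<close> onto \<open>carrier_vec n\<close>.
\<close>

definition lborel_vec :: "nat \<Rightarrow> real vec measure" where
  "lborel_vec n = embed_measure (\<Pi>\<^sub>M i\<in>{..<n}. lborel) (vec n)"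

definition cball_vec :: "nat \<Rightarrow> real \<Rightarrow> real vec set" where
  "cball_vec n r = {x \<in> carrier_vec n. norm_vec x \<le> r}"

definition discrete_vecs :: "real vec set \<Rightarrow> bool" where
  "discrete_vecs L \<longleftrightarrow> (\<forall>x\<in>L. \<exists>e>0. \<forall>y\<in>L. y \<noteq> x \<longrightarrow> e \<le> norm_vec (y - x))"

text \<open>The columns of \<open>B\<close> are a basis of the \<open>\<int>\<close>-module \<open>L\<close>, which is thus free of rank \<open>n\<close>.\<close>

definition is_zbasis :: "nat \<Rightarrow> real vec set \<Rightarrow> real mat \<Rightarrow> bool" where
  "is_zbasis n L B \<longleftrightarrow> B \<in> carrier_mat n n \<and>
     L = {B *\<^sub>v map_vec real_of_int z | z. z \<in> carrier_vec n} \<and>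
     (\<forall>z\<in>carrier_vec n. B *\<^sub>v map_vec real_of_int z = 0\<^sub>v n \<longrightarrow> z = 0\<^sub>v n)"

definition is_lattice :: "nat \<Rightarrow> real vec set \<Rightarrow> bool" where
  "is_lattice n L \<longleftrightarrow> discrete_vecs L \<and> (\<exists>B. is_zbasis n L B)"

definition fundamental_region :: "nat \<Rightarrow> real vec set \<Rightarrow> real vec set \<Rightarrow> bool" where
  "fundamental_region n L F \<longleftrightarrow> F \<in> sets (lborel_vec n) \<and>
     (\<forall>x\<in>carrier_vec n. \<exists>!v. v \<in> L \<and> x - v \<in> F)"

text \<open>All fundamental regions of a lattice have the same volume.\<close>

definition covolume :: "nat \<Rightarrow> real vec set \<Rightarrow> real" where
  "covolume n L = (THE v. \<exists>F. fundamental_region n L F \<and> v = measure (lborel_vec n) F)"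

definition minimum :: "nat \<Rightarrow> real vec set \<Rightarrow> real" where
  "minimum n L = (LEAST r. \<exists>x \<in> L - {0\<^sub>v n}. r = norm_vec x)"

definition packing_density :: "nat \<Rightarrow> real vec set \<Rightarrow> real" where
  "packing_density n L = measure (lborel_vec n) (cball_vec n (minimum n L)) / (2 ^ n * covolume n L)"

section \<open>Algorithms and their number of binary operations\<close>

text \<open>
  An algorithm is a structured program acting on stacks of bits, all of them finite and finitely
  many occurring in each program.  Every elementary step pushes, pops or inspects a single bit and
  costs one binary operation.  As two stacks simulate a tape and a tape simulates a stack, running
  times agree with those of deterministic multitape Turing machines up to a constant factor that
  depends on the program only.
\<close>

type_synonym store = "nat \<Rightarrow> bool list"

datatype test = Nonempty nat | Top nat

text \<open>The top bit of an empty stack reads as \<open>False\<close>.\<close>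

fun holds :: "test \<Rightarrow> store \<Rightarrow> bool" where
  "holds (Nonempty r) s \<longleftrightarrow> s r \<noteq> []"
| "holds (Top r) s \<longleftrightarrow> s r \<noteq> [] \<and> hd (s r)"

datatype program =
    Skip
  | Push nat bool
  | Pop nat
  | Seq program program
  | Branch test program program
  | While test program

text \<open>\<open>exec P s t s'\<close>: started in \<open>s\<close>, \<open>P\<close> halts in \<open>s'\<close> after exactly \<open>t\<close> operations.\<close>

inductive exec :: "program \<Rightarrow> store \<Rightarrow> nat \<Rightarrow> store \<Rightarrow> bool" where
  Skip: "exec Skip s 1 s"
| Push: "exec (Push r b) s 1 (s(r := b # s r))"
| Pop: "exec (Pop r) s 1 (s(r := tl (s r)))"
| Seq: "exec P s t s' \<Longrightarrow> exec Q s' u s'' \<Longrightarrow> exec (Seq P Q) s (t + u) s''"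
| BranchT: "holds c s \<Longrightarrow> exec P s t s' \<Longrightarrow> exec (Branch c P Q) s (1 + t) s'"
| BranchF: "\<not> holds c s \<Longrightarrow> exec Q s t s' \<Longrightarrow> exec (Branch c P Q) s (1 + t) s'"
| WhileF: "\<not> holds c s \<Longrightarrow> exec (While c P) s 1 s"
| WhileT: "holds c s \<Longrightarrow> exec P s t s' \<Longrightarrow> exec (While c P) s' u s'' \<Longrightarrow>
    exec (While c P) s (1 + t + u) s''"

text \<open>Binary digits, least significant first.\<close>

fun bits :: "nat \<Rightarrow> bool list" where
  "bits n = (if n = 0 then [] else odd n # bits (n div 2))"

declare bits.simps [simp del]

text \<open>
  Self-delimiting codes: each digit of a natural number is preceded by \<open>True\<close>, and \<open>False\<close> marks
  the end.  An integer is a sign bit followed by the absolute value; a rational is its numerator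
  followed by its positive denominator, in lowest terms; a matrix is listed row by row.
\<close>

definition encode_nat :: "nat \<Rightarrow> bool list" where
  "encode_nat n = concat (map (\<lambda>b. [True, b]) (bits n)) @ [False]"

definition encode_int :: "int \<Rightarrow> bool list" where
  "encode_int k = (k < 0) # encode_nat (nat \<bar>k\<bar>)"

definition encode_rat :: "rat \<Rightarrow> bool list" where
  "encode_rat q = (case quotient_of q of (a, b) \<Rightarrow> encode_int a @ encode_nat (nat b))"

definition encode_mat :: "rat mat \<Rightarrow> bool list" where
  "encode_mat G = concat (map (\<lambda>i. concat (map (\<lambda>j. encode_rat (G $$ (i, j))) [0..<dim_col G]))
     [0..<dim_row G])"

text \<open>The input \<open>n\<close> is given in binary in stack 0, all other stacks being empty.\<close>

definition input :: "nat \<Rightarrow> store" where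
  "input n = (\<lambda>_. [])(0 := bits n)"

text \<open>
  The output, in stack 1, is the Gram matrix of some \<open>\<int>\<close>-basis, with rational entries; it
  determines the lattice up to isometry.
\<close>

definition constructs_lattice :: "program \<Rightarrow> nat \<Rightarrow> nat \<Rightarrow> real vec set \<Rightarrow> bool" where
  "constructs_lattice P n t L \<longleftrightarrow> is_lattice n L \<and>
     (\<exists>B G s. is_zbasis n L B \<and> map_mat real_of_rat G = transpose_mat B * B \<and>
        exec P (input n) t s \<and> s 1 = encode_mat G)"

text \<open>Sanity checks: executions are deterministic and the output can be decoded.\<close>

lemma exec_deterministic:
  "exec P s t s' \<Longrightarrow> exec P s u s'' \<Longrightarrow> u = t \<and> s'' = s'"
proof (induction arbitrary: u s'' rule: exec.induct)
  case (Skip s)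
  then show ?case by (cases rule: exec.cases) simp_all
next
  case (Push r b s)
  then show ?case by (cases rule: exec.cases) simp_all
next
  case (Pop r s)
  then show ?case by (cases rule: exec.cases) simp_all
next
  case (Seq P s t s1 Q t' s2)
  from Seq.prems obtain v v' r where r: "exec P s v r" "exec Q r v' s''" "u = v + v'"
    by (cases rule: exec.cases) auto
  from Seq.IH(1)[OF r(1)] have "v = t" "r = s1" by auto
  with Seq.IH(2)[of v' s''] r show ?case by simp
next
  case (BranchT c s P t s' Q)
  from BranchT.prems BranchT.hyps(1) obtain v where v: "exec P s v s''" "u = 1 + v"
    by (cases rule: exec.cases) auto
  with BranchT.IH[OF v(1)] show ?case by simp
next
  case (BranchF c s Q t s' P)
  from BranchF.prems BranchF.hyps(1) obtain v where v: "exec Q s v s''" "u = 1 + v"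
    by (cases rule: exec.cases) auto
  with BranchF.IH[OF v(1)] show ?case by simp
next
  case (WhileF c s P)
  from WhileF.prems show ?case
    by (cases rule: exec.cases) (use WhileF.hyps in simp_all)
next
  case (WhileT c s P t s1 t' s2)
  from WhileT.prems WhileT.hyps(1)
  obtain v v' r where r: "exec P s v r" "exec (While c P) r v' s''" "u = 1 + v + v'"
    by (cases rule: exec.cases) auto
  from WhileT.IH(1)[OF r(1)] have "v = t" "r = s1" by auto
  with WhileT.IH(2)[of v' s''] r show ?case by simp
qed

lemma bits_inject: "bits m = bits n \<Longrightarrow> m = n"
proof (induction m arbitrary: n rule: less_induct)
  case (less m)
  show ?case
  proof (cases "m = 0 \<or> n = 0")
    case True
    then show ?thesis using less.prems by (auto simp: bits.simps[of m] bits.simps[of n] split: if_splits)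
  next
    case False
    then have "odd m = odd n" and "bits (m div 2) = bits (n div 2)"
      using less.prems by (simp_all add: bits.simps[of m] bits.simps[of n])
    moreover from this(2) False have "m div 2 = n div 2" by (intro less.IH) auto
    ultimately show ?thesis by (metis bit_eq_rec)
  qed
qed

lemma encode_nat_prefix_free:
  assumes "encode_nat m @ xs = encode_nat n @ ys"
  shows "m = n \<and> xs = ys"
proof -
  have "us = vs \<and> xs = ys"
    if "concat (map (\<lambda>b. [True, b]) us) @ False # xs = concat (map (\<lambda>b. [True, b]) vs) @ False # ys"
    for us vs
    using that
  proof (induction us arbitrary: vs)
    case Nil
    then show ?case by (cases vs) auto
  next
    case (Cons u us)
    then show ?case by (cases vs) auto
  qed
  from this[of "bits m" "bits n"] assms have "bits m = bits n" "xs = ys"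
    by (simp_all add: encode_nat_def)
  then show ?thesis using bits_inject by blast
qed

lemma encode_rat_prefix_free:
  assumes "encode_rat p @ xs = encode_rat q @ ys"
  shows "p = q \<and> xs = ys"
proof -
  obtain a b c d where pq: "quotient_of p = (a, b)" "quotient_of q = (c, d)"
    by (metis surj_pair)
  then have pos: "b > 0" "d > 0" using quotient_of_denom_pos by blast+
  have "(a < 0) = (c < 0)"
    and *: "encode_nat (nat \<bar>a\<bar>) @ encode_nat (nat b) @ xs =
         encode_nat (nat \<bar>c\<bar>) @ encode_nat (nat d) @ ys"
    using assms by (auto simp: encode_rat_def encode_int_def pq)
  moreover from encode_nat_prefix_free[OF *]
  have "nat \<bar>a\<bar> = nat \<bar>c\<bar>" and **: "encode_nat (nat b) @ xs = encode_nat (nat d) @ ys" by auto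
  moreover from encode_nat_prefix_free[OF **] have "nat b = nat d" "xs = ys" by auto
  ultimately have "a = c" "b = d" using pos by linarith+
  then show ?thesis using pq \<open>xs = ys\<close> by (metis quotient_of_inject)
qed

lemma encode_mat_inject:
  assumes "G \<in> carrier_mat n m" "H \<in> carrier_mat n m" "encode_mat G = encode_mat H"
  shows "G = H"
proof -
  have row: "(\<forall>x\<in>set is. f x = g x) \<and> xs = ys"
    if "concat (map f is) @ xs = concat (map g is) @ ys"
      and "\<And>x xs ys. x \<in> set is \<Longrightarrow> f x @ xs = g x @ ys \<Longrightarrow> f x = g x \<and> xs = ys"
    for f g :: "nat \<Rightarrow> bool list" and "is" xs ys
    using that
  proof (induction "is")
    case (Cons i js)
    have "f i @ (concat (map f js) @ xs) = g i @ (concat (map g js) @ ys)"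
      using Cons.prems(1) by simp
    then have "f i = g i" "concat (map f js) @ xs = concat (map g js) @ ys"
      using Cons.prems(2)[of i] by (meson list.set_intros(1))+
    moreover from this(2) have "(\<forall>x\<in>set js. f x = g x) \<and> xs = ys"
      by (rule Cons.IH) (rule Cons.prems(2), simp_all)
    ultimately show ?case by simp
  qed simp
  define f where "f = (\<lambda>M i. concat (map (\<lambda>j. encode_rat (M $$ (i, j))) [0..<m]))"
  have inner: "(\<forall>j<m. G $$ (i, j) = H $$ (i, j)) \<and> xs = ys" if "f G i @ xs = f H i @ ys" for i xs ys
  proof -
    have *: "(\<forall>j\<in>set [0..<m]. encode_rat (G $$ (i, j)) = encode_rat (H $$ (i, j))) \<and> xs = ys"
      using that unfolding f_def
      by (rule row) (auto dest: encode_rat_prefix_free)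
    have eq: "p = q" if "encode_rat p = encode_rat q" for p q
      using encode_rat_prefix_free[of p "[]" q "[]"] that by simp
    show ?thesis using * by (intro conjI allI impI eq) simp_all
  qed
  have "concat (map (f G) [0..<n]) @ [] = concat (map (f H) [0..<n]) @ []"
    using assms by (simp add: encode_mat_def f_def)
  then have "(\<forall>i\<in>set [0..<n]. f G i = f H i) \<and> [] = ([] :: bool list)"
  proof (rule row)
    fix i xs ys
    assume *: "f G i @ xs = f H i @ ys"
    then have "\<forall>j<m. G $$ (i, j) = H $$ (i, j)" and "xs = ys" using inner by blast+
    then show "f G i = f H i \<and> xs = ys" using * by simp
  qed
  then have "G $$ (i, j) = H $$ (i, j)" if "i < n" "j < m" for i j
    using inner[of i "[]" "[]"] that by auto
  then show ?thesis using assms(1,2) by (intro eq_matI) auto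
qed

end

theory Submission
 imports Defs "HOL-Number_Theory.Number_Theory" "HOL-Computational_Algebra.Squarefree"
  "HOL-Real_Asymp.Real_Asymp" "Jordan_Normal_Form.Char_Poly"
begin

text \<open>
 Let \<open>m\<close> be squarefree and \<open>n = 2 \<phi>(m)\<close>.  A copy of \<open>\<int>[\<zeta>\<^sub>m]\<close> lives inside the \<open>m\<close>-periodic functions
 on \<open>\<int>\<close>, where the shift acts as multiplication by \<open>\<zeta>\<^sub>m\<close> and as an isometry.  The lattices of all
 \<open>(x, (T / N) w)\<close> with \<open>w \<equiv> a x (mod N)\<close> are invariant under the shift, so their short vectors come
 in orbits of size \<open>m\<close>.  Averaging over the multipliers \<open>a\<close> shows that, if every one of these lattices
 had a nonzero vector of length at most \<open>r\<close>, then \<open>m\<close> copies of their common volume would fit into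
 a ball of radius slightly more than \<open>r\<close>; hence some \<open>a\<close> gives a density of about \<open>m / 2\<^sup>n\<close>.
 By a one-sided Mertens theorem \<open>m / \<phi>(m)\<close> exceeds a constant times \<open>log log n\<close> infinitely often, with a
 constant close enough to \<open>exp \<gamma>\<close>, and \<open>exp \<gamma> / 2 > 0.89\<close>.  There are \<open>N ^ (n / 2)\<close> multipliers, where
 \<open>N\<close> is roughly \<open>n\<close> to the power 2.5, and about \<open>n ^ (n / 4)\<close> vectors to inspect for each of them, which
 accounts for the exponent \<open>1.5 n log n\<close>.
\<close>

section \<open>Lattice tilings and equidistribution\<close>

text \<open>The average over multipliers is an integral over a real torus, and the grid of mesh 1/N
  enters as an error. Moving a vector within a grid cell changes its squared norm by a linear term
  of mean zero and a small quadratic one; the variance of the former decides how fine the grid has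
  to be, and this fixes the exponent 2.5. The multiplier must act bijectively on the real span of
  any nonzero \<open>x\<close>. This expresses that \<int>[\<zeta>] has no zero divisors and is
  proved by Landau's argument. Time permits the enumeration of \<open>x\<close> alone:
  \<open>T\<close> is so large that \<open>w\<close> either is the centred residue of its class or
  makes the vector long at once. A short \<open>x\<close> has squared norm about n^2, so a box
  around all of them has n^(n/2) points; dividing each coordinate by about sqrt n and writing the
  quotients in unary brings this down to n^(n/4). The program computes with natural numbers; the
  real triangular factor of the Gram matrix occurs in proofs only. The gap between 0.89 and exp
  \<gamma> / 2 = 0.8905... is shared out by the constants 1.7804, 0.8901 and 0.9999.\<close>

abbreviation leb :: "nat set => (nat => real) measure" where
 "leb I \<equiv> Pi\<^sub>M I (%_. lborel)"

interpretation leb: product_sigma_finite "%_::nat. lborel :: real measure"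
 by standard

text \<open>Points are extensional functions on \<open>I\<close>, as in the space of the product
  measure, so sums and negatives have to be cut back to \<open>I\<close>.\<close>

definition padd :: "nat set => (nat => real) => (nat => real) => nat => real" where
 "padd I x y = (\<lambda>i\<in>I. x i + y i)"

definition pneg :: "nat set => (nat => real) => nat => real" where
 "pneg I x = (\<lambda>i\<in>I. - x i)"

lemma space_leb: "space (leb I) = I \<rightarrow>\<^sub>E UNIV"
 by (simp add: space_PiM)

lemma padd_space [simp]: "padd I x y : I \<rightarrow>\<^sub>E UNIV"
 and pneg_space [simp]: "pneg I x : I \<rightarrow>\<^sub>E UNIV"
 by (auto simp: padd_def pneg_def)

lemma padd_pneg: "x : I \<rightarrow>\<^sub>E UNIV ==> padd I (padd I x v) (pneg I v) = x"
 and padd_pneg': "x : I \<rightarrow>\<^sub>E UNIV ==> padd I (padd I x (pneg I v)) v = x"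
 and pneg_pneg: "x : I \<rightarrow>\<^sub>E UNIV ==> pneg I (pneg I x) = x"
 by (auto simp: padd_def pneg_def PiE_def extensional_def restrict_def fun_eq_iff)

lemma padd_assoc: "padd I (padd I x y) z = padd I x (padd I y z)"
 and padd_commute: "padd I x y = padd I y x"
 by (auto simp: padd_def fun_eq_iff add.assoc)

lemma measurable_padd [measurable]: "padd I c : measurable (leb I) (leb I)"
 unfolding padd_def by measurable

lemma measurable_padd2:
 assumes "f : measurable M (leb I)" "g : measurable M (leb I)"
 shows "(%x. padd I (f x) (g x)) : measurable M (leb I)"
proof -
 have "(%x. f x i) : borel_measurable M" "(%x. g x i) : borel_measurable M" if "i : I" for i
  using measurable_compose[OF assms(1) measurable_component_singleton[OF that]]
   measurable_compose[OF assms(2) measurable_component_singleton[OF that]] by simp_all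
 thus ?thesis unfolding padd_def by (intro measurable_restrict) simp
qed

text \<open>Boxes determine the product measure, and on a box this is translation invariance in each
  coordinate.\<close>

lemma distr_padd:
 assumes "finite I"
 shows "distr (leb I) (leb I) (padd I c) = leb I"
proof (rule leb.PiM_eqI[OF assms])
 fix A :: "nat => real set" assume A: "!!i. i : I ==> A i : sets lborel"
 have vim: "(+) (c i) -` A i : sets lborel" if "i : I" for i
 proof -
  have "(+) (c i) -` A i \<inter> space borel : sets borel"
   by (rule measurable_sets[of _ _ borel]) (use A[OF that] in auto)
  thus ?thesis by simp
 qed
 have "padd I c -` Pi\<^sub>E I A \<inter> space (leb I) = Pi\<^sub>E I (%i. (+) (c i) -` A i)"
  by (auto simp: space_leb padd_def PiE_def Pi_def)
 hence "emeasure (distr (leb I) (leb I) (padd I c)) (Pi\<^sub>E I A) = emeasure (leb I) (Pi\<^sub>E I (%i. (+) (c i) -` A i))"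
  using A assms by (subst emeasure_distr) (auto intro: sets_PiM_I_finite)
 also have "... = (\<Prod>i\<in>I. emeasure lborel ((+) (c i) -` A i))"
  using vim assms by (intro leb.emeasure_PiM) auto
 also have "... = (\<Prod>i\<in>I. emeasure lborel (A i))"
 proof (rule prod.cong[OF refl])
  fix i assume "i : I"
  have "emeasure lborel (A i) = emeasure (distr lborel borel ((+) (c i))) (A i)"
   by (simp add: lborel_distr_plus)
  also have "... = emeasure lborel ((+) (c i) -` A i)"
   using A[OF \<open>i : I\<close>] by (subst emeasure_distr) auto
  finally show "emeasure lborel ((+) (c i) -` A i) = emeasure lborel (A i)" by simp
 qed
 finally show "emeasure (distr (leb I) (leb I) (padd I c)) (Pi\<^sub>E I A) = (\<Prod>i\<in>I. emeasure lborel (A i))" .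
qed auto

lemma nn_integral_padd:
 assumes "finite I" "f : borel_measurable (leb I)"
 shows "nn_integral (leb I) (%x. f (padd I c x)) = nn_integral (leb I) (%x. f x)"
proof -
 have "nn_integral (leb I) (%x. f x) = nn_integral (distr (leb I) (leb I) (padd I c)) (%x. f x)"
  by (simp add: distr_padd[OF assms(1)])
 also have "... = nn_integral (leb I) (%x. f (padd I c x))"
  using assms by (subst nn_integral_distr) auto
 finally show ?thesis by simp
qed

text \<open>Translates are formed with \<open>padd\<close>; closure of \<open>L\<close> under
  \<open>pneg\<close> reconciles this with the subtraction in
  \<open>fundamental_region\<close>.\<close>

definition tiles :: "nat set => (nat => real) set => (nat => real) set => bool" where
 "tiles I L F \<longleftrightarrow> finite I & F : sets (leb I) & L \<subseteq> I \<rightarrow>\<^sub>E UNIV & countable L & (ALL v:L. pneg I v : L) &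
   (ALL x:I \<rightarrow>\<^sub>E UNIV. EX! v. v : L & padd I x v : F)"

lemma tiles_count:
 assumes "tiles I L F" "x : I \<rightarrow>\<^sub>E UNIV"
 shows "nn_integral (count_space L) (%v. indicator F (padd I x v)) = (1::ennreal)"
proof -
 from assms have ex: "EX! v. v : L & padd I x v : F" by (simp add: tiles_def)
 then obtain w where w: "w : L" "padd I x w : F" by blast
 with ex have u: "padd I x v : F \<longleftrightarrow> v = w" if "v : L" for v using that by blast
 have "nn_integral (count_space L) (%v. indicator F (padd I x v)) = nn_integral (count_space L) (%v. indicator {w} v)"
  by (intro nn_integral_cong) (simp add: indicator_def u)
 also have "... = 1" using w by (subst nn_integral_indicator) auto
 finally show ?thesis .
qed

lemma tiles_count_neg:
 assumes "tiles I L F" "x : I \<rightarrow>\<^sub>E UNIV"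
 shows "nn_integral (count_space L) (%v. indicator F (padd I x (pneg I v))) = (1::ennreal)"
proof -
 have neg: "pneg I (pneg I v) = v" "pneg I v : L" if "v : L" for v
  using assms(1) that by (auto simp: tiles_def pneg_pneg)
 have "bij_betw (pneg I) L L"
  by (rule bij_betwI[where g = "pneg I"]) (use neg in auto)
 from nn_integral_bij_count_space[OF this, of "%v. indicator F (padd I x v)"]
 show ?thesis using tiles_count[OF assms] by simp
qed

text \<open>The substitution x -> x - v moves the sum from \<open>f\<close> to the translates of
  \<open>F\<close>, which cover every point exactly once.\<close>

lemma tiles_unfold:
 assumes t: "tiles I L F" and f: "f : borel_measurable (leb I)"
 shows "nn_integral (leb I) (%x. indicator F x * nn_integral (count_space L) (%v. f (padd I x v))) = nn_integral (leb I) (%x. f x)"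
proof -
 have I: "finite I" and F [measurable]: "F : sets (leb I)" and L: "countable L" using t by (auto simp: tiles_def)
 have 1: "(%x. padd I x v) : measurable (leb I) (leb I)" for v
  unfolding padd_commute[of I _ v] by (rule measurable_padd)
 note f1 = measurable_compose[OF 1 f]
 have F1: "(%x. indicator F (padd I x v) :: ennreal) : borel_measurable (leb I)" for v
  by (rule measurable_compose[OF 1]) simp
 have "nn_integral (leb I) (%x. indicator F x * nn_integral (count_space L) (%v. f (padd I x v)))
   = nn_integral (leb I) (%x. (nn_integral (count_space L) (%v. indicator F x * f (padd I x v))))"
  by (simp add: nn_integral_cmult)
 also have "... = nn_integral (count_space L) (%v. (nn_integral (leb I) (%x. indicator F x * f (padd I x v))))"
  by (rule nn_integral_count_space_nn_integral[OF L]) (use f1 in measurable)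
 also have "... = nn_integral (count_space L) (%v. (nn_integral (leb I) (%x. indicator F (padd I x (pneg I v)) * f x)))"
 proof (rule nn_integral_cong)
  fix v assume "v : space (count_space L)"
  have "nn_integral (leb I) (%x. indicator F (padd I x (pneg I v)) * f x) =
    nn_integral (leb I) (%x. indicator F (padd I (padd I v x) (pneg I v)) * f (padd I v x))"
   by (rule nn_integral_padd[OF I, symmetric]) (use F1 f in measurable)
  also have "... = nn_integral (leb I) (%x. indicator F x * f (padd I x v))"
  proof (rule nn_integral_cong)
   fix x assume "x : space (leb I)"
   hence "padd I (padd I v x) (pneg I v) = x" using padd_pneg[of x I v] by (simp add: padd_commute space_leb)
   thus "indicator F (padd I (padd I v x) (pneg I v)) * f (padd I v x) = indicator F x * f (padd I x v)"
    by (simp add: padd_commute[of I v])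
  qed
  finally show "nn_integral (leb I) (%x. indicator F x * f (padd I x v)) =
    nn_integral (leb I) (%x. indicator F (padd I x (pneg I v)) * f x)" by simp
 qed
 also have "... = nn_integral (leb I) (%x. (nn_integral (count_space L) (%v. indicator F (padd I x (pneg I v)) * f x)))"
  by (rule nn_integral_count_space_nn_integral[OF L, symmetric]) (use F1 f in measurable)
 also have "... = nn_integral (leb I) (%x. f x)"
  by (intro nn_integral_cong) (simp add: nn_integral_multc tiles_count_neg[OF t] space_leb)
 finally show ?thesis .
qed

text \<open>Unfold the indicator of \<open>F'\<close> over \<open>F\<close>: each point of
  \<open>F\<close> has exactly one translate in \<open>F'\<close>, so the inner sum is 1. This makes
  the covolume well defined.\<close>

lemma tiles_measure_eq:
 assumes t: "tiles I L F" and t': "tiles I L F'"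
 shows "emeasure (leb I) F = emeasure (leb I) F'"
proof -
 have F: "F : sets (leb I)" "F' : sets (leb I)" using t t' by (auto simp: tiles_def)
 have "emeasure (leb I) F' = nn_integral (leb I) (%x. indicator F x * nn_integral (count_space L) (%v. indicator F' (padd I x v)))"
  using tiles_unfold[OF t, of "indicator F'"] F by simp
 also have "... = nn_integral (leb I) (%x. indicator F x)"
  by (intro nn_integral_cong) (simp add: tiles_count[OF t'] space_leb)
 finally show ?thesis using F by simp
qed

text \<open>The left side is an integral over a shifted copy of \<open>F\<close>. Unfolding it over
  \<open>L\<close> and pulling out the periodic \<open>h\<close> leaves a count of translates, which
  is again 1.\<close>

lemma tiles_periodic_shift:
 assumes t: "tiles I L F" and h: "h : borel_measurable (leb I)"
  and per: "!!x v. x : I \<rightarrow>\<^sub>E UNIV ==> v : L ==> h (padd I x v) = h x"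
 shows "nn_integral (leb I) (%x. indicator F x * h (padd I x c)) = nn_integral (leb I) (%x. indicator F x * h x)"
proof -
 have I: "finite I" and F [measurable]: "F : sets (leb I)" using t by (auto simp: tiles_def)
 have 1: "(%x. padd I x v) : measurable (leb I) (leb I)" for v
  unfolding padd_commute[of I _ v] by (rule measurable_padd)
 have F1: "(%x. indicator F (padd I x v) :: ennreal) : borel_measurable (leb I)" for v
  by (rule measurable_compose[OF 1]) simp
 let ?g = "%x. indicator F (padd I x (pneg I c)) * h x"
 have g: "?g : borel_measurable (leb I)" using F1 h by measurable
 have "nn_integral (leb I) (%x. indicator F x * h (padd I x c)) = nn_integral (leb I) (%x. ?g (padd I c x))"
 proof (rule nn_integral_cong)
  fix x assume "x : space (leb I)"
  hence "padd I (padd I c x) (pneg I c) = x" using padd_pneg[of x I c] by (simp add: padd_commute space_leb)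
  thus "indicator F x * h (padd I x c) = ?g (padd I c x)" by (simp add: padd_commute[of I c])
 qed
 also have "... = nn_integral (leb I) (%x. ?g x)" by (rule nn_integral_padd[OF I g])
 also have "... = nn_integral (leb I) (%x. indicator F x * nn_integral (count_space L) (%v. ?g (padd I x v)))"
  by (rule tiles_unfold[OF t g, symmetric])
 also have "... = nn_integral (leb I) (%x. indicator F x * h x)"
 proof (rule nn_integral_cong)
  fix x assume x: "x : space (leb I)"
  have "nn_integral (count_space L) (%v. ?g (padd I x v)) =
    nn_integral (count_space L) (%v. indicator F (padd I (padd I x (pneg I c)) v) * h x)"
  proof (rule nn_integral_cong)
   fix v assume "v : space (count_space L)"
   moreover have "padd I (padd I x v) (pneg I c) = padd I (padd I x (pneg I c)) v"
    by (simp add: padd_assoc padd_commute[of I v])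
   ultimately show "?g (padd I x v) = indicator F (padd I (padd I x (pneg I c)) v) * h x"
    using per x by (simp add: space_leb)
  qed
  also have "... = h x" by (simp add: nn_integral_multc tiles_count[OF t])
  finally show "indicator F x * nn_integral (count_space L) (%v. ?g (padd I x v)) = indicator F x * h x" by simp
 qed
 finally show ?thesis .
qed

text \<open>
 By periodicity the left-hand side does not change when a vector \<open>c\<close> in the range of \<open>M\<close> is added
 to \<open>M a\<close>; averaging over \<open>c \<in> F\<close> gives the right-hand side.  No determinant is involved.
\<close>
lemma tiles_equidistribution:
 fixes M :: "(nat => real) => nat => real"
 assumes t: "tiles I L F" and t': "tiles J L' Q" and h: "h : borel_measurable (leb I)"
  and per: "!!x v. x : I \<rightarrow>\<^sub>E UNIV ==> v : L ==> h (padd I x v) = h x"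
  and M: "M : measurable (leb J) (leb I)"
  and lin: "!!x y. x : J \<rightarrow>\<^sub>E UNIV ==> y : J \<rightarrow>\<^sub>E UNIV ==> M (padd J x y) = padd I (M x) (M y)"
  and lat: "!!v. v : L' ==> M v : L"
  and onto: "!!c. c : I \<rightarrow>\<^sub>E UNIV ==> EX a:J \<rightarrow>\<^sub>E UNIV. M a = c"
 shows "emeasure (leb I) F * nn_integral (leb J) (%a. indicator Q a * h (M a)) =
     emeasure (leb J) Q * nn_integral (leb I) (%x. indicator F x * h x)"
proof -
 have I: "finite I" and J: "finite J" and F [measurable]: "F : sets (leb I)" and Q [measurable]: "Q : sets (leb J)"
  and L': "L' \<subseteq> J \<rightarrow>\<^sub>E UNIV"
  using t t' by (auto simp: tiles_def)
 interpret sI: sigma_finite_measure "leb I" by (rule leb.sigma_finite[OF I])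
 interpret sJ: sigma_finite_measure "leb J" by (rule leb.sigma_finite[OF J])
 interpret pair_sigma_finite "leb I" "leb J" ..
 have Msp: "a : J \<rightarrow>\<^sub>E UNIV ==> M a : I \<rightarrow>\<^sub>E UNIV" for a
  using measurable_space[OF M] by (simp add: space_leb)
 have hM: "(%a. h (M a)) : borel_measurable (leb J)" by (rule measurable_compose[OF M h])
 \<comment> \<open>Writing \<open>c = M b\<close> turns the shift of \<open>M a\<close> into a shift
   of \<open>a\<close>, and \<open>h\<close> after \<open>M\<close> has the periods
   \<open>L'\<close> because \<open>M\<close> maps \<open>L'\<close> into \<open>L\<close>.\<close>
 have shift: "nn_integral (leb J) (%a. indicator Q a * h (padd I (M a) c)) = nn_integral (leb J) (%a. indicator Q a * h (M a))"
  if c: "c : I \<rightarrow>\<^sub>E UNIV" for c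
 proof -
  from onto[OF c] obtain b where b: "b : J \<rightarrow>\<^sub>E UNIV" "M b = c" by blast
  have "nn_integral (leb J) (%a. indicator Q a * h (padd I (M a) c)) = nn_integral (leb J) (%a. indicator Q a * h (M (padd J a b)))"
   by (intro nn_integral_cong) (simp add: lin b space_leb)
  also have "... = nn_integral (leb J) (%a. indicator Q a * h (M a))"
  proof (rule tiles_periodic_shift[OF t' hM])
   fix x v assume "x : J \<rightarrow>\<^sub>E (UNIV :: real set)" "v : L'"
   thus "h (M (padd J x v)) = h (M x)" using lin[of x v] L' per lat Msp by auto
  qed
  finally show ?thesis .
 qed
 have m2: "(%(c, a). padd I (M a) c) : measurable (leb I \<Otimes>\<^sub>M leb J) (leb I)"
  unfolding case_prod_beta
  by (rule measurable_padd2) (use M in measurable)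
 have m3: "(%(c, a). indicator F c * (indicator Q a * h (padd I (M a) c))) : borel_measurable (leb I \<Otimes>\<^sub>M leb J)"
  using measurable_compose[OF m2 h] unfolding case_prod_beta by measurable
 have m4: "(%x. h (padd I x c)) : borel_measurable (leb I)" for c
  unfolding padd_commute[of I _ c] using h by measurable
 have "emeasure (leb I) F * nn_integral (leb J) (%a. indicator Q a * h (M a)) =
   nn_integral (leb I) (%c. indicator F c * nn_integral (leb J) (%a. indicator Q a * h (M a)))"
  by (simp add: nn_integral_multc)
 also have "... = nn_integral (leb I) (%c. (nn_integral (leb J) (%a. indicator F c * (indicator Q a * h (padd I (M a) c)))))"
 proof (rule nn_integral_cong)
  fix c assume "c : space (leb I)"
  hence c: "c : I \<rightarrow>\<^sub>E UNIV" by (simp add: space_leb)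
  have "(%a. indicator Q a * h (padd I (M a) c)) : borel_measurable (leb J)"
   using measurable_compose[OF M m4] by measurable
  thus "indicator F c * nn_integral (leb J) (%a. indicator Q a * h (M a)) =
    nn_integral (leb J) (%a. indicator F c * (indicator Q a * h (padd I (M a) c)))"
   by (simp add: nn_integral_cmult shift[OF c])
 qed
 also have "... = nn_integral (leb J) (%a. (nn_integral (leb I) (%c. indicator F c * (indicator Q a * h (padd I (M a) c)))))"
  using Fubini'[OF m3] by simp
 also have "... = nn_integral (leb J) (%a. indicator Q a * nn_integral (leb I) (%x. indicator F x * h x))"
 proof (rule nn_integral_cong)
  fix a assume "a : space (leb J)"
  have "nn_integral (leb I) (%c. indicator F c * (indicator Q a * h (padd I (M a) c))) =
    nn_integral (leb I) (%c. indicator Q a * (indicator F c * h (padd I c (M a))))"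
   by (intro nn_integral_cong) (simp add: mult_ac padd_commute)
  also have "... = indicator Q a * nn_integral (leb I) (%c. indicator F c * h (padd I c (M a)))"
   by (rule nn_integral_cmult) (use m4 in measurable)
  finally show "nn_integral (leb I) (%c. indicator F c * (indicator Q a * h (padd I (M a) c))) =
    indicator Q a * nn_integral (leb I) (%x. indicator F x * h x)"
   by (simp add: tiles_periodic_shift[OF t h per])
 qed
 also have "... = emeasure (leb J) Q * nn_integral (leb I) (%x. indicator F x * h x)"
  by (simp add: nn_integral_multc)
 finally show ?thesis .
qed

section \<open>Boxes\<close>

definition upper_tri :: "nat => (nat => nat => real) => bool" where
 "upper_tri d C \<longleftrightarrow> (ALL i<d. 0 < C i i) & (ALL i<d. ALL j<i. C i j = 0)"

definition lin :: "nat => (nat => nat => real) => (nat => real) => nat => real" where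
 "lin d C z i = (\<Sum>j<d. C i j * z j)"

text \<open>The offset \<open>k\<close> moves the index set, so that two lattices of dimension
  \<open>d\<close> can sit on disjoint halves of one index set of size \<open>2 * d\<close>.\<close>

definition lat :: "nat => nat => (nat => nat => real) => (nat => real) set" where
 "lat k d C = {(\<lambda>i\<in>{k..<k+d}. lin d C (%j. real_of_int (z j)) (i - k)) | z. True}"

definition box :: "nat => nat => (nat => real) => (nat => real) => (nat => real) set" where
 "box k d l c = Pi\<^sub>E {k..<k+d} (%i. {l (i - k)..<l (i - k) + c (i - k)})"

lemma int_in_interval:
 fixes x c l :: real assumes "c > 0"
 shows "EX z::int. l <= x + c * z & x + c * z < l + c"
proof -
 define z where "z = \<lceil>(l - x) / c\<rceil>"
 have "(l - x) / c <= z" "z < (l - x) / c + 1" unfolding z_def by linarith+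
 hence "l - x <= c * z" "c * z < l - x + c" using assms by (auto simp: field_simps)
 thus ?thesis by (intro exI[of _ z]) auto
qed

lemma upper_tri_split:
 assumes "upper_tri d C" "i < d"
 shows "lin d C z i = C i i * z i + (\<Sum>j\<in>{Suc i..<d}. C i j * z j)"
proof -
 have "{..<d} = {..<i} \<union> {i} \<union> {Suc i..<d}" using assms(2) by auto
 moreover have "(\<Sum>j\<in>{..<i} \<union> {i} \<union> {Suc i..<d}. C i j * z j) =
   (\<Sum>j<i. C i j * z j) + C i i * z i + (\<Sum>j\<in>{Suc i..<d}. C i j * z j)"
  by (subst sum.union_disjoint, auto)+
 moreover have "(\<Sum>j<i. C i j * z j) = 0" using assms by (intro sum.neutral) (auto simp: upper_tri_def)
 ultimately show ?thesis by (simp add: lin_def)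
qed

text \<open>Back substitution: \<open>z k\<close> does not enter the rows after \<open>k\<close>, so
  the coordinates can be brought into their intervals one by one, from the last to the
  first.\<close>

lemma box_exists:
 assumes C: "upper_tri d C"
 shows "EX z :: nat => int. ALL i<d. l i <= x i + lin d C (%j. z j) i & x i + lin d C (%j. z j) i < l i + C i i"
proof -
 have "EX z :: nat => int. ALL i<d. k <= i --> l i <= x i + lin d C (%j. z j) i & x i + lin d C (%j. z j) i < l i + C i i"
  if "k <= d" for k using that
 proof (induction rule: inc_induct)
  case (step k)
  then obtain z where z: "!!i. i < d ==> Suc k <= i ==>
   l i <= x i + lin d C (%j. real_of_int (z j)) i & x i + lin d C (%j. real_of_int (z j)) i < l i + C i i" by blast
  define R where "R = x k + (\<Sum>j\<in>{Suc k..<d}. C k j * z j)"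
  have "C k k > 0" using C step.hyps by (simp add: upper_tri_def)
  from int_in_interval[OF this, of "l k" R] obtain w :: int
   where w: "l k <= R + C k k * w" "R + C k k * w < l k + C k k" by blast
  have same: "lin d C (%j. real_of_int ((z(k := w)) j)) i = lin d C (%j. real_of_int (z j)) i" if "i < d" "Suc k <= i" for i
   using upper_tri_split[OF C that(1), of "%j. real_of_int ((z(k := w)) j)"]
    upper_tri_split[OF C that(1), of "%j. real_of_int (z j)"] that(2) by simp
  have new: "x k + lin d C (%j. real_of_int ((z(k := w)) j)) k = R + C k k * w"
   using upper_tri_split[OF C step.hyps(2), of "%j. real_of_int ((z(k := w)) j)"] by (simp add: R_def)
  show ?case
  proof (intro exI[of _ "z(k := w)"] allI impI)
   fix i assume i: "i < d" "k <= i"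
   show "l i <= x i + lin d C (%j. real_of_int ((z(k := w)) j)) i & x i + lin d C (%j. real_of_int ((z(k := w)) j)) i < l i + C i i"
   proof (cases "i = k")
    case True
    thus ?thesis using w new by simp
   next
    case False
    thus ?thesis using z[of i] same[of i] i by simp
   qed
  qed
 qed auto
 from this[of 0] show ?thesis by simp
qed

text \<open>Again from the last row upwards: once the later coefficients agree, the two values in
  row \<open>i\<close> differ by a multiple of \<open>C i i\<close> that is smaller than
  \<open>C i i\<close>.\<close>

lemma box_unique:
 fixes z w :: "nat => int"
 assumes C: "upper_tri d C"
  and z: "!!i. i < d ==> l i <= x i + lin d C (%j. z j) i & x i + lin d C (%j. z j) i < l i + C i i"
  and w: "!!i. i < d ==> l i <= x i + lin d C (%j. w j) i & x i + lin d C (%j. w j) i < l i + C i i"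
  and "i < d"
 shows "z i = w i"
 using \<open>i < d\<close>
proof (induction "d - i" arbitrary: i rule: less_induct)
 case less
 have eq: "(\<Sum>j\<in>{Suc i..<d}. C i j * z j) = (\<Sum>j\<in>{Suc i..<d}. C i j * w j)"
 proof (rule sum.cong[OF refl])
  fix j assume j: "j : {Suc i..<d}"
  hence "z j = w j" by (intro less.hyps) auto
  thus "C i j * z j = C i j * w j" by simp
 qed
 have c: "C i i > 0" using C less.prems by (simp add: upper_tri_def)
 have "C i i * (real_of_int (z i) - real_of_int (w i)) < C i i * 1"
  "C i i * (real_of_int (w i) - real_of_int (z i)) < C i i * 1"
  using z[OF less.prems] w[OF less.prems] upper_tri_split[OF C less.prems, of "%j. real_of_int (z j)"]
   upper_tri_split[OF C less.prems, of "%j. real_of_int (w j)"] eq by (auto simp: algebra_simps)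
 hence "real_of_int (z i) - real_of_int (w i) < 1" "real_of_int (w i) - real_of_int (z i) < 1"
  using c by (simp_all only: mult_less_cancel_left_pos)
 thus ?case by linarith
qed

lemma box_sets: "box k d l c : sets (leb {k..<k+d})"
 unfolding box_def by (rule sets_PiM_I_finite) auto

lemma emeasure_box:
 assumes "!!i. i < d ==> 0 <= c i"
 shows "emeasure (leb {k..<k+d}) (box k d l c) = ennreal (\<Prod>i<d. c i)"
proof -
 have "emeasure (leb {k..<k+d}) (box k d l c) = (\<Prod>i\<in>{k..<k+d}. emeasure lborel {l (i - k)..<l (i - k) + c (i - k)})"
  unfolding box_def by (rule leb.emeasure_PiM) auto
 also have "... = (\<Prod>i<d. ennreal (c i))"
 proof (rule prod.reindex_bij_witness[of _ "%i. i + k" "%i. i - k"])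
  fix i assume "i : {k..<k+d}"
  hence "0 <= c (i - k)" by (intro assms) auto
  thus "ennreal (c (i - k)) = emeasure lborel {l (i - k)..<l (i - k) + c (i - k)}" by simp
 qed auto
 also have "... = ennreal (\<Prod>i<d. c i)" using assms by (intro prod_ennreal) auto
 finally show ?thesis .
qed

text \<open>Triangularity lets the rows be solved one after another, for any corner \<open>l\<close>
  of the box. The volume of the box, the product of the diagonal, is therefore the covolume.\<close>

lemma tiles_box:
 assumes C: "upper_tri d C"
 shows "tiles {k..<k+d} (lat k d C) (box k d l (%i. C i i))"
 unfolding tiles_def
proof (intro conjI ballI)
 show "box k d l (%i. C i i) : sets (leb {k..<k+d})" by (rule box_sets)
 show "lat k d C \<subseteq> {k..<k+d} \<rightarrow>\<^sub>E UNIV" by (auto simp: lat_def)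
 show "countable (lat k d C)"
 proof -
  let ?f = "%z. \<lambda>i\<in>{k..<k+d}. lin d C (%j. real_of_int (z j)) (i - k)"
  have "lat k d C \<subseteq> ?f ` ({..<d} \<rightarrow>\<^sub>E (UNIV :: int set))"
  proof
   fix v assume "v : lat k d C"
   then obtain z where z: "v = ?f z" by (auto simp: lat_def)
   have "lin d C (%j. real_of_int (z j)) i = lin d C (%j. real_of_int (restrict z {..<d} j)) i" for i
    by (simp add: lin_def)
   hence "v = ?f (restrict z {..<d})" unfolding z by simp
   thus "v : ?f ` ({..<d} \<rightarrow>\<^sub>E (UNIV :: int set))"
    by (intro image_eqI[where x = "restrict z {..<d}"]) simp_all
  qed
  moreover have "countable ({..<d} \<rightarrow>\<^sub>E (UNIV :: int set))" by (rule countable_PiE) auto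
  ultimately show ?thesis by (meson countable_image countable_subset)
 qed
next
 fix v assume "v : lat k d C"
 then obtain z where z: "v = (\<lambda>i\<in>{k..<k+d}. lin d C (%j. real_of_int (z j)) (i - k))" by (auto simp: lat_def)
 have "pneg {k..<k+d} v = (\<lambda>i\<in>{k..<k+d}. lin d C (%j. real_of_int (- z j)) (i - k))"
  by (auto simp: z pneg_def lin_def sum_negf fun_eq_iff)
 thus "pneg {k..<k+d} v : lat k d C" unfolding lat_def by (intro CollectI exI[of _ "%j. - z j"]) simp
next
 fix x assume "x : {k..<k+d} \<rightarrow>\<^sub>E (UNIV :: real set)"
 let ?v = "%z. \<lambda>i\<in>{k..<k+d}. lin d C (%j. real_of_int (z j)) (i - k)"
 have mem: "padd {k..<k+d} x (?v z) : box k d l (%i. C i i) \<longleftrightarrow>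
  (ALL i<d. l i <= x (i + k) + lin d C (%j. z j) i & x (i + k) + lin d C (%j. z j) i < l i + C i i)" for z
 proof -
  have "padd {k..<k+d} x (?v z) : box k d l (%i. C i i) \<longleftrightarrow> (ALL i:{k..<k+d}. l (i - k) <= x i + lin d C (%j. z j) (i - k) &
    x i + lin d C (%j. z j) (i - k) < l (i - k) + C (i - k) (i - k))"
   by (auto simp: box_def padd_def PiE_iff)
  also have "... \<longleftrightarrow> (ALL i<d. l i <= x (i + k) + lin d C (%j. z j) i & x (i + k) + lin d C (%j. z j) i < l i + C i i)"
  proof safe
   fix i assume *: "ALL i:{k..<k+d}. l (i - k) <= x i + lin d C (%j. z j) (i - k) &
    x i + lin d C (%j. z j) (i - k) < l (i - k) + C (i - k) (i - k)" "i < d"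
   from bspec[OF *(1), of "i + k"] *(2)
   show "l i <= x (i + k) + lin d C (%j. z j) i" "x (i + k) + lin d C (%j. z j) i < l i + C i i" by auto
  next
   fix i assume *: "ALL i<d. l i <= x (i + k) + lin d C (%j. z j) i & x (i + k) + lin d C (%j. z j) i < l i + C i i"
    "i : {k..<k+d}"
   from spec[OF *(1), of "i - k"] *(2)
   show "l (i - k) <= x i + lin d C (%j. z j) (i - k)" "x i + lin d C (%j. z j) (i - k) < l (i - k) + C (i - k) (i - k)"
    by auto
  qed
  finally show ?thesis .
 qed
 from box_exists[OF C, of l "%i. x (i + k)"] obtain z :: "nat => int" where
  z: "ALL i<d. l i <= x (i + k) + lin d C (%j. z j) i & x (i + k) + lin d C (%j. z j) i < l i + C i i" by blast
 show "EX! v. v : lat k d C & padd {k..<k+d} x v : box k d l (%i. C i i)"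
 proof (rule ex1I[of _ "?v z"])
  show "?v z : lat k d C & padd {k..<k+d} x (?v z) : box k d l (%i. C i i)"
   using z mem by (auto simp: lat_def)
  fix v assume v: "v : lat k d C & padd {k..<k+d} x v : box k d l (%i. C i i)"
  then obtain w where w: "v = ?v w" by (auto simp: lat_def)
  with v mem[of w] have "ALL i<d. l i <= x (i + k) + lin d C (%j. w j) i & x (i + k) + lin d C (%j. w j) i < l i + C i i" by simp
  with z box_unique[OF C, of l "%i. x (i + k)" z w] have "z j = w j" if "j < d" for j using that by blast
  hence "lin d C (%j. real_of_int (w j)) = lin d C (%j. real_of_int (z j))" by (simp add: lin_def fun_eq_iff)
  thus "v = ?v z" unfolding w by simp
 qed
qed simp

section \<open>A second moment bound\<close>

lemma nn_integral_square_interval: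
 fixes b t c :: real assumes "c >= 0"
 shows "nn_integral lborel (%x. indicator {-c/2..<c/2} x * ennreal ((b + t * x)\<^sup>2)) = ennreal (c * (b\<^sup>2 + t\<^sup>2 * c\<^sup>2 / 12))"
proof -
 let ?F = "%x. b\<^sup>2 * x + b * t * x\<^sup>2 + t\<^sup>2 * x ^ 3 / 3"
 have "nn_integral lborel (%x. indicator {-c/2..<c/2} x * ennreal ((b + t * x)\<^sup>2)) =
   nn_integral lborel (%x. ennreal ((b + t * x)\<^sup>2) * indicator {-c/2..c/2} x)"
 proof (rule nn_integral_cong_AE)
  have "AE x in lborel. x ~= c / 2" by (rule AE_lborel_singleton)
  thus "AE x in lborel. indicator {-c/2..<c/2} x * ennreal ((b + t * x)\<^sup>2) = ennreal ((b + t * x)\<^sup>2) * indicator {-c/2..c/2} x"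
   by eventually_elim (auto simp: indicator_def)
 qed
 also have "... = ennreal (?F (c/2) - ?F (-c/2))"
 proof (rule nn_integral_FTC_Icc)
  fix x
  show "(?F has_real_derivative (b + t * x)\<^sup>2) (at x)"
   by (auto intro!: derivative_eq_intros simp: power2_eq_square algebra_simps)
  show "0 <= (b + t * x)\<^sup>2" by simp
 qed (use assms in auto)
 also have "?F (c/2) - ?F (-c/2) = c * (b\<^sup>2 + t\<^sup>2 * c\<^sup>2 / 12)"
  by (simp add: field_simps power2_eq_square power3_eq_cube)
 finally show ?thesis .
qed

text \<open>The coordinates are independent and centred: mixed terms integrate to 0, and an interval
  of length c has variance c^2 / 12. The constant \<open>b\<close> is arbitrary because the
  induction puts one coordinate at a time into it.\<close>

lemma nn_integral_square_box:
 fixes t c :: "nat => real"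
 assumes "finite I" "!!i. i : I ==> 0 <= c i"
 shows "nn_integral (leb I) (%x. indicator (Pi\<^sub>E I (%i. {-c i/2..<c i/2})) x * ennreal ((b + (\<Sum>i\<in>I. t i * x i))\<^sup>2)) =
   ennreal ((\<Prod>i\<in>I. c i) * (b\<^sup>2 + (\<Sum>i\<in>I. (t i)\<^sup>2 * (c i)\<^sup>2 / 12)))"
 using assms
proof (induction arbitrary: b)
 case empty
 thus ?case by (simp add: leb.nn_integral_empty)
next
 case (insert k I)
 let ?B = "%I. Pi\<^sub>E I (%i. {-c i/2..<c i/2})"
 let ?S = "\<Sum>i\<in>I. (t i)\<^sup>2 * (c i)\<^sup>2 / 12"
 have B: "?B I : sets (leb I)" if "finite I" for I using that by (intro sets_PiM_I_finite) auto
 have P: "(\<Prod>i\<in>I. c i) >= 0" using insert by (intro prod_nonneg) auto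
 have "(%x. indicator (?B (insert k I)) x * ennreal ((b + (\<Sum>i\<in>insert k I. t i * x i))\<^sup>2)) : borel_measurable (leb (insert k I))"
 proof (intro borel_measurable_times_ennreal)
  show "(%x. indicator (?B (insert k I)) x :: ennreal) : borel_measurable (leb (insert k I))"
   using B[of "insert k I"] insert.hyps by simp
  show "(%x. ennreal ((b + (\<Sum>i\<in>insert k I. t i * x i))\<^sup>2)) : borel_measurable (leb (insert k I))"
   by measurable
 qed
 hence "nn_integral (leb (insert k I)) (%x. indicator (?B (insert k I)) x * ennreal ((b + (\<Sum>i\<in>insert k I. t i * x i))\<^sup>2)) =
  nn_integral lborel (%y. (nn_integral (leb I) (%x. indicator (?B (insert k I)) (x(k := y)) * ennreal ((b + (\<Sum>i\<in>insert k I. t i * (x(k := y)) i))\<^sup>2))))"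
  using insert.hyps by (intro leb.product_nn_integral_insert_rev) auto
 also have "... = nn_integral lborel (%y. indicator {-c k/2..<c k/2} y * ennreal ((\<Prod>i\<in>I. c i) * ((b + t k * y)\<^sup>2 + ?S)))"
 proof (rule nn_integral_cong)
  fix y :: real
  have "nn_integral (leb I) (%x. indicator (?B (insert k I)) (x(k := y)) * ennreal ((b + (\<Sum>i\<in>insert k I. t i * (x(k := y)) i))\<^sup>2)) =
   nn_integral (leb I) (%x. indicator {-c k/2..<c k/2} y * (indicator (?B I) x * ennreal (((b + t k * y) + (\<Sum>i\<in>I. t i * x i))\<^sup>2)))"
  proof (rule nn_integral_cong)
   fix x assume "x : space (leb I)"
   hence x: "x : extensional I" by (auto simp: space_leb PiE_def)
   have "(\<Sum>i\<in>I. t i * (x(k := y)) i) = (\<Sum>i\<in>I. t i * x i)" using insert.hyps by (intro sum.cong) auto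
   hence "b + (\<Sum>i\<in>insert k I. t i * (x(k := y)) i) = (b + t k * y) + (\<Sum>i\<in>I. t i * x i)"
    using insert.hyps by simp
   moreover have "x(k := y) : ?B (insert k I) \<longleftrightarrow> y : {-c k/2..<c k/2} & x : ?B I"
    using insert.hyps(2) x by (auto simp: PiE_iff extensional_def)
   ultimately show "indicator (?B (insert k I)) (x(k := y)) * ennreal ((b + (\<Sum>i\<in>insert k I. t i * (x(k := y)) i))\<^sup>2) =
    indicator {-c k/2..<c k/2} y * (indicator (?B I) x * ennreal (((b + t k * y) + (\<Sum>i\<in>I. t i * x i))\<^sup>2))"
    by (auto simp: indicator_def add.assoc)
  qed
  also have "... = indicator {-c k/2..<c k/2} y * nn_integral (leb I) (%x. indicator (?B I) x * ennreal (((b + t k * y) + (\<Sum>i\<in>I. t i * x i))\<^sup>2))"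
  proof (rule nn_integral_cmult)
   show "(%x. indicator (?B I) x * ennreal (((b + t k * y) + (\<Sum>i\<in>I. t i * x i))\<^sup>2)) : borel_measurable (leb I)"
    using B[OF insert.hyps(1)] by measurable
  qed
  finally show "nn_integral (leb I) (%x. indicator (?B (insert k I)) (x(k := y)) * ennreal ((b + (\<Sum>i\<in>insert k I. t i * (x(k := y)) i))\<^sup>2)) =
    indicator {-c k/2..<c k/2} y * ennreal ((\<Prod>i\<in>I. c i) * ((b + t k * y)\<^sup>2 + ?S))"
   using insert.IH[of "b + t k * y"] insert.prems by simp
 qed
 also have "... = nn_integral lborel (%y. ennreal (\<Prod>i\<in>I. c i) * (indicator {-c k/2..<c k/2} y * ennreal ((b + t k * y)\<^sup>2) +
   ennreal ?S * indicator {-c k/2..<c k/2} y))"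
  using P by (intro nn_integral_cong) (auto simp: ennreal_mult ennreal_plus indicator_def sum_nonneg distrib_left)
 also have "... = ennreal (\<Prod>i\<in>I. c i) * (ennreal (c k * (b\<^sup>2 + (t k)\<^sup>2 * (c k)\<^sup>2 / 12)) + ennreal ?S * ennreal (c k))"
  using insert.prems nn_integral_square_interval[of "c k" b "t k"]
  by (simp add: nn_integral_cmult nn_integral_add)
 also have "... = ennreal ((\<Prod>i\<in>I. c i) * (c k * (b\<^sup>2 + (t k)\<^sup>2 * (c k)\<^sup>2 / 12) + ?S * c k))"
  using P insert.prems by (simp add: ennreal_mult[symmetric] ennreal_plus[symmetric] sum_nonneg del: ennreal_plus)
 also have "(\<Prod>i\<in>I. c i) * (c k * (b\<^sup>2 + (t k)\<^sup>2 * (c k)\<^sup>2 / 12) + ?S * c k) =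
   (\<Prod>i\<in>insert k I. c i) * (b\<^sup>2 + (\<Sum>i\<in>insert k I. (t i)\<^sup>2 * (c i)\<^sup>2 / 12))"
  using insert.hyps by (simp add: algebra_simps)
 finally show ?case .
qed

text \<open>Chebyshev's inequality, not normalised. It will be applied to the linear part of a
  squared norm, whose standard deviation is smaller than the bound from Cauchy-Schwarz by a factor
  of order sqrt d.\<close>

lemma box_chebyshev:
 fixes t c :: "nat => real"
 assumes I: "finite I" and c: "!!i. i : I ==> 0 <= c i" and q: "q > 0" and v: "(\<Sum>i\<in>I. (t i)\<^sup>2 * (c i)\<^sup>2 / 12) <= v"
  and v1: "v <= q\<^sup>2"
 shows "ennreal ((\<Prod>i\<in>I. c i) * (1 - v / q\<^sup>2)) \<le>
  (nn_integral (leb I) (%x. indicator (Pi\<^sub>E I (%i. {-c i/2..<c i/2})) x * indicator {x. (\<Sum>i\<in>I. t i * x i) <= q} x))"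
proof -
 let ?B = "Pi\<^sub>E I (%i. {-c i/2..<c i/2})"
 let ?s = "%x. \<Sum>i\<in>I. t i * x i"
 have B: "?B : sets (leb I)" using I by (intro sets_PiM_I_finite) auto
 have P: "(\<Prod>i\<in>I. c i) >= 0" using c by (intro prod_nonneg) auto
 have v0: "0 <= v" using v by (rule order_trans[rotated]) (auto intro!: sum_nonneg)
 have sm: "?s : borel_measurable (leb I)" by measurable
 have "ennreal (\<Prod>i\<in>I. c i) = emeasure (leb I) ?B"
  using I c by (subst leb.emeasure_PiM) (auto simp: prod_ennreal)
 also have "... = nn_integral (leb I) (%x. indicator ?B x)" using B by simp
 also have "... <= nn_integral (leb I) (%x. indicator ?B x * indicator {x. ?s x <= q} x +
   ennreal (1 / q\<^sup>2) * (indicator ?B x * ennreal ((0 + ?s x)\<^sup>2)))"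
 proof (rule nn_integral_mono)
  fix x
  show "indicator ?B x <= indicator ?B x * indicator {x. ?s x <= q} x + ennreal (1 / q\<^sup>2) * (indicator ?B x * ennreal ((0 + ?s x)\<^sup>2))"
  proof (cases "?s x <= q")
   case False
   hence "q\<^sup>2 <= (?s x)\<^sup>2" using q by (intro power_mono) auto
   hence "1 <= 1 / q\<^sup>2 * (?s x)\<^sup>2" using q by (simp add: field_simps)
   hence "ennreal 1 <= ennreal (1 / q\<^sup>2 * (?s x)\<^sup>2)" by (rule ennreal_leI)
   also have "... = ennreal (1 / q\<^sup>2) * ennreal ((?s x)\<^sup>2)" by (rule ennreal_mult) auto
   finally show ?thesis by (auto simp: indicator_def)
  qed (auto simp: indicator_def)
 qed
 also have "... = nn_integral (leb I) (%x. indicator ?B x * indicator {x. ?s x <= q} x) +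
   ennreal (1 / q\<^sup>2) * ennreal ((\<Prod>i\<in>I. c i) * (0\<^sup>2 + (\<Sum>i\<in>I. (t i)\<^sup>2 * (c i)\<^sup>2 / 12)))"
 proof -
  have m1: "(%x. indicator ?B x * ennreal ((0 + ?s x)\<^sup>2)) : borel_measurable (leb I)" using B by measurable
  have m2: "(%x. indicator ?B x * indicator {x. ?s x <= q} x :: ennreal) : borel_measurable (leb I)"
  proof -
   have "(%x. indicator ?B x * indicator {..q} (?s x) :: ennreal) : borel_measurable (leb I)"
    using B sm by measurable
   thus ?thesis by (simp add: indicator_def)
  qed
  show ?thesis
   using nn_integral_square_box[OF I c, where b = 0 and t = t] m1 m2
   by (subst nn_integral_add) (auto simp: nn_integral_cmult)
 qed
 also have "... <= nn_integral (leb I) (%x. indicator ?B x * indicator {x. ?s x <= q} x) + ennreal ((\<Prod>i\<in>I. c i) * (v / q\<^sup>2))"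
 proof -
  have "1 / q\<^sup>2 * ((\<Prod>i\<in>I. c i) * (0\<^sup>2 + (\<Sum>i\<in>I. (t i)\<^sup>2 * (c i)\<^sup>2 / 12))) <= 1 / q\<^sup>2 * ((\<Prod>i\<in>I. c i) * v)"
   using v P q by (intro mult_left_mono) auto
  thus ?thesis using P v0
   by (intro add_left_mono) (simp add: ennreal_mult[symmetric] sum_nonneg mult.commute ennreal_leI)
 qed
 finally have *: "ennreal (\<Prod>i\<in>I. c i) <= nn_integral (leb I) (%x. indicator ?B x * indicator {x. ?s x <= q} x) + ennreal ((\<Prod>i\<in>I. c i) * (v / q\<^sup>2))" .
 have "ennreal ((\<Prod>i\<in>I. c i) * (1 - v / q\<^sup>2)) = ennreal (\<Prod>i\<in>I. c i) - ennreal ((\<Prod>i\<in>I. c i) * (v / q\<^sup>2))"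
  using P v0 by (subst ennreal_minus) (auto simp: algebra_simps)
 also have "... <= nn_integral (leb I) (%x. indicator ?B x * indicator {x. ?s x <= q} x)"
  using * by (simp add: ennreal_minus_le_iff add.commute)
 finally show ?thesis .
qed

section \<open>Averaging over a torus of lattices\<close>

lemma sum_shift_index: "(\<Sum>i\<in>{d..<d+d}. f i) = (\<Sum>i<d. f (d + i))" for f :: "nat => 'a::comm_monoid_add"
 by (rule sum.reindex_bij_witness[of _ "%i. d + i" "%i. i - d"]) auto

lemma ball_shift_index: "(ALL i:{d..<d+d}. P i (i - d)) \<longleftrightarrow> (ALL k<d. P (d + k) k)" for d :: nat
proof (intro iffI allI ballI impI)
 fix k assume "ALL i:{d..<d+d}. P i (i - d)" "k < d"
 thus "P (d + k) k" using bspec[of "{d..<d+d}" "%i. P i (i - d)" "d + k"] by simp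
next
 fix i assume "ALL k<d. P (d + k) k" "i : {d..<d+d}"
 moreover from this(2) have "i - d < d" "d + (i - d) = i" by auto
 ultimately show "P i (i - d)" by metis
qed

lemma borel_measurable_nn_integral_count_space:
 fixes f :: "'i => 'a => ennreal"
 assumes "countable I" "!!i. i : I ==> f i : borel_measurable M"
 shows "(%x. \<integral>\<^sup>+i. f i x \<partial>count_space I) : borel_measurable M"
proof -
 interpret sigma_finite_measure "count_space I" by (rule sigma_finite_measure_count_space_countable[OF assms(1)])
 have "(%z. f (fst z) (snd z)) : borel_measurable (count_space I \<Otimes>\<^sub>M M)"
  by (rule measurable_pair_measure_countable1) (use assms in auto)
 from measurable_compose[OF measurable_pair_swap' this]
 have "(%(x, i). f i x) : borel_measurable (M \<Otimes>\<^sub>M count_space I)" by (simp add: case_prod_beta)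
 thus ?thesis by (rule borel_measurable_nn_integral)
qed

lemma nn_integral_count_space_mono_set:
 fixes f :: "'a => ennreal"
 assumes "A \<subseteq> B"
 shows "nn_integral (count_space A) (%x. f x) <= nn_integral (count_space B) (%x. f x)"
proof -
 have "nn_integral (count_space A) (%x. f x) = nn_integral (count_space A) (%x. f x * indicator A x)"
  by (intro nn_integral_cong) simp
 also have "... = nn_integral (count_space B) (%x. f x * indicator A x)"
  by (rule nn_integral_count_space_eq) (use assms in auto)
 also have "... <= nn_integral (count_space B) (%x. f x)"
  by (intro nn_integral_mono) (auto simp: indicator_def)
 finally show ?thesis .
qed

lemma ennreal_inverse_mult: "0 < x ==> ennreal (1 / x) * ennreal x = 1"
 by (subst ennreal_mult[symmetric]) auto

lemma nn_integral_count_space_ge_sum: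
 fixes h :: "'a => ennreal"
 assumes "finite A" "A \<subseteq> X"
 shows "(\<Sum>a\<in>A. h a) <= nn_integral (count_space X) (%a. h a)"
proof -
 have "(\<Sum>a\<in>A. h a) = (\<Sum>a\<in>A. h a * indicator A a)" by (intro sum.cong) auto
 also have "... = nn_integral (count_space X) (%a. h a * indicator A a)"
  by (rule nn_integral_count_space'[symmetric]) (use assms in auto)
 also have "... <= nn_integral (count_space X) (%a. h a)"
  by (intro nn_integral_mono) (auto simp: indicator_def)
 finally show ?thesis .
qed

lemma nn_integral_count_space_ge_pairs:
 fixes h :: "'a => 'b => ennreal"
 assumes "finite P" "P \<subseteq> X \<times> Y"
 shows "(\<Sum>(a, b)\<in>P. h a b) <= nn_integral (count_space X) (%a. (nn_integral (count_space Y) (%b. h a b)))"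
proof -
 have "(\<Sum>(a, b)\<in>P. h a b) = (\<Sum>a\<in>fst ` P. \<Sum>b\<in>{b. (a, b) : P}. h a b)"
 proof -
  have fin: "finite {b. (a, b) : P}" for a
   by (rule finite_subset[of _ "snd ` P"]) (use assms in \<open>auto intro: rev_image_eqI\<close>)
  have "P = Sigma (fst ` P) (%a. {b. (a, b) : P})" by force
  hence "(\<Sum>(a, b)\<in>P. h a b) = (\<Sum>(a, b)\<in>Sigma (fst ` P) (%a. {b. (a, b) : P}). h a b)" by simp
  also have "... = (\<Sum>a\<in>fst ` P. \<Sum>b\<in>{b. (a, b) : P}. h a b)"
   by (rule sum.Sigma[symmetric]) (use assms fin in auto)
  finally show ?thesis .
 qed
 also have "... <= (\<Sum>a\<in>fst ` P. \<integral>\<^sup>+b. h a b \<partial>count_space Y)"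
 proof (rule sum_mono)
  fix a
  have "finite {b. (a, b) : P}"
   by (rule finite_subset[of _ "snd ` P"]) (use assms in \<open>auto intro: rev_image_eqI\<close>)
  thus "(\<Sum>b\<in>{b. (a, b) : P}. h a b) <= nn_integral (count_space Y) (%b. h a b)"
   by (rule nn_integral_count_space_ge_sum) (use assms in auto)
 qed
 also have "... <= nn_integral (count_space X) (%a. (nn_integral (count_space Y) (%b. h a b)))"
  by (rule nn_integral_count_space_ge_sum) (use assms in auto)
 finally show ?thesis .
qed

lemma lat_add:
 assumes "u : lat k d C" "v : lat k d C" shows "padd {k..<k+d} u v : lat k d C"
proof -
 from assms obtain y z where "u = (\<lambda>i\<in>{k..<k+d}. lin d C (%j. real_of_int (y j)) (i - k))"
  "v = (\<lambda>i\<in>{k..<k+d}. lin d C (%j. real_of_int (z j)) (i - k))" by (auto simp: lat_def)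
 hence "padd {k..<k+d} u v = (\<lambda>i\<in>{k..<k+d}. lin d C (%j. real_of_int (y j + z j)) (i - k))"
  by (auto simp: padd_def lin_def fun_eq_iff distrib_left sum.distrib)
 thus ?thesis unfolding lat_def by (intro CollectI exI[of _ "%j. y j + z j"]) simp
qed

lemma lin_scale: "lin d (%i j. T * C i j) z i = T * lin d C z i"
 by (simp add: lin_def sum_distrib_left mult.assoc)

lemma nn_integral_lat_shift:
 assumes "v : lat k d C" "upper_tri d C"
 shows "nn_integral (count_space (lat k d C)) (%y. h (padd {k..<k+d} v y)) = nn_integral (count_space (lat k d C)) (%y. h y)"
proof -
 let ?J = "{k..<k+d}"
 have t: "tiles ?J (lat k d C) (box k d (%_. 0) (%i. C i i))" by (rule tiles_box[OF assms(2)])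
 have neg: "pneg ?J v : lat k d C" and sub: "lat k d C \<subseteq> ?J \<rightarrow>\<^sub>E UNIV" using t assms(1) by (auto simp: tiles_def)
 have "bij_betw (padd ?J v) (lat k d C) (lat k d C)"
 proof (rule bij_betwI[where g = "%y. padd ?J y (pneg ?J v)"])
  show "padd ?J v : lat k d C \<rightarrow> lat k d C" using lat_add[OF assms(1)] by auto
  show "(%y. padd ?J y (pneg ?J v)) : lat k d C \<rightarrow> lat k d C" using lat_add[OF _ neg] by auto
  fix x assume x: "x : lat k d C"
  hence x': "x : ?J \<rightarrow>\<^sub>E UNIV" using sub by blast
  show "padd ?J (padd ?J v x) (pneg ?J v) = x" using padd_pneg[OF x', of v] by (simp add: padd_commute)
  show "padd ?J v (padd ?J x (pneg ?J v)) = x" using padd_pneg'[OF x', of v] by (simp add: padd_commute)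
 qed
 from nn_integral_bij_count_space[OF this] show ?thesis .
qed

lemma dist_nearest_unique:
 fixes A B :: nat and a :: real
 assumes "N > 0" "- 1 / (2 * N) <= a - A / N" "a - A / N < 1 / (2 * N)"
  "- 1 / (2 * N) <= a - B / N" "a - B / N < 1 / (2 * real N)"
 shows "A = B"
proof -
 have "1 / (2 * real N) + 1 / (2 * real N) = 1 / N" by simp
 hence "\<bar>real A / N - real B / N\<bar> < 1 / N" using assms unfolding abs_less_iff by linarith
 hence "\<bar>real A - real B\<bar> < 1" using assms(1)
  by (simp add: diff_divide_distrib[symmetric] divide_less_cancel)
 thus ?thesis by linarith
qed

text \<open>Vectors in a ball of radius \<open>r1\<close> are counted in two ways, averaged over a
  displacement \<open>u\<close> of the first half and over all real multipliers \<open>a\<close>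
  modulo 1. From above: for fixed \<open>x\<close> the points \<open>M x a\<close> equidistribute
  modulo \<open>L\<close>, which turns the sum over \<open>L\<close> into an integral divided by a
  covolume, and the average over \<open>u\<close> does the same for the sum over \<open>x\<close>.
  From below: near each grid point \<open>A / N\<close> the \<open>m\<close> vectors of
  \<open>PP A\<close> stay in the ball for all but a fraction \<open>v / \<theta>\<^sup>2\<close> of
  the displacements. Here \<open>p x\<close> is the first half of a vector and \<open>w x k\<close>
  is the vector of \<open>x\<close> after the \<open>k\<close>-th shift.\<close>

theorem averaging:
 fixes X :: "'x set" and p :: "'x => nat => real" and w :: "'x => nat => nat => real"
  and N m :: nat and PP :: "(nat => nat) => ('x \<times> (nat => real)) set"
 assumes d0: "d > 0" and C: "upper_tri d C" and C\<beta>: "!!i. i < d ==> (C i i)\<^sup>2 <= \<beta>" and T: "T > 0" and N: "N > 0"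
  and X: "countable X"
  and inj: "inj_on (%x. \<lambda>i\<in>{0..<0+d}. p x i) X"
  and p: "!!x. x : X ==> (\<lambda>i\<in>{0..<0+d}. p x i) : lat 0 d C"
  and w: "!!x k. x : X ==> k < d ==> EX z::nat => int. ALL i<d. w x k i = lin d C (%j. z j) i"
  and wnorm: "!!x k. x : X ==> k < d ==> (\<Sum>i<d. (w x k i)\<^sup>2) = (\<Sum>i<d. (p x i)\<^sup>2)"
  and onto: "!!x c. x : X ==> EX a. ALL i<d. (\<Sum>k<d. a k * w x k i) = c i"
  and P: "!!A. A : {..<d} \<rightarrow>\<^sub>E {..<N} ==> finite (PP A) & card (PP A) = m &
    PP A \<subseteq> X \<times> lat d d (%i j. T * C i j)"
  and PN: "!!A x y. A : {..<d} \<rightarrow>\<^sub>E {..<N} ==> (x, y) : PP A ==>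
    (\<Sum>i<d. (p x i)\<^sup>2) + (\<Sum>i<d. (y (d + i) + T * (\<Sum>k<d. A k / N * w x k i))\<^sup>2) <= r\<^sup>2"
  and v: "v = \<beta> * r\<^sup>2 / 3 + T\<^sup>2 * d * r ^ 4 / (12 * (real N)\<^sup>2)" and \<theta>: "\<theta> > 0" "v <= \<theta>\<^sup>2"
  and r1: "r1 > 0" "r1\<^sup>2 >= r\<^sup>2 + d * \<beta> / 4 + T\<^sup>2 * d\<^sup>2 * r\<^sup>2 / (4 * (real N)\<^sup>2) + \<theta>"
 shows "m * (1 - v / \<theta>\<^sup>2) * (\<Prod>i<d. C i i)\<^sup>2 * T ^ d <= unit_ball_vol (2 * d) * r1 ^ (2 * d)"
proof -
 define I where "I = {0..<0+d}"
 define J where "J = {d..<d+d}"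
 have IJ: "finite I" "finite J" "I \<inter> J = {}" by (auto simp: I_def J_def)
 have sI: "(\<Sum>i\<in>I. g i) = (\<Sum>i<d. g i)" for g :: "nat => real" by (simp add: I_def lessThan_atLeast0)
 have sJ: "(\<Sum>i\<in>J. g i) = (\<Sum>i<d. g (d + i))" for g :: "nat => real" unfolding J_def by (rule sum_shift_index)
 let ?\<kappa> = "\<Prod>i<d. C i i"
 have Cpos: "C i i > 0" if "i < d" for i using C that by (simp add: upper_tri_def)
 have \<kappa>: "?\<kappa> > 0" using Cpos by (intro prod_pos) auto
 interpret MI: sigma_finite_measure "leb I" by (rule leb.sigma_finite[OF IJ(1)])
 interpret MJ: sigma_finite_measure "leb J" by (rule leb.sigma_finite[OF IJ(2)])
 define TC where "TC = (%i j. T * C i j)"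
 have TC: "upper_tri d TC" using C T by (auto simp: upper_tri_def TC_def)
 define Id :: "nat => nat => real" where "Id i j = (if i = j then 1 else 0)" for i j
 have Id: "upper_tri d Id" by (auto simp: upper_tri_def Id_def)
 define L where "L = lat d d TC"
 define FI where "FI = box 0 d (%i. - C i i / 2) (%i. C i i)"
 define FJ where "FJ = box d d (%i. 0) (%i. TC i i)"
 \<comment> \<open>The unit cube is moved by half a mesh, so that it is the disjoint union of the
   \<open>N ^ d\<close> cells \<open>Q0 + A / N\<close>.\<close>
 define Q where "Q = box d d (%_. - 1 / (2 * N)) (%i. Id i i)"
 define Q0 where "Q0 = box d d (%_. - 1 / (2 * N)) (%_. 1 / N)"
 have tI: "tiles I (lat 0 d C) FI" unfolding I_def FI_def by (rule tiles_box[OF C])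
 have tJ: "tiles J L FJ" unfolding J_def L_def FJ_def by (rule tiles_box[OF TC])
 have tQ: "tiles J (lat d d Id) Q" unfolding J_def Q_def by (rule tiles_box[OF Id])
 have sets: "FI : sets (leb I)" "FJ : sets (leb J)" "Q : sets (leb J)" "Q0 : sets (leb J)"
  using tI tJ tQ by (auto simp: tiles_def Q0_def J_def box_sets)
 note [measurable] = sets
 have cL: "countable L" and L_sub: "L \<subseteq> J \<rightarrow>\<^sub>E UNIV" using tJ by (auto simp: tiles_def)
 have eFJ: "emeasure (leb J) FJ = ennreal (T ^ d * ?\<kappa>)"
  unfolding FJ_def J_def by (subst emeasure_box) (use Cpos T in \<open>auto simp: TC_def prod.distrib less_imp_le\<close>)
 have eQ: "emeasure (leb J) Q = 1"
  unfolding Q_def J_def by (subst emeasure_box) (auto simp: Id_def)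
 \<comment> \<open>Indicator of the ball of radius \<open>r1\<close>, with the two halves of the
   coordinates kept apart.\<close>
 define f :: "(nat => real) => (nat => real) => ennreal" where
  "f a b = indicator {..r1\<^sup>2} ((\<Sum>i\<in>I. (a i)\<^sup>2) + (\<Sum>i\<in>J. (b i)\<^sup>2))" for a b
 \<comment> \<open>Second half of the vector of \<open>x\<close> for the real multiplier
   \<open>a\<close>, up to elements of \<open>L\<close>.\<close>
 define M where "M x a = (\<lambda>i\<in>J. T * (\<Sum>k<d. a (d + k) * w x k (i - d)))" for x and a :: "nat => real"
 define p' where "p' x = (\<lambda>i\<in>I. p x i)" for x
 let ?f = "%x u a y. f (padd I (p' x) u) (padd J (M x a) y)"
 have f_meas: "(%x. f (g x) (h x)) : borel_measurable S"
  if "g : measurable S (leb I)" "h : measurable S (leb J)" for g h and S :: "'s measure"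
 proof -
  have "(%x. g x i) : borel_measurable S" if "i : I" for i
   using measurable_compose[OF \<open>g : measurable S (leb I)\<close> measurable_component_singleton[OF that]] by simp
  moreover have "(%x. h x i) : borel_measurable S" if "i : J" for i
   using measurable_compose[OF \<open>h : measurable S (leb J)\<close> measurable_component_singleton[OF that]] by simp
  ultimately have "(%x. (\<Sum>i\<in>I. (g x i)\<^sup>2) + (\<Sum>i\<in>J. (h x i)\<^sup>2)) : borel_measurable S"
   by (intro borel_measurable_add borel_measurable_sum borel_measurable_power)
  thus ?thesis unfolding f_def by measurable
 qed
 have M_meas: "M x : measurable (leb J) (leb J)" for x
 proof -
  have "(%a. a (d + k)) : borel_measurable (leb J)" if "k < d" for k
   using measurable_component_singleton[of "d + k" J "%_. lborel"] that by (simp add: J_def)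
  hence "(%a. T * (\<Sum>k<d. a (d + k) * w x k (i - d))) : borel_measurable (leb J)" for i
   by (intro borel_measurable_times borel_measurable_const borel_measurable_sum) auto
  thus ?thesis unfolding M_def by (intro measurable_restrict) simp
 qed
 have M_sp: "M x a : J \<rightarrow>\<^sub>E UNIV" for x a by (auto simp: M_def)
 define g where "g a = nn_integral (leb J) (%b. f a b)" for a
 have g_meas: "g : borel_measurable (leb I)"
 proof -
  have "(%z. f (fst z) (snd z)) : borel_measurable (leb I \<Otimes>\<^sub>M leb J)" by (rule f_meas) measurable
  hence "(%(a, b). f a b) : borel_measurable (leb I \<Otimes>\<^sub>M leb J)" by (simp add: case_prod_beta)
  thus ?thesis unfolding g_def by (rule MJ.borel_measurable_nn_integral)
 qed
 have V: "nn_integral (leb I) (%a. g a) = ennreal (unit_ball_vol (2 * d) * r1 ^ (2 * d))"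
 proof -
  have sq: "sqrt x <= r1 \<longleftrightarrow> x <= r1\<^sup>2" if "x >= 0" for x
   using r1(1) real_sqrt_le_iff[of x "r1\<^sup>2"] by simp
  let ?S = "{z. sqrt (\<Sum>i\<in>I \<union> J. (z i)\<^sup>2) <= r1} \<inter> space (leb (I \<union> J))"
  have S: "?S : sets (leb (I \<union> J))" by measurable
  have "emeasure (leb (I \<union> J)) ?S = nn_integral (leb (I \<union> J)) (%z. indicator ?S z)" using S by simp
  also have "... = nn_integral (leb I) (%a. (nn_integral (leb J) (%b. indicator ?S (merge I J (a, b)))))"
   by (rule leb.product_nn_integral_fold) (use IJ S in auto)
  also have "... = nn_integral (leb I) (%a. g a)"
   unfolding g_def
  proof (intro nn_integral_cong)
   fix a b assume "a : space (leb I)" "b : space (leb J)"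
   hence "merge I J (a, b) : space (leb (I \<union> J))" by (simp add: space_leb merge_def PiE_def Pi_def extensional_def)
   moreover have "(\<Sum>i\<in>I \<union> J. (merge I J (a, b) i)\<^sup>2) = (\<Sum>i\<in>I. (a i)\<^sup>2) + (\<Sum>i\<in>J. (b i)\<^sup>2)"
    using IJ by (subst sum.union_disjoint) (auto simp: merge_def intro!: arg_cong2[where f = "(+)"] sum.cong)
   moreover have "0 <= (\<Sum>i\<in>I. (a i)\<^sup>2) + (\<Sum>i\<in>J. (b i)\<^sup>2)" by (intro add_nonneg_nonneg sum_nonneg) auto
   ultimately show "indicator ?S (merge I J (a, b)) = f a b"
    unfolding f_def by (simp add: indicator_def sq)
  qed
  also have "emeasure (leb (I \<union> J)) ?S = ennreal (unit_ball_vol (2 * d) * r1 ^ (2 * d))"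
  proof -
   have "card (I \<union> J) = 2 * d" using IJ by (subst card_Un_disjoint) (auto simp: I_def J_def)
   thus ?thesis using emeasure_cball_aux[of "I \<union> J" r1] IJ r1 by simp
  qed
  finally show ?thesis by simp
 qed
 define Dxy where "Dxy x y = nn_integral (leb I) (%u. indicator FI u *
   nn_integral (leb J) (%a. indicator Q a * ?f x u a y))" for x y
 define J0 where "J0 = nn_integral (count_space X) (%x. (nn_integral (count_space L) (%y. Dxy x y)))"
 have pm: "(%a. padd J a y) : measurable (leb J) (leb J)" for y
  unfolding padd_commute[of J _ y] by (rule measurable_padd)
 have joint: "(%(u, a). indicator Q a * ?f x u a y) : borel_measurable (leb I \<Otimes>\<^sub>M leb J)" for x y
 proof -
  have "(%z. f (padd I (p' x) (fst z)) (padd J (M x (snd z)) y)) : borel_measurable (leb I \<Otimes>\<^sub>M leb J)"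
   by (rule f_meas) (use measurable_compose[OF measurable_fst measurable_padd]
    measurable_compose[OF measurable_snd measurable_compose[OF M_meas pm]] in auto)
  thus ?thesis unfolding case_prod_beta by measurable
 qed
 have upper: "ennreal (T ^ d * ?\<kappa>) * J0 <= ennreal (unit_ball_vol (2 * d) * r1 ^ (2 * d))"
 proof -
  have "ennreal (T ^ d * ?\<kappa>) * nn_integral (count_space L) (%y. Dxy x y) = nn_integral (leb I) (%u. indicator FI u * g (padd I u (p' x)))"
   if x: "x : X" for x
  proof -
   \<comment> \<open>\<open>h b\<close> counts the points of the coset \<open>b + L\<close> that lie
     in the ball when the first half is \<open>q\<close>. It is periodic, so it equidistributes, and
     unfolding it over \<open>FJ\<close> gives the volume \<open>g q\<close> of a slice of the
     ball.\<close>
   have inner: "ennreal (T ^ d * ?\<kappa>) * nn_integral (leb J) (%a. indicator Q a * nn_integral (count_space L) (%y. f q (padd J (M x a) y))) = g q"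
    if q: "q : space (leb I)" for q
   proof -
    define h where "h b = nn_integral (count_space L) (%y. f q (padd J b y))" for b
    have fq: "(%b. f q b) : borel_measurable (leb J)" by (rule f_meas) (use q in auto)
    have h_meas: "h : borel_measurable (leb J)" unfolding h_def
     by (rule borel_measurable_nn_integral_count_space[OF cL]) (use measurable_compose[OF pm fq] in auto)
    have "emeasure (leb J) FJ * nn_integral (leb J) (%a. indicator Q a * h (M x a)) =
      emeasure (leb J) Q * nn_integral (leb J) (%b. indicator FJ b * h b)"
    proof (rule tiles_equidistribution[OF tJ tQ h_meas _ M_meas])
     fix b v assume "b : J \<rightarrow>\<^sub>E (UNIV :: real set)" and vL: "v : L"
     have "h (padd J b v) = nn_integral (count_space L) (%y. f q (padd J b (padd J v y)))" by (simp add: h_def padd_assoc)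
     also have "... = h b"
      unfolding h_def L_def J_def by (rule nn_integral_lat_shift) (use vL TC in \<open>auto simp: L_def\<close>)
     finally show "h (padd J b v) = h b" .
    next
     fix a b assume "a : J \<rightarrow>\<^sub>E (UNIV :: real set)" "b : J \<rightarrow>\<^sub>E (UNIV :: real set)"
     have "padd J a b (d + k) = a (d + k) + b (d + k)" if "k < d" for k using that by (simp add: padd_def J_def)
     hence "(\<Sum>k<d. padd J a b (d + k) * w x k j) = (\<Sum>k<d. a (d + k) * w x k j) + (\<Sum>k<d. b (d + k) * w x k j)" for j
      by (simp add: sum.distrib[symmetric] distrib_right)
     thus "M x (padd J a b) = padd J (M x a) (M x b)" unfolding M_def padd_def[of J "M x a"]
      by (auto simp: fun_eq_iff padd_def distrib_left M_def)
    next
     fix v assume "v : lat d d Id"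
     then obtain z where z: "v = (\<lambda>i\<in>J. lin d Id (%j. real_of_int (z j)) (i - d))" by (auto simp: lat_def J_def)
     have vz: "v (d + k) = z k" if "k < d" for k
     proof -
      have "v (d + k) = (\<Sum>j<d. Id k j * z j)" using that by (simp add: z J_def lin_def)
      also have "... = (\<Sum>j<d. if j = k then real_of_int (z j) else 0)" by (intro sum.cong) (auto simp: Id_def)
      also have "... = z k" using that by simp
      finally show ?thesis .
     qed
     from w[OF x] obtain y where y: "!!k i. k < d ==> i < d ==> w x k i = lin d C (%j. real_of_int (y k j)) i" by metis
     have "M x v = (\<lambda>i\<in>J. lin d TC (%j. real_of_int (\<Sum>k<d. z k * y k j)) (i - d))"
     proof
      fix i show "M x v i = (\<lambda>i\<in>J. lin d TC (%j. real_of_int (\<Sum>k<d. z k * y k j)) (i - d)) i"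
      proof (cases "i : J")
       case True
       hence "M x v i = T * (\<Sum>k<d. z k * lin d C (%j. real_of_int (y k j)) (i - d))"
        by (auto simp: M_def vz y J_def intro!: sum.cong)
       also have "(\<Sum>k<d. z k * lin d C (%j. real_of_int (y k j)) (i - d)) = lin d C (%j. real_of_int (\<Sum>k<d. z k * y k j)) (i - d)"
        unfolding lin_def by (simp add: sum_distrib_left sum_distrib_right mult_ac) (rule sum.swap)
       finally show ?thesis using True by (simp add: TC_def lin_scale)
      qed (simp add: M_def)
     qed
     thus "M x v : L" unfolding L_def lat_def J_def
      by (intro CollectI exI[of _ "%j. \<Sum>k<d. z k * y k j"] conjI) auto
    next
     fix c assume c: "c : J \<rightarrow>\<^sub>E (UNIV :: real set)"
     from onto[OF x, of "%i. c (d + i) / T"] obtain a where a: "ALL i<d. (\<Sum>k<d. a k * w x k i) = c (d + i) / T" by blast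
     have "M x (\<lambda>i\<in>J. a (i - d)) = c"
     proof
      fix i show "M x (\<lambda>i\<in>J. a (i - d)) i = c i"
      proof (cases "i : J")
       case True
       hence "i - d < d" "d + (i - d) = i" by (auto simp: J_def)
       hence "T * (\<Sum>k<d. a k * w x k (i - d)) = c i" using a T by simp
       moreover have "(\<Sum>k<d. (\<lambda>i\<in>J. a (i - d)) (d + k) * w x k (i - d)) = (\<Sum>k<d. a k * w x k (i - d))"
        by (intro sum.cong) (auto simp: J_def)
       ultimately show ?thesis using True by (simp add: M_def)
      next
       case False
       thus ?thesis using c by (simp add: M_def PiE_def extensional_def)
      qed
     qed
     thus "EX a:J \<rightarrow>\<^sub>E UNIV. M x a = c" by (intro bexI[of _ "\<lambda>i\<in>J. a (i - d)"]) auto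
    qed
    also have "nn_integral (leb J) (%b. indicator FJ b * h b) = g q"
     unfolding h_def g_def by (rule tiles_unfold[OF tJ fq])
    finally show ?thesis by (simp add: eFJ eQ h_def)
   qed
   have "nn_integral (count_space L) (%y. Dxy x y) = nn_integral (leb I) (%u. (nn_integral (count_space L) (%y. indicator FI u *
     nn_integral (leb J) (%a. indicator Q a * ?f x u a y))))"
    unfolding Dxy_def
   proof (rule nn_integral_count_space_nn_integral[OF cL, symmetric])
    fix y
    show "(%u. indicator FI u * nn_integral (leb J) (%a. indicator Q a * ?f x u a y)) : borel_measurable (leb I)"
     using MJ.borel_measurable_nn_integral[OF joint[of x y]] by measurable
   qed
   also have "... = nn_integral (leb I) (%u. indicator FI u *
     nn_integral (leb J) (%a. indicator Q a * nn_integral (count_space L) (%y. ?f x u a y)))"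
   proof (rule nn_integral_cong)
    fix u assume u: "u : space (leb I)"
    have fy: "(%a. indicator Q a * ?f x u a y) : borel_measurable (leb J)" for y
     using measurable_Pair2[OF joint u, of x y] by simp
    have "nn_integral (leb J) (%a. indicator Q a * nn_integral (count_space L) (%y. ?f x u a y)) =
      nn_integral (leb J) (%a. (nn_integral (count_space L) (%y. indicator Q a * ?f x u a y)))"
     by (simp add: nn_integral_cmult)
    also have "... = nn_integral (count_space L) (%y. (nn_integral (leb J) (%a. indicator Q a * ?f x u a y)))"
     by (rule nn_integral_count_space_nn_integral[OF cL fy])
    finally show "nn_integral (count_space L) (%y. indicator FI u * nn_integral (leb J) (%a. indicator Q a * ?f x u a y))
     = indicator FI u * nn_integral (leb J) (%a. indicator Q a * nn_integral (count_space L) (%y. ?f x u a y))"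
     by (simp add: nn_integral_cmult)
   qed
   finally have e: "nn_integral (count_space L) (%y. Dxy x y) = nn_integral (leb I) (%u. indicator FI u *
     nn_integral (leb J) (%a. indicator Q a * nn_integral (count_space L) (%y. ?f x u a y)))" .
   have K: "nn_integral (leb J) (%a. indicator Q a * nn_integral (count_space L) (%y. ?f x u a y)) =
     ennreal (1 / (T ^ d * ?\<kappa>)) * g (padd I u (p' x))" if "u : space (leb I)" for u
   proof -
    have "padd I (p' x) u : space (leb I)" by (simp add: space_leb)
    from inner[OF this] have "g (padd I u (p' x)) = ennreal (T ^ d * ?\<kappa>) *
     nn_integral (leb J) (%a. indicator Q a * nn_integral (count_space L) (%y. ?f x u a y))"
     by (simp add: padd_commute)
    moreover have "ennreal (1 / (T ^ d * ?\<kappa>)) * ennreal (T ^ d * ?\<kappa>) = 1"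
     by (rule ennreal_inverse_mult) (intro mult_pos_pos zero_less_power T \<kappa>)
    ultimately show ?thesis by (simp add: mult.assoc[symmetric])
   qed
   have gm: "(%u. g (padd I u (p' x))) : borel_measurable (leb I)"
    unfolding padd_commute[of I _ "p' x"] using g_meas by measurable
   have "nn_integral (count_space L) (%y. Dxy x y) = nn_integral (leb I) (%u. ennreal (1 / (T ^ d * ?\<kappa>)) * (indicator FI u * g (padd I u (p' x))))"
    unfolding e by (rule nn_integral_cong) (simp add: K mult_ac)
   also have "... = ennreal (1 / (T ^ d * ?\<kappa>)) * nn_integral (leb I) (%u. indicator FI u * g (padd I u (p' x)))"
    by (intro nn_integral_cmult borel_measurable_times_ennreal borel_measurable_indicator sets gm)
   also have "ennreal (T ^ d * ?\<kappa>) * ... = nn_integral (leb I) (%u. indicator FI u * g (padd I u (p' x)))"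
   proof -
    have "ennreal (T ^ d * ?\<kappa>) * ennreal (1 / (T ^ d * ?\<kappa>)) = 1"
     by (subst mult.commute, rule ennreal_inverse_mult) (intro mult_pos_pos zero_less_power T \<kappa>)
    thus ?thesis by (simp add: mult.assoc[symmetric])
   qed
   finally show ?thesis .
  qed
  \<comment> \<open>The \<open>p' x\<close> are distinct points of \<open>lat 0 d C\<close>.
    Enlarging the sum to the whole lattice allows the average over \<open>u\<close> to be unfolded
    to an integral over the space.\<close>
  hence "ennreal (T ^ d * ?\<kappa>) * J0 = nn_integral (count_space X) (%x. (nn_integral (leb I) (%u. indicator FI u * g (padd I u (p' x)))))"
   unfolding J0_def by (simp add: nn_integral_cmult[symmetric] cong: nn_integral_cong_simp)
  also have "... = nn_integral (count_space (p' ` X)) (%y. (nn_integral (leb I) (%u. indicator FI u * g (padd I u y))))"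
  proof -
   have "inj_on p' X" using inj unfolding p'_def[abs_def] I_def .
   hence "bij_betw p' X (p' ` X)" by (rule inj_on_imp_bij_betw)
   from nn_integral_bij_count_space[OF this] show ?thesis by simp
  qed
  also have "... <= nn_integral (count_space (lat 0 d C)) (%y. (nn_integral (leb I) (%u. indicator FI u * g (padd I u y))))"
  proof -
   have sub: "p' ` X \<subseteq> lat 0 d C" using p by (auto simp: p'_def I_def)
   thus ?thesis by (rule nn_integral_count_space_mono_set)
  qed
  also have "... = nn_integral (leb I) (%u. (nn_integral (count_space (lat 0 d C)) (%y. indicator FI u * g (padd I u y))))"
  proof (rule nn_integral_count_space_nn_integral[symmetric])
   show "countable (lat 0 d C)" using tI by (simp add: tiles_def)
   fix y
   have "(%u. g (padd I u y)) : borel_measurable (leb I)"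
    unfolding padd_commute[of I _ y] using g_meas by measurable
   thus "(%u. indicator FI u * g (padd I u y)) : borel_measurable (leb I)"
    by (intro borel_measurable_times_ennreal borel_measurable_indicator sets)
  qed
  also have "... = nn_integral (leb I) (%u. indicator FI u * nn_integral (count_space (lat 0 d C)) (%y. g (padd I u y)))"
   by (simp add: nn_integral_cmult)
  also have "... = nn_integral (leb I) (%u. g u)" by (rule tiles_unfold[OF tI g_meas])
  finally show ?thesis using V by simp
 qed
 define \<A> where "\<A> = {..<d} \<rightarrow>\<^sub>E {..<N}"
 have fin\<A>: "finite \<A>" unfolding \<A>_def by (rule finite_PiE) auto
 define cA where "cA A = (\<lambda>i\<in>J. real (A (i - d)) / N)" for A :: "nat => nat"
 define qA where "qA A a = (indicator Q0 (padd J a (pneg J (cA A))) :: ennreal)" for A a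
 have Q0_mem: "padd J a (pneg J (cA A)) : Q0 \<longleftrightarrow>
   (ALL k<d. - 1 / (2 * N) <= a (d + k) - A k / N & a (d + k) - A k / N < 1 / (2 * N))" for A a
 proof -
  have "- 1 / (2 * real N) + 1 / N = 1 / (2 * N)" using N by (simp add: field_simps)
  hence "padd J a (pneg J (cA A)) : Q0 \<longleftrightarrow>
    (ALL i:J. - 1 / (2 * N) <= a i - A (i - d) / N & a i - A (i - d) / N < 1 / (2 * N))"
   unfolding Q0_def box_def J_def[symmetric] padd_def pneg_def cA_def by (simp add: PiE_iff)
  also have "... \<longleftrightarrow> (ALL k<d. - 1 / (2 * N) <= a (d + k) - A k / N & a (d + k) - A k / N < 1 / (2 * N))"
   unfolding J_def by (rule ball_shift_index[where P = "%i k. - 1 / (2 * N) <= a i - A k / N & a i - A k / N < 1 / (2 * N)"])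
  finally show ?thesis .
 qed
 \<comment> \<open>The cells around the grid points are disjoint and lie in
   \<open>Q\<close>.\<close>
 have qA_sum: "(\<Sum>A\<in>\<A>. qA A a) <= indicator Q a" if a: "a : J \<rightarrow>\<^sub>E UNIV" for a
 proof (cases "EX A:\<A>. padd J a (pneg J (cA A)) : Q0")
  case False
  hence "(\<Sum>A\<in>\<A>. qA A a) = 0" by (intro sum.neutral) (auto simp: qA_def)
  thus ?thesis by simp
 next
  case True
  then obtain A where A: "A : \<A>" "padd J a (pneg J (cA A)) : Q0" by blast
  have uniq: "B = A" if B: "B : \<A>" "padd J a (pneg J (cA B)) : Q0" for B
  proof (rule PiE_ext)
   show "B : {..<d} \<rightarrow>\<^sub>E {..<N}" "A : {..<d} \<rightarrow>\<^sub>E {..<N}" using A B by (auto simp: \<A>_def)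
   fix k assume "k : {..<d}"
   thus "B k = A k" using dist_nearest_unique[OF N, of "a (d + k)" "B k" "A k"] A(2) B(2) unfolding Q0_mem by auto
  qed
  have "(\<Sum>B\<in>\<A>. qA B a) = (\<Sum>B\<in>\<A>. if B = A then 1 else 0)"
  proof (rule sum.cong[OF refl])
   fix B assume "B : \<A>"
   hence "padd J a (pneg J (cA B)) : Q0 \<longleftrightarrow> B = A" using uniq A(2) by blast
   thus "qA B a = (if B = A then 1 else 0)" by (cases "B = A") (simp_all add: qA_def)
  qed
  also have "... = 1" using A fin\<A> by simp
  also have "a : Q"
  proof -
   have *: "- 1 / (2 * N) <= a (d + k) & a (d + k) < - 1 / (2 * N) + 1" if k: "k < d" for k
   proof -
    have "A k < N" using A(1) k by (auto simp: \<A>_def PiE_iff)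
    hence "A k / N <= (N - 1) / N" using N by (intro divide_right_mono) auto
    also have "... = 1 - 1 / N" using N by (simp add: field_simps)
    finally have u: "A k / N <= 1 - 1 / N" .
    have "0 <= A k / N" by simp
    moreover have "- 1 / (2 * N) <= a (d + k) - A k / N" "a (d + k) - A k / N < 1 / (2 * N)"
     using A(2) k unfolding Q0_mem by auto
    moreover have "1 / real N = 1 / (2 * N) + 1 / (2 * N)" by simp
    moreover have "- 1 / (2 * real N) = - (1 / (2 * real N))" by simp
    ultimately show ?thesis using u by (intro conjI) linarith+
   qed
   have "- 1 / (2 * N) <= a i & a i < - 1 / (2 * N) + 1" if "i : J" for i
   proof -
    from that obtain k where "i = d + k" "k < d" by (auto simp: J_def le_iff_add)
    thus ?thesis using * by simp
   qed
   thus ?thesis using a unfolding Q_def box_def J_def[symmetric] by (auto simp: PiE_iff Id_def)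
  qed
  hence "(1::ennreal) <= indicator Q a" by simp
  finally show ?thesis .
 qed
 define c0 where "c0 = (?\<kappa> * (1 / N) ^ d) * (1 - v / \<theta>\<^sup>2)"
 have MA: "ennreal c0 <= nn_integral (leb I) (%u. indicator FI u * nn_integral (leb J) (%a. qA A a * ?f x u a y))"
  if A: "A : \<A>" and xy: "(x, y) : PP A" for A x y
 proof -
  have A': "A : {..<d} \<rightarrow>\<^sub>E {..<N}" using A by (simp add: \<A>_def)
  have x: "x : X" and yL: "y : L" using P[OF A'] xy by (auto simp: L_def TC_def)
  define z where "z i = y (d + i) + T * (\<Sum>k<d. A k / N * w x k i)" for i
  have rr: "(\<Sum>i<d. (p x i)\<^sup>2) + (\<Sum>i<d. (z i)\<^sup>2) <= r\<^sup>2" using PN[OF A' xy] by (simp add: z_def)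
  \<comment> \<open>Coefficients of the linear part of the squared norm, for a displacement
    \<open>u\<close> of the first half and a displacement of the multiplier. The sides
    \<open>cc\<close> describe the box in which both vary.\<close>
  define tt where "tt i = (if i < d then 2 * p x i else 2 * T * (\<Sum>j<d. z j * w x (i - d) j))" for i
  define cc where "cc i = (if i < d then C i i else 1 / N)" for i
  have cc0: "0 <= cc i" if "i : I \<union> J" for i using that Cpos by (auto simp: cc_def less_imp_le)
  have pcc: "(\<Prod>i\<in>I \<union> J. cc i) = ?\<kappa> * (1 / N) ^ d"
  proof -
   have "(\<Prod>i\<in>I \<union> J. cc i) = (\<Prod>i\<in>I. cc i) * (\<Prod>i\<in>J. cc i)" using IJ by (intro prod.union_disjoint) auto
   also have "(\<Prod>i\<in>I. cc i) = ?\<kappa>" by (intro prod.cong) (auto simp: I_def cc_def)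
   also have "(\<Prod>i\<in>J. cc i) = (\<Prod>i\<in>J. 1 / N)" by (intro prod.cong) (auto simp: J_def cc_def)
   also have "... = (1 / N) ^ d" by (simp add: J_def)
   finally show ?thesis .
  qed
  have pnn: "(\<Sum>i<d. (p x i)\<^sup>2) >= 0" "(\<Sum>i<d. (z i)\<^sup>2) >= 0" by (auto intro!: sum_nonneg)
  have var: "(\<Sum>i\<in>I \<union> J. (tt i)\<^sup>2 * (cc i)\<^sup>2 / 12) <= v"
  proof -
   have "(\<Sum>i\<in>I \<union> J. (tt i)\<^sup>2 * (cc i)\<^sup>2 / 12) = (\<Sum>i\<in>I. (tt i)\<^sup>2 * (cc i)\<^sup>2 / 12) + (\<Sum>i\<in>J. (tt i)\<^sup>2 * (cc i)\<^sup>2 / 12)"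
    using IJ by (intro sum.union_disjoint) auto
   also have "(\<Sum>i\<in>I. (tt i)\<^sup>2 * (cc i)\<^sup>2 / 12) = (\<Sum>i<d. (p x i)\<^sup>2 * (C i i)\<^sup>2 / 3)"
    unfolding sI by (intro sum.cong) (auto simp: tt_def cc_def power_mult_distrib)
   also have "... <= (\<Sum>i<d. (p x i)\<^sup>2 * \<beta> / 3)"
    using C\<beta> by (intro sum_mono divide_right_mono mult_left_mono) auto
   also have "... = (\<Sum>i<d. (p x i)\<^sup>2) * \<beta> / 3" by (simp add: sum_distrib_right sum_divide_distrib)
   also have "... <= r\<^sup>2 * \<beta> / 3"
   proof -
    have "0 <= \<beta>" using C\<beta>[OF d0] by (auto intro: order_trans[OF zero_le_power2])
    thus ?thesis using rr pnn by (intro divide_right_mono mult_right_mono) auto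
   qed
   also have "(\<Sum>i\<in>J. (tt i)\<^sup>2 * (cc i)\<^sup>2 / 12) = (\<Sum>k<d. 4 * T\<^sup>2 * (\<Sum>j<d. z j * w x k j)\<^sup>2 / (12 * (real N)\<^sup>2))"
    unfolding sJ by (intro sum.cong) (auto simp: tt_def cc_def power_mult_distrib power_divide)
   also have "... <= (\<Sum>k<d. 4 * T\<^sup>2 * (r ^ 4 / 4) / (12 * (real N)\<^sup>2))"
   proof (intro sum_mono divide_right_mono mult_left_mono)
    fix k assume k: "k : {..<d}"
    let ?a = "\<Sum>i<d. (z i)\<^sup>2" and ?b = "\<Sum>i<d. (p x i)\<^sup>2"
    have "(\<Sum>j<d. z j * w x k j)\<^sup>2 <= ?a * (\<Sum>i<d. (w x k i)\<^sup>2)" by (rule Cauchy_Schwarz_ineq_sum)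
    also have "... = ?a * ?b" using wnorm[OF x, of k] k by simp
    \<comment> \<open>Arithmetic and geometric mean; the two squared norms add up to at most
      \<open>r\<^sup>2\<close>.\<close>
    also have "4 * (?a * ?b) <= (?b + ?a)\<^sup>2"
     using zero_le_power2[of "?b - ?a"] by (simp add: power2_eq_square algebra_simps)
    also have "... <= (r\<^sup>2)\<^sup>2" using rr pnn by (intro power_mono) auto
    finally show "(\<Sum>j<d. z j * w x k j)\<^sup>2 <= r ^ 4 / 4" by simp
   qed auto
   also have "... = T\<^sup>2 * d * r ^ 4 / (12 * (real N)\<^sup>2)" by (simp add: field_simps)
   finally show ?thesis unfolding v by (simp add: mult.commute)
  qed
  let ?B = "Pi\<^sub>E (I \<union> J) (%i. {-cc i/2..<cc i/2})"
  let ?G = "{\<xi>. (\<Sum>i\<in>I \<union> J. tt i * \<xi> i) <= \<theta>}"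
  have Bs: "?B : sets (leb (I \<union> J))" using IJ by (intro sets_PiM_I_finite) auto
  have Gm: "(%\<xi>. indicator ?B \<xi> * indicator ?G \<xi> :: ennreal) : borel_measurable (leb (I \<union> J))"
  proof -
   have "(%\<xi>. \<Sum>i\<in>I \<union> J. tt i * \<xi> i) : borel_measurable (leb (I \<union> J))" by measurable
   hence "(%\<xi>. indicator ?B \<xi> * indicator {..\<theta>} (\<Sum>i\<in>I \<union> J. tt i * \<xi> i) :: ennreal) : borel_measurable (leb (I \<union> J))"
    using Bs by measurable
   thus ?thesis by (simp add: indicator_def)
  qed
  have "ennreal c0 <= (\<integral>\<^sup>+\<xi>. indicator ?B \<xi> * indicator ?G \<xi> \<partial>leb (I \<union> J))"
   using box_chebyshev[OF _ cc0 \<theta>(1) var \<theta>(2)] IJ unfolding pcc c0_def by simp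
  also have "... = nn_integral (leb I) (%u. (nn_integral (leb J) (%e. indicator ?B (merge I J (u, e)) * indicator ?G (merge I J (u, e)))))"
   by (rule leb.product_nn_integral_fold) (use IJ Gm in auto)
  also have "... <= nn_integral (leb I) (%u. (nn_integral (leb J) (%e. indicator FI u * (indicator Q0 e * f (padd I (p' x) u) (padd J (M x (padd J (cA A) e)) y)))))"
  proof (intro nn_integral_mono)
   fix u e assume u: "u : space (leb I)" and e: "e : space (leb J)"
   let ?\<xi> = "merge I J (u, e)"
   show "indicator ?B ?\<xi> * indicator ?G ?\<xi> \<le>
    indicator FI u * (indicator Q0 e * f (padd I (p' x) u) (padd J (M x (padd J (cA A) e)) y))"
   proof (cases "?\<xi> : ?B & ?\<xi> : ?G")
    case True
    have mI: "?\<xi> i = u i" if "i : I" for i using that by (simp add: merge_def)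
    have mJ: "?\<xi> i = e i" if "i : J" for i using that IJ(3) by (auto simp: merge_def)
    have ub: "- C i i / 2 <= u i & u i < C i i / 2" if "i < d" for i
    proof -
     have "i : I" using that by (simp add: I_def)
     hence "?\<xi> i : {-cc i/2..<cc i/2}" using True by (auto simp: PiE_iff)
     thus ?thesis using mI[OF \<open>i : I\<close>] that by (simp add: cc_def)
    qed
    have eb: "- 1 / (2 * N) <= e (d + i) & e (d + i) < 1 / (2 * N)" if "i < d" for i
    proof -
     have "d + i : J" using that by (simp add: J_def)
     hence "?\<xi> (d + i) : {-cc (d + i)/2..<cc (d + i)/2}" using True by (auto simp: PiE_iff)
     thus ?thesis using mJ[OF \<open>d + i : J\<close>] by (simp add: cc_def)
    qed
    have uF: "u : FI"
    proof -
     have "u i : {- C (i - 0) (i - 0) / 2..<- C (i - 0) (i - 0) / 2 + C (i - 0) (i - 0)}" if "i : I" for i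
      using ub[of i] that by (auto simp: I_def)
     thus ?thesis using u unfolding FI_def box_def I_def[symmetric] by (auto simp: PiE_iff space_leb)
    qed
    have eQ0: "e : Q0"
    proof -
     have "e i : {- 1 / (2 * real N)..<- 1 / (2 * real N) + 1 / N}" if "i : J" for i
     proof -
      have "i - d < d" "d + (i - d) = i" using that by (auto simp: J_def)
      with eb[of "i - d"] have "- 1 / (2 * N) <= e i" "e i < 1 / (2 * N)" by auto
      moreover have "- 1 / (2 * real N) + 1 / N = 1 / (2 * N)" using N by (simp add: field_simps)
      ultimately show ?thesis by simp
     qed
     thus ?thesis using e unfolding Q0_def box_def J_def[symmetric] by (auto simp: PiE_iff space_leb)
    qed
    define S where "S i = T * (\<Sum>k<d. e (d + k) * w x k i)" for i
    \<comment> \<open>Three parts: the norm before the displacement is at most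
      \<open>r\<^sup>2\<close>, the linear part is at most \<open>\<theta>\<close> on
      \<open>?G\<close>, and the squares in \<open>u2\<close> and \<open>S2\<close> are bounded by
      their worst case.\<close>
    have norm: "(\<Sum>i\<in>I. (padd I (p' x) u i)\<^sup>2) + (\<Sum>i\<in>J. (padd J (M x (padd J (cA A) e)) y i)\<^sup>2) <= r1\<^sup>2"
    proof -
     have 1: "(\<Sum>i\<in>I. (padd I (p' x) u i)\<^sup>2) = (\<Sum>i<d. (p x i + u i)\<^sup>2)"
      unfolding sI by (intro sum.cong) (auto simp: padd_def p'_def I_def)
     have 2: "(\<Sum>i\<in>J. (padd J (M x (padd J (cA A) e)) y i)\<^sup>2) = (\<Sum>i<d. (z i + S i)\<^sup>2)"
      unfolding sJ
     proof (rule sum.cong[OF refl])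
      fix i assume "i : {..<d}"
      hence iJ: "d + i : J" by (simp add: J_def)
      have "padd J (cA A) e (d + k) = A k / N + e (d + k)" if "k < d" for k
       using that by (simp add: padd_def cA_def J_def)
      hence "(\<Sum>k<d. padd J (cA A) e (d + k) * w x k i) = (\<Sum>k<d. A k / N * w x k i) + (\<Sum>k<d. e (d + k) * w x k i)"
       by (simp add: sum.distrib[symmetric] distrib_right)
      moreover have "padd J (M x b) y (d + i) = T * (\<Sum>k<d. b (d + k) * w x k i) + y (d + i)" for b
       using iJ by (simp add: padd_def M_def)
      ultimately have "padd J (M x (padd J (cA A) e)) y (d + i) = z i + S i"
       by (simp add: z_def S_def distrib_left)
      thus "(padd J (M x (padd J (cA A) e)) y (d + i))\<^sup>2 = (z i + S i)\<^sup>2" by simp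
     qed
     have lin_eq: "(\<Sum>i\<in>I \<union> J. tt i * ?\<xi> i) = 2 * (\<Sum>i<d. p x i * u i) + 2 * (\<Sum>i<d. z i * S i)"
     proof -
      have "(\<Sum>i\<in>I \<union> J. tt i * ?\<xi> i) = (\<Sum>i\<in>I. tt i * ?\<xi> i) + (\<Sum>i\<in>J. tt i * ?\<xi> i)"
       using IJ by (intro sum.union_disjoint) auto
      also have "(\<Sum>i\<in>I. tt i * ?\<xi> i) = (\<Sum>i\<in>I. 2 * (p x i * u i))"
      proof (rule sum.cong[OF refl])
       fix i assume i: "i : I"
       hence "i < d" by (simp add: I_def)
       thus "tt i * ?\<xi> i = 2 * (p x i * u i)" by (simp add: mI[OF i] tt_def)
      qed
      also have "... = 2 * (\<Sum>i<d. p x i * u i)" unfolding sI by (simp add: sum_distrib_left)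
      also have "(\<Sum>i\<in>J. tt i * ?\<xi> i) = (\<Sum>i\<in>J. 2 * T * (\<Sum>j<d. z j * w x (i - d) j) * e i)"
      proof (rule sum.cong[OF refl])
       fix i assume i: "i : J"
       hence "\<not> i < d" by (simp add: J_def)
       thus "tt i * ?\<xi> i = 2 * T * (\<Sum>j<d. z j * w x (i - d) j) * e i" by (simp add: mJ[OF i] tt_def)
      qed
      also have "... = (\<Sum>k<d. \<Sum>j<d. 2 * T * (z j * w x k j) * e (d + k))"
       unfolding sJ by (simp add: sum_distrib_left sum_distrib_right)
      also have "... = (\<Sum>j<d. \<Sum>k<d. 2 * T * (z j * w x k j) * e (d + k))" by (rule sum.swap)
      also have "... = 2 * (\<Sum>i<d. z i * S i)"
       unfolding S_def by (simp add: sum_distrib_left mult_ac)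
      finally show ?thesis .
     qed
     have u2: "(\<Sum>i<d. (u i)\<^sup>2) <= d * \<beta> / 4"
     proof -
      have "(u i)\<^sup>2 <= \<beta> / 4" if "i < d" for i
      proof -
       have "\<bar>u i\<bar> <= C i i / 2" using ub[OF that] by (auto simp: abs_le_iff)
       hence "(u i)\<^sup>2 <= (C i i / 2)\<^sup>2" by (rule abs_le_square_iff[THEN iffD1, OF order_trans]) (use Cpos[OF that] in auto)
       thus ?thesis using C\<beta>[OF that] by (simp add: power_divide)
      qed
      hence "(\<Sum>i<d. (u i)\<^sup>2) <= (\<Sum>i<d. \<beta> / 4)" by (intro sum_mono) auto
      thus ?thesis by simp
     qed
     have S2: "(\<Sum>i<d. (S i)\<^sup>2) <= T\<^sup>2 * d\<^sup>2 * r\<^sup>2 / (4 * (real N)\<^sup>2)"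
     proof -
      have e2: "(\<Sum>k<d. (e (d + k))\<^sup>2) <= d / (4 * (real N)\<^sup>2)"
      proof -
       have "(e (d + k))\<^sup>2 <= 1 / (4 * (real N)\<^sup>2)" if "k < d" for k
       proof -
        have "\<bar>e (d + k)\<bar> <= \<bar>1 / (2 * real N)\<bar>" using eb[OF that] by (auto simp: abs_le_iff)
        hence "(e (d + k))\<^sup>2 <= (1 / (2 * real N))\<^sup>2" by (simp only: abs_le_square_iff)
        thus ?thesis by (simp add: power_divide power_mult_distrib)
       qed
       hence "(\<Sum>k<d. (e (d + k))\<^sup>2) <= (\<Sum>k<d. 1 / (4 * (real N)\<^sup>2))" by (intro sum_mono) auto
       thus ?thesis by simp
      qed
      have "(\<Sum>i<d. (S i)\<^sup>2) = T\<^sup>2 * (\<Sum>i<d. (\<Sum>k<d. e (d + k) * w x k i)\<^sup>2)"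
       by (simp add: S_def power_mult_distrib sum_distrib_left[symmetric])
      also have "... <= T\<^sup>2 * (\<Sum>i<d. (\<Sum>k<d. (e (d + k))\<^sup>2) * (\<Sum>k<d. (w x k i)\<^sup>2))"
       by (intro mult_left_mono sum_mono Cauchy_Schwarz_ineq_sum) auto
      also have "... = T\<^sup>2 * ((\<Sum>k<d. (e (d + k))\<^sup>2) * (\<Sum>k<d. \<Sum>i<d. (w x k i)\<^sup>2))"
      proof -
       have sw: "(\<Sum>k<d. \<Sum>i<d. (w x k i)\<^sup>2) = (\<Sum>i<d. \<Sum>k<d. (w x k i)\<^sup>2)" by (rule sum.swap)
       show ?thesis unfolding sw by (simp only: sum_distrib_left[symmetric])
      qed
      also have "(\<Sum>k<d. \<Sum>i<d. (w x k i)\<^sup>2) = d * (\<Sum>i<d. (p x i)\<^sup>2)" using wnorm[OF x] by simp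
      also have "T\<^sup>2 * ((\<Sum>k<d. (e (d + k))\<^sup>2) * (d * (\<Sum>i<d. (p x i)\<^sup>2))) <= T\<^sup>2 * (d / (4 * (real N)\<^sup>2) * (d * r\<^sup>2))"
       using e2 rr pnn by (intro mult_left_mono mult_mono) auto
      also have "... = T\<^sup>2 * d\<^sup>2 * r\<^sup>2 / (4 * (real N)\<^sup>2)" by (simp add: power2_eq_square)
      finally show ?thesis .
     qed
     have "(\<Sum>i<d. (p x i + u i)\<^sup>2) + (\<Sum>i<d. (z i + S i)\<^sup>2) =
       ((\<Sum>i<d. (p x i)\<^sup>2) + (\<Sum>i<d. (z i)\<^sup>2)) + (2 * (\<Sum>i<d. p x i * u i) + 2 * (\<Sum>i<d. z i * S i)) +
       (\<Sum>i<d. (u i)\<^sup>2) + (\<Sum>i<d. (S i)\<^sup>2)"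
      by (simp add: power2_sum sum.distrib sum_distrib_left mult_ac)
     moreover have "2 * (\<Sum>i<d. p x i * u i) + 2 * (\<Sum>i<d. z i * S i) <= \<theta>" using True lin_eq by simp
     ultimately show ?thesis unfolding 1 2 using rr u2 S2 r1(2) by (simp only: of_nat_power)
    qed
    hence "f (padd I (p' x) u) (padd J (M x (padd J (cA A) e)) y) = 1" unfolding f_def by simp
    hence "indicator FI u * (indicator Q0 e * f (padd I (p' x) u) (padd J (M x (padd J (cA A) e)) y)) = 1"
     by (simp only: indicator_simps(1)[OF uF] indicator_simps(1)[OF eQ0] mult_1)
    moreover have "indicator ?B ?\<xi> * indicator ?G ?\<xi> <= (1::ennreal)"
     by (simp only: indicator_simps(1)[OF conjunct1[OF True]] indicator_simps(1)[OF conjunct2[OF True]] mult_1 order_refl)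
    ultimately show ?thesis by (simp only:)
   next
    case False
    hence "indicator ?B ?\<xi> = (0::ennreal) \<or> indicator ?G ?\<xi> = (0::ennreal)" by (simp only: indicator_eq_0_iff) blast
    hence "indicator ?B ?\<xi> * indicator ?G ?\<xi> = (0::ennreal)" by (elim disjE) (simp_all only: mult_zero_left mult_zero_right)
    thus ?thesis by (simp only: zero_le)
   qed
  qed
  also have "... = nn_integral (leb I) (%u. indicator FI u * nn_integral (leb J) (%a. qA A a * ?f x u a y))"
  proof (rule nn_integral_cong)
   fix u assume u: "u : space (leb I)"
   have m1: "(%a. ?f x u a y) : borel_measurable (leb J)"
    by (rule f_meas) (use measurable_compose[OF M_meas pm] in \<open>auto simp: space_leb\<close>)
   have m2: "qA A : borel_measurable (leb J)" unfolding qA_def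
    by (rule measurable_compose[OF pm]) simp
   have "nn_integral (leb J) (%a. qA A a * ?f x u a y) =
     nn_integral (leb J) (%e. qA A (padd J (cA A) e) * f (padd I (p' x) u) (padd J (M x (padd J (cA A) e)) y))"
    by (rule nn_integral_padd[OF IJ(2), symmetric]) (intro borel_measurable_times_ennreal m1 m2)
   also have "... = nn_integral (leb J) (%e. indicator Q0 e * f (padd I (p' x) u) (padd J (M x (padd J (cA A) e)) y))"
   proof (rule nn_integral_cong)
    fix e assume "e : space (leb J)"
    hence "padd J (padd J (cA A) e) (pneg J (cA A)) = e"
     using padd_pneg[of e J "cA A"] by (simp add: space_leb padd_commute)
    thus "qA A (padd J (cA A) e) * f (padd I (p' x) u) (padd J (M x (padd J (cA A) e)) y) =
     indicator Q0 e * f (padd I (p' x) u) (padd J (M x (padd J (cA A) e)) y)" by (simp add: qA_def)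
   qed
   finally have eq: "nn_integral (leb J) (%a. qA A a * ?f x u a y) =
    nn_integral (leb J) (%e. indicator Q0 e * f (padd I (p' x) u) (padd J (M x (padd J (cA A) e)) y))" .
   have m3: "(%e. f (padd I (p' x) u) (padd J (M x (padd J (cA A) e)) y)) : borel_measurable (leb J)"
    by (rule measurable_compose[OF measurable_padd m1])
   show "nn_integral (leb J) (%e. indicator FI u * (indicator Q0 e * f (padd I (p' x) u) (padd J (M x (padd J (cA A) e)) y))) =
    indicator FI u * nn_integral (leb J) (%a. qA A a * ?f x u a y)"
    unfolding eq by (rule nn_integral_cmult) (intro borel_measurable_times_ennreal borel_measurable_indicator sets m3)
  qed
  finally show ?thesis .
 qed
 have lower: "ennreal (N ^ d * (m * c0)) <= J0"
 proof -
  define h where "h A x y = nn_integral (leb I) (%u. indicator FI u * nn_integral (leb J) (%a. qA A a * ?f x u a y))" for A x y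
  have c0: "0 <= c0" unfolding c0_def using \<kappa> \<theta> by (intro mult_nonneg_nonneg) (auto simp: field_simps)
  have "ennreal (m * c0) <= nn_integral (count_space X) (%x. (nn_integral (count_space L) (%y. h A x y)))" if A: "A : \<A>" for A
  proof -
   have PA: "finite (PP A)" "card (PP A) = m" "PP A \<subseteq> X \<times> L"
    using P[of A] A by (auto simp: \<A>_def L_def TC_def)
   have "ennreal (m * c0) = (\<Sum>z\<in>PP A. ennreal c0)" using c0 PA(2) by (simp add: ennreal_mult ennreal_of_nat_eq_real_of_nat)
   also have "... <= (\<Sum>(x, y)\<in>PP A. h A x y)"
    by (rule sum_mono) (use MA[OF A] in \<open>auto simp: h_def\<close>)
   also have "... <= nn_integral (count_space X) (%x. (nn_integral (count_space L) (%y. h A x y)))"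
    by (rule nn_integral_count_space_ge_pairs[OF PA(1,3)])
   finally show ?thesis .
  qed
  hence "(\<Sum>A\<in>\<A>. ennreal (m * c0)) <= (\<Sum>A\<in>\<A>. \<integral>\<^sup>+x. (nn_integral (count_space L) (%y. h A x y)) \<partial>count_space X)"
   by (rule sum_mono)
  also have "(\<Sum>A\<in>\<A>. ennreal (m * c0)) = ennreal (N ^ d * (m * c0))"
   using c0 by (simp add: \<A>_def card_PiE ennreal_mult ennreal_of_nat_eq_real_of_nat ennreal_power)
  also have "(\<Sum>A\<in>\<A>. \<integral>\<^sup>+x. (nn_integral (count_space L) (%y. h A x y)) \<partial>count_space X) =
    nn_integral (count_space X) (%x. (nn_integral (count_space L) (%y. (\<Sum>A\<in>\<A>. h A x y))))"
   by (simp add: nn_integral_sum)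
  also have "... <= J0" unfolding J0_def
  proof (intro nn_integral_mono)
   fix x y
   have m1: "(%z. f (padd I (p' x) (fst z)) (padd J (M x (snd z)) y)) : borel_measurable (leb I \<Otimes>\<^sub>M leb J)"
    by (rule f_meas) (use measurable_compose[OF measurable_fst measurable_padd]
     measurable_compose[OF measurable_snd measurable_compose[OF M_meas pm]] in auto)
   have m2: "qA A : borel_measurable (leb J)" for A unfolding qA_def
    by (rule measurable_compose[OF pm]) simp
   have m3: "(%(u, a). qA A a * ?f x u a y) : borel_measurable (leb I \<Otimes>\<^sub>M leb J)" for A
    unfolding case_prod_beta using m1 measurable_compose[OF measurable_snd m2] by (intro borel_measurable_times_ennreal) auto
   have m4: "(%a. qA A a * ?f x u a y) : borel_measurable (leb J)" if "u : space (leb I)" for A u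
    using measurable_Pair2[OF m3 that, of A] by simp
   have "(\<Sum>A\<in>\<A>. h A x y) = nn_integral (leb I) (%u. (\<Sum>A\<in>\<A>. indicator FI u * nn_integral (leb J) (%a. qA A a * ?f x u a y)))"
    unfolding h_def by (rule nn_integral_sum[symmetric])
     (intro borel_measurable_times_ennreal borel_measurable_indicator sets MJ.borel_measurable_nn_integral[OF m3])
   also have "... <= Dxy x y" unfolding Dxy_def
   proof (rule nn_integral_mono)
    fix u assume u: "u : space (leb I)"
    have "(\<Sum>A\<in>\<A>. indicator FI u * nn_integral (leb J) (%a. qA A a * ?f x u a y)) =
      indicator FI u * nn_integral (leb J) (%a. (\<Sum>A\<in>\<A>. qA A a * ?f x u a y))"
     by (simp add: sum_distrib_left[symmetric] nn_integral_sum[OF m4[OF u]])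
    also have "... <= indicator FI u * nn_integral (leb J) (%a. indicator Q a * ?f x u a y)"
    proof (intro mult_left_mono nn_integral_mono)
     fix a assume "a : space (leb J)"
     thus "(\<Sum>A\<in>\<A>. qA A a * ?f x u a y) <= indicator Q a * ?f x u a y"
      unfolding sum_distrib_right[symmetric] by (intro mult_right_mono qA_sum) (auto simp: space_leb)
    qed auto
    finally show "(\<Sum>A\<in>\<A>. indicator FI u * nn_integral (leb J) (%a. qA A a * ?f x u a y)) \<le>
      indicator FI u * nn_integral (leb J) (%a. indicator Q a * ?f x u a y)" .
   qed
   finally show "(\<Sum>A\<in>\<A>. h A x y) <= Dxy x y" .
  qed
  finally show ?thesis .
 qed
 have "ennreal (T ^ d * ?\<kappa>) * ennreal (N ^ d * (m * c0)) <= ennreal (unit_ball_vol (2 * d) * r1 ^ (2 * d))"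
  using mult_left_mono[OF lower, of "ennreal (T ^ d * ?\<kappa>)"] upper by (rule order_trans) simp
 moreover have c0: "0 <= c0" unfolding c0_def using \<kappa> \<theta> by (intro mult_nonneg_nonneg) (auto simp: field_simps)
 ultimately have "ennreal (T ^ d * ?\<kappa> * (N ^ d * (m * c0))) <= ennreal (unit_ball_vol (2 * d) * r1 ^ (2 * d))"
  using \<kappa> T by (subst ennreal_mult) (auto simp: less_imp_le)
 moreover have "0 <= unit_ball_vol (2 * d) * r1 ^ (2 * d)" using r1 by simp
 ultimately have "T ^ d * ?\<kappa> * (N ^ d * (m * c0)) <= unit_ball_vol (2 * d) * r1 ^ (2 * d)" by simp
 moreover have "T ^ d * ?\<kappa> * (N ^ d * (m * c0)) = m * (1 - v / \<theta>\<^sup>2) * ?\<kappa>\<^sup>2 * T ^ d"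
  using N by (simp add: c0_def power_divide power2_eq_square field_simps)
 ultimately show ?thesis by (simp only: of_nat_mult of_nat_numeral)
qed

section \<open>Lattices with an upper triangular basis\<close>

lemma ex1_bij:
 assumes "inj_on g D" "!!v. P v \<longleftrightarrow> v : D & Q (g v)" "!!V. Q V ==> V : g ` D"
 shows "(EX! v. P v) \<longleftrightarrow> (EX! V. Q V)"
proof
 assume "EX! v. P v"
 then obtain v where v: "P v" "!!w. P w ==> w = v" by blast
 show "EX! V. Q V"
 proof (rule ex1I)
  show "Q (g v)" using v(1) assms(2) by blast
  fix V assume "Q V"
  then obtain w where "w : D" "V = g w" using assms(3) by blast
  thus "V = g v" using v(2)[of w] assms(2) \<open>Q V\<close> by blast
 qed
next
 assume "EX! V. Q V"
 then obtain V where V: "Q V" "!!W. Q W ==> W = V" by blast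
 obtain v where v: "v : D" "V = g v" using assms(3)[OF V(1)] by blast
 show "EX! v. P v"
 proof (rule ex1I)
  show "P v" using v V(1) assms(2) by blast
  fix w assume "P w"
  hence w: "w : D" "Q (g w)" using assms(2) by blast+
  hence "g w = g v" using V(2) v(2) by blast
  thus "w = v" using w(1) v(1) by (rule inj_onD[OF assms(1)])
 qed
qed

lemma inj_vec: "inj_on (Matrix.vec n) ({..<n} \<rightarrow>\<^sub>E UNIV)"
proof (rule inj_onI)
 fix f g :: "nat => 'a" assume fg: "f : {..<n} \<rightarrow>\<^sub>E UNIV" "g : {..<n} \<rightarrow>\<^sub>E UNIV" "Matrix.vec n f = Matrix.vec n g"
 have "f i = g i" if "i < n" for i using arg_cong[OF fg(3), of "%v. v $ i"] that by simp
 thus "f = g" using fg(1,2) by (intro PiE_ext[of f "{..<n}" "%_. UNIV" g]) auto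
qed

lemma vec_image: "Matrix.vec n ` ({..<n} \<rightarrow>\<^sub>E UNIV) = (carrier_vec n :: 'a vec set)"
proof
 show "(carrier_vec n :: 'a vec set) \<subseteq> Matrix.vec n ` ({..<n} \<rightarrow>\<^sub>E UNIV)"
 proof
  fix v :: "'a vec" assume v: "v : carrier_vec n"
  show "v : Matrix.vec n ` ({..<n} \<rightarrow>\<^sub>E UNIV)"
   by (rule image_eqI[of _ _ "\<lambda>i\<in>{..<n}. v $ i"]) (use v in \<open>auto intro!: eq_vecI\<close>)
 qed
qed (rule image_subsetI, rule vec_carrier)

lemma sets_lborel_vec: "sets (lborel_vec n) = {Matrix.vec n ` A | A. A : sets (leb {..<n})}"
 unfolding lborel_vec_def by (rule sets_embed_measure') (use inj_vec in \<open>simp add: space_leb\<close>)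

lemma emeasure_lborel_vec:
 assumes "A : sets (leb {..<n})"
 shows "emeasure (lborel_vec n) (Matrix.vec n ` A) = emeasure (leb {..<n}) A"
proof -
 have sub: "A \<subseteq> {..<n} \<rightarrow>\<^sub>E UNIV" using sets.sets_into_space[OF assms] by (simp add: space_leb)
 have "Matrix.vec n ` A : sets (lborel_vec n)" using assms sets_lborel_vec by auto
 hence "emeasure (lborel_vec n) (Matrix.vec n ` A) = emeasure (leb {..<n}) (Matrix.vec n -` Matrix.vec n ` A \<inter> space (leb {..<n}))"
  unfolding lborel_vec_def by (intro emeasure_embed_measure') (use inj_vec in \<open>simp_all add: space_leb\<close>)
 also have "Matrix.vec n -` Matrix.vec n ` A \<inter> space (leb {..<n}) = A"
  using sub inj_onD[OF inj_vec] by (fastforce simp: space_leb)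
 finally show ?thesis .
qed

text \<open>The bijection sends \<open>v\<close> to the vector of its negative, which accounts for
  the two sign conventions.\<close>

lemma fundamental_region_iff_tiles:
 assumes C: "upper_tri n C" and A: "A : sets (leb {..<n})"
 shows "fundamental_region n (Matrix.vec n ` lat 0 n C) (Matrix.vec n ` A) \<longleftrightarrow> tiles {..<n} (lat 0 n C) A"
proof -
 let ?I = "{..<n}"
 have "tiles {0..<0+n} (lat 0 n C) (box 0 n (%_. 0) (%i. C i i))" by (rule tiles_box[OF C])
 hence t: "tiles ?I (lat 0 n C) (box 0 n (%_. 0) (%i. C i i))" by (simp only: lessThan_atLeast0 add_0)
 hence sub: "lat 0 n C \<subseteq> ?I \<rightarrow>\<^sub>E UNIV" and cnt: "countable (lat 0 n C)" and neg: "!!v. v : lat 0 n C ==> pneg ?I v : lat 0 n C"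
  by (auto simp: tiles_def)
 have Asub: "A \<subseteq> ?I \<rightarrow>\<^sub>E UNIV" using sets.sets_into_space[OF A] by (simp add: space_leb)
 have nn: "pneg ?I (pneg ?I v) = v" if "v : ?I \<rightarrow>\<^sub>E UNIV" for v
  using that by (auto simp: pneg_def fun_eq_iff PiE_def extensional_def)
 have eq: "(EX! v. v : lat 0 n C & padd ?I x v : A) \<longleftrightarrow>
   (EX! V. V : Matrix.vec n ` lat 0 n C & Matrix.vec n x - V : Matrix.vec n ` A)" if x: "x : ?I \<rightarrow>\<^sub>E UNIV" for x
 proof (rule ex1_bij[where g = "%v. Matrix.vec n (pneg ?I v)" and D = "lat 0 n C"])
  show "inj_on (%v. Matrix.vec n (pneg ?I v)) (lat 0 n C)"
  proof (rule inj_onI)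
   fix v w assume vw: "v : lat 0 n C" "w : lat 0 n C" "Matrix.vec n (pneg ?I v) = Matrix.vec n (pneg ?I w)"
   hence "pneg ?I v = pneg ?I w" using inj_onD[OF inj_vec, OF vw(3)] neg sub by blast
   thus "v = w" using nn vw(1,2) sub by (metis subsetD)
  qed
  fix v
  show "(v : lat 0 n C & padd ?I x v : A) \<longleftrightarrow> v : lat 0 n C &
   Matrix.vec n (pneg ?I v) : Matrix.vec n ` lat 0 n C & Matrix.vec n x - Matrix.vec n (pneg ?I v) : Matrix.vec n ` A"
  proof (cases "v : lat 0 n C")
   case True
   have "Matrix.vec n x - Matrix.vec n (pneg ?I v) = Matrix.vec n (padd ?I x v)"
    by (intro eq_vecI) (auto simp: padd_def pneg_def)
   moreover have "Matrix.vec n (padd ?I x v) : Matrix.vec n ` A \<longleftrightarrow> padd ?I x v : A"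
    using inj_on_image_mem_iff[OF inj_vec padd_space Asub] .
   ultimately show ?thesis using True neg by simp
  qed simp
 next
  fix V assume "V : Matrix.vec n ` lat 0 n C & Matrix.vec n x - V : Matrix.vec n ` A"
  then obtain w where w: "w : lat 0 n C" "V = Matrix.vec n w" by auto
  thus "V : (%v. Matrix.vec n (pneg ?I v)) ` lat 0 n C"
   using neg[OF w(1)] nn[of w] sub by (intro image_eqI[of _ _ "pneg ?I w"]) auto
 qed
 have F: "Matrix.vec n ` A : sets (lborel_vec n)" using A sets_lborel_vec by blast
 have "fundamental_region n (Matrix.vec n ` lat 0 n C) (Matrix.vec n ` A) \<longleftrightarrow>
   (ALL x:?I \<rightarrow>\<^sub>E UNIV. EX! V. V : Matrix.vec n ` lat 0 n C & Matrix.vec n x - V : Matrix.vec n ` A)"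
  unfolding fundamental_region_def vec_image[symmetric] by (simp only: F simp_thms ball_simps)
 also have "... \<longleftrightarrow> tiles ?I (lat 0 n C) A"
  unfolding tiles_def using eq A sub cnt neg by simp
 finally show ?thesis .
qed

text \<open>The description in \<open>covolume\<close> has a unique value by
  \<open>tiles_measure_eq\<close>, and the box of \<open>tiles_box\<close> supplies it.\<close>

lemma covolume_upper_tri:
 assumes C: "upper_tri n C"
 shows "covolume n (Matrix.vec n ` lat 0 n C) = (\<Prod>i<n. C i i)"
proof -
 define b where "b = box 0 n (%_. 0) (%i. C i i)"
 have pos: "!!i. i < n ==> 0 <= C i i" using C by (simp add: upper_tri_def less_imp_le)
 hence P: "0 <= (\<Prod>i<n. C i i)" by (intro prod_nonneg) auto
 have I: "{0..<0+n} = {..<n}" by (simp add: lessThan_atLeast0)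
 have b: "b : sets (leb {..<n})" using box_sets[of 0 n] unfolding b_def I .
 have bt: "tiles {..<n} (lat 0 n C) b" using tiles_box[OF C, of 0] unfolding b_def I .
 have bm: "emeasure (leb {..<n}) b = ennreal (\<Prod>i<n. C i i)"
  using emeasure_box[of n "%i. C i i" 0] pos unfolding b_def I by blast
 show ?thesis unfolding covolume_def
 proof (rule the_equality)
  show "EX F. fundamental_region n (Matrix.vec n ` lat 0 n C) F & (\<Prod>i<n. C i i) = measure (lborel_vec n) F"
  proof (intro exI conjI)
   show "fundamental_region n (Matrix.vec n ` lat 0 n C) (Matrix.vec n ` b)"
    using fundamental_region_iff_tiles[OF C b] bt by blast
   show "(\<Prod>i<n. C i i) = measure (lborel_vec n) (Matrix.vec n ` b)"
    using P by (simp add: measure_def emeasure_lborel_vec[OF b] bm)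
  qed
  fix v assume "EX F. fundamental_region n (Matrix.vec n ` lat 0 n C) F & v = measure (lborel_vec n) F"
  then obtain F where F: "fundamental_region n (Matrix.vec n ` lat 0 n C) F" "v = measure (lborel_vec n) F" by blast
  then obtain A where A: "A : sets (leb {..<n})" "F = Matrix.vec n ` A"
   unfolding fundamental_region_def sets_lborel_vec by blast
  hence "tiles {..<n} (lat 0 n C) A" using F(1) fundamental_region_iff_tiles[OF C A(1)] by blast
  from tiles_measure_eq[OF bt this] have "emeasure (leb {..<n}) A = ennreal (\<Prod>i<n. C i i)" unfolding bm ..
  thus "v = (\<Prod>i<n. C i i)"
   using P by (simp add: F(2) A(2) measure_def emeasure_lborel_vec[OF A(1)])
 qed
qed

lemma measure_cball_vec:
 assumes "r > 0"
 shows "measure (lborel_vec n) (cball_vec n r) = unit_ball_vol n * r ^ n"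
proof -
 define A where "A = {f. sqrt (\<Sum>i\<in>{..<n}. (f i)\<^sup>2) <= r} \<inter> space (leb {..<n})"
 have A: "A : sets (leb {..<n})"
 proof -
  have "A = {f : space (leb {..<n}). sqrt (\<Sum>i\<in>{..<n}. (f i)\<^sup>2) <= r}" by (auto simp: A_def)
  also have "... : sets (leb {..<n})" by measurable
  finally show ?thesis .
 qed
 have nv: "norm_vec (Matrix.vec n f) = sqrt (\<Sum>i\<in>{..<n}. (f i)\<^sup>2)" for f
  by (simp add: norm_vec_def scalar_prod_def power2_eq_square lessThan_atLeast0)
 have "cball_vec n r = Matrix.vec n ` A"
  unfolding cball_vec_def vec_image[symmetric] A_def space_leb using nv by auto
 moreover have "emeasure (leb {..<n}) A = ennreal (unit_ball_vol n * r ^ n)"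
  using emeasure_cball_aux[of "{..<n}" r] assms unfolding A_def by simp
 ultimately show ?thesis using assms by (simp add: measure_def emeasure_lborel_vec[OF A])
qed

text \<open>\<open>bound\<close> yields independence and discreteness. \<open>int\<close> restricts
  squared norms to natural numbers, so that the \<open>LEAST\<close> over the reals in
  \<open>minimum\<close> is attained by a vector.\<close>

lemma upper_tri_lattice:
 fixes C :: "nat => nat => real" and \<mu> :: real
 assumes C: "upper_tri n C" and n: "n > 0" and \<mu>: "\<mu> > 0"
  and int: "!!z :: nat => int. EX k::nat. (\<Sum>i<n. (lin n C (%j. real_of_int (z j)) i)\<^sup>2) = real k"
  and bound: "!!z :: nat => int. EX j<n. z j ~= 0 ==> \<mu>\<^sup>2 <= (\<Sum>i<n. (lin n C (%j. real_of_int (z j)) i)\<^sup>2)"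
 defines "B \<equiv> mat n n (%(i, j). C i j)"
 defines "L \<equiv> {B *\<^sub>v map_vec real_of_int z | z. z : carrier_vec n}"
 shows "is_zbasis n L B" "is_lattice n L"
  "packing_density n L >= unit_ball_vol n * \<mu> ^ n / (2 ^ n * (\<Prod>i<n. C i i))"
proof -
 have B: "B : carrier_mat n n" by (simp add: B_def)
 define Z where "Z z = (%j. if j < n then z $ j else 0)" for z :: "int vec"
 have mv: "B *\<^sub>v map_vec real_of_int z = Matrix.vec n (lin n C (%j. real_of_int (z $ j)))" if "z : carrier_vec n" for z
  using that by (intro eq_vecI) (auto simp: B_def lin_def scalar_prod_def lessThan_atLeast0)
 have nv: "(norm_vec (Matrix.vec n f))\<^sup>2 = (\<Sum>i<n. (f i)\<^sup>2)" for f :: "nat => real"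
  by (simp add: norm_vec_def scalar_prod_def power2_eq_square lessThan_atLeast0 sum_nonneg)
 have nv0: "0 <= norm_vec v" for v by (simp add: norm_vec_def scalar_prod_def sum_nonneg)
 have norm2: "(norm_vec (B *\<^sub>v map_vec real_of_int z))\<^sup>2 = (\<Sum>i<n. (lin n C (%j. real_of_int (z $ j)) i)\<^sup>2)"
  if "z : carrier_vec n" for z unfolding mv[OF that] nv ..
 have lb: "\<mu> <= norm_vec (B *\<^sub>v map_vec real_of_int z)" if z: "z : carrier_vec n" "z ~= 0\<^sub>v n" for z
 proof -
  have "EX j<n. z $ j ~= 0" using z by (auto intro!: eq_vecI)
  hence "\<mu>\<^sup>2 <= (norm_vec (B *\<^sub>v map_vec real_of_int z))\<^sup>2" unfolding norm2[OF z(1)] by (rule bound)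
  thus ?thesis using nv0 by (rule power2_le_imp_le)
 qed
 have norm0: "norm_vec (0\<^sub>v n) = 0" by (simp add: norm_vec_def)
 show basis: "is_zbasis n L B"
  unfolding is_zbasis_def L_def
 proof (intro conjI ballI impI B refl)
  fix z assume z: "z : carrier_vec n" "B *\<^sub>v map_vec real_of_int z = 0\<^sub>v n"
  show "z = 0\<^sub>v n" using lb[OF z(1)] norm0 \<mu> z(2) by (metis not_le)
 qed
 have "discrete_vecs L" unfolding discrete_vecs_def
 proof (intro ballI exI[of _ \<mu>] conjI impI \<mu>)
  fix x y assume "x : L" "y : L" "y ~= x"
  then obtain a b where ab: "a : carrier_vec n" "b : carrier_vec n"
   "x = B *\<^sub>v map_vec real_of_int a" "y = B *\<^sub>v map_vec real_of_int b" by (auto simp: L_def)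
  have "b ~= a" using \<open>y ~= x\<close> ab by auto
  have "b - a ~= 0\<^sub>v n"
  proof
   assume *: "b - a = 0\<^sub>v n"
   have "b = a"
   proof (rule eq_vecI)
    show "b $ i = a $ i" if "i < dim_vec a" for i
     using arg_cong[OF *, of "%v. v $ i"] that ab(1,2) by simp
   qed (use ab in simp)
   thus False using \<open>b ~= a\<close> by simp
  qed
  moreover have "b - a : carrier_vec n" using ab by simp
  ultimately have "\<mu> <= norm_vec (B *\<^sub>v map_vec real_of_int (b - a))" by (intro lb)
  moreover have "map_vec real_of_int (b - a) = map_vec real_of_int b - map_vec real_of_int a"
   using ab(1,2) by (intro eq_vecI) auto
  ultimately show "\<mu> <= norm_vec (y - x)"
   using ab B by (simp add: mult_minus_distrib_mat_vec[OF B])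
 qed
 thus "is_lattice n L" using basis by (auto simp: is_lattice_def)
 have "L = Matrix.vec n ` lat 0 n C"
 proof -
  have "Matrix.vec n ` lat 0 n C = {Matrix.vec n (lin n C (%j. real_of_int (z j))) | z. True}"
  proof -
   have *: "Matrix.vec n (\<lambda>i\<in>{0..<n}. f i) = Matrix.vec n f" for f :: "nat => real"
    by (intro eq_vecI) auto
   show ?thesis unfolding lat_def add_0 diff_zero setcompr_eq_image image_image * ..
  qed
  also have "... = L"
  proof (intro equalityI subsetI)
   fix x assume "x : {Matrix.vec n (lin n C (%j. real_of_int (z j))) | z. True}"
   then obtain z where z: "x = Matrix.vec n (lin n C (%j. real_of_int (z j)))" by blast
   have "x = B *\<^sub>v map_vec real_of_int (Matrix.vec n z)"
    unfolding z by (subst mv) (auto simp: lin_def intro!: eq_vecI)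
   thus "x : L" unfolding L_def by (intro CollectI exI[of _ "Matrix.vec n z"]) auto
  next
   fix x assume "x : L"
   thus "x : {Matrix.vec n (lin n C (%j. real_of_int (z j))) | z. True}"
    unfolding L_def using mv by auto
  qed
  finally show ?thesis by simp
 qed
 hence cov: "covolume n L = (\<Prod>i<n. C i i)" using covolume_upper_tri[OF C] by simp
 define K where "K k \<longleftrightarrow> (EX x:L - {0\<^sub>v n}. (norm_vec x)\<^sup>2 = real k)" for k :: nat
 have ex: "EX k. K k & x : L - {0\<^sub>v n} & (norm_vec x)\<^sup>2 = real k" if x: "x : L - {0\<^sub>v n}" for x
 proof -
  obtain z where z: "z : carrier_vec n" "x = B *\<^sub>v map_vec real_of_int z" using x by (auto simp: L_def)
  obtain k where "(\<Sum>i<n. (lin n C (%j. real_of_int (z $ j)) i)\<^sup>2) = real k" using int by blast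
  hence "(norm_vec x)\<^sup>2 = real k" using norm2[OF z(1)] z(2) by simp
  thus ?thesis using x by (auto simp: K_def)
 qed
 define k0 where "k0 = (LEAST k. K k)"
 have "EX x. x : L - {0\<^sub>v n}"
 proof -
  define z :: "int vec" where "z = unit_vec n 0"
  have z: "z : carrier_vec n" "z ~= 0\<^sub>v n" using n by (simp_all add: z_def)
  hence "norm_vec (B *\<^sub>v map_vec real_of_int z) ~= 0" using lb[OF z] \<mu> by linarith
  hence "B *\<^sub>v map_vec real_of_int z ~= 0\<^sub>v n" using norm0 by metis
  thus ?thesis using z(1) by (intro exI[of _ "B *\<^sub>v map_vec real_of_int z"]) (auto simp: L_def)
 qed
 then obtain k1 where "K k1" using ex by blast
 hence K0: "K k0" unfolding k0_def by (rule LeastI)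
 have K0_le: "k0 <= k" if "K k" for k unfolding k0_def using that by (rule Least_le)
 obtain x0 where x0: "x0 : L - {0\<^sub>v n}" "(norm_vec x0)\<^sup>2 = real k0" using K0 by (auto simp: K_def)
 have min: "minimum n L = norm_vec x0" unfolding minimum_def
 proof (rule Least_equality)
  show "EX x:L - {0\<^sub>v n}. norm_vec x0 = norm_vec x" using x0(1) by blast
  fix r assume "EX x:L - {0\<^sub>v n}. r = norm_vec x"
  then obtain x where x: "x : L - {0\<^sub>v n}" "r = norm_vec x" by blast
  obtain k where "K k" "(norm_vec x)\<^sup>2 = real k" using ex[OF x(1)] by blast
  hence "(norm_vec x0)\<^sup>2 <= r\<^sup>2" using K0_le x0(2) x(2) by simp
  thus "norm_vec x0 <= r" using nv0 x(2) by (metis power2_le_imp_le)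
 qed
 have "\<mu> <= norm_vec x0"
 proof -
  obtain z where z: "z : carrier_vec n" "x0 = B *\<^sub>v map_vec real_of_int z" using x0(1) by (auto simp: L_def)
  have "z ~= 0\<^sub>v n"
  proof
   assume "z = 0\<^sub>v n"
   hence "x0 = 0\<^sub>v n" unfolding z(2) mv[OF z(1)] by (auto simp: lin_def intro!: eq_vecI)
   thus False using x0(1) by simp
  qed
  thus ?thesis using lb[OF z(1)] z(2) by simp
 qed
 hence "\<mu> ^ n <= norm_vec x0 ^ n" using \<mu> by (intro power_mono) auto
 moreover have "measure (lborel_vec n) (cball_vec n (minimum n L)) = unit_ball_vol n * norm_vec x0 ^ n"
  unfolding min by (rule measure_cball_vec) (use \<mu> \<open>\<mu> <= norm_vec x0\<close> in linarith)
 moreover have "0 < (\<Prod>i<n. C i i)" using C by (intro prod_pos) (auto simp: upper_tri_def)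
 ultimately show "packing_density n L >= unit_ball_vol n * \<mu> ^ n / (2 ^ n * (\<Prod>i<n. C i i))"
  unfolding packing_density_def cov by (intro divide_right_mono) (auto intro!: mult_left_mono)
qed

section \<open>Periodic functions attached to the cyclotomic integers\<close>

lemma periodic_int:
 fixes f :: "int => 'a"
 assumes "!!t. f (t + m) = f t"
 shows "f (t + k * m) = f t"
proof (induction k rule: int_induct[where k = 0])
 case (step1 i)
 thus ?case using assms[of "t + i * m"] by (simp add: algebra_simps)
next
 case (step2 i)
 thus ?case using assms[of "t + (i - 1) * m"] by (simp add: algebra_simps)
qed simp

lemma sum_periodic_shift:
 fixes f :: "int => 'a :: comm_monoid_add"
 assumes "!!t. f (t + int m) = f t" "m > 0"
 shows "(\<Sum>t\<in>{0..<int m}. f (t - k)) = (\<Sum>t\<in>{0..<int m}. f t)"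
proof -
 have mod: "f (t mod int m) = f t" for t
  using periodic_int[of f "int m" "t mod int m" "t div int m"] assms by (simp add: mult.commute)
 have "(\<Sum>t\<in>{0..<int m}. f ((t - k) mod int m)) = (\<Sum>t\<in>{0..<int m}. f t)"
 proof (rule sum.reindex_bij_witness[of _ "%t. (t + k) mod int m" "%t. (t - k) mod int m"])
  fix t assume "t : {0..<int m}"
  thus "((t - k) mod int m + k) mod int m = t" by (simp add: mod_simps)
 next
  fix t assume "t : {0..<int m}"
  thus "((t + k) mod int m - k) mod int m = t" by (simp add: mod_simps)
 qed (use assms(2) in auto)
 thus ?thesis by (simp add: mod)
qed

lemma unique_multiple_in_progression:
 fixes a M :: int and p :: nat
 assumes "coprime (int p) M" "p > 0"
 shows "EX! i. i < p & int p dvd a + int i * M"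
proof (rule ex_ex1I)
 obtain x where x: "[M * x = 1] (mod int p)" using cong_solve_coprime_int[of M "int p"] assms(1) by (auto simp: coprime_commute)
 define i where "i = nat ((- a * x) mod int p)"
 have i: "int i = (- a * x) mod int p" "i < p" using assms(2) by (auto simp: i_def nat_less_iff)
 have "[a + int i * M = a + (- a * x) * M] (mod int p)" unfolding i(1) by (intro cong_add cong_mult) (auto simp: cong_def)
 also have "a + (- a * x) * M = a + (- a) * (M * x)" by simp
 also have "[a + (- a) * (M * x) = a + (- a) * 1] (mod int p)" using x by (intro cong_add cong_mult cong_refl)
 finally show "EX i. i < p & int p dvd a + int i * M" using i(2) by (auto simp: cong_0_iff)
next
 fix i j assume "i < p & int p dvd a + int i * M" "j < p & int p dvd a + int j * M"
 hence ij: "i < p" "j < p" "int p dvd (a + int i * M) - (a + int j * M)" by (blast intro: dvd_diff)+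
 from ij(3) have "int p dvd (int i - int j) * M" by (simp add: algebra_simps)
 hence "int p dvd int i - int j" using assms(1) by (simp add: coprime_dvd_mult_left_iff)
 hence "[i = j] (mod p)" by (simp add: cong_iff_dvd_diff flip: cong_int_iff)
 thus "i = j" using ij(1,2) by (rule cong_less_modulus_unique_nat)
qed

locale cyclotomic =
 fixes m d :: nat and u :: "nat => nat"
 assumes m1: "m > 1" and sqf: "squarefree m"
  and u: "bij_betw u {..<d} {t. t < m & coprime t m}"
begin

text \<open>Values of the basis of \<open>V\<close> dual to evaluation at the units. For a prime
  modulus, a function of sum 0 that is a delta at \<open>j\<close> among the nonzero residues takes
  the value -1 at 0; for squarefree \<open>m\<close> such functions are multiplied over the
  primes.\<close>

definition e :: "int => nat => int" where
 "e t j = (\<Prod>p\<in>prime_factors m. if int p dvd t then - 1 else of_bool (int p dvd t - int j))"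

definition ext :: "(nat => int) => int => int" where
 "ext v t = (\<Sum>j<d. e t (u j) * v j)"

text \<open>The coset sums vanish exactly when the polynomial with coefficients \<open>f t\<close>
  vanishes at the \<open>m\<close>-th roots of unity that are not primitive. These functions form
  the ideal generated by the quotient of X^m - 1 by the cyclotomic polynomial, a copy of
  \<int>[\<zeta>] as a module over itself.\<close>

definition V :: "(int => int) => bool" where
 "V f \<longleftrightarrow> (ALL t. f (t + int m) = f t) &
   (ALL p:prime_factors m. ALL t. (\<Sum>i<p. f (t + int i * int (m div p))) = 0)"

lemma pf: "p : prime_factors m \<longleftrightarrow> prime p & p dvd m"
 using m1 by (auto simp: in_prime_factors_iff)

lemma dvd_iff: "int m dvd a \<longleftrightarrow> (ALL p:prime_factors m. int p dvd a)"
proof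
 assume *: "ALL p:prime_factors m. int p dvd a"
 show "int m dvd a"
 proof (cases "a = 0")
  case False
  have "m dvd nat \<bar>a\<bar>"
  proof (rule multiplicity_le_imp_dvd)
   fix p :: nat assume p: "prime p"
   show "multiplicity p m <= multiplicity p (nat \<bar>a\<bar>)"
   proof (cases "p : prime_factors m")
    case True
    hence "multiplicity p m = 1" using sqf m1 squarefree_factorial_semiring'[of m] by auto
    moreover have "p dvd nat \<bar>a\<bar>" using * True by (simp add: int_dvd_int_iff[symmetric])
    hence "multiplicity p (nat \<bar>a\<bar>) > 0" using p False by (subst prime_multiplicity_gt_zero_iff) auto
    ultimately show ?thesis by simp
   next
    case False
    hence "multiplicity p m = 0" using p pf by (simp add: not_dvd_imp_multiplicity_0)
    thus ?thesis by simp
   qed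
  qed (use m1 in auto)
  thus ?thesis by (simp add: int_dvd_int_iff[symmetric])
 qed simp
qed (auto intro: dvd_trans simp: pf)

lemma pf_div:
 assumes "p : prime_factors m"
 shows "p > 0" "m = p * (m div p)" "coprime (int p) (int (m div p))"
  "!!q. q : prime_factors m ==> q ~= p ==> int q dvd int (m div p)"
proof -
 have p: "prime p" "p dvd m" using assms pf by auto
 show p0: "p > 0" using p(1) prime_gt_0_nat by auto
 show eq: "m = p * (m div p)" using p by simp
 have "\<not> p dvd m div p"
 proof
  assume "p dvd m div p"
  hence "p\<^sup>2 dvd m" using eq by (metis dvd_triv_right mult_dvd_mono dvd_refl power2_eq_square)
  thus False using squarefreeD[OF sqf] p(1) by (metis not_prime_unit)
 qed
 thus "coprime (int p) (int (m div p))" using p(1) by (simp add: prime_imp_coprime)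
 fix q assume q: "q : prime_factors m" "q ~= p"
 hence "prime q" "q dvd p * (m div p)" using pf eq by auto
 moreover have "\<not> q dvd p" using q(2) p(1) \<open>prime q\<close> primes_dvd_imp_eq by blast
 ultimately show "int q dvd int (m div p)" by (simp add: prime_dvd_mult_iff)
qed

lemma coprime_iff: "coprime (nat t) m \<longleftrightarrow> (ALL p:prime_factors m. \<not> int p dvd t)" if "t >= 0"
proof -
 have "int p dvd t \<longleftrightarrow> p dvd nat t" for p using that by (metis int_dvd_int_iff int_nat_eq)
 hence eq: "(ALL p:prime_factors m. \<not> int p dvd t) \<longleftrightarrow> (ALL p. prime p --> p dvd m --> \<not> p dvd nat t)"
  using pf by auto
 show ?thesis unfolding eq
 proof
  assume "coprime (nat t) m"
  thus "ALL p. prime p --> p dvd m --> \<not> p dvd nat t"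
   using coprime_common_divisor_nat not_prime_1 by blast
 next
  assume *: "ALL p. prime p --> p dvd m --> \<not> p dvd nat t"
  show "coprime (nat t) m"
  proof (rule ccontr)
   assume "\<not> coprime (nat t) m"
   hence "gcd (nat t) m ~= 1" by (auto simp only: coprime_iff_gcd_eq_1)
   then obtain p where "prime p" "p dvd gcd (nat t) m" using prime_factor_nat by blast
   thus False using * gcd_nat.boundedE by blast
  qed
 qed
qed

lemma u_props:
 assumes "j < d"
 shows "u j < m" "p : prime_factors m ==> \<not> int p dvd int (u j)"
proof -
 have "u j : {t. t < m & coprime t m}" using u assms by (auto simp: bij_betw_def)
 thus "u j < m" "p : prime_factors m ==> \<not> int p dvd int (u j)"
  using coprime_iff[of "int (u j)"] by auto
qed

lemma ex_u:
 assumes "!!p. p : prime_factors m ==> \<not> int p dvd t"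
 shows "EX j<d. int (u j) = t mod int m"
proof -
 have "\<not> int p dvd t mod int m" if "p : prime_factors m" for p
  using assms[OF that] that by (simp add: dvd_mod_iff pf)
 hence "coprime (nat (t mod int m)) m" using m1 by (subst coprime_iff) auto
 hence "nat (t mod int m) : {t. t < m & coprime t m}" using m1 by (auto simp: nat_less_iff)
 hence "nat (t mod int m) : u ` {..<d}" using u by (simp only: bij_betw_def)
 then obtain j where "j < d" "u j = nat (t mod int m)" by auto
 thus ?thesis using m1 by (intro exI[of _ j]) auto
qed

lemma e_u: "j < d ==> k < d ==> e (int (u k)) (u j) = of_bool (j = k)"
proof -
 assume jk: "j < d" "k < d"
 have "e (int (u k)) (u j) = of_bool (ALL p:prime_factors m. int p dvd int (u k) - int (u j))"
 proof -
  have "e (int (u k)) (u j) = (\<Prod>p\<in>prime_factors m. of_bool (int p dvd int (u k) - int (u j)))"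
   unfolding e_def by (rule prod.cong) (use u_props(2)[OF jk(2)] in auto)
  thus ?thesis by (auto simp: of_bool_def)
 qed
 also have "(ALL p:prime_factors m. int p dvd int (u k) - int (u j)) \<longleftrightarrow> [u k = u j] (mod m)"
  unfolding dvd_iff[symmetric] by (simp add: cong_iff_dvd_diff flip: cong_int_iff)
 also have "... \<longleftrightarrow> u k = u j" using u_props(1) jk by (auto simp: cong_def)
 also have "... \<longleftrightarrow> j = k" using u jk by (auto simp: bij_betw_def inj_on_def)
 finally show ?thesis .
qed

lemma ext_u: "k < d ==> ext v (int (u k)) = v k"
proof -
 assume k: "k < d"
 have "ext v (int (u k)) = (\<Sum>j<d. if j = k then v j else 0)"
  unfolding ext_def by (rule sum.cong) (use e_u k in auto)
 thus ?thesis using k by simp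
qed

lemma e_periodic: "e (t + int m) j = e t j"
proof -
 have "int p dvd t + int m \<longleftrightarrow> int p dvd t" "int p dvd t + int m - int j \<longleftrightarrow> int p dvd t - int j"
  if "p : prime_factors m" for p
 proof -
  have "int p dvd int m" using that pf by auto
  moreover have "t + int m - int j = t - int j + int m" by simp
  ultimately show "int p dvd t + int m \<longleftrightarrow> int p dvd t" "int p dvd t + int m - int j \<longleftrightarrow> int p dvd t - int j"
   using dvd_add_left_iff by (blast, metis)
 qed
 thus ?thesis unfolding e_def by (intro prod.cong) auto
qed

text \<open>Only the factor at \<open>p\<close> varies along the coset: it is -1 at the one multiple
  of \<open>p\<close>, 1 at the one point congruent to \<open>u k\<close>, and 0 elsewhere.\<close>

lemma e_coset:
 assumes p: "p : prime_factors m" and k: "k < d"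
 shows "(\<Sum>i<p. e (t + int i * int (m div p)) (u k)) = 0"
proof -
 define g where "g q i = (if int q dvd t + int i * int (m div p) then - 1
  else of_bool (int q dvd t + int i * int (m div p) - int (u k)) :: int)" for q i
 have "e (t + int i * int (m div p)) (u k) = g p i * (\<Prod>q\<in>prime_factors m - {p}. g q 0)" for i
 proof -
  have "g q i = g q 0" if "q : prime_factors m - {p}" for q
  proof -
   have "int q dvd int i * int (m div p)" using pf_div(4)[OF p, of q] that by auto
   thus ?thesis unfolding g_def
    by (simp add: dvd_add_left_iff diff_add_eq[symmetric])
  qed
  hence "(\<Prod>q\<in>prime_factors m - {p}. g q i) = (\<Prod>q\<in>prime_factors m - {p}. g q 0)" by (rule prod.cong[OF refl])
  thus ?thesis unfolding e_def using prod.remove[OF _ p, of "%q. g q i"] by (simp add: g_def)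
 qed
 hence "(\<Sum>i<p. e (t + int i * int (m div p)) (u k)) = (\<Sum>i<p. g p i) * (\<Prod>q\<in>prime_factors m - {p}. g q 0)"
  by (simp add: sum_distrib_right)
 moreover have "(\<Sum>i<p. g p i) = 0"
 proof -
  from unique_multiple_in_progression[OF pf_div(3,1)[OF p], of t]
  obtain i0 where i0: "i0 < p" "!!i. i < p ==> int p dvd t + int i * int (m div p) \<longleftrightarrow> i = i0" by blast
  from unique_multiple_in_progression[OF pf_div(3,1)[OF p], of "t - int (u k)"]
  obtain i1 where i1: "i1 < p" "!!i. i < p ==> int p dvd t - int (u k) + int i * int (m div p) \<longleftrightarrow> i = i1" by blast
  have ne: "i0 ~= i1"
  proof
   assume "i0 = i1"
   hence "int p dvd t + int i0 * int (m div p)" "int p dvd t - int (u k) + int i0 * int (m div p)"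
    using i0 i1 by auto
   hence "int p dvd (t + int i0 * int (m div p)) - (t - int (u k) + int i0 * int (m div p))" by (rule dvd_diff)
   thus False using u_props(2)[OF k p] by simp
  qed
  have "g p i = of_bool (i = i1) - of_bool (i = i0)" if "i < p" for i
   using i0(2)[OF that] i1(2)[OF that] ne by (auto simp: g_def diff_add_eq)
  hence "(\<Sum>i<p. g p i) = (\<Sum>i<p. of_bool (i = i1) - of_bool (i = i0))" by (intro sum.cong) auto
  also have "... = 0" using i0(1) i1(1) by (simp add: sum_subtractf of_bool_def)
  finally show ?thesis .
 qed
 ultimately show ?thesis by simp
qed

lemma V_ext: "V (ext v)"
 unfolding V_def
proof (intro conjI allI ballI)
 fix t show "ext v (t + int m) = ext v t" by (simp add: ext_def e_periodic)
next
 fix p t assume p: "p : prime_factors m"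
 have "(\<Sum>i<p. ext v (t + int i * int (m div p))) = (\<Sum>j<d. (\<Sum>i<p. e (t + int i * int (m div p)) (u j)) * v j)"
  unfolding ext_def sum_distrib_right by (rule sum.swap)
 also have "... = 0" using e_coset[OF p] by simp
 finally show "(\<Sum>i<p. ext v (t + int i * int (m div p))) = 0" .
qed

lemma V_shift: "V f ==> V (%t. f (t - k))"
 by (simp add: V_def diff_add_eq[symmetric])

lemma V_diff: "V f ==> V g ==> V (%t. f t - g t)"
 by (simp add: V_def sum_subtractf)

text \<open>Induction on the number of primes of \<open>m\<close> dividing \<open>t\<close>: the
  coset relation at one of them expresses \<open>f t\<close> by values at points where strictly
  fewer primes divide.\<close>

lemma V_zero:
 assumes f: "V f" and z: "!!j. j < d ==> f (int (u j)) = 0"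
 shows "f t = 0"
proof (induction "card {p : prime_factors m. int p dvd t}" arbitrary: t rule: less_induct)
 case less
 show ?case
 proof (cases "EX p:prime_factors m. int p dvd t")
  case False
  then obtain j where "j < d" "int (u j) = t mod int m" using ex_u by blast
  hence "f (t mod int m) = 0" using z by metis
  moreover have "f (t mod int m + t div int m * int m) = f (t mod int m)"
   by (rule periodic_int) (use f in \<open>simp add: V_def\<close>)
  ultimately show ?thesis by simp
 next
  case True
  then obtain p where p: "p : prime_factors m" "int p dvd t" by blast
  have "f (t + int i * int (m div p)) = 0" if i: "i : {..<p} - {0}" for i
  proof (rule less)
   have np: "\<not> int p dvd t + int i * int (m div p)"
   proof
    assume "int p dvd t + int i * int (m div p)"
    hence "int p dvd int i * int (m div p)" using p(2) by (simp add: dvd_add_right_iff)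
    hence "p dvd i" using pf_div(3)[OF p(1)] by (simp add: coprime_dvd_mult_left_iff)
    thus False using i by (auto dest: dvd_imp_le)
   qed
   have "{q : prime_factors m. int q dvd t + int i * int (m div p)} \<subseteq> {q : prime_factors m. int q dvd t} - {p}"
   proof
    fix q assume "q : {q : prime_factors m. int q dvd t + int i * int (m div p)}"
    hence q: "q : prime_factors m" "int q dvd t + int i * int (m div p)" by auto
    hence "q ~= p" using np by auto
    hence "int q dvd int i * int (m div p)" using pf_div(4)[OF p(1) q(1)] by simp
    hence "int q dvd t" using q(2) by (simp add: dvd_add_left_iff)
    thus "q : {q : prime_factors m. int q dvd t} - {p}" using q(1) \<open>q ~= p\<close> by simp
   qed
   hence "{q : prime_factors m. int q dvd t + int i * int (m div p)} \<subset> {q : prime_factors m. int q dvd t}"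
    using p by blast
   thus "card {q : prime_factors m. int q dvd t + int i * int (m div p)} < card {q : prime_factors m. int q dvd t}"
    by (intro psubset_card_mono) auto
  qed
  hence "(\<Sum>i\<in>{..<p} - {0}. f (t + int i * int (m div p))) = 0" by (intro sum.neutral) auto
  moreover have "(\<Sum>i<p. f (t + int i * int (m div p))) = 0" using f p(1) by (simp add: V_def)
  ultimately show ?thesis using sum.remove[of "{..<p}" 0 "%i. f (t + int i * int (m div p))"] pf_div(1)[OF p(1)] by simp
 qed
qed

lemma V_eqI: "V f ==> V g ==> (!!j. j < d ==> f (int (u j)) = g (int (u j))) ==> f = g"
 using V_zero[OF V_diff] by (intro ext) (metis eq_iff_diff_eq_0)

text \<open>Multiplication by the \<open>k\<close>-th power of \<zeta>, in the coordinates of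
  \<open>ext\<close>.\<close>

definition shift :: "nat => (nat => int) => nat => int" where
 "shift k v j = ext v (int (u j) - int k)"

lemma ext_shift: "ext (shift k v) t = ext v (t - int k)"
proof -
 have "ext (shift k v) = (%t. ext v (t - int k))"
  by (rule V_eqI[OF V_ext V_shift[OF V_ext]]) (simp add: ext_u shift_def)
 thus ?thesis by simp
qed

lemma shift_shift: "shift k (shift l v) = shift (k + l) v"
 by (rule ext) (simp add: shift_def ext_shift algebra_simps)

lemma shift_linear: "shift k (%j. \<Sum>i\<in>A. c i * v i j) = (%j. \<Sum>i\<in>A. c i * shift k (v i) j)"
proof
 fix j
 show "shift k (%j. \<Sum>i\<in>A. c i * v i j) j = (\<Sum>i\<in>A. c i * shift k (v i) j)"
  unfolding shift_def ext_def sum_distrib_left by (subst sum.swap) (simp add: mult_ac)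
qed

lemma shift_add: "shift k (%j. a * v j + b * w j) j = a * shift k v j + b * shift k w j"
 by (simp add: shift_def ext_def sum.distrib sum_distrib_left algebra_simps)

text \<open>A period \<open>k\<close> implies the period \<open>gcd k m\<close>, a proper divisor of
  \<open>m\<close>, and hence the period \<open>m div p\<close> for some prime \<open>p\<close>;
  then the coset sum is \<open>p * f t\<close>.\<close>

lemma V_period:
 assumes f: "V f" and k: "0 < k" "k < m" and per: "!!t. f (t + int k) = f t"
 shows "f t = 0"
proof -
 define g where "g = gcd k m"
 have g: "g dvd m" "g > 0" "g < m" using k by (auto simp: g_def intro: le_less_trans[OF gcd_le1_nat])
 obtain a b where ab: "a * int k + b * int m = int g"
  using bezout_int[of "int k" "int m"] by (auto simp: g_def)
 have pg: "f (t + int g) = f t" for t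
 proof -
  have "f (t + int g) = f (t + a * int k + b * int m)" by (simp add: ab[symmetric] algebra_simps)
  also have "... = f (t + a * int k)" by (rule periodic_int) (use f in \<open>simp add: V_def\<close>)
  also have "... = f t" by (rule periodic_int) (rule per)
  finally show ?thesis .
 qed
 have "m div g ~= 1" using g by (metis dvd_mult_div_cancel less_not_refl mult.right_neutral)
 then obtain p where p: "prime p" "p dvd m div g" using prime_factor_nat by blast
 then obtain s where "m div g = p * s" by auto
 hence ms: "m = p * (s * g)" using g by (metis dvd_div_mult_self mult.assoc)
 hence pm: "p : prime_factors m" using p pf by auto
 have "m div p = s * g" using ms pf_div(1)[OF pm] by (metis nonzero_mult_div_cancel_left neq0_conv)
 hence "f (t + int i * int (m div p)) = f t" for i
  using periodic_int[of f "int g" t "int i * int s", OF pg] by (simp add: mult.assoc)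
 moreover have "(\<Sum>i<p. f (t + int i * int (m div p))) = 0" using f pm by (simp add: V_def)
 ultimately show ?thesis using pf_div(1)[OF pm] by simp
qed

text \<open>The orbit of a nonzero vector thus has exactly \<open>m\<close> elements, which is the
  source of the factor \<open>m\<close> in the density.\<close>

lemma shift_inj:
 assumes "j < d" "v j ~= 0" "k < m" "l < m" "!!i. i < d ==> shift k v i = shift l v i"
 shows "k = l"
proof -
 have *: False if kl: "k < l" "l < m" "!!i. i < d ==> shift k v i = shift l v i" for k l
 proof -
  have "ext (shift k v) = ext (shift l v)" by (rule V_eqI[OF V_ext V_ext]) (use kl in \<open>simp add: ext_u\<close>)
  hence eq: "ext v (t - int k) = ext v (t - int l)" for t by (metis ext_shift)
  have "ext v (int (u j)) = 0"
  proof (rule V_period[OF V_ext, of "l - k"])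
   show "ext v (t + int (l - k)) = ext v t" for t using eq[of "t + int l"] kl(1) by (simp add: of_nat_diff algebra_simps)
  qed (use kl in auto)
  thus False using assms(1,2) by (simp add: ext_u)
 qed
 show ?thesis using *[of k l] *[of l k] assms by (metis linorder_neqE_nat)
qed

end

section \<open>Independence of the shifts of a nonzero vector\<close>

lemma coeffs_zero_of_roots:
 fixes c :: "nat => 'a :: idom"
 assumes S: "finite S" "card S >= n" and z: "!!z. z : S ==> (\<Sum>r<n. c r * z ^ r) = 0" and r: "r < n"
 shows "c r = 0"
proof -
 define Q where "Q = (\<Sum>r<n. Polynomial.monom (c r) r)"
 have cf: "poly.coeff Q r = (if r < n then c r else 0)" for r
  by (simp add: Q_def Polynomial.coeff_sum)
 have pz: "poly Q z = (\<Sum>r<n. c r * z ^ r)" for z by (simp add: Q_def poly_sum poly_monom)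
 have "Q = 0"
 proof (rule ccontr)
  assume Q: "Q ~= 0"
  have "S \<subseteq> {z. poly Q z = 0}" using z pz by auto
  hence "card S <= card {z. poly Q z = 0}" using poly_roots_finite[OF Q] by (rule card_mono[rotated])
  also have "... <= Polynomial.degree Q" by (rule card_poly_roots_bound[OF Q])
  also have "... <= n - 1" by (rule Polynomial.degree_le) (auto simp: cf)
  finally show False using S(2) r by simp
 qed
 thus ?thesis using cf[of r] r by simp
qed

lemma freshmans_dream_mod:
 fixes a b :: "'a :: comm_ring_1"
 assumes p: "prime (p::nat)"
 shows "EX c. (a + b) ^ p = a ^ p + b ^ p + of_nat p * c"
proof -
 have p0: "p > 0" using p prime_gt_0_nat by auto
 have "(a + b) ^ p = (\<Sum>k\<le>p. of_nat (p choose k) * a ^ k * b ^ (p - k))" by (rule binomial_ring)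
 also have "{..p} = insert 0 (insert p {0<..<p})" using p0 by auto
 also have "(\<Sum>k\<in>insert 0 (insert p {0<..<p}). of_nat (p choose k) * a ^ k * b ^ (p - k)) =
   b ^ p + (a ^ p + (\<Sum>k\<in>{0<..<p}. of_nat (p choose k) * a ^ k * b ^ (p - k)))" using p0 by simp
 also have "(\<Sum>k\<in>{0<..<p}. of_nat (p choose k) * a ^ k * b ^ (p - k)) =
   (\<Sum>k\<in>{0<..<p}. of_nat p * (of_nat ((p choose k) div p) * a ^ k * b ^ (p - k)))"
 proof (rule sum.cong[OF refl])
  fix k assume "k : {0<..<p}"
  hence "p dvd p choose k" by (intro dvd_choose_prime) (use p in auto)
  hence "of_nat (p choose k) = (of_nat p * of_nat ((p choose k) div p) :: 'a)" by (metis dvd_mult_div_cancel of_nat_mult)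
  thus "of_nat (p choose k) * a ^ k * b ^ (p - k) = of_nat p * (of_nat ((p choose k) div p) * a ^ k * b ^ (p - k))"
   by (simp add: mult.assoc)
 qed
 also have "... = of_nat p * (\<Sum>k\<in>{0<..<p}. of_nat ((p choose k) div p) * a ^ k * b ^ (p - k))"
  by (rule sum_distrib_left[symmetric])
 finally have eq: "(a + b) ^ p = b ^ p + (a ^ p + of_nat p * (\<Sum>k\<in>{0<..<p}. of_nat ((p choose k) div p) * a ^ k * b ^ (p - k)))" .
 show ?thesis unfolding eq by (intro exI) (subst add.assoc, rule add.left_commute)
qed

lemma fermat_int:
 assumes p: "prime (p::nat)"
 shows "EX c::int. a ^ p = a + int p * c"
proof (induction a rule: int_induct[where k = 0])
 case base
 have "p > 0" using p prime_gt_0_nat by auto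
 thus ?case by (intro exI[of _ 0]) simp
next
 case (step1 i)
 then obtain c where "i ^ p = i + int p * c" by blast
 moreover obtain b where "(i + 1) ^ p = i ^ p + 1 ^ p + int p * b" using freshmans_dream_mod[OF p, of i 1] by auto
 ultimately show ?case by (intro exI[of _ "b + c"]) (simp add: algebra_simps)
next
 case (step2 i)
 then obtain c where "i ^ p = i + int p * c" by blast
 moreover obtain b where "((i - 1) + 1) ^ p = (i - 1) ^ p + 1 ^ p + int p * b" using freshmans_dream_mod[OF p, of "i - 1" 1] by auto
 ultimately show ?case by (intro exI[of _ "c - b"]) (simp add: algebra_simps)
qed

text \<open>Frobenius modulo \<open>p\<close>: coefficients are fixed by Fermat's theorem, sums are
  treated by the binomial theorem. The error is kept as an explicit polynomial, to be evaluated at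
  complex numbers later.\<close>

lemma frobenius_poly:
 fixes P :: "int poly"
 assumes p: "prime (p::nat)"
 shows "EX g. pcompose P (Polynomial.monom 1 p) = P ^ p + of_nat p * g"
proof (induction P)
 case 0
 have "p > 0" using p prime_gt_0_nat by auto
 thus ?case by (intro exI[of _ 0]) simp
next
 case (pCons a P)
 then obtain g where g: "pcompose P (Polynomial.monom 1 p) = P ^ p + of_nat p * g" by blast
 define X where "X = Polynomial.monom (1::int) 1"
 have Xp: "Polynomial.monom 1 p = X ^ p" by (simp add: X_def monom_power)
 obtain c where c: "a ^ p = a + int p * c" using fermat_int[OF p] by blast
 have pc: "pCons a P = [:a:] + X * P" by (simp add: X_def monom_altdef)
 obtain b where b: "([:a:] + X * P) ^ p = [:a:] ^ p + (X * P) ^ p + of_nat p * b"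
  using freshmans_dream_mod[OF p] by blast
 define K where "K = [:c:]"
 have K: "[:a:] ^ p = [:a:] + of_nat p * K" by (simp add: poly_const_pow c of_nat_poly K_def)
 have "pcompose (pCons a P) (Polynomial.monom 1 p) = [:a:] + X ^ p * (P ^ p + of_nat p * g)"
  by (simp add: pcompose_pCons g Xp[symmetric])
 also have "... = ([:a:] + X * P) ^ p + of_nat p * (X ^ p * g - K - b)"
  unfolding b K by (simp add: algebra_simps power_mult_distrib)
 finally show ?case unfolding pc by blast
qed

lemma power_mod_root:
 fixes z :: "'a :: monoid_mult"
 assumes "z ^ m = 1" shows "z ^ i = z ^ (i mod m)"
proof -
 have "z ^ i = z ^ (m * (i div m) + i mod m)" by simp
 also have "... = z ^ (i mod m)" by (simp only: power_add power_mult assms power_one mult_1)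
 finally show ?thesis .
qed

lemma poly_eq_sum_lt:
 fixes h :: "int poly"
 assumes "m > 0"
 shows "EX H::nat => int. ALL z::complex. z ^ m = 1 --> poly (map_poly of_int h) z = (\<Sum>r<m. of_int (H r) * z ^ r)"
proof (intro exI allI impI)
 fix z :: complex assume z: "z ^ m = 1"
 have zm: "z ^ i = z ^ (i mod m)" for i using z by (rule power_mod_root)
 have "poly (map_poly of_int h) z = (\<Sum>i\<le>Polynomial.degree h. of_int (poly.coeff h i) * z ^ i)"
  by (simp add: poly_altdef coeff_map_poly degree_map_poly)
 also have "... = (\<Sum>i\<le>Polynomial.degree h. \<Sum>r<m. if i mod m = r then of_int (poly.coeff h i) * z ^ r else 0)"
  by (rule sum.cong[OF refl], subst zm) (use assms in simp)
 also have "... = (\<Sum>r<m. \<Sum>i\<le>Polynomial.degree h. if i mod m = r then of_int (poly.coeff h i) * z ^ r else 0)"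
  by (rule sum.swap)
 also have "... = (\<Sum>r<m. of_int (\<Sum>i\<le>Polynomial.degree h. if i mod m = r then poly.coeff h i else 0) * z ^ r)"
  unfolding of_int_sum sum_distrib_right by (intro sum.cong refl) simp
 finally show "poly (map_poly of_int h) z = (\<Sum>r<m. of_int (\<Sum>i\<le>Polynomial.degree h. if i mod m = r then poly.coeff h i else 0) * z ^ r)" .
qed

text \<open>Landau's argument: a coefficient that is divisible by a prime exceeding its absolute value vanishes.\<close>

lemma product_vanishes_large_primes:
 fixes E f :: "nat => int" and m d :: nat
 defines "EE \<equiv> %z::complex. \<Sum>i<d. of_int (E i) * z ^ i" and "PP \<equiv> %z::complex. \<Sum>t<m. of_int (f t) * z ^ t"
 assumes m: "m > 0" and base: "!!z. z ^ m = 1 ==> EE z * PP z = 0"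
  and k: "k > 0" "!!p. prime p ==> p dvd k ==> (\<Sum>i<d. \<bar>E i\<bar>) * (\<Sum>t<m. \<bar>f t\<bar>) < int p"
  and z: "z ^ m = 1"
 shows "EE z * PP (z ^ k) = 0"
 using k z
proof (induction k arbitrary: z rule: less_induct)
 case (less k)
 show ?case
 proof (cases "k = 1")
  case True
  thus ?thesis using base[OF less.prems(3)] by simp
 next
  case False
  then obtain p where p: "prime p" "p dvd k" using prime_factor_nat by blast
  then obtain l where l: "k = p * l" by blast
  have l0: "0 < l" "l < k" using l less.prems(1) prime_gt_1_nat[OF p(1)] by auto
  have IH: "EE w * PP (w ^ l) = 0" if "w ^ m = 1" for w
   by (rule less.IH[OF l0(2,1) _ that]) (use less.prems(2) l in \<open>auto intro: dvd_mult\<close>)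
  define P where "P = (\<Sum>t<m. Polynomial.monom (f t) t)"
  define F where "F = (\<Sum>i<d. Polynomial.monom (E i) i)"
  have mono: "map_poly of_int (Polynomial.monom c i) = (Polynomial.monom (of_int c) i :: complex poly)" for c i
   by (simp add: map_poly_monom)
  have PPz: "poly (map_poly of_int P) w = PP w" for w
   by (simp add: P_def PP_def hom_distribs mono poly_sum poly_monom)
  have EEz: "poly (map_poly of_int F) w = EE w" for w
   by (simp add: F_def EE_def hom_distribs mono poly_sum poly_monom)
  obtain g where g: "pcompose P (Polynomial.monom 1 p) = P ^ p + of_nat p * g" using frobenius_poly[OF p(1)] by blast
  have PPp: "PP (w ^ p) = PP w ^ p + of_nat p * poly (map_poly of_int g) w" for w
  proof -
   have "poly (map_poly of_int (pcompose P (Polynomial.monom 1 p))) w = PP (w ^ p)"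
    by (simp add: hom_distribs poly_pcompose PPz mono poly_monom)
   thus ?thesis unfolding g
    by (simp add: hom_distribs PPz of_nat_poly mono map_poly_pCons)
  qed
  define h where "h = F * pcompose g (Polynomial.monom 1 l)"
  have hz: "poly (map_poly of_int h) w = EE w * poly (map_poly of_int g) (w ^ l)" for w :: complex
   by (simp add: h_def hom_distribs poly_pcompose EEz mono poly_monom)
  obtain H where H: "!!w::complex. w ^ m = 1 ==> poly (map_poly of_int h) w = (\<Sum>r<m. of_int (H r) * w ^ r)"
   using poly_eq_sum_lt[OF m, of h] by blast
  have p0: "p > 0" using p(1) prime_gt_0_nat by auto
  \<comment> \<open>\<open>w ^ k\<close> is the \<open>p\<close>-th power of \<open>w ^ l\<close>,
    so up to a multiple of \<open>p\<close> the value is \<open>EE w * PP (w ^ l) ^ p\<close>, which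
    contains a factor that vanishes by induction.\<close>
  have Ek: "EE w * PP (w ^ k) = of_nat p * (\<Sum>r<m. of_int (H r) * w ^ r)" if "w ^ m = 1" for w
  proof -
   obtain q where q: "p = Suc q" using p0 by (cases p) auto
   have wk: "w ^ k = (w ^ l) ^ p" by (simp only: l power_mult[symmetric] mult.commute)
   have "EE w * PP (w ^ k) = EE w * (PP (w ^ l) * PP (w ^ l) ^ q + of_nat p * poly (map_poly of_int g) (w ^ l))"
    unfolding wk PPp by (simp only: q power_Suc)
   also have "... = (EE w * PP (w ^ l)) * PP (w ^ l) ^ q + of_nat p * poly (map_poly of_int h) w"
    unfolding hz by (simp only: distrib_left mult_ac)
   finally show ?thesis unfolding IH[OF that] H[OF that] by (simp only: mult_zero_left add_0_left)
  qed
  \<comment> \<open>The same product expanded directly: whatever \<open>k\<close> is, its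
    coefficients are bounded by the product of the two sums of absolute values.\<close>
  define c where "c r = (\<Sum>i<d. \<Sum>t<m. of_bool ((i + k * t) mod m = r) * (E i * f t))" for r
  have Ec: "EE w * PP (w ^ k) = (\<Sum>r<m. of_int (c r) * w ^ r)" if w: "w ^ m = 1" for w
  proof -
   have wm: "w ^ i = w ^ (i mod m)" for i using w by (rule power_mod_root)
   have "EE w * PP (w ^ k) = (\<Sum>i<d. \<Sum>t<m. of_int (E i * f t) * w ^ (i + k * t))"
    unfolding EE_def PP_def sum_product
    by (intro sum.cong refl) (simp only: power_add power_mult of_int_mult mult.assoc mult.left_commute)
   also have "... = (\<Sum>i<d. \<Sum>t<m. \<Sum>r<m. of_int (of_bool ((i + k * t) mod m = r) * (E i * f t)) * w ^ r)"
   proof (intro sum.cong refl)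
    fix i t
    have "(\<Sum>r<m. of_int (of_bool ((i + k * t) mod m = r) * (E i * f t)) * w ^ r) =
     (\<Sum>r<m. if (i + k * t) mod m = r then of_int (E i * f t) * w ^ r else 0)" by (intro sum.cong) auto
    also have "... = of_int (E i * f t) * w ^ ((i + k * t) mod m)" using m by simp
    finally show "of_int (E i * f t) * w ^ (i + k * t) = (\<Sum>r<m. of_int (of_bool ((i + k * t) mod m = r) * (E i * f t)) * w ^ r)"
     using wm by simp
   qed
   also have "... = (\<Sum>i<d. \<Sum>r<m. \<Sum>t<m. of_int (of_bool ((i + k * t) mod m = r) * (E i * f t)) * w ^ r)"
    by (rule sum.cong[OF refl], rule sum.swap)
   also have "... = (\<Sum>r<m. \<Sum>i<d. \<Sum>t<m. of_int (of_bool ((i + k * t) mod m = r) * (E i * f t)) * w ^ r)"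
    by (rule sum.swap)
   finally show ?thesis by (simp only: c_def of_int_sum sum_distrib_right)
  qed
  \<comment> \<open>A polynomial of degree below \<open>m\<close> is determined by its values at the
    \<open>m\<close> roots of unity.\<close>
  have cH: "c r = int p * H r" if r: "r < m" for r
  proof -
   have "of_int (c r - int p * H r) = (0::complex)"
   proof (rule coeffs_zero_of_roots[where S = "{z::complex. z ^ m = 1}" and n = m and c = "%r. of_int (c r - int p * H r)"])
    show "finite {z::complex. z ^ m = 1}" using m by (intro finite_roots_unity) auto
    show "m <= card {z::complex. z ^ m = 1}" using card_roots_unity_eq[OF m] by simp
    fix w :: complex assume "w : {z. z ^ m = 1}"
    hence w: "w ^ m = 1" by simp
    have "(\<Sum>r<m. of_int (c r) * w ^ r) = of_nat p * (\<Sum>r<m. of_int (H r) * w ^ r)" using Ec[OF w] Ek[OF w] by simp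
    thus "(\<Sum>r<m. of_int (c r - int p * H r) * w ^ r) = 0"
     by (simp add: algebra_simps sum_subtractf sum_distrib_left)
   qed (rule r)
   thus ?thesis by (simp only: of_int_eq_0_iff eq_iff_diff_eq_0[symmetric])
  qed
  have "c r = 0" if r: "r < m" for r
  proof -
   have "\<bar>c r\<bar> <= (\<Sum>i<d. \<Sum>t<m. \<bar>of_bool ((i + k * t) mod m = r) * (E i * f t)\<bar>)"
    unfolding c_def by (rule order_trans[OF sum_abs]) (intro sum_mono sum_abs)
   also have "... <= (\<Sum>i<d. \<Sum>t<m. \<bar>E i\<bar> * \<bar>f t\<bar>)"
    by (intro sum_mono) (auto simp: abs_mult)
   also have "... = (\<Sum>i<d. \<bar>E i\<bar>) * (\<Sum>t<m. \<bar>f t\<bar>)" by (simp add: sum_product)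
   also have "... < int p" by (rule less.prems(2)[OF p])
   finally have "int p * \<bar>H r\<bar> < int p * 1" using cH[OF r] by (simp add: abs_mult)
   hence "H r = 0" using p0 by (simp only: mult_less_cancel_left_pos of_nat_0_less_iff)
   thus ?thesis using cH[OF r] by simp
  qed
  thus ?thesis using Ec[OF less.prems(3)] by simp
 qed
qed

text \<open>Add to \<open>k\<close> the product of \<open>m\<close> and of the small primes not
  dividing \<open>k\<close>. Every small prime then divides exactly one of the two summands; for
  primes dividing \<open>k\<close> this uses coprimality to \<open>m\<close>.\<close>

lemma ex_large_prime_factors:
 assumes "coprime k (m::nat)" "m > 0"
 shows "EX l>0. [l = k] (mod m) & (ALL p. prime p --> p dvd l --> A < p)"
proof -
 define Q where "Q = {p. prime p & p <= A & \<not> p dvd k}"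
 have finQ: "finite Q" by (rule finite_subset[of _ "{..A}"]) (auto simp: Q_def)
 define l where "l = k + m * (\<Prod>p\<in>Q. p)"
 have Q0: "(\<Prod>p\<in>Q. p) > 0" by (rule prod_pos) (auto simp: Q_def prime_gt_0_nat)
 have "A < p" if p: "prime p" "p dvd l" for p
 proof (rule ccontr)
  assume pA: "\<not> A < p"
  show False
  proof (cases "p dvd k")
   case True
   hence "p dvd m * (\<Prod>p\<in>Q. p)" using p(2) unfolding l_def by (simp add: dvd_add_right_iff)
   moreover have "\<not> p dvd m" using True assms(1) p(1) by (metis coprime_common_divisor_nat not_prime_1)
   ultimately have "p dvd (\<Prod>p\<in>Q. p)" using p(1) by (simp add: prime_dvd_mult_iff)
   then obtain q where q: "q : Q" "p dvd q" using p(1) finQ by (auto simp: prime_dvd_prod_iff)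
   hence "p = q" using p(1) by (intro primes_dvd_imp_eq) (auto simp: Q_def)
   thus False using q True by (simp add: Q_def)
  next
   case False
   hence "p : Q" using p pA by (simp add: Q_def)
   hence "p dvd (\<Prod>p\<in>Q. p)" using finQ by (rule dvd_prodI[rotated])
   thus False using p(2) False unfolding l_def by (simp add: dvd_add_left_iff)
  qed
 qed
 moreover have "[l = k] (mod m)" by (simp add: l_def cong_def)
 moreover have "l > 0" using Q0 assms(2) by (simp add: l_def)
 ultimately show ?thesis by blast
qed

context cyclotomic
begin

text \<open>Absence of zero divisors, by transforms: \<open>EE\<close> belongs to the multiplier,
  \<open>PP\<close> to \<open>ext v\<close>, and their product vanishes at all \<open>m\<close>-th
  roots of unity. Fewer than \<open>d\<close> of the \<open>d\<close> primitive roots are zeros of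
  \<open>EE\<close>, so it is nonzero at one of them. Landau's argument carries the vanishing of
  \<open>PP\<close> from there to all primitive roots, and the coset relations deal with the
  others.\<close>

lemma shifts_independent:
 assumes v: "j < d" "v j ~= 0" and ker: "!!i. i < d ==> (\<Sum>k<d. E k * shift k v i) = 0" and k: "k < d"
 shows "E k = 0"
proof (rule ccontr)
 assume Ek: "E k ~= 0"
 define f where "f = ext v"
 have m0: "m > 0" using m1 by simp
 have per: "f (t + int m) = f t" for t using V_ext by (simp add: f_def V_def)
 have conv: "(\<Sum>k<d. E k * f (t - int k)) = 0" for t
 proof -
  have "ext (%i. \<Sum>k<d. E k * shift k v i) t = (\<Sum>k<d. E k * ext (shift k v) t)"
   unfolding ext_def sum_distrib_left by (subst sum.swap) (simp add: mult_ac)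
  moreover have "ext (%i. \<Sum>k<d. E k * shift k v i) t = 0" unfolding ext_def using ker by simp
  ultimately show ?thesis by (simp add: ext_shift f_def)
 qed
 define EE where "EE z = (\<Sum>i<d. of_int (E i) * z ^ i)" for z :: complex
 define PP where "PP z = (\<Sum>t<m. of_int (f (int t)) * z ^ t)" for z :: complex
 have PPi: "PP z = (\<Sum>t\<in>{0..<int m}. of_int (f t) * z powi t)" for z
  unfolding PP_def by (rule sum.reindex_bij_witness[of _ nat int]) auto
 have pp: "of_int (f (t + int m)) * z powi (t + int m) = of_int (f t) * z powi t" if "z ^ m = 1" for z :: complex and t
 proof -
  have "z ~= 0" using that m0 by (metis power_0_left less_not_refl zero_neq_one)
  thus ?thesis using that by (simp add: per power_int_add)
 qed
 have base: "EE z * PP z = 0" if z: "z ^ m = 1" for z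
 proof -
  have z0: "z ~= 0" using z m0 by (metis power_0_left less_not_refl zero_neq_one)
  have "EE z * PP z = (\<Sum>i<d. of_int (E i) * (\<Sum>t\<in>{0..<int m}. of_int (f t) * z powi (t + int i)))"
   unfolding EE_def PPi sum_product using z0 by (simp add: sum_distrib_left power_int_add mult_ac)
  also have "... = (\<Sum>i<d. of_int (E i) * (\<Sum>t\<in>{0..<int m}. of_int (f (t - int i)) * z powi t))"
  proof -
   have inner: "(\<Sum>t\<in>{0..<int m}. of_int (f t) * z powi (t + int i)) = (\<Sum>t\<in>{0..<int m}. of_int (f (t - int i)) * z powi t)" for i
   proof -
   define F where "F t = of_int (f t) * z powi (t + int i)" for t
   have "F (t + int m) = F t" for t using pp[OF z, of t] z0 by (simp add: F_def per power_int_add)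
   from sum_periodic_shift[of F m "int i", OF this m0]
   show ?thesis by (simp add: F_def)
   qed
   show ?thesis by (simp only: inner)
  qed
  also have "... = (\<Sum>t\<in>{0..<int m}. of_int (\<Sum>i<d. E i * f (t - int i)) * z powi t)"
   unfolding of_int_sum sum_distrib_left sum_distrib_right by (subst sum.swap) (simp add: mult_ac)
  also have "... = 0" using conv by simp
  finally show ?thesis .
 qed
 define W where "W = cis (2 * pi / m)"
 have W: "W ^ m = 1" using m0 by (simp add: W_def Complex.DeMoivre)
 have Winj: "a = b" if "W ^ a = W ^ b" "a < m" "b < m" for a b
 proof -
  have "W ^ a = cis (2 * pi * real a / real m)" for a by (simp add: W_def Complex.DeMoivre mult_ac)
  thus ?thesis using Complex.bij_betw_roots_unity[OF m0] that by (auto simp: bij_betw_def inj_on_def)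
 qed
 have Wmod: "W ^ a = W ^ b" if "[a = b] (mod m)" for a b
  unfolding power_mod_root[OF W, of a] power_mod_root[OF W, of b] using that by (simp only: cong_def)
 have Wm: "(W ^ a) ^ m = 1" for a using W by (simp add: power_mult[symmetric] mult.commute[of a]) (simp add: power_mult)
 have "EX a<d. EE (W ^ u a) ~= 0"
 proof (rule ccontr)
  assume "\<not> (EX a<d. EE (W ^ u a) ~= 0)"
  hence z: "EE z = 0" if "z : (%a. W ^ u a) ` {..<d}" for z using that by auto
  have "inj_on (%a. W ^ u a) {..<d}"
  proof (rule inj_onI)
   fix a b assume ab: "a : {..<d}" "b : {..<d}" "W ^ u a = W ^ u b"
   hence "u a = u b" using Winj u_props(1) by auto
   thus "a = b" using u ab by (auto simp: bij_betw_def inj_on_def)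
  qed
  hence c: "card ((%a. W ^ u a) ` {..<d}) >= d" by (simp add: card_image)
  have "of_int (E k) = (0::complex)"
   by (rule coeffs_zero_of_roots[OF _ c _ k, of "%i. of_int (E i)"]) (use z in \<open>auto simp: EE_def\<close>)
  thus False using Ek by simp
 qed
 then obtain a where a: "a < d" "EE (W ^ u a) ~= 0" by blast
 have cop: "coprime (u a) m" using u a(1) by (auto simp: bij_betw_def)
 \<comment> \<open>With \<open>x\<close> the inverse of \<open>u a\<close> modulo \<open>m\<close>,
   the exponent \<open>x * t\<close> carries \<open>W ^ u a\<close> to \<open>W ^ t\<close>. It is
   replaced by a congruent \<open>l\<close> with large prime factors.\<close>
 have PPu: "PP (W ^ t) = 0" if t: "coprime t m" for t
 proof -
  obtain x where x: "[u a * x = 1] (mod m)" using cong_solve_coprime_nat[OF cop] by auto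
  have "coprime x m"
  proof -
   have "coprime (u a * x) m" using cong_imp_coprime[OF cong_sym[OF x]] by simp
   thus ?thesis by simp
  qed
  hence "coprime (x * t) m" using t by simp
  then obtain l where l: "l > 0" "[l = x * t] (mod m)"
   "!!p. prime p ==> p dvd l ==> nat ((\<Sum>i<d. \<bar>E i\<bar>) * (\<Sum>t<m. \<bar>f (int t)\<bar>)) < p"
   using ex_large_prime_factors[OF _ m0] by blast
  have "EE (W ^ u a) * PP ((W ^ u a) ^ l) = 0"
   unfolding EE_def PP_def
   by (rule product_vanishes_large_primes[OF m0 _ l(1)]) (use base l(3) Wm in \<open>auto simp: EE_def PP_def nat_less_iff\<close>)
  hence "PP (W ^ (u a * l)) = 0" using a(2) by (simp add: power_mult)
  moreover have "[u a * l = t] (mod m)"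
  proof -
   have "[u a * l = u a * (x * t)] (mod m)" by (intro cong_mult cong_refl l(2))
   also have "u a * (x * t) = u a * x * t" by simp
   also have "[u a * x * t = 1 * t] (mod m)" by (intro cong_mult cong_refl x)
   finally show ?thesis by simp
  qed
  ultimately show ?thesis using Wmod[of "u a * l" t] by simp
 qed
 \<comment> \<open>At a root that is not primitive, \<open>z ^ M = 1\<close> for some
   \<open>M = m div p\<close>. Translating \<open>f\<close> by multiples of \<open>M\<close> does
   not change the value, and the translates add up to 0.\<close>
 have PPn: "PP (W ^ t) = 0" for t
 proof (cases "coprime t m")
  case False
  then obtain p where p: "prime p" "p dvd gcd t m" by (metis coprime_iff_gcd_eq_1 prime_factor_nat)
  hence pm: "p : prime_factors m" and pt: "p dvd t" using pf by auto
  define M where "M = m div p"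
  have mM: "m = p * M" using pf_div(2)[OF pm] by (simp add: M_def)
  define z where "z = W ^ t"
  have z: "z ^ m = 1" unfolding z_def by (rule Wm)
  have zM: "z ^ M = 1"
  proof -
   obtain s where "t = p * s" using pt by auto
   hence "z ^ M = (W ^ m) ^ s" unfolding z_def mM by (simp add: power_mult[symmetric] mult_ac)
   thus ?thesis using W by simp
  qed
  have z0: "z ~= 0" using z m0 by (metis power_0_left less_not_refl zero_neq_one)
  have "PP z = (\<Sum>t\<in>{0..<int m}. of_int (f (t + int i * int M)) * z powi t)" for i
  proof -
   define F where "F t = of_int (f t) * z powi t" for t
   have "F (t + int m) = F t" for t using pp[OF z, of t] by (simp add: F_def)
   from sum_periodic_shift[of F m "- (int i * int M)", OF this m0]
   have "PP z = (\<Sum>t\<in>{0..<int m}. F (t + int i * int M))" by (simp add: F_def PPi)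
   moreover have "z powi (t + int i * int M) = z powi t" for t
    using z0 zM by (simp add: power_int_add power_int_mult power_int_power mult.commute[of "int i"])
   ultimately show ?thesis by (simp add: F_def)
  qed
  hence "(\<Sum>i<p. PP z) = (\<Sum>i<p. \<Sum>t\<in>{0..<int m}. of_int (f (t + int i * int M)) * z powi t)" by (intro sum.cong) auto
  also have "... = (\<Sum>t\<in>{0..<int m}. of_int (\<Sum>i<p. f (t + int i * int M)) * z powi t)"
   unfolding of_int_sum sum_distrib_right by (rule sum.swap)
  also have "... = 0" using V_ext pm unfolding f_def M_def by (simp add: V_def)
  finally show ?thesis using pf_div(1)[OF pm] by (simp add: z_def)
 qed (rule PPu)
 have "of_int (f (int (u j))) = (0::complex)"
 proof (rule coeffs_zero_of_roots[where n = m and S = "(%t. W ^ t) ` {..<m}" and c = "%t. of_int (f (int t))"])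
  have "inj_on (%t. W ^ t) {..<m}" using Winj by (intro inj_onI) auto
  thus "m <= card ((%t. W ^ t) ` {..<m})" by (simp add: card_image)
  show "(\<Sum>r<m. of_int (f (int r)) * z ^ r) = 0" if "z : (%t. W ^ t) ` {..<m}" for z
   using that PPn by (auto simp: PP_def)
 qed (use u_props(1) v(1) in auto)
 thus False using v by (simp add: f_def ext_u)
qed

end

section \<open>The trace form\<close>

text \<open>Completion of the square in the first variable. Domination of the sum of squares is
  inherited by the remaining form \<open>G'\<close> and bounds every pivot below by 1.\<close>

lemma cholesky:
 fixes G :: "nat => nat => real"
 assumes "!!i j. i < d ==> j < d ==> G i j = G j i"
  and "!!v. (\<Sum>j<d. (v j)\<^sup>2) <= (\<Sum>j<d. \<Sum>k<d. G j k * (v j * v k))"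
 shows "EX C. upper_tri d C & (ALL i<d. 1 <= C i i) &
  (ALL v. (\<Sum>i<d. (lin d C v i)\<^sup>2) = (\<Sum>j<d. \<Sum>k<d. G j k * (v j * v k)))"
 using assms
proof (induction d arbitrary: G)
 case 0
 show ?case by (simp add: upper_tri_def)
next
 case (Suc d)
 define g where "g = G 0 0"
 define h where "h j = G 0 (Suc j)" for j
 define G' where "G' j k = G (Suc j) (Suc k) - h j * h k / g" for j k
 have g1: "1 <= g"
 proof -
  have "(\<Sum>j<Suc d. (of_bool (j = 0))\<^sup>2) <= (\<Sum>j<Suc d. \<Sum>k<Suc d. G j k * (of_bool (j = 0) * of_bool (k = 0)))"
   by (rule Suc.prems(2))
  moreover have "(\<Sum>j<Suc d. (of_bool (j = 0))\<^sup>2) = (1::real)"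
   by (subst sum.lessThan_Suc_shift) simp
  moreover have "(\<Sum>j<Suc d. \<Sum>k<Suc d. G j k * (of_bool (j = 0) * of_bool (k = 0))) = g"
   by (subst sum.lessThan_Suc_shift, subst sum.lessThan_Suc_shift) (simp add: g_def)
  ultimately show ?thesis by simp
 qed
 have split: "(\<Sum>j<Suc d. \<Sum>k<Suc d. G j k * (v j * v k)) =
   g * (v 0 + (\<Sum>j<d. h j * v (Suc j)) / g)\<^sup>2 + (\<Sum>j<d. \<Sum>k<d. G' j k * (v (Suc j) * v (Suc k)))" for v
 proof -
  let ?H = "\<Sum>j<d. h j * v (Suc j)"
  have "G (Suc j) 0 = h j" if "j < d" for j using Suc.prems(1)[of "Suc j" 0] that by (simp add: h_def)
  hence "(\<Sum>j<Suc d. \<Sum>k<Suc d. G j k * (v j * v k)) =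
    g * (v 0 * v 0) + (\<Sum>k<d. h k * (v 0 * v (Suc k))) +
    (\<Sum>j<d. h j * (v (Suc j) * v 0)) + (\<Sum>j<d. \<Sum>k<d. G (Suc j) (Suc k) * (v (Suc j) * v (Suc k)))"
   by (simp add: sum.lessThan_Suc_shift g_def h_def sum.distrib del: sum.lessThan_Suc)
  also have "(\<Sum>k<d. h k * (v 0 * v (Suc k))) = v 0 * ?H" by (simp add: sum_distrib_left mult_ac)
  also have "(\<Sum>j<d. h j * (v (Suc j) * v 0)) = v 0 * ?H" by (simp add: sum_distrib_left mult_ac)
  also have "(\<Sum>j<d. \<Sum>k<d. G (Suc j) (Suc k) * (v (Suc j) * v (Suc k))) =
    (\<Sum>j<d. \<Sum>k<d. G' j k * (v (Suc j) * v (Suc k))) + (\<Sum>j<d. \<Sum>k<d. h j * v (Suc j) * (h k * v (Suc k)) / g)"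
   unfolding sum.distrib[symmetric] by (intro sum.cong refl) (simp add: G'_def algebra_simps)
  also have "(\<Sum>j<d. \<Sum>k<d. h j * v (Suc j) * (h k * v (Suc k)) / g) = ?H * ?H / g"
   by (simp add: sum_product sum_divide_distrib)
  finally show ?thesis using g1 by (simp add: power2_eq_square field_simps)
 qed
 have "EX C. upper_tri d C & (ALL i<d. 1 <= C i i) &
  (ALL v. (\<Sum>i<d. (lin d C v i)\<^sup>2) = (\<Sum>j<d. \<Sum>k<d. G' j k * (v j * v k)))"
 proof (rule Suc.IH)
  show "G' i j = G' j i" if "i < d" "j < d" for i j
   using Suc.prems(1)[of "Suc i" "Suc j"] that by (simp add: G'_def)
  fix v :: "nat => real"
  \<comment> \<open>The first coordinate is chosen to make the completed square vanish.\<close>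
  define w where "w j = (case j of 0 => - (\<Sum>j<d. h j * v j) / g | Suc i => v i)" for j
  have "(\<Sum>j<d. (v j)\<^sup>2) <= (\<Sum>j<Suc d. (w j)\<^sup>2)" by (subst sum.lessThan_Suc_shift) (simp add: w_def)
  also have "... <= (\<Sum>j<Suc d. \<Sum>k<Suc d. G j k * (w j * w k))" by (rule Suc.prems(2))
  also have "... = (\<Sum>j<d. \<Sum>k<d. G' j k * (v j * v k))" unfolding split by (simp add: w_def)
  finally show "(\<Sum>j<d. (v j)\<^sup>2) <= (\<Sum>j<d. \<Sum>k<d. G' j k * (v j * v k))" .
 qed
 then obtain C where C: "upper_tri d C" "!!i. i < d ==> 1 <= C i i"
  "!!v. (\<Sum>i<d. (lin d C v i)\<^sup>2) = (\<Sum>j<d. \<Sum>k<d. G' j k * (v j * v k))" by blast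
 define C' where "C' i j = (case i of 0 => (case j of 0 => sqrt g | Suc j' => h j' / sqrt g) |
  Suc i' => (case j of 0 => 0 | Suc j' => C i' j'))" for i j
 have ut: "upper_tri (Suc d) C'"
  using C(1) g1 by (auto simp: upper_tri_def C'_def split: nat.splits)
 have diag: "1 <= C' i i" if "i < Suc d" for i using that C(2) g1 by (auto simp: C'_def split: nat.splits)
 have form: "(\<Sum>i<Suc d. (lin (Suc d) C' v i)\<^sup>2) = (\<Sum>j<Suc d. \<Sum>k<Suc d. G j k * (v j * v k))" for v
 proof -
  have l0: "lin (Suc d) C' v 0 = sqrt g * (v 0 + (\<Sum>j<d. h j * v (Suc j)) / g)"
  proof -
   have "lin (Suc d) C' v 0 = sqrt g * v 0 + (\<Sum>j<d. h j / sqrt g * v (Suc j))"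
    unfolding lin_def by (subst sum.lessThan_Suc_shift) (simp add: C'_def)
   also have "(\<Sum>j<d. h j / sqrt g * v (Suc j)) = (\<Sum>j<d. h j * v (Suc j)) / sqrt g"
    by (simp add: sum_divide_distrib)
   also have "... = sqrt g * ((\<Sum>j<d. h j * v (Suc j)) / g)"
    using g1 by (simp add: real_div_sqrt field_simps)
   finally show ?thesis by (simp add: distrib_left)
  qed
  have lS: "lin (Suc d) C' v (Suc i) = lin d C (%j. v (Suc j)) i" for i
   unfolding lin_def by (subst sum.lessThan_Suc_shift) (simp add: C'_def)
  have "(\<Sum>i<Suc d. (lin (Suc d) C' v i)\<^sup>2) = (lin (Suc d) C' v 0)\<^sup>2 + (\<Sum>i<d. (lin d C (%j. v (Suc j)) i)\<^sup>2)"
   by (simp only: sum.lessThan_Suc_shift lS)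
  thus ?thesis unfolding split C(3) l0 using g1 by (simp add: power_mult_distrib)
 qed
 show ?case using ut diag form by blast
qed

lemma real_system_solvable:
 fixes M :: "nat => nat => real"
 assumes "!!a. (!!i. i < d ==> (\<Sum>k<d. M i k * a k) = 0) ==> ALL k<d. a k = 0"
 shows "EX a. ALL i<d. (\<Sum>k<d. M i k * a k) = c i"
proof -
 define A where "A = mat d d (%(i, k). M i k)"
 have A: "A : carrier_mat d d" by (simp add: A_def)
 have mv: "(A *\<^sub>v v) $ i = (\<Sum>k<d. M i k * v $ k)" if "i < d" "v : carrier_vec d" for i v
  using that by (auto simp: A_def scalar_prod_def lessThan_atLeast0 intro!: sum.cong)
 have "det A ~= 0"
 proof
  assume "det A = 0"
  then obtain v where v: "v : carrier_vec d" "v ~= 0\<^sub>v d" "A *\<^sub>v v = 0\<^sub>v d"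
   using det_0_iff_vec_prod_zero[OF A] by blast
  have "ALL k<d. v $ k = 0" by (rule assms) (use mv[OF _ v(1)] v(3) in auto)
  thus False using v(1,2) by (auto intro!: eq_vecI)
 qed
 then obtain B where B: "B : carrier_mat d d" "A * B = 1\<^sub>m d"
  using det_non_zero_imp_unit[OF A] by (auto simp: Units_def ring_mat_def)
 have "A *\<^sub>v (B *\<^sub>v Matrix.vec d c) = Matrix.vec d c"
  using A B by (simp add: assoc_mult_mat_vec[symmetric])
 hence "ALL i<d. (\<Sum>k<d. M i k * (B *\<^sub>v Matrix.vec d c) $ k) = c i"
  using mv[of _ "B *\<^sub>v Matrix.vec d c"] B(1) by (metis index_vec mult_mat_vec_carrier vec_carrier)
 thus ?thesis by (intro exI[of _ "%k. (B *\<^sub>v Matrix.vec d c) $ k"])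
qed

text \<open>Independence over \<int> makes an integer determinant nonzero, and it stays nonzero over
  \<real>.\<close>

lemma real_kernel_trivial:
 fixes S :: "nat => nat => int" and a :: "nat => real"
 assumes "!!E. (!!i. i < d ==> (\<Sum>k<d. S i k * E k) = 0) ==> ALL k<d. E k = 0"
  and a: "!!i. i < d ==> (\<Sum>k<d. real_of_int (S i k) * a k) = 0"
 shows "ALL k<d. a k = 0"
proof -
 define A where "A = mat d d (%(i, k). S i k)"
 have A: "A : carrier_mat d d" by (simp add: A_def)
 have mv: "(A *\<^sub>v v) $ i = (\<Sum>k<d. S i k * v $ k)" if "i < d" "v : carrier_vec d" for i v
  using that by (auto simp: A_def scalar_prod_def lessThan_atLeast0 intro!: sum.cong)
 have "det A ~= 0"
 proof
  assume "det A = 0"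
  then obtain v where v: "v : carrier_vec d" "v ~= 0\<^sub>v d" "A *\<^sub>v v = 0\<^sub>v d"
   using det_0_iff_vec_prod_zero[OF A] by blast
  have "ALL k<d. v $ k = 0" by (rule assms) (use mv[OF _ v(1)] v(3) in auto)
  thus False using v(1,2) by (auto intro!: eq_vecI)
 qed
 hence "det (map_mat real_of_int A) ~= 0" by (simp add: of_int_hom.hom_det)
 moreover have RA: "map_mat real_of_int A : carrier_mat d d" using A by simp
 moreover have "map_mat real_of_int A *\<^sub>v Matrix.vec d a = 0\<^sub>v d"
  using a by (intro eq_vecI) (auto simp: A_def scalar_prod_def lessThan_atLeast0)
 ultimately have "Matrix.vec d a = 0\<^sub>v d" using det_0_iff_vec_prod_zero[OF RA] vec_carrier[of d a] by blast
 thus ?thesis by (metis index_vec index_zero_vec(1))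
qed

context cyclotomic
begin

text \<open>The sign does not depend on \<open>j\<close>, so it cancels in a product of two values.
  The Gram entries therefore are cardinalities, found by divisibility tests.\<close>

lemma e_eq: "e t j = (if int m dvd t * (t - int j) then (- 1) ^ card {p : prime_factors m. int p dvd t} else 0)"
proof (cases "int m dvd t * (t - int j)")
 case True
 hence *: "int p dvd t \<or> int p dvd t - int j" if "p : prime_factors m" for p
  using that unfolding dvd_iff by (auto simp: prime_dvd_mult_iff pf)
 have "e t j = (\<Prod>p\<in>prime_factors m. if int p dvd t then - 1 else 1)"
  unfolding e_def by (rule prod.cong) (use * in auto)
 also have "... = (\<Prod>p\<in>{p \<in> prime_factors m. int p dvd t}. - 1)" by (simp only: prod.inter_filter finite_set_mset)
 finally show ?thesis using True by (simp add: prod_constant)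
next
 case False
 then obtain p where "p : prime_factors m" "\<not> int p dvd t" "\<not> int p dvd t - int j"
  unfolding dvd_iff by (auto simp: prime_dvd_mult_iff pf)
 hence "e t j = 0" unfolding e_def by (intro prod_zero) auto
 thus ?thesis using False by simp
qed

definition Gm :: "nat => nat => nat" where
 "Gm j k = card {t : {0..<int m}. int m dvd t * (t - int (u j)) & int m dvd t * (t - int (u k))}"

lemma Gm_eq: "int (Gm j k) = (\<Sum>t\<in>{0..<int m}. e t (u j) * e t (u k))"
proof -
 have "(\<Sum>t\<in>{0..<int m}. e t (u j) * e t (u k)) =
  (\<Sum>t\<in>{0..<int m}. if int m dvd t * (t - int (u j)) & int m dvd t * (t - int (u k)) then 1 else 0)"
  unfolding e_eq by (intro sum.cong) (auto simp: power_mult_distrib[symmetric])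
 thus ?thesis by (simp add: Gm_def sum.If_cases Int_def)
qed

lemma Gm_commute: "Gm j k = Gm k j"
 by (simp add: Gm_def conj_commute)

lemma Gm_form:
 fixes v :: "nat => 'a :: comm_ring_1"
 shows "(\<Sum>j<d. \<Sum>k<d. of_nat (Gm j k) * (v j * v k)) = (\<Sum>t\<in>{0..<int m}. (\<Sum>j<d. of_int (e t (u j)) * v j)\<^sup>2)"
proof -
 have "of_nat (Gm j k) = (\<Sum>t\<in>{0..<int m}. of_int (e t (u j)) * of_int (e t (u k)) :: 'a)" for j k
  using arg_cong[OF Gm_eq, of of_int] by simp
 hence "(\<Sum>j<d. \<Sum>k<d. of_nat (Gm j k) * (v j * v k)) =
  (\<Sum>j<d. \<Sum>k<d. \<Sum>t\<in>{0..<int m}. (of_int (e t (u j)) * v j) * (of_int (e t (u k)) * v k))"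
  by (simp only: sum_distrib_right) (intro sum.cong refl, simp only: mult_ac)
 also have "... = (\<Sum>j<d. \<Sum>t\<in>{0..<int m}. \<Sum>k<d. (of_int (e t (u j)) * v j) * (of_int (e t (u k)) * v k))"
  by (rule sum.cong[OF refl], rule sum.swap)
 also have "... = (\<Sum>t\<in>{0..<int m}. \<Sum>j<d. \<Sum>k<d. (of_int (e t (u j)) * v j) * (of_int (e t (u k)) * v k))"
  by (rule sum.swap)
 finally show ?thesis by (simp add: power2_eq_square sum_product)
qed

text \<open>The sum over all residues \<open>t\<close> contains the units, where the linear forms
  reduce to single coordinates.\<close>

lemma Gm_ge:
 fixes v :: "nat => 'a :: linordered_idom"
 shows "(\<Sum>j<d. (v j)\<^sup>2) <= (\<Sum>j<d. \<Sum>k<d. of_nat (Gm j k) * (v j * v k))"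
proof -
 have "(\<Sum>j<d. of_int (e (int (u k)) (u j)) * v j) = v k" if "k < d" for k
 proof -
  have "(\<Sum>j<d. of_int (e (int (u k)) (u j)) * v j) = (\<Sum>j<d. if j = k then v j else 0)"
   by (rule sum.cong) (use e_u that in auto)
  thus ?thesis using that by simp
 qed
 hence "(\<Sum>k<d. (v k)\<^sup>2) = (\<Sum>k<d. (\<Sum>j<d. of_int (e (int (u k)) (u j)) * v j)\<^sup>2)" by simp
 also have "... = (\<Sum>t\<in>(%k. int (u k)) ` {..<d}. (\<Sum>j<d. of_int (e t (u j)) * v j)\<^sup>2)"
  using u by (subst sum.reindex) (auto simp: bij_betw_def inj_on_def)
 also have "... <= (\<Sum>t\<in>{0..<int m}. (\<Sum>j<d. of_int (e t (u j)) * v j)\<^sup>2)"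
  by (rule sum_mono2) (use u_props(1) in auto)
 finally show ?thesis unfolding Gm_form .
qed

text \<open>A counted \<open>t\<close> is congruent to 0 or to \<open>u j\<close> modulo each prime
  of \<open>m\<close>, so it is determined by the set of primes that divide it.\<close>

lemma Gm_diag_le: "Gm j j <= 2 ^ card (prime_factors m)"
proof -
 let ?S = "{t : {0..<int m}. int m dvd t * (t - int (u j)) & int m dvd t * (t - int (u j))}"
 have "card ?S <= card (Pow (prime_factors m))"
 proof (rule card_inj_on_le[where f = "%t. {p : prime_factors m. int p dvd t}"])
  show "inj_on (%t. {p : prime_factors m. int p dvd t}) ?S"
  proof (rule inj_onI)
   fix s t assume s: "s : ?S" and t: "t : ?S" and eq: "{p : prime_factors m. int p dvd s} = {p : prime_factors m. int p dvd t}"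
   have "int m dvd s - t" unfolding dvd_iff
   proof
    fix p assume p: "p : prime_factors m"
    hence iff: "int p dvd s \<longleftrightarrow> int p dvd t" using eq by blast
    have "int p dvd s * (s - int (u j))" "int p dvd t * (t - int (u j))" using s t p unfolding dvd_iff by auto
    hence "int p dvd s \<or> int p dvd s - int (u j)" "int p dvd t \<or> int p dvd t - int (u j)"
     using p by (auto simp: prime_dvd_mult_iff pf)
    thus "int p dvd s - t" using iff by (metis diff_diff_eq2 diff_add_cancel dvd_diff add_diff_cancel)
   qed
   hence "[s = t] (mod int m)" by (simp add: cong_iff_dvd_diff)
   thus "s = t" using s t by (simp add: cong_def)
  qed
 qed auto
 thus ?thesis by (simp add: Gm_def card_Pow)
qed

definition q :: "(nat => int) => int" where
 "q v = (\<Sum>j<d. \<Sum>k<d. int (Gm j k) * (v j * v k))"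

lemma q_ext: "q v = (\<Sum>t\<in>{0..<int m}. (ext v t)\<^sup>2)"
 using Gm_form[of v] by (simp add: q_def ext_def)

lemma q_shift: "q (shift k v) = q v"
proof -
 have "(\<Sum>t\<in>{0..<int m}. (ext v (t - int k))\<^sup>2) = (\<Sum>t\<in>{0..<int m}. (ext v t)\<^sup>2)"
  by (rule sum_periodic_shift[of "%t. (ext v t)\<^sup>2"]) (use V_ext m1 in \<open>auto simp: V_def\<close>)
 thus ?thesis by (simp add: q_ext ext_shift)
qed

lemma q_ge: "(\<Sum>j<d. (v j)\<^sup>2) <= q v"
 using Gm_ge[of v] by (simp add: q_def)

lemma q_cong: "(!!j. j < d ==> v j = w j) ==> q v = q w"
 by (simp add: q_def)

lemma shift_cong: "(!!j. j < d ==> v j = w j) ==> shift k v = shift k w"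
 by (simp add: shift_def ext_def fun_eq_iff)

lemma gram_factor:
 "EX C. upper_tri d C & (ALL i<d. 1 <= C i i & (C i i)\<^sup>2 <= 2 ^ card (prime_factors m)) &
   (ALL v. (\<Sum>i<d. (lin d C v i)\<^sup>2) = (\<Sum>j<d. \<Sum>k<d. real (Gm j k) * (v j * v k)))"
proof -
 from cholesky[of d "%j k. real (Gm j k)"] Gm_commute Gm_ge[where 'a = real]
 obtain C where C: "upper_tri d C" "!!i. i < d ==> 1 <= C i i"
  "!!v. (\<Sum>i<d. (lin d C v i)\<^sup>2) = (\<Sum>j<d. \<Sum>k<d. real (Gm j k) * (v j * v k))" by auto
 \<comment> \<open>The square is one term of the squared norm of column \<open>i\<close>, which is a
   diagonal Gram entry.\<close>
 have "(C i i)\<^sup>2 <= 2 ^ card (prime_factors m)" if i: "i < d" for i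
 proof -
  define v where "v j = (if j = i then 1 else 0 :: real)" for j
  have v: "(\<Sum>j<d. f j * v j) = f i" for f
  proof -
   have "(\<Sum>j<d. f j * v j) = (\<Sum>j<d. if j = i then f j else 0)" by (intro sum.cong) (auto simp: v_def)
   thus ?thesis using i by simp
  qed
  have "lin d C v i = C i i" unfolding lin_def by (rule v)
  hence "(C i i)\<^sup>2 <= (\<Sum>i<d. (lin d C v i)\<^sup>2)" using i member_le_sum[of i "{..<d}" "%i. (lin d C v i)\<^sup>2"] by simp
  also have "... = real (Gm i i)" unfolding C(3) mult.assoc[symmetric] v ..
  also have "... <= 2 ^ card (prime_factors m)" using Gm_diag_le[of i]
   by (metis of_nat_le_iff of_nat_numeral of_nat_power)
  finally show ?thesis .
 qed
 thus ?thesis using C by blast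
qed

text \<open>Both the congruence and \<open>q\<close> are invariant under shifts, so one short vector
  for a multiplier yields \<open>m\<close> of them by \<open>shift_inj\<close>; these form the sets
  \<open>PP A\<close> of \<open>averaging\<close>. The surjectivity required there comes from
  \<open>shifts_independent\<close>.\<close>

lemma averaging_shifts:
 fixes C :: "nat => nat => real" and N :: nat and T r r1 \<theta> \<beta> :: real
 assumes C: "upper_tri d C" and C\<beta>: "!!i. i < d ==> (C i i)\<^sup>2 <= \<beta>"
  and form: "!!v. (\<Sum>i<d. (lin d C v i)\<^sup>2) = (\<Sum>j<d. \<Sum>k<d. real (Gm j k) * (v j * v k))"
  and T: "T > 0" and N: "N > 0"
  and short: "!!A. A : {..<d} \<rightarrow>\<^sub>E {..<N} ==> EX x w. (EX j<d. x j ~= 0) &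
   (ALL i<d. [w i = (\<Sum>k<d. int (A k) * shift k x i)] (mod int N)) &
   real_of_int (q x) + (T / N)\<^sup>2 * real_of_int (q w) <= r\<^sup>2"
  and v: "v = \<beta> * r\<^sup>2 / 3 + T\<^sup>2 * d * r ^ 4 / (12 * (real N)\<^sup>2)" and \<theta>: "\<theta> > 0" "v <= \<theta>\<^sup>2"
  and r1: "r1 > 0" "r1\<^sup>2 >= r\<^sup>2 + d * \<beta> / 4 + T\<^sup>2 * (real d)\<^sup>2 * r\<^sup>2 / (4 * (real N)\<^sup>2) + \<theta>"
 shows "m * (1 - v / \<theta>\<^sup>2) * (\<Prod>i<d. C i i)\<^sup>2 * T ^ d <= unit_ball_vol (2 * real d) * r1 ^ (2 * d)"
proof -
 define R where "R x i = lin d C (%j. real_of_int (x j)) i" for x i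
 have R_lin: "R (%j. a * x j + b * y j) i = a * R x i + b * R y i" for a b x y i
  by (simp add: R_def lin_def sum.distrib sum_distrib_left algebra_simps)
 have R_sum: "R (%j. \<Sum>k\<in>K. a k * x k j) i = (\<Sum>k\<in>K. a k * R (x k) i)" for K :: "nat set" and a x i
  unfolding R_def lin_def of_int_sum sum_distrib_left by (subst sum.swap) (simp add: mult_ac)
 have R_q: "(\<Sum>i<d. (R x i)\<^sup>2) = real_of_int (q x)" for x
  unfolding R_def form by (simp add: q_def)
 have R_cong: "R x i = R y i" if "!!j. j < d ==> x j = y j" for x y i
  using that by (simp add: R_def lin_def)
 have q0: "x j = 0" if "q x = 0" "j < d" for x j
 proof -
  have "(x j)\<^sup>2 <= (\<Sum>j<d. (x j)\<^sup>2)" using that(2) member_le_sum[of j "{..<d}" "%j. (x j)\<^sup>2"] by simp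
  hence "(x j)\<^sup>2 <= 0" using q_ge[of x] that(1) by linarith
  thus ?thesis by simp
 qed
 define X where "X = {x : {..<d} \<rightarrow>\<^sub>E (UNIV :: int set). EX j<d. x j ~= 0}"
 define sh where "sh A z \<longleftrightarrow> (EX j<d. fst z j ~= 0) &
   (ALL i<d. [snd z i = (\<Sum>k<d. int (A k) * shift k (fst z) i)] (mod int N)) &
   real_of_int (q (fst z)) + (T / N)\<^sup>2 * real_of_int (q (snd z)) <= r\<^sup>2" for A :: "nat => nat" and z
 define x where "x A = fst (SOME z. sh A z)" for A
 define w where "w A = snd (SOME z. sh A z)" for A
 have shA: "sh A (SOME z. sh A z)" if A: "A : {..<d} \<rightarrow>\<^sub>E {..<N}" for A
 proof (rule someI_ex)
  obtain x w where "(EX j<d. x j ~= 0) &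
   (ALL i<d. [w i = (\<Sum>k<d. int (A k) * shift k x i)] (mod int N)) &
   real_of_int (q x) + (T / N)\<^sup>2 * real_of_int (q w) <= r\<^sup>2" using short[OF A] by blast
  hence "sh A (x, w)" unfolding sh_def fst_conv snd_conv .
  thus "EX z. sh A z" ..
 qed
 have xw: "!!A. A : {..<d} \<rightarrow>\<^sub>E {..<N} ==> EX j<d. x A j ~= 0"
  "!!A i. A : {..<d} \<rightarrow>\<^sub>E {..<N} ==> i < d ==> [w A i = (\<Sum>k<d. int (A k) * shift k (x A) i)] (mod int N)"
  "!!A. A : {..<d} \<rightarrow>\<^sub>E {..<N} ==> real_of_int (q (x A)) + (T / N)\<^sup>2 * real_of_int (q (w A)) <= r\<^sup>2"
  using shA unfolding sh_def x_def w_def by blast+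
 \<comment> \<open>Lattice coordinates: the congruence says that the second half differs from the
   image of the first by \<open>N\<close> times an integral vector.\<close>
 define z where "z A l j = (shift l (w A) j - (\<Sum>k<d. int (A k) * shift k (shift l (x A)) j)) div int N" for A l j
 have z: "shift l (w A) j = int N * z A l j + (\<Sum>k<d. int (A k) * shift k (shift l (x A)) j)"
  if A: "A : {..<d} \<rightarrow>\<^sub>E {..<N}" for A l j
 proof -
  obtain y where y: "!!i. i < d ==> w A i - (\<Sum>k<d. int (A k) * shift k (x A) i) = int N * y i"
   using xw(2)[OF A] by (simp add: cong_iff_dvd_diff dvd_def) metis
  have "shift l (w A) = shift l (%i. int N * y i + 1 * (\<Sum>k<d. int (A k) * shift k (x A) i))"
   by (rule shift_cong) (use y in \<open>simp add: algebra_simps\<close>)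
  hence "shift l (w A) j = int N * shift l y j + (\<Sum>k<d. int (A k) * shift k (shift l (x A)) j)"
   unfolding shift_add shift_linear shift_shift add.commute[of l] by (simp only: mult_1)
  thus ?thesis using N by (simp add: z_def)
 qed
 define pt where "pt A l = (restrict (shift l (x A)) {..<d},
   \<lambda>i\<in>{d..<d+d}. lin d (%i j. T * C i j) (%j. real_of_int (z A l j)) (i - d))" for A l
 have nz: "EX j<d. shift l (x A) j ~= 0" if A: "A : {..<d} \<rightarrow>\<^sub>E {..<N}" for A l
 proof (rule ccontr)
  assume "\<not> (EX j<d. shift l (x A) j ~= 0)"
  hence "q (shift l (x A)) = 0" by (simp add: q_def)
  thus False using q0[of "x A"] q_shift[of l "x A"] xw(1)[OF A] by auto
 qed
 show ?thesis
 proof (rule averaging[where X = X and p = R and w = "%x k. R (shift k x)" and PP = "%A. pt A ` {..<m}",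
   OF _ C C\<beta> T N _ _ _ _ _ _ _ _ v \<theta> r1])
  have "1 : {t. t < m & coprime t m}" using m1 by simp
  hence "u ` {..<d} ~= {}" using u by (auto simp only: bij_betw_def)
  thus "0 < d" by auto
  have "countable ({..<d} \<rightarrow>\<^sub>E (UNIV :: int set))" by (rule countable_PiE) auto
  thus "countable X" unfolding X_def by (rule countable_subset[rotated]) auto
  show "inj_on (%x. \<lambda>i\<in>{0..<0 + d}. R x i) X"
  proof (rule inj_onI)
   fix x y assume xy: "x : X" "y : X" "(\<lambda>i\<in>{0..<0 + d}. R x i) = (\<lambda>i\<in>{0..<0 + d}. R y i)"
   have "R x i = R y i" if "i < d" for i using fun_cong[OF xy(3), of i] that by simp
   hence "(\<Sum>i<d. (R (%j. 1 * x j + (- 1) * y j) i)\<^sup>2) = 0" unfolding R_lin by simp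
   hence "q (%j. x j - y j) = 0" unfolding R_q by simp
   hence "x j = y j" if "j < d" for j using q0[of "%j. x j - y j" j] that by simp
   thus "x = y" using xy(1,2) unfolding X_def by (intro PiE_ext[of x "{..<d}" "%_. UNIV" y]) auto
  qed
  show "(\<lambda>i\<in>{0..<0 + d}. R x i) : lat 0 d C" for x
   unfolding lat_def R_def by (intro CollectI exI[of _ x]) simp
  show "EX z. ALL i<d. R (shift k x) i = lin d C (%j. real_of_int (z j)) i" for k x
   by (intro exI[of _ "shift k x"]) (simp add: R_def)
  show "(\<Sum>i<d. (R (shift k x) i)\<^sup>2) = (\<Sum>i<d. (R x i)\<^sup>2)" for k x unfolding R_q q_shift ..
  show "EX a. ALL i<d. (\<Sum>k<d. a k * R (shift k x) i) = c i" if x: "x : X" for x c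
  proof -
   have "EX a. ALL i<d. (\<Sum>k<d. R (shift k x) i * a k) = c i"
   proof (rule real_system_solvable)
    fix a assume a: "!!i. i < d ==> (\<Sum>k<d. R (shift k x) i * a k) = 0"
    define y where "y j = (\<Sum>k<d. real_of_int (shift k x j) * a k)" for j
    have "lin d C y i = 0" if "i < d" for i
    proof -
     have "lin d C y i = (\<Sum>k<d. R (shift k x) i * a k)"
      unfolding lin_def y_def R_def sum_distrib_left sum_distrib_right by (subst sum.swap) (simp add: mult_ac)
     thus ?thesis using a[OF that] by simp
    qed
    hence "(\<Sum>i<d. (lin d C y i)\<^sup>2) = 0" by simp
    hence "(\<Sum>j<d. (y j)\<^sup>2) <= 0" using Gm_ge[of y] unfolding form by simp
    have y0: "y j = 0" if j: "j < d" for j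
    proof -
     have "(y j)\<^sup>2 <= (\<Sum>j<d. (y j)\<^sup>2)" using j member_le_sum[of j "{..<d}" "%j. (y j)\<^sup>2"] by simp
     hence "(y j)\<^sup>2 <= 0" using \<open>(\<Sum>j<d. (y j)\<^sup>2) <= 0\<close> by linarith
     thus ?thesis by simp
    qed
    obtain j0 where j0: "j0 < d" "x j0 ~= 0" using x by (auto simp: X_def)
    show "ALL k<d. a k = 0"
    proof (rule real_kernel_trivial[of d "%i k. shift k x i"])
     fix E :: "nat => int" assume "!!i. i < d ==> (\<Sum>k<d. shift k x i * E k) = 0"
     thus "ALL k<d. E k = 0" using shifts_independent[of j0 x E, OF j0] by (simp add: mult.commute)
    qed (use y0 in \<open>simp add: y_def\<close>)
   qed
   thus ?thesis by (simp add: mult.commute)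
  qed
  fix A assume A: "A : {..<d} \<rightarrow>\<^sub>E {..<N}"
  obtain j0 where j0: "j0 < d" "x A j0 ~= 0" using xw(1)[OF A] by blast
  have "inj_on (pt A) {..<m}"
  proof (rule inj_onI)
   fix k l assume kl: "k : {..<m}" "l : {..<m}" "pt A k = pt A l"
   hence "restrict (shift k (x A)) {..<d} = restrict (shift l (x A)) {..<d}" by (simp add: pt_def)
   hence "shift k (x A) i = shift l (x A) i" if "i < d" for i using that by (metis lessThan_iff restrict_apply')
   thus "k = l" using shift_inj[of j0 "x A" k l, OF j0] kl by simp
  qed
  moreover have "pt A l : X \<times> lat d d (%i j. T * C i j)" for l
  proof -
   have "restrict (shift l (x A)) {..<d} : X" using nz[OF A, of l] by (auto simp: X_def)
   thus ?thesis unfolding pt_def lat_def by blast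
  qed
  ultimately show "finite (pt A ` {..<m}) & card (pt A ` {..<m}) = m & pt A ` {..<m} \<subseteq> X \<times> lat d d (%i j. T * C i j)"
   using card_image[of "pt A" "{..<m}"] by (intro conjI) (simp_all add: image_subset_iff)
  fix x' y assume "(x', y) : pt A ` {..<m}"
  then obtain l where l: "x' = restrict (shift l (x A)) {..<d}"
   "y = (\<lambda>i\<in>{d..<d+d}. lin d (%i j. T * C i j) (%j. real_of_int (z A l j)) (i - d))"
   by (auto simp: pt_def)
  have x': "x' j = shift l (x A) j" if "j < d" for j using that l(1) by simp
  have "(\<Sum>i<d. (R x' i)\<^sup>2) = (\<Sum>i<d. (R (shift l (x A)) i)\<^sup>2)"
   using R_cong[OF x'] by simp
  hence 1: "(\<Sum>i<d. (R x' i)\<^sup>2) = real_of_int (q (x A))" unfolding R_q q_shift .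
  have "y (d + i) + T * (\<Sum>k<d. A k / N * R (shift k x') i) = (T / N) * R (shift l (w A)) i" if i: "i < d" for i
  proof -
   have "R (shift l (w A)) i = R (%j. int N * z A l j + 1 * (\<Sum>k<d. int (A k) * shift k (shift l (x A)) j)) i"
    by (rule R_cong) (simp add: z[OF A])
   also have "... = N * R (z A l) i + (\<Sum>k<d. A k * R (shift k (shift l (x A))) i)"
    unfolding R_lin R_sum by simp
   also have "(\<Sum>k<d. A k * R (shift k (shift l (x A))) i) = (\<Sum>k<d. A k * R (shift k x') i)"
    using shift_cong[of x' "shift l (x A)"] x' by simp
   finally have *: "R (shift l (w A)) i = N * R (z A l) i + (\<Sum>k<d. A k * R (shift k x') i)" .
   have "y (d + i) = T * R (z A l) i" using i by (simp add: l(2) R_def lin_def sum_distrib_left mult.assoc)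
   moreover have "(\<Sum>k<d. A k / N * R (shift k x') i) = (\<Sum>k<d. A k * R (shift k x') i) / N"
    by (simp add: sum_divide_distrib)
   ultimately show ?thesis unfolding * using N by (simp add: field_simps)
  qed
  hence "(\<Sum>i<d. (y (d + i) + T * (\<Sum>k<d. A k / N * R (shift k x') i))\<^sup>2) =
   (\<Sum>i<d. (T / N)\<^sup>2 * (R (shift l (w A)) i)\<^sup>2)" by (intro sum.cong refl) (simp only: lessThan_iff power_mult_distrib)
  also have "... = (T / N)\<^sup>2 * real_of_int (q (w A))"
   unfolding sum_distrib_left[symmetric] R_q q_shift ..
  finally show "(\<Sum>i<d. (R x' i)\<^sup>2) + (\<Sum>i<d. (y (d + i) + T * (\<Sum>k<d. A k / N * R (shift k x') i))\<^sup>2) <= r\<^sup>2"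
   using 1 xw(3)[OF A] by simp
 qed
qed

end

section \<open>A one-sided Mertens theorem\<close>

text \<open>As exp \<gamma> = 1.78107..., the margin is about 0.0004, which the bounds at 31 can
  resolve. There 32 is a power of 2, so its logarithm is a multiple of \<open>ln 2\<close>.\<close>

lemma ln_lt_euler_mascheroni: "ln 1.7804 < (euler_mascheroni :: real)"
proof -
 have "ln 2 <= (0.693148 :: real)"
  using ln_approx_bounds[of 2 5] by (simp add: eval_nat_numeral)
 moreover have "ln 1.7804 <= (0.57684 :: real)"
  using ln_approx_bounds[of "1.7804" 5] by (simp add: eval_nat_numeral)
 moreover have "euler_mascheroni >= harm 31 - ln (of_nat (Suc 31)) + inverse (of_nat (2 * (31 + 1)) :: real)"
  using euler_mascheroni_bounds[of 31] by auto
 moreover have "ln (of_nat (Suc 31)) = 5 * ln (2::real)"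
  using ln_realpow[of "2::real" 5] by simp
 moreover have "(harm 31 :: real) >= 4.02724"
  by (simp add: harm_expand)
 ultimately show ?thesis by simp
qed

text \<open>One half of Euler's product for finite sets: splitting off the power of one prime bounds
  the sum by a finite geometric series times a sum over numbers built from the remaining
  primes.\<close>

lemma smooth_sum_le_prod:
 fixes f :: "nat => real"
 assumes f: "!!k. 0 <= f k" "!!a b. f (a * b) = f a * f b" "f 1 = 1" "!!p. p : P ==> f p < 1"
  and P: "finite P" "!!p. p : P ==> prime p"
  and A: "finite A" "!!k. k : A ==> k > 0 & prime_factors k \<subseteq> P"
 shows "(\<Sum>k\<in>A. f k) <= (\<Prod>p\<in>P. 1 / (1 - f p))"
 using P A f(4)
proof (induction P arbitrary: A rule: finite_induct)
 case empty
 have "A \<subseteq> {1}"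
 proof
  fix k assume "k : A"
  hence "k > 0" "prime_factors k = {}" using empty.prems by auto
  thus "k : {1}" using prime_factorization_empty_iff[of k] by auto
 qed
 hence "(\<Sum>k\<in>A. f k) <= (\<Sum>k\<in>{1}. f k)" using f(1) by (intro sum_mono2) auto
 thus ?case using f(3) by simp
next
 case (insert p P)
 have p: "prime p" using insert.prems by auto
 have p1: "f p < 1" using insert.prems by auto
 have powf: "f (p ^ i) = f p ^ i" for i by (induction i) (simp_all add: f(2,3)[unfolded One_nat_def])
 define g where "g k = (multiplicity p k, k div p ^ multiplicity p k)" for k
 define I where "I = Suc (Max (insert 0 ((%k. multiplicity p k) ` A)))"
 define B where "B = snd ` g ` A"
 have dec: "k = p ^ fst (g k) * snd (g k)" for k by (simp add: g_def multiplicity_dvd)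
 have gA: "g ` A \<subseteq> {..<I} \<times> B"
 proof
  fix z assume "z : g ` A"
  then obtain k where k: "k : A" "z = g k" by auto
  have "multiplicity p k <= Max (insert 0 ((%k. multiplicity p k) ` A))"
   using k(1) insert.prems(2) by (intro Max_ge) auto
  hence "fst z < I" by (simp add: k(2) g_def I_def)
  moreover have "snd z : B" using k by (auto simp: B_def)
  ultimately show "z : {..<I} \<times> B" by (simp add: mem_Times_iff)
 qed
 have B: "k > 0 & prime_factors k \<subseteq> P" if kB: "k : B" for k
 proof -
  obtain a where a: "a : A" "k = snd (g a)" using kB by (auto simp: B_def)
  have a0: "a > 0" "prime_factors a \<subseteq> insert p P" using insert.prems(3)[OF a(1)] by auto
  have ak: "a = p ^ fst (g a) * k" using dec[of a] a(2) by simp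
  hence k0: "k > 0" using a0(1) by (metis mult_0_right neq0_conv)
  have "\<not> p dvd k"
  proof
   assume "p dvd k"
   hence "p ^ Suc (multiplicity p a) dvd a"
    using ak by (metis fst_conv g_def mult_dvd_mono dvd_refl power_Suc2)
   hence "Suc (multiplicity p a) <= multiplicity p a"
    using a0(1) prime_gt_1_nat[OF p] power_dvd_iff_le_multiplicity[where p = p and n = "Suc (multiplicity p a)" and x = a] by (auto simp del: power_Suc)
   thus False by simp
  qed
  moreover have "prime_factors k \<subseteq> prime_factors a"
   using ak a0(1) by (intro dvd_prime_factors) (auto intro: dvdI[of _ _ "p ^ fst (g a)"] simp: mult.commute)
  ultimately have "prime_factors k \<subseteq> P" using a0(2) by (auto simp: in_prime_factors_iff)
  thus ?thesis using k0 by simp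
 qed
 have finB: "finite B" using insert.prems(2) by (simp add: B_def)
 have inj: "inj_on g A"
 proof (rule inj_onI)
  fix a b assume "g a = g b" thus "a = b" using dec[of a] dec[of b] by simp
 qed
 have "(\<Sum>k\<in>A. f k) = (\<Sum>k\<in>A. f p ^ fst (g k) * f (snd (g k)))"
  by (intro sum.cong refl) (metis dec f(2) powf)
 also have "... = (\<Sum>z\<in>g ` A. f p ^ fst z * f (snd z))" using inj by (simp add: sum.reindex)
 also have "... <= (\<Sum>z\<in>{..<I} \<times> B. f p ^ fst z * f (snd z))"
  by (rule sum_mono2[OF _ gA]) (use finB f(1) in auto)
 also have "... = (\<Sum>i<I. f p ^ i) * (\<Sum>k\<in>B. f k)"
  unfolding sum_product sum.cartesian_product by (simp add: case_prod_beta)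
 also have "... <= 1 / (1 - f p) * (\<Prod>p\<in>P. 1 / (1 - f p))"
 proof (rule mult_mono)
  show "(\<Sum>k\<in>B. f k) <= (\<Prod>p\<in>P. 1 / (1 - f p))"
   by (rule insert.IH) (use B finB insert.prems in auto)
  have "(\<Sum>i<I. f p ^ i) = (1 - f p ^ I) / (1 - f p)" using p1 by (simp add: sum_gp_strict)
  also have "... <= 1 / (1 - f p)" using p1 f(1) by (intro divide_right_mono) auto
  finally show "(\<Sum>i<I. f p ^ i) <= 1 / (1 - f p)" .
 qed (use p1 f(1) in \<open>auto intro!: sum_nonneg\<close>)
 also have "... = (\<Prod>p\<in>insert p P. 1 / (1 - f p))" using insert.hyps by simp
 finally show ?case .
qed

text \<open>The left side is convex in \<open>t\<close> and 0 at \<open>t = 0\<close>. With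
  \<open>x = 1 / p\<close> and \<open>t = p powr - d\<close> this separates the weight in
  \<open>d\<close> from the term of \<open>prime_log_sum\<close>.\<close>

lemma neg_ln_one_minus_mult_le:
 fixes x t :: real
 assumes "0 <= x" "x < 1" "0 <= t" "t <= 1"
 shows "- ln (1 - x * t) <= t * (- ln (1 - x))"
proof -
 have pos: "0 < 1 - x" "0 < 1 - x * t"
  using assms mult_left_le[of t x] by auto
 have "convex_on {0<..} (%x. - ln x :: real)" using concave_on_def ln_concave by blast
 from convex_onD[OF this, of t 1 "1 - x"] assms pos
 have "- ln (1 - t + t * (1 - x)) <= t * (- ln (1 - x))" by simp
 moreover have "1 - t + t * (1 - x) = 1 - x * t" by (simp add: algebra_simps)
 ultimately show ?thesis by (simp only:)
qed

text \<open>Comparison of the zeta series at 1 + d with an integral, telescoped by the mean value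
  theorem.\<close>

lemma sum_powr_ge:
 fixes d :: real assumes "d > 0"
 shows "(1 - real (Suc K) powr - d) / d <= (\<Sum>k=1..K. real k powr - (1 + d))"
proof (induction K)
 case (Suc K)
 define x where "x = real (Suc K)"
 have x: "x > 0" by (simp add: x_def)
 have "EX z. x < z & z < x + 1 & (x + 1) powr - d - x powr - d = (x + 1 - x) * (- d * z powr (- d - 1))"
  using x by (intro MVT2) (auto intro!: derivative_eq_intros simp: field_simps powr_diff)
 then obtain z where z: "x < z" "(x + 1) powr - d - x powr - d = - d * z powr (- d - 1)" by auto
 have "z powr (- d - 1) <= x powr (- d - 1)" using z(1) x assms by (intro powr_mono2') auto
 hence "d * z powr (- d - 1) <= d * x powr (- d - 1)" using assms by simp
 hence "x powr - d - (x + 1) powr - d <= x powr (- d - 1) * d" using z(2) by (simp only: mult.commute)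
 moreover have "x powr - (1 + d) = x powr (- d - 1)" by (rule arg_cong) simp
 ultimately have "(x powr - d - (x + 1) powr - d) / d <= x powr - (1 + d)"
  by (simp only: pos_divide_le_eq[OF assms])
 hence "(1 - (x + 1) powr - d) / d <= (1 - x powr - d) / d + x powr - (1 + d)"
  by (simp add: diff_divide_distrib)
 also have "... <= (\<Sum>k=1..Suc K. real k powr - (1 + d))" using Suc by (simp add: x_def)
 finally show ?case by (simp add: x_def add.commute)
qed simp

text \<open>Logarithm of m / \<phi>(m) for the product \<open>m\<close> of the primes up to
  \<open>y\<close>.\<close>

definition prime_log_sum :: "nat => real" where
 "prime_log_sum y = (\<Sum>p | prime p & p <= y. - ln (1 - 1 / real p))"

lemma prime_log_sum_mono: "x <= y ==> prime_log_sum x <= prime_log_sum y"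
 unfolding prime_log_sum_def
proof (rule sum_mono2)
 show "finite {p. prime p & p <= y}" by (rule finite_subset[of _ "{..y}"]) auto
 fix p assume "p : {p. prime p & p <= y} - {p. prime p & p <= x}"
 hence "real p >= 2" using prime_ge_2_nat[of p] by simp
 thus "0 <= - ln (1 - 1 / real p)" by (simp add: field_simps)
qed auto

lemma prime_log_sum_Suc: "prime_log_sum (Suc k) = prime_log_sum k + (if prime (Suc k) then - ln (1 - 1 / real (Suc k)) else 0)"
proof -
 have fin: "finite {p. prime p & p <= k}" by (rule finite_subset[of _ "{..k}"]) auto
 have "{p. prime p & p <= Suc k} = (if prime (Suc k) then insert (Suc k) {p. prime p & p <= k} else {p. prime p & p <= k})"
  by (auto simp: le_Suc_eq)
 thus ?thesis using fin by (auto simp: prime_log_sum_def)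
qed

lemma prime_log_sum_abel:
 "(\<Sum>p | prime p & p <= K. g p * (- ln (1 - 1 / real p))) = prime_log_sum K * g K + (\<Sum>k<K. prime_log_sum k * (g k - g (Suc k)))"
proof (induction K)
 case 0
 show ?case by (simp add: prime_log_sum_def)
next
 case (Suc K)
 have fin: "finite {p. prime p & p <= K}" by (rule finite_subset[of _ "{..K}"]) auto
 have "{p. prime p & p <= Suc K} = (if prime (Suc K) then insert (Suc K) {p. prime p & p <= K} else {p. prime p & p <= K})"
  by (auto simp: le_Suc_eq)
 hence "(\<Sum>p | prime p & p <= Suc K. g p * (- ln (1 - 1 / real p))) =
   (\<Sum>p | prime p & p <= K. g p * (- ln (1 - 1 / real p))) + g (Suc K) * (prime_log_sum (Suc K) - prime_log_sum K)"
  using fin by (auto simp: prime_log_sum_Suc)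
 thus ?case using Suc by (simp add: algebra_simps)
qed

text \<open>Numbers up to \<open>K\<close> only have prime factors up to \<open>K\<close>, so the
  partial sum of zeta at 1 + d is below a partial Euler product; its logarithm is estimated by
  convexity.\<close>

lemma zeta_partial_le:
 fixes d :: real assumes "0 < d" and that: "K >= 1"
 shows "ln ((1 - real (Suc K) powr - d) / d) <= (\<Sum>p | prime p & p <= K. real p powr - d * (- ln (1 - 1 / real p)))"
proof -
 let ?P = "{p. prime p & p <= K}"
 have fin: "finite ?P" by (rule finite_subset[of _ "{..K}"]) auto
 have lt: "real p powr - (1 + d) < 1" "real p >= 2" if "p : ?P" for p
 proof -
  show "real p >= 2" using that prime_ge_2_nat[of p] by simp
  thus "real p powr - (1 + d) < 1" using assms by (intro powr_less_one) auto
 qed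
 have "(\<Sum>k\<in>{1..K}. real k powr - (1 + d)) <= (\<Prod>p\<in>?P. 1 / (1 - real p powr - (1 + d)))"
 proof (rule smooth_sum_le_prod[OF _ _ _ _ fin])
  show "k > 0 & prime_factors k \<subseteq> ?P" if "k : {1..K}" for k
   using that by (auto simp: in_prime_factors_iff intro: order_trans[OF dvd_imp_le])
 qed (use lt in \<open>auto simp: powr_mult\<close>)
 with sum_powr_ge[OF assms(1), of K] have le: "(1 - real (Suc K) powr - d) / d <= (\<Prod>p\<in>?P. 1 / (1 - real p powr - (1 + d)))"
  by simp
 have "real (Suc K) powr - d < 1" using assms that by (intro powr_less_one) auto
 hence "0 < (1 - real (Suc K) powr - d) / d" using assms by simp
 hence "ln ((1 - real (Suc K) powr - d) / d) <= ln (\<Prod>p\<in>?P. 1 / (1 - real p powr - (1 + d)))"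
  using le by (intro ln_mono) auto
 also have "... = (\<Sum>p\<in>?P. - ln (1 - 1 / real p * real p powr - d))"
 proof (subst ln_prod)
  show "(\<Sum>p\<in>?P. ln (1 / (1 - real p powr - (1 + d)))) = (\<Sum>p\<in>?P. - ln (1 - 1 / real p * real p powr - d))"
  proof (rule sum.cong[OF refl])
   fix p assume p: "p : ?P"
   hence "real p powr - (1 + d) = 1 / real p * real p powr - d"
    using powr_add[of "real p" "- 1" "- d"] powr_neg_one[of "real p"] lt(2)[OF p] by simp
   thus "ln (1 / (1 - real p powr - (1 + d))) = - ln (1 - 1 / real p * real p powr - d)"
    using lt[OF p] by (simp add: ln_div)
  qed
 next
  fix p assume "p : ?P"
  from lt(1)[OF this] show "1 / (1 - real p powr - (1 + d)) ~= 0" by simp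
 qed (rule fin)
 also have "... <= (\<Sum>p\<in>?P. real p powr - d * (- ln (1 - 1 / real p)))"
 proof (rule sum_mono)
  fix p assume p: "p : ?P"
  show "- ln (1 - 1 / real p * real p powr - d) <= real p powr - d * (- ln (1 - 1 / real p))"
   using lt(2)[OF p] assms(1) powr_less_one[of "real p" "- d"] by (intro neg_ln_one_minus_mult_le) auto
 qed
 finally show ?thesis .
qed


text \<open>In the variable t = d ln k the differences are integrals of exp (-t), and t powr h is
  replaced by its value at the left end, so this is a lower sum for the Gamma integral.\<close>

lemma weighted_sum_le_Gamma:
 fixes d h :: real
 assumes d: "0 < d" and h: "0 < h" and Y: "1 <= Y"
 shows "(\<Sum>k\<in>{Suc Y..<K}. (real k powr - d - real (Suc k) powr - d) * (d * ln (real k)) powr h) <= Gamma (1 + h)"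
proof -
 define \<phi> where "\<phi> t = t powr (1 + h - 1) / exp t" for t :: real
 define a where "a k = d * ln (real k)" for k :: nat
 have G: "(\<phi> has_integral Gamma (1 + h)) {0..}" unfolding \<phi>_def by (rule Gamma_integral_real) (use h in simp)
 have \<phi>0: "0 <= \<phi> t" for t by (simp add: \<phi>_def)
 have a0: "0 <= a k" "a k <= a (Suc k)" if "k >= 1" for k
  using that d by (simp_all add: a_def)
 have int: "\<phi> integrable_on {x..y}" if "0 <= x" for x y
  using G that by (intro integrable_on_subinterval[of \<phi> "{0..}"]) (auto simp: has_integral_integrable)
 have stepk: "(real k powr - d - real (Suc k) powr - d) * a k powr h <= integral {a k..a (Suc k)} \<phi>" if k: "k >= 1" for k
 proof -
  have "((%t. exp (- t)) has_integral (- exp (- a (Suc k)) - (- exp (- a k)))) {a k..a (Suc k)}"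
   by (rule fundamental_theorem_of_calculus)
    (use a0[OF k] in \<open>auto intro!: derivative_eq_intros simp flip: has_real_derivative_iff_has_vector_derivative\<close>)
  hence I: "((%t. a k powr h * exp (- t)) has_integral a k powr h * (exp (- a k) - exp (- a (Suc k)))) {a k..a (Suc k)}"
   using has_integral_mult_right[of "%t. exp (- t)" _ _ "a k powr h"] by simp
  have "a k powr h * (exp (- a k) - exp (- a (Suc k))) = integral {a k..a (Suc k)} (%t. a k powr h * exp (- t))"
   using I by (rule integral_unique[symmetric])
  also have "... <= integral {a k..a (Suc k)} \<phi>"
  proof (rule integral_le)
   show "(%t. a k powr h * exp (- t)) integrable_on {a k..a (Suc k)}" using I by (rule has_integral_integrable)
   show "\<phi> integrable_on {a k..a (Suc k)}" by (rule int) (rule a0[OF k])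
   fix t assume t: "t : {a k..a (Suc k)}"
   hence "a k powr h <= t powr h" using a0[OF k] h by (intro powr_mono2) auto
   thus "a k powr h * exp (- t) <= \<phi> t" by (simp add: \<phi>_def exp_minus divide_inverse)
  qed
  finally show ?thesis using k by (simp add: a_def powr_def mult.commute)
 qed
 have sum: "(\<Sum>k\<in>{Suc Y..<K}. (real k powr - d - real (Suc k) powr - d) * a k powr h) <= integral {a (Suc Y)..a K} \<phi>"
  if "Suc Y <= K" for K
  using that
 proof (induction K rule: dec_induct)
  case (step K)
  have mono: "a (Suc Y) <= a K" using step.hyps d by (simp add: a_def)
  have "{Suc Y..<Suc K} = insert K {Suc Y..<K}" using step.hyps by auto
  hence "(\<Sum>k\<in>{Suc Y..<Suc K}. (real k powr - d - real (Suc k) powr - d) * a k powr h) \<le>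
   integral {a (Suc Y)..a K} \<phi> + integral {a K..a (Suc K)} \<phi>"
   using step.IH stepk[of K] step.hyps Y by simp
  also have "... = integral {a (Suc Y)..a (Suc K)} \<phi>"
   by (rule Henstock_Kurzweil_Integration.integral_combine[OF mono]) (use a0[of K] a0[of "Suc Y"] step.hyps Y int in auto)
  finally show ?case .
 qed simp
 show ?thesis
 proof (cases "Suc Y <= K")
  case True
  have "integral {a (Suc Y)..a K} \<phi> <= integral {0..} \<phi>"
   using int G \<phi>0 a0(1)[of "Suc Y"] by (intro integral_subset_le) (auto simp: has_integral_integrable)
  thus ?thesis using sum[OF True] G by (simp add: integral_unique a_def)
 next
  case False
  thus ?thesis using Gamma_real_pos[of "1 + h"] h by simp
 qed
qed

lemma ln_le_powr_minus_one:
 fixes x h :: real assumes "0 < x" "0 < h"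
 shows "ln x <= (x powr h - 1) / h"
proof -
 have "ln (x powr h) <= x powr h - 1" using assms by (intro ln_le_minus_one) auto
 thus ?thesis using assms by (simp add: ln_powr field_simps)
qed

text \<open>Abel summation turns the logarithm of a partial zeta sum into a weighted sum of
  \<open>prime_log_sum\<close>. Up to \<open>Y\<close> monotonicity is enough. Beyond
  \<open>Y\<close> the assumed bound is ln (1 / d) + ln (d ln k) + C, and its middle term is
  majorised by a power with exponent \<open>h\<close>, so that a value of Gamma appears in place of
  a logarithmic integral.\<close>

lemma mertens_partial:
 fixes c d h :: real
 assumes Y: "Y >= 2" and F: "!!k. k > Y ==> prime_log_sum k <= ln (ln (real k)) + C"
  and d: "0 < d" and h: "0 < h" and K: "K > Y"
 defines "S \<equiv> real (Suc Y) powr - d - real K powr - d"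
 shows "ln ((1 - real (Suc K) powr - d) / d) <= (ln (ln (real K)) + C) * real K powr - d +
  prime_log_sum Y * (1 - real (Suc Y) powr - d) + S * C + (Gamma (1 + h) - S) / h + ln (1 / d) * S"
proof -
 define g where "g k = real k powr - d" for k :: nat
 have g: "0 <= g k - g (Suc k)" if "k >= 1" for k
  using that d by (simp add: g_def powr_mono2')
 have F01: "prime_log_sum 0 = 0" by (simp add: prime_log_sum_def)
 have tele: "(\<Sum>k\<in>{a..<b}. g k - g (Suc k)) = g a - g b" if "a <= b" for a b
  using sum_Suc_diff'[OF that, of "%k. - g k"] by simp
 have "(\<Sum>k<Suc Y. prime_log_sum k * (g k - g (Suc k))) = (\<Sum>k\<in>{1..<Suc Y}. prime_log_sum k * (g k - g (Suc k)))"
  by (rule sum.mono_neutral_right) (use F01 in \<open>auto simp: not_less_eq_eq\<close>)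
 also have "... <= (\<Sum>k\<in>{1..<Suc Y}. prime_log_sum Y * (g k - g (Suc k)))"
  using g prime_log_sum_mono by (intro sum_mono mult_right_mono) auto
 also have "... = prime_log_sum Y * (1 - g (Suc Y))"
  unfolding sum_distrib_left[symmetric] using tele[of 1 "Suc Y"] by (simp add: g_def)
 finally have part1: "(\<Sum>k<Suc Y. prime_log_sum k * (g k - g (Suc k))) <= prime_log_sum Y * (1 - g (Suc Y))" .
 have SS: "(\<Sum>k\<in>{Suc Y..<K}. g k - g (Suc k)) = S" using tele[of "Suc Y" K] K by (simp add: S_def g_def)
 have "(\<Sum>k\<in>{Suc Y..<K}. prime_log_sum k * (g k - g (Suc k))) \<le>
  (\<Sum>k\<in>{Suc Y..<K}. (g k - g (Suc k)) * (d * ln (real k)) powr h / h + (g k - g (Suc k)) * (C + ln (1 / d) - 1 / h))"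
 proof (rule sum_mono)
  fix k assume k: "k : {Suc Y..<K}"
  hence lk: "ln (real k) > 0" using Y by simp
  have "ln (d * ln (real k)) <= ((d * ln (real k)) powr h - 1) / h"
   by (rule ln_le_powr_minus_one) (use d h lk in auto)
  hence "prime_log_sum k <= ((d * ln (real k)) powr h - 1) / h + ln (1 / d) + C"
   using F[of k] k d lk by (simp add: ln_mult ln_div)
  hence "prime_log_sum k * (g k - g (Suc k)) <= (((d * ln (real k)) powr h - 1) / h + ln (1 / d) + C) * (g k - g (Suc k))"
   using g[of k] k by (intro mult_right_mono) auto
  also have "... = (g k - g (Suc k)) * (d * ln (real k)) powr h / h + (g k - g (Suc k)) * (C + ln (1 / d) - 1 / h)"
   by (simp add: algebra_simps diff_divide_distrib)
  finally show "prime_log_sum k * (g k - g (Suc k)) <= (g k - g (Suc k)) * (d * ln (real k)) powr h / h + (g k - g (Suc k)) * (C + ln (1 / d) - 1 / h)" .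
 qed
 also have "... = (\<Sum>k\<in>{Suc Y..<K}. (g k - g (Suc k)) * (d * ln (real k)) powr h) / h + S * (C + ln (1 / d) - 1 / h)"
  by (simp only: sum.distrib sum_divide_distrib sum_distrib_right[symmetric] SS)
 also have "... <= Gamma (1 + h) / h + S * (C + ln (1 / d) - 1 / h)"
  using weighted_sum_le_Gamma[OF d h, of Y K] Y h by (intro add_right_mono divide_right_mono) (auto simp: g_def)
 finally have part2: "(\<Sum>k\<in>{Suc Y..<K}. prime_log_sum k * (g k - g (Suc k))) <= Gamma (1 + h) / h + S * (C + ln (1 / d) - 1 / h)" .
 have U: "{..<K} = {..<Suc Y} \<union> {Suc Y..<K}" using K by auto
 have split: "(\<Sum>k<K. prime_log_sum k * (g k - g (Suc k))) =
  (\<Sum>k<Suc Y. prime_log_sum k * (g k - g (Suc k))) + (\<Sum>k\<in>{Suc Y..<K}. prime_log_sum k * (g k - g (Suc k)))"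
  unfolding U by (rule sum.union_disjoint) auto
 have "prime_log_sum K * g K <= (ln (ln (real K)) + C) * g K" using F[OF K] by (intro mult_right_mono) (auto simp: g_def)
 moreover have "ln ((1 - real (Suc K) powr - d) / d) <= prime_log_sum K * g K + (\<Sum>k<K. prime_log_sum k * (g k - g (Suc k)))"
  using zeta_partial_le[OF d, of K] K prime_log_sum_abel[of g K] by (simp add: g_def)
 ultimately have "ln ((1 - real (Suc K) powr - d) / d) <= (ln (ln (real K)) + C) * g K +
   (prime_log_sum Y * (1 - g (Suc Y)) + (Gamma (1 + h) / h + S * (C + ln (1 / d) - 1 / h)))"
  using part1 part2 split by linarith
 thus ?thesis by (simp add: g_def algebra_simps diff_divide_distrib)
qed

text \<open>Limits in the order K to infinity, d to 0, h to 0. The terms ln (1 / d) drop out after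
  the first, the contribution of \<open>Y\<close> in the second, and the third is the derivative of
  Gamma at 1, which is - \<gamma>.\<close>

lemma mertens_limit:
 assumes Y: "Y >= 2" and F: "!!k. k > Y ==> prime_log_sum k <= ln (ln (real k)) + C"
 shows "euler_mascheroni <= C"
proof -
 have 1: "0 <= prime_log_sum Y * (1 - real (Suc Y) powr - d) + real (Suc Y) powr - d * C + (Gamma (1 + h) - real (Suc Y) powr - d) / h"
  if d: "0 < d" "d < 1" and h: "0 < h" for d h
 proof -
  define s where "s = real (Suc Y) powr - d"
  have s: "s <= 1" unfolding s_def using d Y powr_less_one[of "real (Suc Y)" "- d"] by simp
  have "ln (1 / d) <= 0 + prime_log_sum Y * (1 - s) + (s - 0) * C + (Gamma (1 + h) - (s - 0)) / h + ln (1 / d) * (s - 0)"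
  proof (rule tendsto_le[OF sequentially_bot])
   have p0: "(%K. real K powr - d) \<longlonglongrightarrow> 0" using d by real_asymp
   have p1: "(%K. real (Suc K) powr - d) \<longlonglongrightarrow> 0" using d by real_asymp
   have p2: "(%K. (ln (ln (real K)) + C) * real K powr - d) \<longlonglongrightarrow> 0" using d by real_asymp
   have "(%K. ln ((1 - real (Suc K) powr - d) / d)) \<longlonglongrightarrow> ln ((1 - 0) / d)"
    using d by (intro tendsto_intros p1) auto
   thus "(%K. ln ((1 - real (Suc K) powr - d) / d)) \<longlonglongrightarrow> ln (1 / d)" by simp
   show "(%K. (ln (ln (real K)) + C) * real K powr - d + prime_log_sum Y * (1 - s) + (s - real K powr - d) * C +
     (Gamma (1 + h) - (s - real K powr - d)) / h + ln (1 / d) * (s - real K powr - d)) \<longlonglongrightarrow>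
     0 + prime_log_sum Y * (1 - s) + (s - 0) * C + (Gamma (1 + h) - (s - 0)) / h + ln (1 / d) * (s - 0)"
    using h by (intro tendsto_intros p0 p2) auto
   show "\<forall>\<^sub>F K in sequentially. ln ((1 - real (Suc K) powr - d) / d) <= (ln (ln (real K)) + C) * real K powr - d + prime_log_sum Y * (1 - s) + (s - real K powr - d) * C +
     (Gamma (1 + h) - (s - real K powr - d)) / h + ln (1 / d) * (s - real K powr - d)"
    using eventually_gt_at_top[of Y]
    by eventually_elim (use mertens_partial[OF Y F d(1) h] in \<open>simp add: s_def\<close>)
  qed
  moreover have "ln (1 / d) * s <= ln (1 / d)" using s d mult_left_mono[of s 1 "ln (1 / d)"] by (simp add: ln_div)
  ultimately show ?thesis unfolding s_def[symmetric] by (simp add: mult.commute[of s])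
 qed
 have 2: "0 <= C + (Gamma (1 + h) - 1) / h" if h: "0 < h" for h
 proof (rule tendsto_lowerbound)
  show "((%d. prime_log_sum Y * (1 - real (Suc Y) powr - d) + real (Suc Y) powr - d * C + (Gamma (1 + h) - real (Suc Y) powr - d) / h)
   \<longlongrightarrow> C + (Gamma (1 + h) - 1) / h) (at_right 0)"
  proof -
   have "((%d. real (Suc Y) powr - d) \<longlongrightarrow> real (Suc Y) powr - 0) (at_right (0::real))" by (intro tendsto_intros) auto
   hence p: "((%d. real (Suc Y) powr - d) \<longlongrightarrow> 1) (at_right (0::real))" by simp
   have "((%d. prime_log_sum Y * (1 - real (Suc Y) powr - d) + real (Suc Y) powr - d * C + (Gamma (1 + h) - real (Suc Y) powr - d) / h)
    \<longlongrightarrow> prime_log_sum Y * (1 - 1) + 1 * C + (Gamma (1 + h) - 1) / h) (at_right 0)"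
    using h by (intro tendsto_intros p) auto
   thus ?thesis by simp
  qed
  show "\<forall>\<^sub>F d in at_right 0. 0 <= prime_log_sum Y * (1 - real (Suc Y) powr - d) + real (Suc Y) powr - d * C + (Gamma (1 + h) - real (Suc Y) powr - d) / h"
   unfolding eventually_at_right_field using 1[OF _ _ h] by (intro exI[of _ 1]) auto
 qed simp
 have "0 <= C + - euler_mascheroni"
 proof (rule tendsto_lowerbound)
  have "(Gamma has_field_derivative Gamma 1 * Digamma 1) (at (1::real))" by (rule has_field_derivative_Gamma) auto
  hence "((%h. (Gamma (1 + h) - 1) / h) \<longlongrightarrow> - euler_mascheroni) (at (0::real))" by (simp add: DERIV_def)
  hence "((%h. (Gamma (1 + h) - 1) / h) \<longlongrightarrow> - euler_mascheroni) (at_right (0::real))"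
   by (rule filterlim_mono) (auto intro: at_le)
  thus "((%h. C + (Gamma (1 + h) - 1) / h) \<longlongrightarrow> C + - euler_mascheroni) (at_right (0::real))"
   by (intro tendsto_intros)
  show "\<forall>\<^sub>F h in at_right 0. 0 <= C + (Gamma (1 + h) - 1) / h"
   unfolding eventually_at_right_field using 2 by (intro exI[of _ 1]) auto
 qed simp
 thus ?thesis by simp
qed

text \<open>Otherwise \<open>mertens_limit\<close> would apply with a constant below
  \<gamma>.\<close>

theorem mertens_lower: "EX y>Y. ln (ln (real y)) + ln 1.7804 < prime_log_sum y"
proof (rule ccontr)
 assume "\<not> (EX y>Y. ln (ln (real y)) + ln 1.7804 < prime_log_sum y)"
 hence "prime_log_sum k <= ln (ln (real k)) + ln 1.7804" if "k > max Y 2" for k using that by force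
 hence "(euler_mascheroni :: real) <= ln 1.7804" by (intro mertens_limit[of "max Y 2"]) auto
 thus False using ln_lt_euler_mascheroni by simp
qed

section \<open>Squarefree moduli: totients, numbers of prime factors, good examples\<close>

lemma fact_card_le_prod:
 assumes "finite T" "!!x::nat. x : T ==> x > 0"
 shows "fact (card T) <= (\<Prod>x\<in>T. x)"
 using assms
proof (induction T rule: finite_linorder_max_induct)
 case (insert b A)
 have "A \<subseteq> {1..<b}" using insert.prems insert.hyps(2) by force
 hence "card A <= b - 1" using card_mono[of "{1..<b}" A] by simp
 moreover have "b > 0" using insert.prems by simp
 ultimately have cb: "Suc (card A) <= b" by simp
 have "b \<notin> A" using insert.hyps(2) by blast
 hence "fact (card (insert b A)) = Suc (card A) * fact (card A)" using insert.hyps(1) by simp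
 also have "... <= b * (\<Prod>x\<in>A. x)" by (intro mult_mono cb insert.IH) (use insert.prems in auto)
 also have "... = (\<Prod>x\<in>insert b A. x)" using insert.hyps(1) \<open>b \<notin> A\<close> by simp
 finally show ?case .
qed simp

lemma power_div_fact_le_exp:
 fixes x :: real assumes "0 <= x" shows "x ^ k <= exp x * fact k"
proof -
 have "(\<Sum>i\<in>{k}. x ^ i / fact i) <= (\<Sum>i. x ^ i / fact i)"
  by (rule sum_le_suminf) (use summable_exp[of x] assms in \<open>auto simp: divide_inverse mult.commute\<close>)
 also have "... = exp x" by (simp add: exp_def divide_inverse mult.commute)
 finally show ?thesis by (simp add: field_simps)
qed

lemma squarefree_eq_prod:
 assumes "squarefree (m::nat)" shows "(\<Prod>p\<in>prime_factors m. p) = m"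
proof -
 have m: "m ~= 0" using assms not_squarefree_0 by metis
 have "(\<Prod>p\<in>prime_factors m. p) = (\<Prod>p\<in>prime_factors m. p ^ multiplicity p m)"
  using squarefree_factorial_semiring'[OF m] assms by (intro prod.cong) auto
 also have "... = m" using prime_factorization_nat[of m] m by simp
 finally show ?thesis .
qed

lemma totient_squarefree:
 assumes "squarefree (m::nat)" shows "totient m = (\<Prod>p\<in>prime_factors m. p - 1)"
proof -
 have "real (totient m) = real (\<Prod>p\<in>prime_factors m. p) * (\<Prod>p\<in>prime_factors m. 1 - 1 / real p)"
  using totient_formula2[of m] squarefree_eq_prod[OF assms] by simp
 also have "... = (\<Prod>p\<in>prime_factors m. real (p - 1))"
  unfolding of_nat_prod prod.distrib[symmetric]
 proof (rule prod.cong[OF refl])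
  fix p assume "p : prime_factors m"
  hence "p >= 1" using prime_ge_1_nat by auto
  thus "real p * (1 - 1 / real p) = real (p - 1)" by (simp add: of_nat_diff right_diff_distrib)
 qed
 finally show ?thesis by (simp flip: of_nat_prod)
qed

text \<open>The numbers \<open>p - 1\<close> are distinct and positive, and their product is the
  totient.\<close>

lemma fact_omega_le:
 assumes "squarefree (m::nat)" shows "fact (card (prime_factors m)) <= totient m"
proof -
 have p: "p >= 2" if "p : prime_factors m" for p using that prime_ge_2_nat by auto
 have inj: "inj_on (%p. p - 1) (prime_factors m)"
 proof (rule inj_onI)
  fix a b assume "a : prime_factors m" "b : prime_factors m" "a - 1 = b - 1"
  thus "a = b" using p[of a] p[of b] by linarith
 qed
 have "fact (card ((%p. p - 1) ` prime_factors m)) <= (\<Prod>x\<in>(%p. p - 1) ` prime_factors m. x)"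
  by (rule fact_card_le_prod) (use p in force)+
 thus ?thesis using inj by (simp add: card_image prod.reindex totient_squarefree[OF assms])
qed

text \<open>An elementary substitute for the maximal order of the number of prime factors: since
  \<open>a\<close> is arbitrary, 2 to that number is at most a constant times any fixed positive
  power of the totient.\<close>

lemma omega_bound:
 assumes "squarefree (m::nat)" "a >= (0::real)"
 shows "a ^ card (prime_factors m) <= exp a * totient m"
proof -
 have "a ^ card (prime_factors m) <= exp a * fact (card (prime_factors m))" using assms(2) by (rule power_div_fact_le_exp)
 also have "... <= exp a * totient m"
 proof (rule mult_left_mono)
  have "real (fact (card (prime_factors m))) <= real (totient m)" using fact_omega_le[OF assms(1)] by (simp only: of_nat_le_iff)
  thus "fact (card (prime_factors m)) <= real (totient m)" by (simp only: of_nat_fact)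
 qed simp
 finally show ?thesis .
qed

text \<open>An odd prime satisfies \<open>p <= (p - 1)\<^sup>2\<close>, and the prime 2 costs one
  factor 2. This limits the search for \<open>m\<close> to \<open>n * n\<close>, with
  \<open>n\<close> twice the totient.\<close>

lemma squarefree_le_totient:
 assumes "squarefree (m::nat)" shows "m <= 4 * (totient m)\<^sup>2"
proof -
 have "m = (\<Prod>p\<in>prime_factors m. p)" using squarefree_eq_prod[OF assms] by simp
 also have "... <= (\<Prod>p\<in>prime_factors m. (if p = 2 then 2 else 1) * (p - 1)\<^sup>2)"
 proof (rule prod_mono)
  fix p assume "p : prime_factors m"
  hence p2: "p >= 2" using prime_ge_2_nat by auto
  show "0 <= p & p <= (if p = 2 then 2 else 1) * (p - 1)\<^sup>2"
  proof (cases "p = 2")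
   case False
   hence "3 <= p" using p2 by linarith
   then obtain k where "p = 3 + k" using le_Suc_ex by blast
   thus ?thesis by (simp add: power2_eq_square)
  qed simp
 qed
 also have "... = (\<Prod>p\<in>prime_factors m. if p = 2 then 2 else 1) * (totient m)\<^sup>2"
  by (simp add: prod.distrib totient_squarefree[OF assms] prod_power_distrib)
 also have "(\<Prod>p\<in>prime_factors m. if p = 2 then 2 else 1) <= (4::nat)"
 proof (cases "2 : prime_factors m")
  case True
  hence "(\<Prod>p\<in>prime_factors m. if p = 2 then 2 else (1::nat)) = 2" by (subst prod.remove[of _ 2]) (auto intro!: prod.neutral)
  thus ?thesis by simp
 next
  case False
  hence "(\<Prod>p\<in>prime_factors m. if p = 2 then 2 else (1::nat)) = 1" by (intro prod.neutral) auto
  thus ?thesis by simp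
 qed
 finally show ?thesis by simp
qed

text \<open>Take the product of the primes up to some \<open>y\<close> from
  \<open>mertens_lower\<close>. As \<open>m <= y ^ y\<close>, the double logarithm of
  \<open>2 * t\<close> exceeds \<open>ln y\<close> by a vanishing proportion at most, which the gap
  between 1.7804 and 1.7802 = 2 * 0.8901 absorbs.\<close>

lemma many_good_moduli:
 "EX m::nat. squarefree m & m > 1 & 2 * totient m > B &
   0.8901 * real (2 * totient m) * ln (ln (real (2 * totient m))) <= m"
proof -
 \<comment> \<open>A prime factor of this size forces twice the totient above \<open>B\<close>, by
   \<open>squarefree_le_totient\<close>.\<close>
 obtain q where q: "prime q" "q > B\<^sup>2 + 3" using bigger_prime by blast
 have "eventually (%y::nat. 1.7802 * ln ((real y + 1) * ln (real y)) <= 1.7804 * ln (real y)) at_top" by real_asymp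
 then obtain Y0 where Y0: "!!y. y >= Y0 ==> 1.7802 * ln ((real y + 1) * ln (real y)) <= 1.7804 * ln (real y)"
  unfolding eventually_at_top_linorder by blast
 obtain y where y: "y > max Y0 q" "ln (ln (real y)) + ln 1.7804 < prime_log_sum y" using mertens_lower by blast
 define S where "S = {p. prime p & p <= y}"
 have fin: "finite S" unfolding S_def by (rule finite_subset[of _ "{..y}"]) auto
 define m where "m = (\<Prod>p\<in>S. p)"
 have pS: "prime p" if "p : S" for p using that by (simp add: S_def)
 have sq: "squarefree m" unfolding m_def
  by (rule squarefree_prod_coprime) (use pS in \<open>auto intro: squarefree_prime primes_coprime\<close>)
 have m0: "m > 0" unfolding m_def using pS by (intro prod_pos) (auto intro: prime_gt_0_nat)
 have pf: "prime_factors m = S"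
 proof -
  have "p dvd m \<longleftrightarrow> p : S" if pp: "prime p" for p
  proof
   assume "p dvd m"
   then obtain q where "q : S" "p dvd q" using pp fin unfolding m_def by (auto simp: prime_dvd_prod_iff)
   thus "p : S" using pp pS primes_dvd_imp_eq by blast
  next
   assume "p : S" thus "p dvd m" unfolding m_def using fin by (rule dvd_prodI[rotated])
  qed
  thus ?thesis using m0 pS by (auto simp: in_prime_factors_iff)
 qed
 define t where "t = totient m"
 have t0: "t > 0" using m0 by (simp add: t_def)
 have tm: "t <= m" unfolding t_def by (rule totient_le)
 have "q : S" using q y(1) by (simp add: S_def)
 hence "q dvd m" unfolding m_def using fin by (rule dvd_prodI[rotated])
 hence qm: "q <= m" using m0 by (simp add: dvd_imp_le)
 have nB: "2 * t > B"
 proof -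
  have "B\<^sup>2 < (2 * t)\<^sup>2" using qm q(2) squarefree_le_totient[OF sq] by (simp add: t_def power_mult_distrib)
  thus ?thesis by (rule power2_less_imp_less) simp
 qed
 have y4: "y >= 4" using y(1) q(2) by simp
 have ly: "ln (real y) > 1"
 proof -
  have "exp 1 < real y" using exp_le y4 by linarith
  hence "ln (exp 1) < ln (real y)" using y4 by (subst ln_less_cancel_iff) auto
  thus ?thesis by simp
 qed
 have ratio: "1.7804 * ln (real y) * t <= m"
 proof -
  have P: "(\<Prod>p\<in>S. 1 - 1 / real p) > 0"
  proof (rule prod_pos)
   fix p assume "p : S"
   hence "real p >= 2" using pS prime_ge_2_nat by fastforce
   thus "0 < 1 - 1 / real p" by (simp add: field_simps)
  qed
  have "exp (prime_log_sum y) = (\<Prod>p\<in>S. exp (- ln (1 - 1 / real p)))" unfolding prime_log_sum_def S_def[symmetric] by (rule exp_sum[OF fin])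
  also have "... = (\<Prod>p\<in>S. inverse (1 - 1 / real p))"
  proof (rule prod.cong[OF refl])
   fix p assume "p : S"
   hence "real p >= 2" using pS prime_ge_2_nat by fastforce
   thus "exp (- ln (1 - 1 / real p)) = inverse (1 - 1 / real p)" by (simp add: exp_minus field_simps)
  qed
  also have "... = inverse (\<Prod>p\<in>S. 1 - 1 / real p)" by (simp add: prod_inversef[symmetric])
  finally have "real m = exp (prime_log_sum y) * t"
   using totient_formula2[of m] P by (simp add: pf t_def)
  moreover have "1.7804 * ln (real y) <= exp (prime_log_sum y)"
  proof -
   have "exp (ln (ln (real y)) + ln 1.7804) <= exp (prime_log_sum y)" using y(2) by simp
   thus ?thesis using ly by (simp add: exp_add)
  qed
  ultimately show ?thesis using t0 by simp
 qed
 have "m <= y ^ y"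
 proof -
  have "m <= (\<Prod>p\<in>S. y)" unfolding m_def by (rule prod_mono) (simp add: S_def)
  also have "... = y ^ card S" by simp
  also have "... <= y ^ y"
  proof (rule power_increasing)
   have "S \<subseteq> {1..y}" using pS prime_ge_1_nat by (auto simp: S_def)
   thus "card S <= y" using card_mono[of "{1..y}" S] by simp
  qed (use y4 in simp)
  finally show ?thesis .
 qed
 hence "2 * t <= y * y ^ y" using tm y4 by (intro mult_mono) auto
 hence "real (2 * t) <= real y ^ Suc y" by (metis of_nat_le_iff of_nat_power power_Suc)
 hence "ln (real (2 * t)) <= ln (real y ^ Suc y)" using t0 y4 by (subst ln_le_cancel_iff) auto
 also have "... = (real y + 1) * ln (real y)" using y4 by (subst ln_realpow) (auto simp: algebra_simps)
 finally have ln2: "ln (real (2 * t)) <= (real y + 1) * ln (real y)" .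
 have "1.7802 * ln (ln (real (2 * t))) <= 1.7804 * ln (real y)"
 proof (cases "ln (real (2 * t)) > 0")
  case True
  hence "ln (ln (real (2 * t))) <= ln ((real y + 1) * ln (real y))" using ln2 by (subst ln_le_cancel_iff) auto
  moreover have "Y0 <= y" using y(1) by simp
  from Y0[OF this] have "1.7802 * ln ((real y + 1) * ln (real y)) <= 1.7804 * ln (real y)" .
  ultimately show ?thesis using mult_left_mono[of "ln (ln (real (2 * t)))" "ln ((real y + 1) * ln (real y))" "1.7802"]
   by (meson order_trans divide_nonneg_nonneg zero_le_numeral zero_le_power)
 next
  case False
  hence "ln (real (2 * t)) = 0" using t0 by simp
  thus ?thesis using ly by simp
 qed
 hence "1.7802 * ln (ln (real (2 * t))) * t <= m" using ratio t0 by (meson mult_right_mono of_nat_0_le_iff order_trans)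
 hence "0.8901 * real (2 * t) * ln (ln (real (2 * t))) <= m" by (simp add: algebra_simps)
 thus ?thesis using sq nB qm q(2) unfolding t_def by (intro exI[of _ m]) auto
qed

section \<open>Verified programs on bit stacks\<close>

lemma bits_0: "bits 0 = []"
 by (simp add: bits.simps)

lemma bits_pos: "n > 0 ==> bits n = odd n # bits (n div 2)"
 by (simp add: bits.simps[of n])

lemma bits_eq_Nil_iff [simp]: "bits n = [] \<longleftrightarrow> n = 0"
 by (auto simp: bits.simps[of n])

lemma tl_bits: "tl (bits n) = bits (n div 2)"
 by (cases "n = 0") (auto simp: bits_pos bits_0)

lemma length_bits_le: "n < 2 ^ k ==> length (bits n) <= k"
proof (induction k arbitrary: n)
 case (Suc k)
 hence "n div 2 < 2 ^ k" by auto
 with Suc.IH[of "n div 2"] show ?case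
  by (cases "n = 0") (auto simp: bits_pos bits_0)
qed (simp add: bits_0)

fun inc_bits :: "bool list => bool list" where
 "inc_bits [] = [True]"
| "inc_bits (False # xs) = True # xs"
| "inc_bits (True # xs) = False # inc_bits xs"

lemma bits_Suc: "bits (Suc n) = inc_bits (bits n)"
proof (induction n rule: less_induct)
 case (less n)
 show ?case
 proof (cases "n = 0")
  case False
  show ?thesis
  proof (cases "even n")
   case True
   thus ?thesis using False by (simp add: bits_pos)
  next
   case odd: False
   hence "Suc n div 2 = Suc (n div 2)" by presburger
   thus ?thesis using odd False less.IH[of "n div 2"] by (simp add: bits_pos)
  qed
 qed (simp add: bits_pos bits_0)
qed

fun dec_bits :: "bool list => bool list" where
 "dec_bits [] = []"
| "dec_bits (True # xs) = (if xs = [] then [] else False # xs)"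
| "dec_bits (False # xs) = True # dec_bits xs"

lemma bits_pred: "n > 0 ==> bits (n - 1) = dec_bits (bits n)"
proof (induction n rule: less_induct)
 case (less n)
 show ?case
 proof (cases "even n")
  case True
  hence "n >= 2" "(n - 1) div 2 = n div 2 - 1" "odd (n - 1)" using less.prems by presburger+
  thus ?thesis using True less.IH[of "n div 2"] by (simp add: bits_pos)
 next
  case False
  hence "(n - 1) div 2 = n div 2" "even (n - 1)" "n = 1 \<or> n > 1" using less.prems by presburger+
  thus ?thesis using False by (auto simp: bits_pos bits_0)
 qed
qed

lemma True_in_bits: "n > 0 ==> True : set (bits n)"
proof (induction n rule: less_induct)
 case (less n)
 hence "odd n \<or> 0 < n div 2" by presburger
 thus ?case using less by (auto simp: bits_pos)
qed

lemma exec_while_count: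
 assumes "!!i. i < k ==> holds c (S i) & (EX t. exec P (S i) t (S (Suc i)) & t <= T i)"
  and "\<not> holds c (S k)"
 shows "EX t. exec (While c P) (S 0) t (S k) & t <= (\<Sum>i<k. T i + 1) + 1"
proof -
 have "EX t. exec (While c P) (S j) t (S k) & t <= (\<Sum>i=j..<k. T i + 1) + 1" if "j <= k" for j
  using that
 proof (induction rule: inc_induct)
  case base
  thus ?case using exec.WhileF[OF assms(2)] by auto
 next
  case (step j)
  from assms(1)[OF step.hyps(2)] obtain t where t: "holds c (S j)" "exec P (S j) t (S (Suc j))" "t <= T j"
   by blast
  from step.IH obtain u where u: "exec (While c P) (S (Suc j)) u (S k)"
   "u <= (\<Sum>i=Suc j..<k. T i + 1) + 1" by blast
  have "(\<Sum>i=j..<k. T i + 1) = T j + 1 + (\<Sum>i=Suc j..<k. T i + 1)"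
   using step.hyps by (simp add: sum.atLeast_Suc_lessThan)
  with exec.WhileT[OF t(1,2) u(1)] t u show ?case by (intro exI[of _ "1 + t + u"]) auto
 qed
 from this[of 0] show ?thesis by (simp add: lessThan_atLeast0)
qed

definition clear_stack :: "nat => program" where
 "clear_stack r = While (Nonempty r) (Pop r)"

lemma exec_clear_stack: "exec (clear_stack r) s (2 * length (s r) + 1) (s(r := []))"
proof (induction "s r" arbitrary: s)
 case Nil
 hence "s(r := []) = s" by auto
 with Nil show ?case unfolding clear_stack_def by (auto intro: exec.WhileF[of "Nonempty r" s, simplified])
next
 case (Cons b xs)
 have 1: "exec (Pop r) s 1 (s(r := xs))" using exec.Pop[of r s] Cons.hyps(2)[symmetric] by simp
 have 2: "exec (While (Nonempty r) (Pop r)) (s(r := xs)) (2 * length xs + 1) (s(r := []))"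
  using Cons.hyps(1)[of "s(r := xs)"] by (simp add: clear_stack_def)
 show ?case unfolding clear_stack_def
  using exec.WhileT[OF _ 1 2] Cons.hyps(2)[symmetric] by simp
qed

definition move_rev :: "nat => nat => program" where
 "move_rev a c = While (Nonempty a) (Branch (Top a) (Seq (Pop a) (Push c True)) (Seq (Pop a) (Push c False)))"

lemma exec_move_rev:
 assumes "a ~= c"
 shows "exec (move_rev a c) s (4 * length (s a) + 1) (s(a := [], c := rev (s a) @ s c))"
 using assms
proof (induction "s a" arbitrary: s)
 case Nil
 hence e: "s(a := [], c := rev (s a) @ s c) = s" by auto
 have "exec (move_rev a c) s 1 s"
  unfolding move_rev_def by (rule exec.WhileF) (use Nil in simp)
 thus ?case unfolding e using Nil.hyps[symmetric] by simp
next
 case (Cons b xs)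
 let ?s = "s(a := xs, c := b # s c)"
 have 1: "exec (Pop a) s 1 (s(a := xs))" using exec.Pop[of a s] Cons.hyps(2)[symmetric] by simp
 have 2: "exec (Seq (Pop a) (Push c b)) s (1 + 1) ?s"
  using exec.Seq[OF 1 exec.Push[of c b]] Cons.prems by simp
 have 3: "exec (Branch (Top a) (Seq (Pop a) (Push c True)) (Seq (Pop a) (Push c False))) s (1 + (1 + 1)) ?s"
 proof (cases b)
  case True
  hence "holds (Top a) s" using Cons.hyps(2)[symmetric] by simp
  from exec.BranchT[OF this 2[unfolded True]] show ?thesis by (simp add: True)
 next
  case False
  hence "\<not> holds (Top a) s" using Cons.hyps(2)[symmetric] by simp
  from exec.BranchF[OF this 2[unfolded False]] show ?thesis by (simp add: False)
 qed
 have 4: "exec (move_rev a c) ?s (4 * length xs + 1) (s(a := [], c := rev (s a) @ s c))"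
  using Cons.hyps(1)[of ?s] Cons.prems Cons.hyps(2)[symmetric] by (simp add: fun_upd_twist)
 show ?case
  using exec.WhileT[OF _ 3 4[unfolded move_rev_def]] Cons.hyps(2)[symmetric]
  by (simp add: move_rev_def eval_nat_numeral)
qed

definition move_rev2 :: "nat => nat => nat => program" where
 "move_rev2 a c d = While (Nonempty a)
   (Branch (Top a) (Seq (Pop a) (Seq (Push c True) (Push d True)))
    (Seq (Pop a) (Seq (Push c False) (Push d False))))"

lemma exec_move_rev2:
 assumes "a ~= c" "a ~= d" "c ~= d"
 shows "exec (move_rev2 a c d) s (5 * length (s a) + 1)
  (s(a := [], c := rev (s a) @ s c, d := rev (s a) @ s d))"
 using assms
proof (induction "s a" arbitrary: s)
 case Nil
 hence e: "s(a := [], c := rev (s a) @ s c, d := rev (s a) @ s d) = s" by auto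
 have "exec (move_rev2 a c d) s 1 s"
  unfolding move_rev2_def by (rule exec.WhileF) (use Nil in simp)
 thus ?case unfolding e using Nil.hyps[symmetric] by simp
next
 case (Cons b xs)
 let ?s = "s(a := xs, c := b # s c, d := b # s d)"
 have 1: "exec (Pop a) s 1 (s(a := xs))" using exec.Pop[of a s] Cons.hyps(2)[symmetric] by simp
 have 2: "exec (Seq (Pop a) (Seq (Push c b) (Push d b))) s (1 + (1 + 1)) ?s"
  using exec.Seq[OF 1 exec.Seq[OF exec.Push[of c b] exec.Push[of d b]]] Cons.prems by simp
 have 3: "exec (Branch (Top a) (Seq (Pop a) (Seq (Push c True) (Push d True)))
    (Seq (Pop a) (Seq (Push c False) (Push d False)))) s (1 + (1 + (1 + 1))) ?s"
 proof (cases b)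
  case True
  hence "holds (Top a) s" using Cons.hyps(2)[symmetric] by simp
  from exec.BranchT[OF this 2[unfolded True]] show ?thesis by (simp add: True)
 next
  case False
  hence "\<not> holds (Top a) s" using Cons.hyps(2)[symmetric] by simp
  from exec.BranchF[OF this 2[unfolded False]] show ?thesis by (simp add: False)
 qed
 have 4: "exec (move_rev2 a c d) ?s (5 * length xs + 1)
   (s(a := [], c := rev (s a) @ s c, d := rev (s a) @ s d))"
  using Cons.hyps(1)[of ?s] Cons.prems Cons.hyps(2)[symmetric] by (simp add: fun_upd_twist)
 show ?case
  using exec.WhileT[OF _ 3 4[unfolded move_rev2_def]] Cons.hyps(2)[symmetric]
  by (simp add: move_rev2_def eval_nat_numeral)
qed

definition copy_stack :: "nat => nat => nat => program" where
 "copy_stack a c u = Seq (move_rev a u) (move_rev2 u a c)"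

lemma exec_copy_stack:
 assumes "a ~= c" "a ~= u" "c ~= u" "s c = []" "s u = []"
 shows "exec (copy_stack a c u) s (9 * length (s a) + 2) (s(c := s a))"
proof -
 have "exec (copy_stack a c u) s (4 * length (s a) + 1 + (5 * length (s a) + 1)) (s(c := s a))"
  unfolding copy_stack_def
 proof (rule exec.Seq)
  show "exec (move_rev a u) s (4 * length (s a) + 1) (s(a := [], u := rev (s a)))"
   using exec_move_rev[of a u s] assms by simp
  have e: "(s(a := [], u := [], a := s a, c := s a)) = s(c := s a)"
   using assms by (auto simp: fun_eq_iff)
  show "exec (move_rev2 u a c) (s(a := [], u := rev (s a))) (5 * length (s a) + 1) (s(c := s a))"
   using exec_move_rev2[of u a c "s(a := [], u := rev (s a))"] assms e by (simp add: fun_upd_twist)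
 qed
 thus ?thesis by (simp add: add.assoc)
qed

definition move_stack :: "nat => nat => nat => program" where
 "move_stack a c u = Seq (move_rev a u) (move_rev u c)"

lemma exec_move_stack:
 assumes "a ~= c" "a ~= u" "c ~= u" "s c = []" "s u = []"
 shows "exec (move_stack a c u) s (8 * length (s a) + 2) (s(a := [], c := s a))"
proof -
 have "exec (move_stack a c u) s (4 * length (s a) + 1 + (4 * length (s a) + 1)) (s(a := [], c := s a))"
  unfolding move_stack_def
 proof (rule exec.Seq)
  show "exec (move_rev a u) s (4 * length (s a) + 1) (s(a := [], u := rev (s a)))"
   using exec_move_rev[of a u s] assms by simp
  have e: "(s(a := [], u := [], c := s a)) = s(a := [], c := s a)"
   using assms by (auto simp: fun_eq_iff)
  show "exec (move_rev u c) (s(a := [], u := rev (s a))) (4 * length (s a) + 1) (s(a := [], c := s a))"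
   using exec_move_rev[of u c "s(a := [], u := rev (s a))"] assms e by (simp add: fun_upd_twist)
 qed
 thus ?thesis by (simp add: add.assoc)
qed

text \<open>The carry: the run of ones on top becomes zeros kept in \<open>u\<close>. The digit that
  stops the run is a zero, to be replaced, or is absent when all digits are ones.\<close>

definition inc_stack :: "nat => nat => program" where
 "inc_stack r u = Seq (While (Top r) (Seq (Pop r) (Push u False)))
   (Seq (Branch (Nonempty r) (Pop r) Skip) (Seq (Push r True) (move_rev u r)))"

lemma exec_inc_stack:
 assumes "r ~= u" "s u = []"
 shows "EX t. exec (inc_stack r u) s t (s(r := inc_bits (s r))) & t <= 7 * length (s r) + 5"
proof -
 define k where "k = length (takeWhile id (s r))"
 define ys where "ys = dropWhile id (s r)"
 have r: "s r = replicate k True @ ys"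
 proof -
  have "takeWhile id (s r) = replicate k True"
   unfolding k_def by (intro replicate_length_same[symmetric]) (auto dest: set_takeWhileD)
  thus ?thesis unfolding ys_def by (metis takeWhile_dropWhile_id)
 qed
 have ys: "ys = [] \<or> (EX zs. ys = False # zs)"
  unfolding ys_def by (metis (full_types) dropWhile_eq_Cons_conv id_apply neq_Nil_conv)
 define S where "S i = s(r := replicate (k - i) True @ ys, u := replicate i False)" for i
 have "EX t. exec (While (Top r) (Seq (Pop r) (Push u False))) (S 0) t (S k) & t <= (\<Sum>i<k. 2 + 1) + 1"
 proof (rule exec_while_count)
  fix i assume i: "i < k"
  then obtain j where j: "k - i = Suc j" "k - Suc i = j" by (metis Suc_diff_Suc)
  have "exec (Seq (Pop r) (Push u False)) (S i) (1 + 1) (S (Suc i))"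
  proof (rule exec.Seq[OF exec.Pop])
   have "(S i)(r := tl (S i r), u := False # ((S i)(r := tl (S i r))) u) = S (Suc i)"
    using j assms(1) by (auto simp: S_def fun_eq_iff)
   thus "exec (Push u False) ((S i)(r := tl (S i r))) 1 (S (Suc i))"
    using exec.Push[of u False "(S i)(r := tl (S i r))"] by simp
  qed
  thus "holds (Top r) (S i) & (EX t. exec (Seq (Pop r) (Push u False)) (S i) t (S (Suc i)) & t <= 2)"
   using j assms(1) by (auto simp: S_def)
 next
  show "\<not> holds (Top r) (S k)" using ys assms(1) by (auto simp: S_def)
 qed
 moreover have "S 0 = s" using r assms by (auto simp: S_def fun_eq_iff)
 ultimately obtain t1 where t1: "exec (While (Top r) (Seq (Pop r) (Push u False))) s t1 (S k)" "t1 <= 3 * k + 1"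
  by auto
 have 2: "EX t. exec (Branch (Nonempty r) (Pop r) Skip) (S k) t ((S k)(r := tl ys)) & t <= 2"
 proof (cases "ys = []")
  case True
  have "exec (Branch (Nonempty r) (Pop r) Skip) (S k) (1 + 1) (S k)"
   by (rule exec.BranchF[OF _ exec.Skip]) (use assms True in \<open>simp add: S_def\<close>)
  moreover have "(S k)(r := tl ys) = S k" using True assms by (auto simp: S_def fun_eq_iff)
  ultimately show ?thesis by auto
 next
  case False
  have "exec (Branch (Nonempty r) (Pop r) Skip) (S k) (1 + 1) ((S k)(r := tl (S k r)))"
   by (rule exec.BranchT[OF _ exec.Pop]) (use assms False in \<open>simp add: S_def\<close>)
  moreover have "S k r = ys" using assms by (simp add: S_def)
  ultimately show ?thesis by auto
 qed
 then obtain t2 where t2: "exec (Branch (Nonempty r) (Pop r) Skip) (S k) t2 ((S k)(r := tl ys))" "t2 <= 2"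
  by blast
 have 3: "exec (Push r True) ((S k)(r := tl ys)) 1 ((S k)(r := True # tl ys))"
  using exec.Push[of r True "(S k)(r := tl ys)"] by simp
 have inc: "inc_bits (replicate k True @ ys) = replicate k False @ True # tl ys"
  using ys by (induction k) auto
 have fin: "((S k)(r := True # tl ys))(u := [], r := rev (replicate k False) @ True # tl ys) = s(r := inc_bits (s r))"
  using assms by (auto simp: S_def fun_eq_iff inc r)
 have 4: "exec (move_rev u r) ((S k)(r := True # tl ys)) (4 * k + 1) (s(r := inc_bits (s r)))"
  using exec_move_rev[of u r "(S k)(r := True # tl ys)"] assms fin by (simp add: S_def)
 have "exec (inc_stack r u) s (t1 + (t2 + (1 + (4 * k + 1)))) (s(r := inc_bits (s r)))"
  unfolding inc_stack_def by (intro exec.Seq[OF t1(1)] exec.Seq[OF t2(1)] exec.Seq[OF 3] 4)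
 moreover have "k <= length (s r)" unfolding k_def by (rule length_takeWhile_le)
 ultimately show ?thesis using t1(2) t2(2) by (intro exI conjI) auto
qed

text \<open>A test cannot be negated, so the loop that skips zeros runs on a flag in
  \<open>v\<close>. The one it finds is replaced by a zero only if digits remain, since
  \<open>bits\<close> has no leading zeros.\<close>

definition dec_stack :: "nat => nat => nat => program" where
 "dec_stack r u v = Seq (Push v True)
   (Seq (While (Nonempty v) (Branch (Top r) (Pop v) (Seq (Pop r) (Push u True))))
   (Seq (Pop r) (Seq (Branch (Nonempty r) (Push r False) Skip) (move_rev u r))))"

lemma exec_dec_stack:
 assumes "r ~= u" "r ~= v" "u ~= v" "s u = []" "s v = []" "True : set (s r)"
 shows "EX t. exec (dec_stack r u v) s t (s(r := dec_bits (s r))) & t <= 9 * length (s r) + 10"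
proof -
 obtain xs ys where split: "s r = xs @ True # ys" and "True \<notin> set xs"
  using assms(6) by (meson split_list_first)
 define k where "k = length xs"
 have "xs = replicate k False" unfolding k_def
  using \<open>True \<notin> set xs\<close> by (intro replicate_length_same[symmetric]) (metis (full_types))
 with split have r: "s r = replicate k False @ True # ys" by simp
 define S where "S i = (if i <= k then s(r := replicate (k - i) False @ True # ys, u := replicate i True, v := [True])
   else s(r := True # ys, u := replicate k True))" for i
 have 0: "exec (Push v True) s 1 (S 0)"
 proof -
  have "s(v := True # s v) = S 0" using assms r by (auto simp: S_def fun_eq_iff)
  thus ?thesis using exec.Push[of v True s] by simp
 qed
 have "EX t. exec (While (Nonempty v) (Branch (Top r) (Pop v) (Seq (Pop r) (Push u True)))) (S 0) t (S (Suc k))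
   & t <= (\<Sum>i<Suc k. 3 + 1) + 1"
 proof (rule exec_while_count)
  fix i assume i: "i < Suc k"
  have "EX t. exec (Branch (Top r) (Pop v) (Seq (Pop r) (Push u True))) (S i) t (S (Suc i)) & t <= 3"
  proof (cases "i = k")
   case True
   have "(S i)(v := tl (S i v)) = S (Suc i)" using True assms by (auto simp: S_def fun_eq_iff)
   moreover have "holds (Top r) (S i)" using True assms by (simp add: S_def)
   ultimately show ?thesis using exec.BranchT[OF _ exec.Pop[of v "S i"], of "Top r"]
    by (intro exI[of _ "1 + 1"]) simp
  next
   case False
   with i obtain j where j: "k - i = Suc j" "k - Suc i = j" "Suc i <= k" "i <= k"
    by (metis Suc_diff_Suc less_Suc_eq less_or_eq_imp_le less_eq_Suc_le)
   have nh: "\<not> holds (Top r) (S i)" using j assms by (simp add: S_def)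
   have "exec (Seq (Pop r) (Push u True)) (S i) (1 + 1) (S (Suc i))"
   proof (rule exec.Seq[OF exec.Pop])
    have "(S i)(r := tl (S i r), u := True # ((S i)(r := tl (S i r))) u) = S (Suc i)"
     using j assms by (auto simp: S_def fun_eq_iff)
    thus "exec (Push u True) ((S i)(r := tl (S i r))) 1 (S (Suc i))"
     using exec.Push[of u True "(S i)(r := tl (S i r))"] by simp
   qed
   from exec.BranchF[OF nh this] show ?thesis by (intro exI conjI) auto
  qed
  thus "holds (Nonempty v) (S i) &
    (EX t. exec (Branch (Top r) (Pop v) (Seq (Pop r) (Push u True))) (S i) t (S (Suc i)) & t <= 3)"
   using i by (simp add: S_def)
 next
  show "\<not> holds (Nonempty v) (S (Suc k))" using assms by (simp add: S_def)
 qed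
 then obtain t1 where t1: "exec (While (Nonempty v) (Branch (Top r) (Pop v) (Seq (Pop r) (Push u True)))) (S 0) t1 (S (Suc k))"
   "t1 <= 4 * k + 5" by auto
 have Sk: "S (Suc k) = s(r := True # ys, u := replicate k True)" by (simp add: S_def)
 have 2: "exec (Pop r) (S (Suc k)) 1 (s(r := ys, u := replicate k True))"
  using exec.Pop[of r "S (Suc k)"] assms by (simp add: Sk fun_upd_twist)
 define zs where "zs = (if ys = [] then [] else False # ys)"
 have 3: "exec (Branch (Nonempty r) (Push r False) Skip) (s(r := ys, u := replicate k True)) (1 + 1)
   (s(r := zs, u := replicate k True))"
 proof (cases "ys = []")
  case True
  show ?thesis using exec.BranchF[OF _ exec.Skip, of "Nonempty r" "s(r := ys, u := replicate k True)"] True assms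
   by (simp add: zs_def)
 next
  case False
  show ?thesis using exec.BranchT[OF _ exec.Push[of r False "s(r := ys, u := replicate k True)"], of "Nonempty r"] False assms
   by (simp add: zs_def fun_upd_twist)
 qed
 have dec: "dec_bits (replicate k False @ True # ys) = replicate k True @ zs"
  by (induction k) (auto simp: zs_def)
 have fin: "(s(r := zs, u := replicate k True))(u := [], r := rev (replicate k True) @ zs) = s(r := dec_bits (s r))"
  using assms by (auto simp: fun_eq_iff dec r)
 have 4: "exec (move_rev u r) (s(r := zs, u := replicate k True)) (4 * k + 1) (s(r := dec_bits (s r)))"
  using exec_move_rev[of u r "s(r := zs, u := replicate k True)"] assms fin by simp
 have "exec (dec_stack r u v) s (1 + (t1 + (1 + (1 + 1 + (4 * k + 1))))) (s(r := dec_bits (s r)))"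
  unfolding dec_stack_def
  by (intro exec.Seq[OF 0] exec.Seq[OF t1(1)] exec.Seq[OF 2] exec.Seq[OF 3] 4)
 moreover have "k <= length (s r)" unfolding k_def split by simp
 ultimately show ?thesis using t1(2) by (intro exI conjI) auto
qed

section \<open>Computable functions with time bounds\<close>

text \<open>A bare power suffices: in every \<open>ctx\<close> the size is at least 2, so constants
  and sums are absorbed by the exponent.\<close>

definition pbd :: "'a set => ('a => nat) => ('a => nat) => bool" where
 "pbd D sz f \<longleftrightarrow> (EX c. ALL a:D. f a <= sz a ^ c)"

text \<open>The number of digits is polynomial; the value itself may be exponential.\<close>

definition psz :: "'a set => ('a => nat) => ('a => nat) => bool" where
 "psz D sz f \<longleftrightarrow> (EX g. pbd D sz g & (ALL a:D. f a < 2 ^ g a))"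

abbreviation up :: "('a => 'c) => 'a \<times> 'b => 'c" where
 "up f \<equiv> %c. f (fst c)"

definition ctx :: "'a set => ('a => nat) => ('a => nat) => ('a => nat) list => bool" where
 "ctx D sz w V \<longleftrightarrow> (ALL a:D. 2 <= sz a & 1 <= w a) & (ALL g:set V. psz D sz g)"

text \<open>The empty registers from \<open>b\<close> on serve as scratch space. In
  \<open>cmp\<close> all of them are returned empty except for the result in \<open>b\<close>, so
  programs can be nested.\<close>

definition loaded :: "('a => nat) list => nat list => nat => 'a => store => bool" where
 "loaded V z b a s \<longleftrightarrow> (ALL i<length V. s (z ! i) = bits ((V ! i) a)) & (ALL r>=b. s r = [])"

text \<open>
 The program may depend on the registers \<open>z\<close> holding the values of \<open>V\<close> and on the first free
 register \<open>b\<close>, which receives the result; \<open>w\<close> carries the part of the time that is not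
 polynomial in \<open>sz\<close>.
\<close>
definition cmp :: "'a set => ('a => nat) => ('a => nat) => ('a => nat) list => ('a => nat) => bool" where
 "cmp D sz w V f \<longleftrightarrow> ctx D sz w V & psz D sz f &
   (ALL z b. length z = length V & (ALL r:set z. r < b) -->
    (EX P q. pbd D sz q & (ALL a:D. ALL s. loaded V z b a s -->
     (EX t. exec P s t (s(b := bits (f a))) & t <= w a * q a))))"

lemma cmp_ctx: "cmp D sz w V f ==> ctx D sz w V"
 by (simp add: cmp_def)

lemma pbd_mono: "pbd D sz g ==> (!!a. a : D ==> f a <= g a) ==> pbd D sz f"
 unfolding pbd_def by (blast intro: order_trans)

lemma pbd_const: "ctx D sz w V ==> pbd D sz (%_. k)"
proof -
 assume "ctx D sz w V"
 hence "k <= sz a ^ k" if "a : D" for a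
  using that power_mono[of 2 "sz a" k] less_exp[of k] by (force simp: ctx_def)
 thus ?thesis unfolding pbd_def by blast
qed

lemma pbd_sz: "pbd D sz sz"
 unfolding pbd_def by (rule exI[of _ 1]) simp

lemma pbd_mult: "pbd D sz f ==> pbd D sz g ==> pbd D sz (%a. f a * g a)"
 unfolding pbd_def
proof (elim exE)
 fix c d assume "ALL a:D. f a <= sz a ^ c" "ALL a:D. g a <= sz a ^ d"
 thus "EX c. ALL a:D. f a * g a <= sz a ^ c"
  by (intro exI[of _ "c + d"]) (simp add: power_add mult_le_mono)
qed

lemma pbd_add:
 assumes "ctx D sz w V" "pbd D sz f" "pbd D sz g"
 shows "pbd D sz (%a. f a + g a)"
proof (rule pbd_mono)
 show "pbd D sz (%a. (f a + 1) * (g a + 1))"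
 proof (rule pbd_mult)
  have "pbd D sz (%a. f a + 1)" if f: "pbd D sz f" for f
  proof -
   from f obtain c where c: "ALL a:D. f a <= sz a ^ c" by (auto simp: pbd_def)
   have "f a + 1 <= sz a ^ (c + 1)" if "a : D" for a
   proof -
    have "2 <= sz a" using assms(1) that by (simp add: ctx_def)
    moreover from this have "1 <= sz a ^ c" by simp
    moreover have "2 * sz a ^ c <= sz a * sz a ^ c" by (rule mult_right_mono) (use \<open>2 <= sz a\<close> in auto)
    moreover have "f a <= sz a ^ c" using c that by blast
    ultimately have "f a + 1 <= sz a * sz a ^ c" by linarith
    thus ?thesis by simp
   qed
   thus ?thesis unfolding pbd_def by blast
  qed
  thus "pbd D sz (%a. f a + 1)" "pbd D sz (%a. g a + 1)" using assms by auto
 qed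
 show "!!a. a : D ==> f a + g a <= (f a + 1) * (g a + 1)" by simp
qed

lemma pbd_power: "ctx D sz w V ==> pbd D sz f ==> pbd D sz (%a. f a ^ k)"
 by (induction k) (auto intro: pbd_mult pbd_const)

lemma pbd_comp: "pbd D sz f ==> h ` E \<subseteq> D ==> pbd E (%x. sz (h x)) (%x. f (h x))"
 unfolding pbd_def by blast

lemma psz_comp: "psz D sz f ==> h ` E \<subseteq> D ==> psz E (%x. sz (h x)) (%x. f (h x))"
 unfolding psz_def using pbd_comp[of D sz _ h E] by fast

lemma psz_of_pbd: "pbd D sz f ==> psz D sz f"
 unfolding psz_def using less_exp by blast

lemma psz_mono: "psz D sz g ==> (!!a. a : D ==> f a <= g a) ==> psz D sz f"
 unfolding psz_def by (blast intro: le_less_trans)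

lemma psz_double:
 assumes "ctx D sz w V" "psz D sz f"
 shows "psz D sz (%a. 2 * f a + 1)"
proof -
 from assms(2) obtain g where g: "pbd D sz g" "ALL a:D. f a < 2 ^ g a" by (auto simp: psz_def)
 have "ALL a:D. 2 * f a + 1 < 2 ^ (g a + 1)" using g(2) by auto
 moreover have "pbd D sz (%a. g a + 1)" by (rule pbd_add[OF assms(1) g(1) pbd_const[OF assms(1)]])
 ultimately show ?thesis unfolding psz_def by blast
qed

lemma psz_max:
 assumes "ctx D sz w V" "psz D sz f" "psz D sz g"
 shows "psz D sz (%a. max (f a) (g a))"
proof -
 from assms obtain p q where pq: "pbd D sz p" "ALL a:D. f a < 2 ^ p a" "pbd D sz q" "ALL a:D. g a < 2 ^ q a"
  by (auto simp: psz_def)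
 have "max (f a) (g a) < 2 ^ (p a + q a)" if "a : D" for a
 proof -
  have "(2::nat) ^ p a <= 2 ^ (p a + q a)" "(2::nat) ^ q a <= 2 ^ (p a + q a)" by (auto intro: power_increasing)
  moreover have "f a < 2 ^ p a" "g a < 2 ^ q a" using pq that by auto
  ultimately show ?thesis by linarith
 qed
 with pbd_add[OF assms(1) pq(1) pq(3)] show ?thesis unfolding psz_def by blast
qed

lemma loaded_upd:
 assumes "loaded V z b a s" "length z = length V" "ALL r:set z. r < b"
 shows "loaded V z (Suc b) a (s(b := xs))"
proof -
 have "z ! i ~= b" if "i < length V" for i using assms(2,3) that nth_mem[of i z] by auto
 with assms(1) show ?thesis by (auto simp: loaded_def)
qed

lemma loaded_mono: "loaded V z b a s ==> b <= b' ==> loaded V z b' a s"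
 by (simp add: loaded_def)

lemma cmpI:
 assumes "ctx D sz w V" "psz D sz f"
  and "!!z b. length z = length V ==> ALL r:set z. r < b ==>
    EX P q. pbd D sz q & (ALL a:D. ALL s. loaded V z b a s -->
     (EX t. exec P s t (s(b := bits (f a))) & t <= w a * q a))"
 shows "cmp D sz w V f"
 using assms by (simp add: cmp_def)

lemma cmpE:
 assumes "cmp D sz w V f" "length z = length V" "ALL r:set z. r < b"
 obtains P q where "pbd D sz q"
  and "!!a s. a : D ==> loaded V z b a s ==> EX t. exec P s t (s(b := bits (f a))) & t <= w a * q a"
 using assms unfolding cmp_def by meson

lemma cmp_psz: "cmp D sz w V f ==> psz D sz f"
 by (simp add: cmp_def)

lemma cmp_length:
 assumes "cmp D sz w V f"
 obtains g where "pbd D sz g" "!!a. a : D ==> length (bits (f a)) <= g a"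
proof -
 from cmp_psz[OF assms] obtain g where "pbd D sz g" "ALL a:D. f a < 2 ^ g a" by (auto simp: psz_def)
 with that[of g] length_bits_le show thesis by blast
qed

lemma cmp_weaken_time:
 assumes "cmp D sz w V f" "!!a. a : D ==> w a <= w' a"
 shows "cmp D sz w' V f"
proof (rule cmpI)
 show "ctx D sz w' V" using cmp_ctx[OF assms(1)] assms(2) unfolding ctx_def by (auto intro: order_trans)
 show "psz D sz f" by (rule cmp_psz[OF assms(1)])
 fix z :: "nat list" and b assume "length z = length V" "ALL r:set z. r < b"
 from assms(1) this obtain P q where "pbd D sz q"
  "!!a s. a : D ==> loaded V z b a s ==> EX t. exec P s t (s(b := bits (f a))) & t <= w a * q a"
  by (rule cmpE) blast
 moreover have "t <= w' a * q a" if "a : D" "t <= w a * q a" for a t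
  using mult_le_mono1[OF assms(2)[OF that(1)], of "q a"] that(2) by (rule order_trans[rotated])
 ultimately show "EX P q. pbd D sz q & (ALL a:D. ALL s. loaded V z b a s -->
     (EX t. exec P s t (s(b := bits (f a))) & t <= w' a * q a))"
  by blast
qed

lemma ctx_comp:
 assumes "ctx D sz w V" "h ` E \<subseteq> D"
 shows "ctx E (%x. sz (h x)) (%x. w (h x)) (map (%g x. g (h x)) V)"
 using assms psz_comp[of D sz _ h E] unfolding ctx_def by auto

text \<open>The same program read over another domain of parameters; together with
  \<open>cmp_mono\<close> this carries programs into contexts with more variables.\<close>

lemma cmp_comp:
 assumes "cmp D sz w V f" "h ` E \<subseteq> D"
 shows "cmp E (%x. sz (h x)) (%x. w (h x)) (map (%g x. g (h x)) V) (%x. f (h x))"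
proof (rule cmpI)
 show "ctx E (%x. sz (h x)) (%x. w (h x)) (map (%g x. g (h x)) V)"
  by (rule ctx_comp[OF cmp_ctx[OF assms(1)] assms(2)])
 show "psz E (%x. sz (h x)) (%x. f (h x))" by (rule psz_comp[OF cmp_psz[OF assms(1)] assms(2)])
 fix z :: "nat list" and b assume z: "length z = length (map (%g x. g (h x)) V)" "ALL r:set z. r < b"
 hence "length z = length V" by simp
 from assms(1) this z(2) obtain P q where "pbd D sz q"
  "!!a s. a : D ==> loaded V z b a s ==> EX t. exec P s t (s(b := bits (f a))) & t <= w a * q a"
  by (rule cmpE) blast
 moreover have "loaded (map (%g x. g (h x)) V) z b x s \<longleftrightarrow> loaded V z b (h x) s" for x s
  by (simp add: loaded_def)
 ultimately show "EX P q. pbd E (%x. sz (h x)) q & (ALL a:E. ALL s. loaded (map (%g x. g (h x)) V) z b a s -->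
     (EX t. exec P s t (s(b := bits (f (h a)))) & t <= w (h a) * q a))"
  using pbd_comp[of D sz q h E] assms(2) by (intro exI[of _ P] exI[of _ "%x. q (h x)"]) auto
qed

lemma cmp_mono:
 assumes "cmp D sz w V f" "set V \<subseteq> set V'" "ctx D sz w V'"
 shows "cmp D sz w V' f"
proof (rule cmpI)
 show "ctx D sz w V'" by fact
 show "psz D sz f" by (rule cmp_psz[OF assms(1)])
 fix z' :: "nat list" and b assume z': "length z' = length V'" "ALL r:set z'. r < b"
 have "ALL i<length V. EX j<length V'. V ! i = V' ! j" using assms(2) by (metis in_set_conv_nth subsetD)
 then obtain j where j: "!!i. i < length V ==> j i < length V' & V ! i = V' ! j i" by metis
 define z where "z = map (%i. z' ! j i) [0..<length V]"
 have "length z = length V" "ALL r:set z. r < b" using z' j by (auto simp: z_def)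
 from assms(1) this obtain P q where "pbd D sz q"
  "!!a s. a : D ==> loaded V z b a s ==> EX t. exec P s t (s(b := bits (f a))) & t <= w a * q a"
  by (rule cmpE) blast
 moreover have "loaded V z b a s" if "loaded V' z' b a s" for a s
  using that j by (auto simp: loaded_def z_def)
 ultimately show "EX P q. pbd D sz q & (ALL a:D. ALL s. loaded V' z' b a s -->
     (EX t. exec P s t (s(b := bits (f a))) & t <= w a * q a))"
  by blast
qed

lemma cmp_var:
 assumes "ctx D sz w V" "f : set V"
 shows "cmp D sz w V f"
proof (rule cmpI)
 show "ctx D sz w V" "psz D sz f" using assms by (auto simp: ctx_def)
 then obtain g where g: "pbd D sz g" "!!a. a : D ==> length (bits (f a)) <= g a"
  unfolding psz_def using length_bits_le by blast
 fix z :: "nat list" and b assume z: "length z = length V" "ALL r:set z. r < b"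
 from assms(2) obtain i where i: "i < length V" "f = V ! i" by (metis in_set_conv_nth)
 have "z ! i < b" using z i by (metis nth_mem)
 have "EX t. exec (copy_stack (z ! i) b (Suc b)) s t (s(b := bits (f a))) & t <= w a * (9 * g a + 2)"
  if "a : D" "loaded V z b a s" for a s
 proof -
  have s: "s (z ! i) = bits (f a)" "s b = []" "s (Suc b) = []" using that i by (auto simp: loaded_def)
  have "1 <= w a" using assms(1) that by (simp add: ctx_def)
  hence "9 * g a + 2 <= w a * (9 * g a + 2)" using mult_le_mono1[of 1 "w a" "9 * g a + 2"] by simp
  hence "9 * length (s (z ! i)) + 2 <= w a * (9 * g a + 2)" using g(2)[OF that(1)] s by simp
  with exec_copy_stack[of "z ! i" b "Suc b" s] s \<open>z ! i < b\<close> show ?thesis by fastforce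
 qed
 moreover have "pbd D sz (%a. 9 * g a + 2)"
  by (intro pbd_add[OF assms(1)] pbd_mult pbd_const[OF assms(1)] g)
 ultimately show "EX P q. pbd D sz q & (ALL a:D. ALL s. loaded V z b a s -->
     (EX t. exec P s t (s(b := bits (f a))) & t <= w a * q a))"
  by blast
qed

lemma cmp_zero:
 assumes "ctx D sz w V"
 shows "cmp D sz w V (%_. 0)"
proof (rule cmpI)
 show "ctx D sz w V" by fact
 show "psz D sz (%_. 0)" by (rule psz_of_pbd[OF pbd_const[OF assms]])
 fix z :: "nat list" and b assume z: "length z = length V" "ALL r:set z. r < b"
 have "EX t. exec Skip s t (s(b := bits 0)) & t <= w a * 1" if "a : D" "loaded V z b a s" for a s
 proof -
  have "s(b := bits 0) = s" using that by (auto simp: loaded_def bits_0)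
  moreover have "1 <= w a" using assms that by (simp add: ctx_def)
  ultimately show ?thesis using exec.Skip[of s] by (intro exI[of _ 1]) simp
 qed
 with pbd_const[OF assms, of 1] show "EX P q. pbd D sz q & (ALL a:D. ALL s. loaded V z b a s -->
     (EX t. exec P s t (s(b := bits 0)) & t <= w a * q a))"
  by blast
qed

text \<open>The bound on \<open>h\<close> lets the number of digits grow by one at most, so that the
  result stays within \<open>psz\<close>.\<close>

lemma cmp_unop:
 assumes f: "cmp D sz w V f"
  and R: "!!b s x. s b = bits x ==> ALL r>b. s r = [] ==>
    EX t. exec (R b) s t (s(b := bits (h x))) & t <= k * length (bits x) + k"
  and h: "!!x. h x <= 2 * x + 1"
 shows "cmp D sz w V (%a. h (f a))"
proof (rule cmpI)
 show ctx: "ctx D sz w V" by (rule cmp_ctx[OF f])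
 show "psz D sz (%a. h (f a))" by (rule psz_mono[OF psz_double[OF ctx cmp_psz[OF f]]]) (rule h)
 fix z :: "nat list" and b assume z: "length z = length V" "ALL r:set z. r < b"
 from f z obtain P q where q: "pbd D sz q"
  and P: "!!a s. a : D ==> loaded V z b a s ==> EX t. exec P s t (s(b := bits (f a))) & t <= w a * q a"
  by (rule cmpE) blast
 from cmp_length[OF f] obtain g where g: "pbd D sz g" "!!a. a : D ==> length (bits (f a)) <= g a" by blast
 have "EX t. exec (Seq P (R b)) s t (s(b := bits (h (f a)))) & t <= w a * (q a + (k * g a + k))"
  if a: "a : D" "loaded V z b a s" for a s
 proof -
  from P[OF a] obtain t where t: "exec P s t (s(b := bits (f a)))" "t <= w a * q a" by blast
  have "EX t. exec (R b) (s(b := bits (f a))) t ((s(b := bits (f a)))(b := bits (h (f a)))) &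
    t <= k * length (bits (f a)) + k"
   by (rule R) (use a in \<open>auto simp: loaded_def\<close>)
  then obtain u where u: "exec (R b) (s(b := bits (f a))) u (s(b := bits (h (f a))))"
   "u <= k * length (bits (f a)) + k" by auto
  have "u <= k * g a + k" using u(2) g(2)[OF a(1)] mult_le_mono2[of "length (bits (f a))" "g a" k] by linarith
  moreover have "1 * (k * g a + k) <= w a * (k * g a + k)"
   using ctx a by (intro mult_le_mono1) (simp add: ctx_def)
  ultimately have "t + u <= w a * (q a + (k * g a + k))" using t(2) by (simp add: distrib_left)
  with exec.Seq[OF t(1) u(1)] show ?thesis by blast
 qed
 moreover have "pbd D sz (%a. q a + (k * g a + k))"
  by (intro pbd_add[OF ctx] pbd_mult pbd_const[OF ctx] g q)
 ultimately show "EX P q. pbd D sz q & (ALL a:D. ALL s. loaded V z b a s -->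
     (EX t. exec P s t (s(b := bits (h (f a)))) & t <= w a * q a))"
  by blast
qed

lemma cmp_Suc: "cmp D sz w V f ==> cmp D sz w V (%a. Suc (f a))"
proof (rule cmp_unop[where R = "%b. inc_stack b (Suc b)" and k = 7 and h = Suc])
 fix b and s :: store and x assume *: "s b = bits x" "ALL r>b. s r = []"
 show "EX t. exec (inc_stack b (Suc b)) s t (s(b := bits (Suc x))) & t <= 7 * length (bits x) + 7"
  using exec_inc_stack[of b "Suc b" s] * by (force simp: bits_Suc)
qed auto

lemma cmp_pred: "cmp D sz w V f ==> cmp D sz w V (%a. f a - 1)"
proof (rule cmp_unop[where R = "%b. Branch (Nonempty b) (dec_stack b (Suc b) (Suc (Suc b))) Skip" and k = 11 and h = "%x. x - 1"])
 fix b and s :: store and x assume *: "s b = bits x" "ALL r>b. s r = []"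
 show "EX t. exec (Branch (Nonempty b) (dec_stack b (Suc b) (Suc (Suc b))) Skip) s t (s(b := bits (x - 1)))
   & t <= 11 * length (bits x) + 11"
 proof (cases "x = 0")
  case True
  have "exec (Branch (Nonempty b) (dec_stack b (Suc b) (Suc (Suc b))) Skip) s (1 + 1) s"
   by (rule exec.BranchF[OF _ exec.Skip]) (use * True in \<open>simp add: bits_0\<close>)
  moreover have "s(b := bits (x - 1)) = s" using * True by (auto simp: bits_0)
  ultimately show ?thesis by (intro exI[of _ "1 + 1"]) simp
 next
  case False
  have e: "bits (x - 1) = dec_bits (s b)" using bits_pred[of x] False * by simp
  obtain t where t: "exec (dec_stack b (Suc b) (Suc (Suc b))) s t (s(b := bits (x - 1)))"
   "t <= 9 * length (bits x) + 10"
   using exec_dec_stack[of b "Suc b" "Suc (Suc b)" s] * False True_in_bits[of x] unfolding e by auto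
  have "exec (Branch (Nonempty b) (dec_stack b (Suc b) (Suc (Suc b))) Skip) s (1 + t) (s(b := bits (x - 1)))"
   by (rule exec.BranchT[OF _ t(1)]) (use * False in simp)
  thus ?thesis using t(2) by (intro exI[of _ "1 + t"]) simp
 qed
qed auto

lemma cmp_half: "cmp D sz w V f ==> cmp D sz w V (%a. f a div 2)"
proof (rule cmp_unop[where R = Pop and k = 1 and h = "%x. x div 2"])
 fix b and s :: store and x assume *: "s b = bits x" "ALL r>b. s r = []"
 show "EX t. exec (Pop b) s t (s(b := bits (x div 2))) & t <= 1 * length (bits x) + 1"
  using exec.Pop[of b s] * by (intro exI[of _ 1]) (simp add: tl_bits)
qed auto

lemma cmp_dbl: "cmp D sz w V f ==> cmp D sz w V (%a. 2 * f a)"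
proof (rule cmp_unop[where R = "%b. Branch (Nonempty b) (Push b False) Skip" and k = 2 and h = "%x. 2 * x"])
 fix b and s :: store and x assume *: "s b = bits x" "ALL r>b. s r = []"
 show "EX t. exec (Branch (Nonempty b) (Push b False) Skip) s t (s(b := bits (2 * x))) & t <= 2 * length (bits x) + 2"
 proof (cases "x = 0")
  case True
  have "exec (Branch (Nonempty b) (Push b False) Skip) s (1 + 1) s"
   by (rule exec.BranchF[OF _ exec.Skip]) (use * True in \<open>simp add: bits_0\<close>)
  moreover have "s(b := bits (2 * x)) = s" using * True by (auto simp: bits_0)
  ultimately show ?thesis by (intro exI[of _ "1 + 1"]) simp
 next
  case False
  have "exec (Branch (Nonempty b) (Push b False) Skip) s (1 + 1) (s(b := False # s b))"
   by (rule exec.BranchT[OF _ exec.Push]) (use * False in simp)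
  moreover have "bits (2 * x) = False # s b" using False * by (simp add: bits_pos[of "2 * x"])
  ultimately show ?thesis by (intro exI[of _ "1 + 1"]) simp
 qed
qed auto

lemma cmp_parity: "cmp D sz w V f ==> cmp D sz w V (%a. f a mod 2)"
proof (rule cmp_unop[where R = "%b. Branch (Top b) (Seq (clear_stack b) (Push b True)) (clear_stack b)" and k = 3 and h = "%x. x mod 2"])
 fix b and s :: store and x assume *: "s b = bits x" "ALL r>b. s r = []"
 show "EX t. exec (Branch (Top b) (Seq (clear_stack b) (Push b True)) (clear_stack b)) s t (s(b := bits (x mod 2)))
  & t <= 3 * length (bits x) + 3"
 proof (cases "odd x")
  case True
  have "exec (Seq (clear_stack b) (Push b True)) s (2 * length (s b) + 1 + 1) (s(b := [True]))"
   using exec.Seq[OF exec_clear_stack exec.Push[of b True "s(b := [])"]] by simp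
  moreover have "holds (Top b) s" using * True by (cases "x = 0") (auto simp: bits_pos[of x])
  moreover have "bits (x mod 2) = [True]" using True by (simp add: mod_2_eq_odd bits_pos[of "Suc 0"] bits_0)
  ultimately show ?thesis using exec.BranchT[of "Top b" s] *
   by (intro exI[of _ "1 + (2 * length (s b) + 1 + 1)"]) auto
 next
  case False
  hence nh: "\<not> holds (Top b) s" using * by (cases "x = 0") (auto simp: bits_pos[of x] bits_0)
  have m: "bits (x mod 2) = []" using False by (simp add: mod_2_eq_odd bits_0)
  have "exec (Branch (Top b) (Seq (clear_stack b) (Push b True)) (clear_stack b)) s
    (1 + (2 * length (s b) + 1)) (s(b := []))"
   by (rule exec.BranchF[OF nh exec_clear_stack])
  thus ?thesis unfolding m using * by (intro exI[of _ "1 + (2 * length (s b) + 1)"]) auto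
 qed
qed auto

lemma cmp_if:
 assumes c: "cmp D sz w V c" and f: "cmp D sz w V f" and g: "cmp D sz w V g"
 shows "cmp D sz w V (%a. if c a = 0 then g a else f a)"
proof (rule cmpI)
 show ctx: "ctx D sz w V" by (rule cmp_ctx[OF f])
 show "psz D sz (%a. if c a = 0 then g a else f a)"
  by (rule psz_mono[OF psz_max[OF ctx cmp_psz[OF f] cmp_psz[OF g]]]) auto
 fix z :: "nat list" and b assume z: "length z = length V" "ALL r:set z. r < b"
 from c z obtain P p where p: "pbd D sz p"
  and P: "!!a s. a : D ==> loaded V z b a s ==> EX t. exec P s t (s(b := bits (c a))) & t <= w a * p a"
  by (rule cmpE) blast
 from f z obtain Q q where q: "pbd D sz q"
  and Q: "!!a s. a : D ==> loaded V z b a s ==> EX t. exec Q s t (s(b := bits (f a))) & t <= w a * q a"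
  by (rule cmpE) blast
 from g z obtain R r where r: "pbd D sz r"
  and R: "!!a s. a : D ==> loaded V z b a s ==> EX t. exec R s t (s(b := bits (g a))) & t <= w a * r a"
  by (rule cmpE) blast
 from cmp_length[OF c] obtain l where l: "pbd D sz l" "!!a. a : D ==> length (bits (c a)) <= l a" by blast
 \<comment> \<open>0 is the empty stack, so \<open>Nonempty\<close> tests for a nonzero value, and
   only that branch has to clear \<open>b\<close>.\<close>
 let ?P = "Seq P (Branch (Nonempty b) (Seq (clear_stack b) Q) R)"
 have "EX t. exec ?P s t (s(b := bits (if c a = 0 then g a else f a))) & t <= w a * (p a + (q a + (r a + (2 * l a + 2))))"
  if a: "a : D" "loaded V z b a s" for a s
 proof -
  from P[OF a] obtain t where t: "exec P s t (s(b := bits (c a)))" "t <= w a * p a" by blast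
  have w: "1 * (2 * l a + 2) <= w a * (2 * l a + 2)"
   using ctx a by (intro mult_le_mono1) (simp add: ctx_def)
  have sb: "s b = []" using a by (simp add: loaded_def)
  show ?thesis
  proof (cases "c a = 0")
   case True
   have "s(b := bits (c a)) = s" using sb True by (auto simp: bits_0)
   with t have t1: "exec P s t s" by simp
   from R[OF a] obtain u where u: "exec R s u (s(b := bits (g a)))" "u <= w a * r a" by blast
   have "exec (Branch (Nonempty b) (Seq (clear_stack b) Q) R) s (1 + u) (s(b := bits (g a)))"
    by (rule exec.BranchF[OF _ u(1)]) (use sb in simp)
   from exec.Seq[OF t1 this] t(2) u(2) w True show ?thesis
    by (intro exI[of _ "t + (1 + u)"]) (simp add: distrib_left)
  next
   case False
   have e: "(s(b := bits (c a)))(b := []) = s" using sb by auto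
   from Q[OF a] obtain u where u: "exec Q s u (s(b := bits (f a)))" "u <= w a * q a" by blast
   let ?k = "2 * length (bits (c a)) + 1"
   have "exec (clear_stack b) (s(b := bits (c a))) ?k s"
    using exec_clear_stack[of b "s(b := bits (c a))"] e by simp
   from exec.Seq[OF this u(1)]
   have "exec (Seq (clear_stack b) Q) (s(b := bits (c a))) (?k + u) (s(b := bits (f a)))" .
   hence "exec (Branch (Nonempty b) (Seq (clear_stack b) Q) R) (s(b := bits (c a))) (1 + (?k + u)) (s(b := bits (f a)))"
    by (intro exec.BranchT) (use False in simp_all)
   from exec.Seq[OF t(1) this] t(2) u(2) w False l(2)[OF a(1)] show ?thesis
    by (intro exI[of _ "t + (1 + (?k + u))"]) (simp add: distrib_left)
  qed
 qed
 moreover have "pbd D sz (%a. p a + (q a + (r a + (2 * l a + 2))))"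
  by (intro pbd_add[OF ctx] pbd_mult pbd_const[OF ctx] p q r l)
 ultimately show "EX P q. pbd D sz q & (ALL a:D. ALL s. loaded V z b a s -->
     (EX t. exec P s t (s(b := bits (if c a = 0 then g a else f a))) & t <= w a * q a))"
  by blast
qed

lemma fold_arith:
 fixes t1 :: nat
 assumes "t1 <= A" "t2 <= B" "k <= C" "1 * (2 * l + (8 * g + 30)) <= E" "x <= l" "y <= g" "t3 <= k + 1"
 shows "t1 + (t2 + (t3 + (2 * x + 1 + (8 * y + 2)))) <= A + (B + (C + E))"
proof -
 have "2 * x <= 2 * l" "8 * y <= 8 * g" using assms by auto
 moreover have "2 * l + (8 * g + 30) <= E" using assms by simp
 ultimately show ?thesis using assms(1,2,3,7) by presburger
qed

text \<open>A loop body has to be correct only at triples that the loop reaches, so its size bounds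
  may use the values \<open>it a i\<close>.\<close>

abbreviation iterates :: "'a set => ('a => nat) => ('a => nat => nat) => ('a \<times> nat \<times> nat) set" where
 "iterates D K it \<equiv> {(a, i, x). a : D & i < K a & x = it a i}"

abbreviation xG2 :: "('a => nat) list => ('a \<times> nat \<times> nat => nat) list" where
 "xG2 V \<equiv> map (%g c. g (fst c)) V @ [%c. fst (snd c), %c. snd (snd c)]"

lemma ctx_fold:
 assumes ctx: "ctx D sz w V" and K: "psz D sz K"
  and g: "pbd D sz g" "!!a i. a : D ==> i <= K a ==> it a i < 2 ^ g a"
 shows "ctx (iterates D K it) (up sz) (up w) (xG2 V)" (is "ctx ?D _ _ _")
proof -
 have sub: "fst ` ?D \<subseteq> D" by auto
 have "psz ?D (up sz) (%c. fst (snd c))"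
  by (rule psz_mono[OF psz_comp[OF K sub]]) auto
 moreover have "psz ?D (up sz) (%c. snd (snd c))"
  unfolding psz_def using pbd_comp[OF g(1) sub] g(2) by (intro exI[of _ "%c. g (fst c)"]) auto
 ultimately show ?thesis using ctx_comp[OF ctx sub] by (auto simp: ctx_def)
qed

text \<open>\<open>b\<close> counts down and serves as loop test, \<open>b + 1\<close> holds the
  index and \<open>b + 2\<close> the accumulator, while the body writes to \<open>b + 3\<close>. The
  number of rounds may be exponential; \<open>\<kappa>\<close> is the factor of it that goes into
  the time outside the polynomial part.\<close>

lemma cmp_fold:
 fixes D :: "'a set"
 assumes K: "cmp D sz w V K" and f0: "cmp D sz w V f0"
  and it0: "!!a. a : D ==> it a 0 = f0 a"
  and itS: "!!a i. a : D ==> i < K a ==> it a (Suc i) = F a i (it a i)"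
  and F': "ctx (iterates D K it) (up sz) (up w) (xG2 V) ==>
    cmp (iterates D K it) (up sz) (up w) (xG2 V) (%c. F (fst c) (fst (snd c)) (snd (snd c)))"
  and g: "pbd D sz g" "!!a i. a : D ==> i <= K a ==> it a i < 2 ^ g a"
  and p: "pbd D sz p" "!!a. a : D ==> K a <= \<kappa> a * p a" "!!a. a : D ==> 1 <= \<kappa> a"
 shows "cmp D sz (%a. \<kappa> a * w a) V (%a. it a (K a))"
proof (rule cmpI)
 have ctx: "ctx D sz w V" by (rule cmp_ctx[OF K])
 note F = F'[OF ctx_fold[OF ctx cmp_psz[OF K] g]]
 have M: "1 <= \<kappa> a * w a" "w a <= \<kappa> a * w a" if "a : D" for a
  using ctx p(3)[OF that] that by (auto simp: ctx_def intro: mult_le_mono)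
 show ctx': "ctx D sz (%a. \<kappa> a * w a) V" using ctx M(1) by (simp add: ctx_def)
 show "psz D sz (%a. it a (K a))" unfolding psz_def using g by blast
 fix z :: "nat list" and b assume z: "length z = length V" "ALL r:set z. r < b"
 let ?V = "xG2 V"
 define D3 where "D3 = (iterates D K it)"
 let ?z = "z @ [b + 1, b + 2]"
 from K z obtain PK qK where qK: "pbd D sz qK"
  and PK: "!!a s. a : D ==> loaded V z b a s ==> EX t. exec PK s t (s(b := bits (K a))) & t <= w a * qK a"
  by (rule cmpE) (rule that, assumption+)
 have "ALL r:set z. r < b + 2" using z by auto
 with f0 z(1) obtain P0 q0 where q0: "pbd D sz q0"
  and P0: "!!a s. a : D ==> loaded V z (b + 2) a s ==> EX t. exec P0 s t (s(b + 2 := bits (f0 a))) & t <= w a * q0 a"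
  by (rule cmpE) blast
 have "length ?z = length ?V" "ALL r:set ?z. r < b + 3" using z by auto
 with F[folded D3_def] have "EX PF qF. pbd D3 (up sz) qF & (ALL c:D3. ALL s. loaded ?V ?z (b + 3) c s -->
    (EX t. exec PF s t (s(b + 3 := bits (F (fst c) (fst (snd c)) (snd (snd c))))) & t <= w (fst c) * qF c))"
  unfolding cmp_def by blast
 then obtain PF qF where qF: "pbd D3 (up sz) qF"
  and PF: "ALL c:D3. ALL s. loaded ?V ?z (b + 3) c s -->
    (EX t. exec PF s t (s(b + 3 := bits (F (fst c) (fst (snd c)) (snd (snd c))))) & t <= w (fst c) * qF c)"
  by (elim exE conjE) (rule that)
 from qF obtain e where e: "ALL c:D3. qF c <= sz (fst c) ^ e" by (auto simp: pbd_def)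
 from cmp_length[OF K] obtain l where l: "pbd D sz l" "!!a. a : D ==> length (bits (K a)) <= l a" by blast
 have psz_le: "length (bits x) <= length (bits y)" if "x <= y" for x y
  using that
 proof (induction y arbitrary: x rule: less_induct)
  case (less y)
  show ?case
  proof (cases "x = 0")
   case False
   with less.prems less.IH[of "y div 2" "x div 2"] show ?thesis by (auto simp: bits_pos div_le_mono)
  qed (simp add: bits_0)
 qed
 define Tb where "Tb a = sz a ^ e + (2 * g a + (8 * g a + (7 * l a + (9 * l a + 30))))" for a
 have Tb: "pbd D sz Tb" unfolding Tb_def
  by (intro pbd_add[OF ctx] pbd_mult pbd_const[OF ctx] pbd_power[OF ctx] pbd_sz g l)
 define Bd where "Bd = Seq PF (Seq (clear_stack (b + 2)) (Seq (move_stack (b + 3) (b + 2) (b + 4))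
   (Seq (inc_stack (b + 1) (b + 4)) (dec_stack b (b + 4) (b + 5)))))"
 define P where "P = Seq PK (Seq P0 (Seq (While (Nonempty b) Bd)
   (Seq (clear_stack (b + 1)) (move_stack (b + 2) b (b + 3)))))"
 define q where "q a = qK a + (q0 a + (p a * (Tb a + 1) + (2 * l a + (8 * g a + 30))))" for a
 have q: "pbd D sz q" unfolding q_def
  by (intro pbd_add[OF ctx] pbd_mult pbd_const[OF ctx] Tb g l p qK q0)
 have "EX t. exec P s t (s(b := bits (it a (K a)))) & t <= \<kappa> a * w a * q a"
  if a: "a : D" "loaded V z b a s" for a s
 proof -
  have emp: "s r = []" if "b <= r" for r using a that by (simp add: loaded_def)
  define S where "S i = s(b := bits (K a - i), b + 1 := bits i, b + 2 := bits (it a i))" for i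
  from PK[OF a] obtain t1 where t1: "exec PK s t1 (s(b := bits (K a)))" "t1 <= w a * qK a" by blast
  have "loaded V z (b + 2) a (s(b := bits (K a)))"
   using loaded_upd[OF a(2) z] by (rule loaded_mono) simp
  from P0[OF a(1) this] obtain t2 where
   t2: "exec P0 (s(b := bits (K a))) t2 (s(b := bits (K a), b + 2 := bits (f0 a)))" "t2 <= w a * q0 a"
   by blast
  have S0: "s(b := bits (K a), b + 2 := bits (f0 a)) = S 0"
   by (auto simp: S_def fun_eq_iff bits_0 it0[OF a(1)] emp)
  have "EX t. exec (While (Nonempty b) Bd) (S 0) t (S (K a)) & t <= (\<Sum>i<K a. w a * Tb a + 1) + 1"
  proof (rule exec_while_count)
   show "\<not> holds (Nonempty b) (S (K a))" by (simp add: S_def bits_0)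
   fix i assume i: "i < K a"
   have len: "length (bits (it a j)) <= g a" if "j <= K a" for j
    using g(2)[OF a(1) that] by (rule length_bits_le)
   have lK: "length (bits j) <= l a" if "j <= K a" for j
    using psz_le[OF that] l(2)[OF a(1)] by linarith
   have c: "(a, i, it a i) : D3" using a i by (simp add: D3_def)
   have "s (z ! j) = bits ((V ! j) a)" "z ! j ~= b" "z ! j ~= Suc b" "z ! j ~= Suc (Suc b)"
    if "j < length V" for j
   proof -
    show "s (z ! j) = bits ((V ! j) a)" using a(2) that by (simp add: loaded_def)
    have "z ! j < b" using z that by auto
    thus "z ! j ~= b" "z ! j ~= Suc b" "z ! j ~= Suc (Suc b)" by auto
   qed
   hence "loaded ?V ?z (b + 3) (a, i, it a i) (S i)"
    using z(1) emp unfolding loaded_def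
    by (auto simp: S_def nth_append less_Suc_eq)
   from PF[rule_format, OF c this] obtain u1 where
    u1: "exec PF (S i) u1 ((S i)(b + 3 := bits (it a (Suc i))))" "u1 <= w a * sz a ^ e"
    using e c itS[OF a(1) i] by (force intro: order_trans mult_le_mono2)
   let ?s1 = "(S i)(b + 3 := bits (it a (Suc i)))"
   let ?s2 = "?s1(b + 2 := [])"
   have u2: "exec (clear_stack (b + 2)) ?s1 (2 * length (bits (it a i)) + 1) ?s2"
    using exec_clear_stack[of "b + 2" ?s1] by (simp add: S_def)
   let ?s3 = "?s2(b + 3 := [], b + 2 := bits (it a (Suc i)))"
   have u3: "exec (move_stack (b + 3) (b + 2) (b + 4)) ?s2 (8 * length (bits (it a (Suc i))) + 2) ?s3"
    using exec_move_stack[of "b + 3" "b + 2" "b + 4" ?s2] emp by (simp add: S_def)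
   have s3: "?s3 = s(b := bits (K a - i), b + 1 := bits i, b + 2 := bits (it a (Suc i)))"
    using emp by (auto simp: S_def fun_eq_iff)
   let ?s4 = "s(b := bits (K a - i), b + 1 := bits (Suc i), b + 2 := bits (it a (Suc i)))"
   obtain u4 where u4: "exec (inc_stack (b + 1) (b + 4)) ?s3 u4 ?s4" "u4 <= 7 * length (bits i) + 5"
    using exec_inc_stack[of "b + 1" "b + 4" ?s3] emp unfolding s3
    by (auto simp: bits_Suc fun_upd_twist)
   have s5: "?s4(b := bits (K a - Suc i)) = S (Suc i)" by (auto simp: S_def fun_eq_iff)
   have "dec_bits (bits (K a - i)) = bits (K a - Suc i)" using bits_pred[of "K a - i"] i by simp
   with exec_dec_stack[of b "b + 4" "b + 5" ?s4] emp True_in_bits[of "K a - i"] i s5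
   obtain u5 where u5: "exec (dec_stack b (b + 4) (b + 5)) ?s4 u5 (S (Suc i))"
    "u5 <= 9 * length (bits (K a - i)) + 10" by auto
   let ?u = "u1 + (2 * length (bits (it a i)) + 1 + (8 * length (bits (it a (Suc i))) + 2 + (u4 + u5)))"
   have ex: "exec Bd (S i) ?u (S (Suc i))" unfolding Bd_def
    by (intro exec.Seq[OF u1(1)] exec.Seq[OF u2] exec.Seq[OF u3] exec.Seq[OF u4(1)] u5(1))
   let ?r = "2 * g a + (8 * g a + (7 * l a + (9 * l a + 30)))"
   have "?u <= w a * sz a ^ e + 1 * ?r"
    using u1(2) u4(2) u5(2) len[of i] len[of "Suc i"] lK[of i] lK[of "K a - i"] i by simp
   also have "... <= w a * sz a ^ e + w a * ?r"
    using ctx a by (intro add_left_mono mult_le_mono1) (simp add: ctx_def)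
   also have "... = w a * Tb a" by (simp add: Tb_def distrib_left)
   finally show "holds (Nonempty b) (S i) & (EX t. exec Bd (S i) t (S (Suc i)) & t <= w a * Tb a)"
    using ex i by (auto simp: S_def)
  qed
  then obtain t3 where t3: "exec (While (Nonempty b) Bd) (S 0) t3 (S (K a))" "t3 <= K a * (w a * Tb a + 1) + 1"
   by auto
  have t4: "exec (clear_stack (b + 1)) (S (K a)) (2 * length (bits (K a)) + 1) (s(b + 2 := bits (it a (K a))))"
  proof -
   have "(S (K a))(b + 1 := []) = s(b + 2 := bits (it a (K a)))"
    using emp by (auto simp: S_def fun_eq_iff bits_0)
   thus ?thesis using exec_clear_stack[of "b + 1" "S (K a)"] by (simp add: S_def)
  qed
  have t5: "exec (move_stack (b + 2) b (b + 3)) (s(b + 2 := bits (it a (K a))))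
    (8 * length (bits (it a (K a))) + 2) (s(b := bits (it a (K a))))"
  proof -
   have "s(b + 2 := [], b := bits (it a (K a))) = s(b := bits (it a (K a)))"
    using emp by (auto simp: fun_eq_iff)
   thus ?thesis using exec_move_stack[of "b + 2" b "b + 3" "s(b + 2 := bits (it a (K a)))"] emp by simp
  qed
  let ?t = "t1 + (t2 + (t3 + (2 * length (bits (K a)) + 1 + (8 * length (bits (it a (K a))) + 2))))"
  have ex: "exec P s ?t (s(b := bits (it a (K a))))" unfolding P_def
   by (intro exec.Seq[OF t1(1)] exec.Seq[OF t2(1)[unfolded S0]] exec.Seq[OF t3(1)] exec.Seq[OF t4] t5)
  let ?M = "\<kappa> a * w a"
  have "t1 <= ?M * qK a" "t2 <= ?M * q0 a"
   using t1(2) t2(2) M(2)[OF a(1)] by (meson order_trans mult_le_mono1)+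
  moreover have "K a * (w a * Tb a + 1) <= ?M * (p a * (Tb a + 1))"
  proof -
   have "K a * (w a * Tb a + 1) <= (\<kappa> a * p a) * (w a * Tb a + w a)"
    using p(2)[OF a(1)] ctx a by (intro mult_le_mono add_left_mono) (auto simp: ctx_def)
   also have "... = ?M * (p a * (Tb a + 1))" by (simp add: algebra_simps)
   finally show ?thesis .
  qed
  moreover have "1 * (2 * l a + (8 * g a + 30)) <= ?M * (2 * l a + (8 * g a + 30))"
   using M(1)[OF a(1)] by (rule mult_le_mono1)
  moreover have "length (bits (K a)) <= l a" "length (bits (it a (K a))) <= g a"
   using l(2)[OF a(1)] length_bits_le[OF g(2)[OF a(1) order_refl]] by auto
  ultimately have "?t <= ?M * qK a + (?M * q0 a + (?M * (p a * (Tb a + 1)) + ?M * (2 * l a + (8 * g a + 30))))"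
   using t3(2) by (rule fold_arith)
  also have "... = ?M * q a" by (simp add: q_def distrib_left)
  finally show ?thesis using ex by blast
 qed
 with q show "EX P q. pbd D sz q & (ALL a:D. ALL s. loaded V z b a s -->
     (EX t. exec P s t (s(b := bits (it a (K a)))) & t <= \<kappa> a * w a * q a))"
  by blast
qed

section \<open>Rules for functions with polynomially bounded values\<close>

definition sm :: "'a set => ('a => nat) => ('a => nat) => ('a => nat) list => ('a => nat) => bool" where
 "sm D sz w V f \<longleftrightarrow> cmp D sz w V f & pbd D sz f"

definition xD :: "'a set => ('a => nat) => ('a \<times> nat) set" where
 "xD D K = {(a, i). a : D & i < K a}"

definition xG :: "('a => nat) list => ('a \<times> nat => nat) list" where
 "xG V = map (%g c. g (fst c)) V @ [%c. snd c]"

text \<open>An assertion moved into the context that has one more variable, bounded by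
  \<open>K\<close>.\<close>

abbreviation inner where
 "inner P D K sz w V \<equiv> P (xD D K) (up sz) (up w) (xG V)"

lemma sm_cmp: "sm D sz w V f ==> cmp D sz w V f"
 and sm_pbd: "sm D sz w V f ==> pbd D sz f"
 and sm_ctx: "sm D sz w V f ==> ctx D sz w V"
 by (auto simp: sm_def cmp_def)

lemma cmp_fold_small:
 fixes D :: "'a set"
 assumes K: "sm D sz w V K" and ini: "cmp D sz w V ini"
  and it: "!!a. a : D ==> it a 0 = ini a"
   "!!a i. a : D ==> i < K a ==> it a (Suc i) = F a i (it a i)"
  and F: "ctx (iterates D K it) (up sz) (up w) (xG2 V) ==>
    cmp (iterates D K it) (up sz) (up w) (xG2 V) (%c. F (fst c) (fst (snd c)) (snd (snd c)))"
  and g: "psz D sz g" "!!a i. a : D ==> i <= K a ==> it a i <= g a"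
 shows "cmp D sz w V (%a. it a (K a))"
proof -
 from g(1) obtain h where h: "pbd D sz h" "ALL a:D. g a < 2 ^ h a" by (auto simp: psz_def)
 have "cmp D sz (%a. 1 * w a) V (%a. it a (K a))"
  by (rule cmp_fold[OF sm_cmp[OF K] ini it F h(1) _ sm_pbd[OF K]]) (use g(2) h(2) in \<open>auto intro: le_less_trans\<close>)
 thus ?thesis by simp
qed

lemma xD_fst: "fst ` xD D K \<subseteq> D"
 by (auto simp: xD_def)

lemma ctx_x:
 assumes "ctx D sz w V" "psz D sz K"
 shows "inner ctx D K sz w V"
proof -
 have "psz (xD D K) (up sz) (%c. snd c)"
  by (rule psz_mono[OF psz_comp[OF assms(2) xD_fst]]) (auto simp: xD_def)
 thus ?thesis using ctx_comp[OF assms(1) xD_fst] by (auto simp: ctx_def xG_def)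
qed

lemma cmp_lift:
 assumes "cmp D sz w V f" "inner ctx D K sz w V"
 shows "inner cmp D K sz w V (%c. f (fst c))"
 by (rule cmp_mono[OF cmp_comp[OF assms(1) xD_fst] _ assms(2)]) (auto simp: xG_def)

lemma sm_lift:
 assumes "sm D sz w V f" "inner ctx D K sz w V"
 shows "inner sm D K sz w V (%c. f (fst c))"
 using assms cmp_lift pbd_comp[OF sm_pbd[OF assms(1)] xD_fst] by (auto simp: sm_def)

lemma cmp_xvar:
 "ctx (xD D K) sz w (xG V) ==> cmp (xD D K) sz w (xG V) (%c. snd c)"
 by (rule cmp_var) (auto simp: xG_def)

lemma sm_xvar:
 assumes "ctx (xD D K) (up sz) w (xG V)" "pbd D sz K"
 shows "sm (xD D K) (up sz) w (xG V) (%c. snd c)"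
proof -
 have "pbd (xD D K) (up sz) (%c. snd c)"
  by (rule pbd_mono[OF pbd_comp[OF assms(2) xD_fst]]) (auto simp: xD_def)
 thus ?thesis using cmp_xvar[OF assms(1)] by (simp add: sm_def)
qed

lemma cmp_unx:
 assumes "inner cmp D K sz w V (%c. G (fst c) (snd c))"
  and "ctx E (up sz) (up w) (xG2 V)"
  and "!!a i x. (a, i, x) : E ==> a : D & i < K a"
 shows "cmp E (up sz) (up w) (xG2 V)
  (%c. G (fst c) (fst (snd c)))"
proof -
 have sub: "(%c. (fst c, fst (snd c))) ` E \<subseteq> xD D K" using assms(3) by (auto simp: xD_def)
 have "cmp E (up sz) (up w) (map (%g c. g (fst c, fst (snd c))) (xG V))
  (%c. G (fst c) (fst (snd c)))"
  using cmp_comp[OF assms(1) sub] by simp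
 thus ?thesis by (rule cmp_mono[OF _ _ assms(2)]) (auto simp: xG_def)
qed

lemma pbd_unx:
 assumes "pbd (xD D K) (up sz) (%c. G (fst c) (snd c))"
  and "!!a i x. (a, i, x) : E ==> a : D & i < K a"
 shows "pbd E (up sz) (%c. G (fst c) (fst (snd c)))"
proof -
 have sub: "(%c. (fst c, fst (snd c))) ` E \<subseteq> xD D K" using assms(2) by (auto simp: xD_def)
 show ?thesis using pbd_comp[OF assms(1) sub] by simp
qed

lemma cmp_const: "ctx D sz w V ==> cmp D sz w V (%_. k)"
 by (induction k) (auto intro: cmp_zero cmp_Suc)

lemma sm_const: "ctx D sz w V ==> sm D sz w V (%_. k)"
 by (simp add: sm_def cmp_const pbd_const)

lemma psz_Suc_like:
 assumes "ctx D sz w V" "psz D sz f" "pbd D sz g"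
 shows "psz D sz (%a. f a + g a)"
proof -
 from assms(2) obtain h where h: "pbd D sz h" "ALL a:D. f a < 2 ^ h a" by (auto simp: psz_def)
 have "f a + g a < 2 ^ (h a + g a)" if "a : D" for a
 proof -
  have "f a + g a < 2 ^ h a + g a" using h that by simp
  also have "... <= 2 ^ h a * (1 + g a)" by simp
  also have "... <= 2 ^ h a * 2 ^ g a" by (intro mult_left_mono) (use less_exp[of "g a"] in \<open>auto simp: Suc_le_eq\<close>)
  finally show ?thesis by (simp add: power_add)
 qed
 with pbd_add[OF assms(1) h(1) assms(3)] show ?thesis unfolding psz_def by blast
qed

text \<open>Addition is done by \<open>g a\<close> increments, and further operations by loops over
  such ones: slow, but polynomial as long as the number of rounds is \<open>sm\<close>.\<close>

lemma cmp_add: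
 assumes f: "cmp D sz w V f" and g: "sm D sz w V g"
 shows "cmp D sz w V (%a. f a + g a)"
proof (rule cmp_fold_small[where it = "%a i. f a + i" and ini = f and F = "%a i x. Suc x" and g = "%a. f a + g a", OF g f])
 show "psz D sz (%a. f a + g a)" by (rule psz_Suc_like[OF cmp_ctx[OF f] cmp_psz[OF f] sm_pbd[OF g]])
qed (auto intro!: cmp_Suc cmp_var)

lemma cmp_diff:
 assumes f: "cmp D sz w V f" and g: "sm D sz w V g"
 shows "cmp D sz w V (%a. f a - g a)"
proof (rule cmp_fold_small[where it = "%a i. f a - i" and ini = f and F = "%a i x. x - 1" and g = f, OF g f])
 show "psz D sz f" by (rule cmp_psz[OF f])
qed ((auto; fail) | (rule cmp_pred, rule cmp_var, assumption, simp))+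

lemma sm_add:
 assumes "sm D sz w V f" "sm D sz w V g" shows "sm D sz w V (%a. f a + g a)"
 using assms cmp_add[OF sm_cmp[OF assms(1)] assms(2)] pbd_add[OF sm_ctx[OF assms(1)]] by (simp add: sm_def)

lemma sm_Suc: "sm D sz w V f ==> sm D sz w V (%a. Suc (f a))"
 using sm_add[OF _ sm_const[OF sm_ctx], of D sz w V f f 1] by simp

lemma sm_diff:
 assumes "sm D sz w V f" "sm D sz w V g" shows "sm D sz w V (%a. f a - g a)"
 using cmp_diff[OF sm_cmp[OF assms(1)] assms(2)] pbd_mono[OF sm_pbd[OF assms(1)]] by (simp add: sm_def)

lemma sm_mult:
 assumes f: "sm D sz w V f" and g: "sm D sz w V g" shows "sm D sz w V (%a. f a * g a)"
proof -
 have *: "pbd D sz (%a. f a * g a)" by (rule pbd_mult[OF sm_pbd[OF f] sm_pbd[OF g]])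
 have "cmp D sz w V (%a. f a * g a)"
 proof (rule cmp_fold_small[where it = "%a i. f a * i" and ini = "%_. 0" and F = "%a i x. x + f a"
    and g = "%a. f a * g a", OF g cmp_zero[OF sm_ctx[OF f]]])
  show "psz D sz (%a. f a * g a)" by (rule psz_of_pbd[OF *])
  let ?D = "{(a, i, x). a : D & i < g a & x = f a * i}"
  let ?V = "xG2 V"
  assume ctx: "ctx ?D (up sz) (up w) ?V"
  have sub: "fst ` ?D \<subseteq> D" by auto
  have "cmp ?D (up sz) (up w) ?V (%c. f (fst c))"
   by (rule cmp_mono[OF cmp_comp[OF sm_cmp[OF f] sub] _ ctx]) auto
  with pbd_comp[OF sm_pbd[OF f] sub]
  have "sm ?D (up sz) (up w) ?V (%c. f (fst c))" by (simp add: sm_def)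
  thus "cmp ?D (up sz) (up w) ?V (%c. snd (snd c) + f (fst c))"
   by (intro cmp_add cmp_var[OF ctx]) auto
 qed auto
 with * show ?thesis by (simp add: sm_def)
qed

lemma sm_sum:
 assumes K: "sm D sz w V K"
  and G: "inner ctx D K sz w V ==>
   inner sm D K sz w V (%c. snd c) ==>
   inner sm D K sz w V (%c. G (fst c) (snd c))"
 shows "sm D sz w V (%a. \<Sum>i<K a. G a i)"
proof -
 have cx: "inner ctx D K sz w V"
  by (rule ctx_x[OF sm_ctx[OF K] psz_of_pbd[OF sm_pbd[OF K]]])
 note G = G[OF cx sm_xvar[OF cx sm_pbd[OF K]]]
 from sm_pbd[OF G] obtain e where e: "ALL c:xD D K. G (fst c) (snd c) <= sz (fst c) ^ e" by (auto simp: pbd_def)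
 have le: "(\<Sum>j<i. G a j) <= K a * sz a ^ e" if "a : D" "i <= K a" for a i
 proof -
  have "(\<Sum>j<i. G a j) <= (\<Sum>j<i. sz a ^ e)" by (rule sum_mono) (use e that in \<open>force simp: xD_def\<close>)
  also have "... <= K a * sz a ^ e" using that by (simp add: mult_le_mono1)
  finally show ?thesis .
 qed
 have b: "pbd D sz (%a. K a * sz a ^ e)"
  by (intro pbd_mult sm_pbd[OF K] pbd_power[OF sm_ctx[OF K]] pbd_sz)
 have "cmp D sz w V (%a. \<Sum>i<K a. G a i)"
 proof (rule cmp_fold_small[where it = "%a i. \<Sum>j<i. G a j" and ini = "%_. 0" and F = "%a i x. x + G a i"
    and g = "%a. K a * sz a ^ e", OF K cmp_zero[OF sm_ctx[OF K]]])
  show "psz D sz (%a. K a * sz a ^ e)" by (rule psz_of_pbd[OF b])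
  let ?D = "{(a, i, x). a : D & i < K a & x = (\<Sum>j<i. G a j)}"
  let ?V = "xG2 V"
  assume ctx: "ctx ?D (up sz) (up w) ?V"
  have "sm ?D (up sz) (up w) ?V (%c. G (fst c) (fst (snd c)))"
   unfolding sm_def
   by (intro conjI cmp_unx[OF sm_cmp[OF G] ctx] pbd_unx[OF sm_pbd[OF G]]) auto
  thus "cmp ?D (up sz) (up w) ?V (%c. snd (snd c) + G (fst c) (fst (snd c)))"
   by (intro cmp_add cmp_var[OF ctx]) auto
 qed (auto intro!: le)
 moreover have "pbd D sz (%a. \<Sum>i<K a. G a i)" by (rule pbd_mono[OF b le]) auto
 ultimately show ?thesis by (simp add: sm_def)
qed

lemma cmp_If:
 assumes "sm D sz w V (%a. of_bool (P a))" "cmp D sz w V f" "cmp D sz w V g"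
 shows "cmp D sz w V (%a. if P a then f a else g a)"
proof -
 have "(%a. if of_bool (P a) = (0::nat) then g a else f a) = (%a. if P a then f a else g a)"
  by (auto simp: fun_eq_iff)
 with cmp_if[OF sm_cmp[OF assms(1)] assms(2,3)] show ?thesis by simp
qed

lemma sm_If:
 assumes "sm D sz w V (%a. of_bool (P a))" "sm D sz w V f" "sm D sz w V g"
 shows "sm D sz w V (%a. if P a then f a else g a)"
proof -
 have "pbd D sz (%a. if P a then f a else g a)"
  by (rule pbd_mono[OF pbd_add[OF sm_ctx[OF assms(2)] sm_pbd[OF assms(2)] sm_pbd[OF assms(3)]]]) auto
 with cmp_If[OF assms(1) sm_cmp[OF assms(2)] sm_cmp[OF assms(3)]] show ?thesis by (simp add: sm_def)
qed

lemma sm_nonzero: "cmp D sz w V f ==> sm D sz w V (%a. of_bool (f a ~= 0))"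
proof -
 assume f: "cmp D sz w V f"
 note c = cmp_ctx[OF f]
 have "(%a. if f a = 0 then 0 else 1) = (%a. of_bool (f a ~= 0) :: nat)" by auto
 with cmp_if[OF f cmp_const[OF c, of 1] cmp_const[OF c, of 0]]
 have "cmp D sz w V (%a. of_bool (f a ~= 0))" by simp
 moreover have "pbd D sz (%a. of_bool (f a ~= 0))" by (rule pbd_mono[OF pbd_const[OF c, of 1]]) auto
 ultimately show ?thesis by (simp add: sm_def)
qed

lemma sm_not:
 assumes "sm D sz w V (%a. of_bool (P a))" shows "sm D sz w V (%a. of_bool (\<not> P a))"
proof -
 have "(%a. 1 - of_bool (P a)) = (%a. of_bool (\<not> P a) :: nat)" by auto
 with sm_diff[OF sm_const[OF sm_ctx[OF assms], of 1] assms] show ?thesis by simp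
qed

lemma sm_less:
 assumes "sm D sz w V f" "sm D sz w V g" shows "sm D sz w V (%a. of_bool (f a < g a))"
proof -
 have "(%a. of_bool (g a - f a ~= 0)) = (%a. of_bool (f a < g a) :: nat)" by auto
 with sm_nonzero[OF sm_cmp[OF sm_diff[OF assms(2,1)]]] show ?thesis by metis
qed

lemma sm_le:
 assumes "sm D sz w V f" "sm D sz w V g" shows "sm D sz w V (%a. of_bool (f a <= g a))"
 using sm_not[OF sm_less[OF assms(2,1)]] by (simp add: not_less)

lemma sm_conj:
 assumes "sm D sz w V (%a. of_bool (P a))" "sm D sz w V (%a. of_bool (Q a))"
 shows "sm D sz w V (%a. of_bool (P a & Q a))"
proof -
 have "(%a. of_bool (P a) * of_bool (Q a)) = (%a. of_bool (P a & Q a) :: nat)" by auto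
 with sm_mult[OF assms] show ?thesis by simp
qed

lemma sm_disj:
 assumes "sm D sz w V (%a. of_bool (P a))" "sm D sz w V (%a. of_bool (Q a))"
 shows "sm D sz w V (%a. of_bool (P a \<or> Q a))"
 using sm_not[OF sm_conj[OF sm_not[OF assms(1)] sm_not[OF assms(2)]]] by simp

lemma sm_eq:
 assumes "sm D sz w V f" "sm D sz w V g" shows "sm D sz w V (%a. of_bool (f a = g a))"
 using sm_conj[OF sm_le[OF assms] sm_le[OF assms(2,1)]] by (simp add: eq_iff[symmetric])

lemma sm_ex:
 assumes K: "sm D sz w V K"
  and G: "inner ctx D K sz w V ==>
   inner sm D K sz w V (%c. snd c) ==>
   inner sm D K sz w V (%c. of_bool (P (fst c) (snd c)))"
 shows "sm D sz w V (%a. of_bool (EX i<K a. P a i))"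
proof -
 have "((\<Sum>i<K a. of_bool (P a i)) ~= (0::nat)) = (EX i<K a. P a i)" for a by auto
 with sm_nonzero[OF sm_cmp[OF sm_sum[OF K G]]] show ?thesis by simp
qed

lemma sm_all:
 assumes K: "sm D sz w V K"
  and G: "inner ctx D K sz w V ==>
   inner sm D K sz w V (%c. snd c) ==>
   inner sm D K sz w V (%c. of_bool (P (fst c) (snd c)))"
 shows "sm D sz w V (%a. of_bool (ALL i<K a. P a i))"
 using sm_not[OF sm_ex[OF K sm_not[OF G]]] by simp

lemma sm_mod:
 assumes x: "sm D sz w V x" and d: "sm D sz w V d" shows "sm D sz w V (%a. x a mod d a)"
proof -
 have "cmp D sz w V (%a. x a mod d a)"
 proof (rule cmp_fold_small[where it = "%a i. i mod d a" and ini = "%_. 0"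
    and F = "%a i x. if Suc x = d a then 0 else Suc x" and g = x, OF x cmp_zero[OF sm_ctx[OF x]]])
  show "psz D sz x" by (rule cmp_psz[OF sm_cmp[OF x]])
  let ?D = "{(a, i, y). a : D & i < x a & y = i mod d a}"
  let ?V = "xG2 V"
  assume ctx: "ctx ?D (up sz) (up w) ?V"
  have sub: "fst ` ?D \<subseteq> D" by auto
  have "sm ?D (up sz) (up w) ?V (%c. d (fst c))"
   unfolding sm_def
   by (intro conjI cmp_mono[OF cmp_comp[OF sm_cmp[OF d] sub] _ ctx] pbd_comp[OF sm_pbd[OF d] sub]) auto
  moreover have "sm ?D (up sz) (up w) ?V (%c. snd (snd c))"
   unfolding sm_def
  proof (intro conjI cmp_var[OF ctx])
   show "pbd ?D (up sz) (%c. snd (snd c))"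
    by (rule pbd_mono[OF pbd_comp[OF sm_pbd[OF x] sub]]) (auto intro!: order_trans[OF mod_less_eq_dividend])
  qed auto
  ultimately show "cmp ?D (up sz) (up w) ?V
    (%c. if Suc (snd (snd c)) = d (fst c) then 0 else Suc (snd (snd c)))"
   by (intro cmp_If sm_eq sm_Suc cmp_const[OF ctx] sm_cmp[OF sm_Suc])
 qed (auto simp: mod_Suc intro!: order_trans[OF mod_less_eq_dividend])
 moreover have "pbd D sz (%a. x a mod d a)" by (rule pbd_mono[OF sm_pbd[OF x]]) simp
 ultimately show ?thesis by (simp add: sm_def)
qed

lemma sm_dvd:
 assumes "sm D sz w V d" "sm D sz w V x" shows "sm D sz w V (%a. of_bool (d a dvd x a))"
 using sm_eq[OF sm_mod[OF assms(2,1)] sm_const[OF sm_ctx[OF assms(1)], of 0]] by (simp add: dvd_eq_mod_eq_0)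

text \<open>Counting multiples of \<open>d\<close> makes division a bounded sum, for which there is
  a rule.\<close>

lemma nat_div_eq_sum: "x div d = (\<Sum>i<x. of_bool (d dvd Suc i))" for x d :: nat
proof (cases "d = 0")
 case False
 thus ?thesis by (induction x) (auto simp: div_Suc dvd_eq_mod_eq_0)
qed simp

lemma sm_div:
 assumes x: "sm D sz w V x" and d: "sm D sz w V d" shows "sm D sz w V (%a. x a div d a)"
 unfolding nat_div_eq_sum by (rule sm_sum[OF x]) (intro sm_dvd sm_Suc sm_lift[OF d])

lemma cmp_pow2:
 assumes e: "sm D sz w V e" shows "cmp D sz w V (%a. 2 ^ e a)"
proof (rule cmp_fold_small[where it = "%a i. 2 ^ i" and ini = "%_. 1"
   and F = "%a i x. 2 * x" and g = "%a. 2 ^ e a", OF e cmp_const[OF sm_ctx[OF e]]])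
 have "pbd D sz (%a. e a + 1)" by (rule pbd_add[OF sm_ctx[OF e] sm_pbd[OF e] pbd_const[OF sm_ctx[OF e]]])
 thus "psz D sz (%a. 2 ^ e a)" unfolding psz_def by (intro exI[of _ "%a. e a + 1"]) simp
qed (auto intro!: cmp_dbl cmp_var)

lemma cmp_shift:
 assumes A: "cmp D sz w V A" and i: "sm D sz w V i" shows "cmp D sz w V (%a. A a div 2 ^ i a)"
proof (rule cmp_fold_small[where it = "%a j. A a div 2 ^ j" and ini = A
   and F = "%a i x. x div 2" and g = A, OF i A])
 show "psz D sz A" by (rule cmp_psz[OF A])
 show "A a div 2 ^ Suc j = A a div 2 ^ j div 2" for a j by (simp add: div_mult2_eq[symmetric] mult.commute)
qed (auto intro!: cmp_half cmp_var)

lemma sm_bit: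
 assumes A: "cmp D sz w V A" and i: "sm D sz w V i"
 shows "sm D sz w V (%a. A a div 2 ^ i a mod 2)"
proof -
 have "pbd D sz (%a. A a div 2 ^ i a mod 2)" by (rule pbd_mono[OF pbd_const[OF cmp_ctx[OF A], of 1]]) auto
 with cmp_parity[OF cmp_shift[OF A i]] show ?thesis by (simp add: sm_def)
qed

text \<open>The number of binary digits; since it never exceeds \<open>x\<close>, the range of
  summation is long enough.\<close>

definition lg :: "nat => nat" where
 "lg x = (\<Sum>i<x. of_bool (x div 2 ^ i ~= 0))"

lemma sm_lg:
 assumes "sm D sz w V x" shows "sm D sz w V (%a. lg (x a))"
 unfolding lg_def
 by (rule sm_sum[OF assms]) (intro sm_nonzero cmp_shift cmp_lift[OF sm_cmp[OF assms]])

primrec last_such :: "(nat => bool) => nat => nat" where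
 "last_such P 0 = 0"
| "last_such P (Suc i) = (if P i then i else last_such P i)"

lemma last_such_le: "last_such P i <= i"
 by (induction i) auto

lemma sm_last_such:
 assumes K: "sm D sz w V K"
  and G: "inner ctx D K sz w V ==>
   inner sm D K sz w V (%c. snd c) ==>
   inner sm D K sz w V (%c. of_bool (P (fst c) (snd c)))"
 shows "sm D sz w V (%a. last_such (P a) (K a))"
proof -
 have cx: "inner ctx D K sz w V"
  by (rule ctx_x[OF sm_ctx[OF K] psz_of_pbd[OF sm_pbd[OF K]]])
 note G = G[OF cx sm_xvar[OF cx sm_pbd[OF K]]]
 have "cmp D sz w V (%a. last_such (P a) (K a))"
 proof (rule cmp_fold_small[where it = "%a i. last_such (P a) i" and ini = "%_. 0" and F = "%a i x. if P a i then i else x"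
    and g = K, OF K cmp_zero[OF sm_ctx[OF K]]])
  show "psz D sz K" by (rule cmp_psz[OF sm_cmp[OF K]])
  let ?D = "{(a, i, x). a : D & i < K a & x = last_such (P a) i}"
  let ?V = "xG2 V"
  assume ctx: "ctx ?D (up sz) (up w) ?V"
  have "sm ?D (up sz) (up w) ?V (%c. of_bool (P (fst c) (fst (snd c))))"
   unfolding sm_def
   by (intro conjI cmp_unx[OF sm_cmp[OF G] ctx] pbd_unx[OF sm_pbd[OF G]]) auto
  thus "cmp ?D (up sz) (up w) ?V (%c. if P (fst c) (fst (snd c)) then fst (snd c) else snd (snd c))"
   by (intro cmp_If cmp_var[OF ctx]) auto
 qed (auto intro: order_trans[OF last_such_le])
 moreover have "pbd D sz (%a. last_such (P a) (K a))" by (rule pbd_mono[OF sm_pbd[OF K] last_such_le])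
 ultimately show ?thesis by (simp add: sm_def)
qed

text \<open>\<open>0\<close> stands for infinity.\<close>

primrec min_over :: "(nat => bool) => (nat => nat) => nat => nat" where
 "min_over P f 0 = 0"
| "min_over P f (Suc i) = (if P i & (min_over P f i = 0 \<or> f i < min_over P f i) then f i else min_over P f i)"

lemma min_over_cases: "min_over P f k = 0 \<or> (EX i<k. P i & min_over P f k = f i)"
 by (induction k) (auto simp: less_Suc_eq)

lemma min_over_le: "i < k ==> P i ==> (!!i. P i ==> f i > 0) ==> min_over P f k <= f i & min_over P f k > 0"
 by (induction k) (auto simp: less_Suc_eq not_less intro: order_trans less_imp_le)

text \<open>The minimum is small although the range may be exponential; the number of rounds enters
  through \<open>\<kappa>\<close>.\<close>

lemma sm_min_over:
 assumes K: "cmp D sz w V K" and p: "pbd D sz p" "!!a. a : D ==> K a <= \<kappa> a * p a" "!!a. a : D ==> 1 <= \<kappa> a"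
  and P: "inner ctx D K sz w V ==>
   inner sm D K sz w V (%c. of_bool (P (fst c) (snd c)))"
  and G: "inner ctx D K sz w V ==>
   inner sm D K sz w V (%c. G (fst c) (snd c))"
 shows "sm D sz (%a. \<kappa> a * w a) V (%a. min_over (P a) (G a) (K a))"
proof -
 have c: "ctx D sz w V" by (rule cmp_ctx[OF K])
 have cx: "inner ctx D K sz w V" by (rule ctx_x[OF c cmp_psz[OF K]])
 note P = P[OF cx] and G = G[OF cx]
 from sm_pbd[OF G] obtain e where e: "ALL c:xD D K. G (fst c) (snd c) <= sz (fst c) ^ e" by (auto simp: pbd_def)
 have le: "min_over (P a) (G a) i <= sz a ^ e" if "a : D" "i <= K a" for a i
  using min_over_cases[of "P a" "G a" i] e that by (force simp: xD_def)
 have b: "pbd D sz (%a. sz a ^ e)" by (intro pbd_power[OF c] pbd_sz)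
 have "cmp D sz (%a. \<kappa> a * w a) V (%a. min_over (P a) (G a) (K a))"
 proof (rule cmp_fold[where it = "%a i. min_over (P a) (G a) i" and ?f0.0 = "%_. 0"
   and F = "%a i x. if P a i & (x = 0 \<or> G a i < x) then G a i else x"
    and g = "%a. sz a ^ e", OF K cmp_zero[OF c] _ _ _ b _ p])
  let ?D = "{(a, i, x). a : D & i < K a & x = min_over (P a) (G a) i}"
  let ?V = "xG2 V"
  assume ctx: "ctx ?D (up sz) (up w) ?V"
  have sub: "fst ` ?D \<subseteq> D" by auto
  have "sm ?D (up sz) (up w) ?V (%c. of_bool (P (fst c) (fst (snd c))))"
   unfolding sm_def
   by (intro conjI cmp_unx[OF sm_cmp[OF P] ctx] pbd_unx[OF sm_pbd[OF P]]) auto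
  moreover have "sm ?D (up sz) (up w) ?V (%c. G (fst c) (fst (snd c)))"
   unfolding sm_def
   by (intro conjI cmp_unx[OF sm_cmp[OF G] ctx] pbd_unx[OF sm_pbd[OF G]]) auto
  moreover have "sm ?D (up sz) (up w) ?V (%c. snd (snd c))"
   unfolding sm_def
  proof (intro conjI cmp_var[OF ctx])
   show "pbd ?D (up sz) (%c. snd (snd c))"
    by (rule pbd_mono[OF pbd_comp[OF b sub]]) (auto intro!: le)
  qed auto
  ultimately show "cmp ?D (up sz) (up w) ?V
    (%c. if P (fst c) (fst (snd c)) & (snd (snd c) = 0 \<or> G (fst c) (fst (snd c)) < snd (snd c))
     then G (fst c) (fst (snd c)) else snd (snd c))"
   by (intro sm_cmp sm_If sm_conj sm_disj sm_eq sm_less sm_const[OF ctx])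
 qed (auto intro: le_less_trans[OF le less_exp])
 moreover have "pbd D sz (%a. min_over (P a) (G a) (K a))" by (rule pbd_mono[OF b le]) auto
 ultimately show ?thesis by (simp add: sm_def)
qed

primrec arg_max_below :: "(nat => nat) => nat => nat" where
 "arg_max_below f 0 = 0"
| "arg_max_below f (Suc i) = (if f (arg_max_below f i) < f i then i else arg_max_below f i)"

lemma arg_max_below_less: "0 < k ==> arg_max_below f k < k"
 by (induction k) (auto simp: less_Suc_eq)

lemma arg_max_below_max: "i < k ==> f i <= f (arg_max_below f k)"
 by (induction k) (auto simp: less_Suc_eq intro: order_trans less_imp_le)

lemma cmp_arg_max_below:
 assumes K: "cmp D sz w V K" and p: "pbd D sz p" "!!a. a : D ==> K a <= \<kappa> a * p a" "!!a. a : D ==> 1 <= \<kappa> a"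
  and G: "inner ctx D K sz w V ==>
   inner sm D K sz w V (%c. G (fst c) (snd c))"
 shows "cmp D sz (%a. \<kappa> a * w a) V (%a. arg_max_below (G a) (K a))"
proof -
 have c: "ctx D sz w V" by (rule cmp_ctx[OF K])
 have cx: "inner ctx D K sz w V" by (rule ctx_x[OF c cmp_psz[OF K]])
 note G = G[OF cx]
 from cmp_psz[OF K] obtain g where g: "pbd D sz g" "ALL a:D. K a < 2 ^ g a" by (auto simp: psz_def)
 have le: "arg_max_below f i <= i" for f i using arg_max_below_less[of i f] by (cases i) auto
 show ?thesis
 proof (rule cmp_fold[where it = "%a i. arg_max_below (G a) i" and ?f0.0 = "%_. 0"
   and F = "%a i x. if G a x < G a i then i else x" and g = g, OF K cmp_zero[OF c] _ _ _ g(1) _ p])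
  let ?D = "{(a, i, x). a : D & i < K a & x = arg_max_below (G a) i}"
  let ?V = "xG2 V"
  assume ctx: "ctx ?D (up sz) (up w) ?V"
  have "sm ?D (up sz) (up w) ?V (%c. G (fst c) (fst (snd c)))"
   unfolding sm_def
   by (intro conjI cmp_unx[OF sm_cmp[OF G] ctx] pbd_unx[OF sm_pbd[OF G]]) auto
  moreover have "sm ?D (up sz) (up w) ?V (%c. G (fst c) (snd (snd c)))"
  proof -
   \<comment> \<open>The index kept in the accumulator lies in the range too, so the program for
     \<open>G\<close> can be run on it: the best value is recomputed in every round instead of being
     stored.\<close>
   have sub: "(%c. (fst c, snd (snd c))) ` ?D \<subseteq> xD D K"
   proof -
    have "arg_max_below (G a) i < K a" if "i < K a" for a i using le[of "G a" i] that by linarith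
    thus ?thesis by (auto simp: xD_def)
   qed
   have "cmp ?D (up sz) (up w) (map (%g c. g (fst c, snd (snd c))) (xG V))
     (%c. G (fst c) (snd (snd c)))"
    using cmp_comp[OF sm_cmp[OF G] sub] by simp
   hence "cmp ?D (up sz) (up w) ?V (%c. G (fst c) (snd (snd c)))"
    by (rule cmp_mono[OF _ _ ctx]) (auto simp: xG_def)
   with pbd_comp[OF sm_pbd[OF G] sub] show ?thesis by (simp add: sm_def)
  qed
  ultimately show "cmp ?D (up sz) (up w) ?V
    (%c. if G (fst c) (snd (snd c)) < G (fst c) (fst (snd c)) then fst (snd c) else snd (snd c))"
   by (intro cmp_If sm_less cmp_var[OF ctx]) auto
 next
  fix a i assume "a : D" "i <= K a"
  moreover from this have "arg_max_below (G a) i <= K a" using le[of "G a" i] by linarith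
  ultimately show "arg_max_below (G a) i < 2 ^ g a" using g(2) by (auto intro: le_less_trans)
 qed auto
qed

section \<open>The algorithm\<close>

text \<open>The number theory is rephrased with bounded sums and bounded quantifiers, to which the
  rules for \<open>sm\<close> apply mechanically.\<close>

definition cop :: "nat => nat => bool" where
 "cop t m \<longleftrightarrow> (ALL e<Suc m. \<not> (2 <= e & e dvd t & e dvd m))"

definition tot :: "nat => nat" where
 "tot m = (\<Sum>t<m. of_bool (cop t m))"

definition sqf :: "nat => bool" where
 "sqf m \<longleftrightarrow> (ALL e<Suc m. \<not> (2 <= e & e * e dvd m))"

text \<open>The largest candidate promises the best density; the range suffices by
  \<open>squarefree_le_totient\<close>.\<close>

definition md :: "nat => nat" where
 "md n = last_such (%m. sqf m & 2 * tot m = n) (Suc (n * n))"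

text \<open>The \<open>j\<close>-th unit modulo \<open>m\<close> in increasing order, picked out as
  the only nonzero term.\<close>

definition unit :: "nat => nat => nat" where
 "unit m j = (\<Sum>t<m. if cop t m & (\<Sum>s<t. of_bool (cop s m)) = j then t else 0)"

definition prm :: "nat => bool" where
 "prm p \<longleftrightarrow> 2 <= p & (ALL e<p. \<not> (2 <= e & e dvd p))"

definition om :: "nat => nat => nat" where
 "om m t = (\<Sum>p<Suc m. of_bool (prm p & p dvd m & p dvd t))"

text \<open>Every prime divides 0, so the exponent is the number of primes of \<open>md n\<close>.
  The value bounds the squared diagonal entries in \<open>gram_factor\<close>.\<close>

definition DD :: "nat => nat" where
 "DD n = 2 ^ om (md n) 0"

text \<open>At the critical radius \<open>r\<^sup>2\<close> is at most
  \<open>T * DD n * n / 2\<close>, so this choice gives \<open>4 * r\<^sup>2 <= T\<^sup>2\<close>.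
  The factor \<open>lg n\<close> also makes the error terms of the averaging small.\<close>

definition TT :: "nat => nat" where
 "TT n = n * DD n * lg n"

text \<open>Makes the square of \<open>NN n\<close> exceed n^3 T^2 lg n, by a factor of 8 at most:
  this is what the second moment over a grid cell demands. With a power of 2 the digits of a
  multiplier are blocks of bits.\<close>

definition bb :: "nat => nat" where
 "bb n = lg (n * n * n * (TT n * TT n) * lg n) div 2 + 1"

definition NN :: "nat => nat" where
 "NN n = 2 ^ bb n"

text \<open>\<open>2 ^ bs n\<close> is the typical size of a coordinate of a short \<open>x\<close>,
  about sqrt n up to lower order factors; what exceeds it goes into a quotient.\<close>

definition bs :: "nat => nat" where
 "bs n = lg (n * (DD n * DD n) * lg n) div 2 + 1"

definition dim2 :: "nat => nat" where
 "dim2 n = n div 2"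

definition Lq :: "nat => nat" where
 "Lq n = dim2 n + 2 * n"

definition Lx :: "nat => nat" where
 "Lx n = 2 * Lq n + bs n * dim2 n"

definition digit :: "nat => nat => nat => nat => nat" where
 "digit c b A i = (\<Sum>l<b. A div 2 ^ (c + (b * i + l)) mod 2 * 2 ^ l)"

text \<open>\<open>e\<close> modulo \<open>NN n\<close>, with \<open>NN n - 1\<close> standing for
  -1; adding \<open>md n\<close> keeps the subtraction from truncating.\<close>

definition eps :: "nat => nat => nat => nat" where
 "eps n t j = (if md n dvd t * (t + md n - j) then (if om (md n) t mod 2 = 0 then 1 else NN n - 1) else 0)"

definition gram :: "nat => nat => nat => nat" where
 "gram n j k = (\<Sum>t<md n. of_bool (md n dvd t * (t + md n - unit (md n) j) & md n dvd t * (t + md n - unit (md n) k)))"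

text \<open>Matrix of multiplication by the multiplier with digits \<open>A\<close>, modulo
  \<open>NN n\<close>: coordinate \<open>k\<close> of the image of the \<open>j\<close>-th basis
  vector.\<close>

definition WW :: "nat => nat => nat => nat => nat" where
 "WW n A j k = (\<Sum>i<dim2 n. digit 0 (bb n) A i * eps n ((unit (md n) k + md n - i) mod md n) (unit (md n) j)) mod NN n"

text \<open>Ones separate and zeros count: this is the length of the \<open>j\<close>-th run of
  zeros among the \<open>L\<close> bits from \<open>c\<close> on.\<close>

definition runs :: "nat => nat => nat => nat => nat" where
 "runs c L X j = (\<Sum>t<L. of_bool (X div 2 ^ (c + t) mod 2 = 0 & (\<Sum>s<t. X div 2 ^ (c + s) mod 2) = j))"

text \<open>A coordinate is \<open>xp\<close> minus \<open>xn\<close>. Its quotient is split by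
  sign; the remainder, never negative, goes to \<open>xp\<close>.\<close>

definition xp :: "nat => nat => nat => nat" where
 "xp n X j = 2 ^ bs n * runs 0 (Lq n) X j + digit (2 * Lq n) (bs n) X j"

definition xn :: "nat => nat => nat => nat" where
 "xn n X j = 2 ^ bs n * runs (Lq n) (Lq n) X j"

text \<open>The quadratic form at the difference of \<open>p\<close> and \<open>q\<close>, with the
  negative terms collected in a single subtraction.\<close>

definition quad :: "nat => (nat => nat) => (nat => nat) => nat" where
 "quad n p q = (\<Sum>j<dim2 n. \<Sum>k<dim2 n. gram n j k * (p j * p k + q j * q k)) -
   (\<Sum>j<dim2 n. \<Sum>k<dim2 n. gram n j k * (p j * q k + q j * p k))"

definition ww :: "nat => nat => nat => nat => nat" where
 "ww n A X k = (\<Sum>j<dim2 n. (xp n X j + (NN n - 1) * xn n X j) mod NN n * WW n A j k) mod NN n"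

text \<open>Together with \<open>wn\<close> this represents the residue of least absolute
  value.\<close>

definition wp :: "nat => nat => nat => nat => nat" where
 "wp n A X k = (if 2 * ww n A X k < NN n then ww n A X k else 0)"

definition wn :: "nat => nat => nat => nat => nat" where
 "wn n A X k = (if 2 * ww n A X k < NN n then 0 else NN n - ww n A X k)"

definition qx :: "nat => nat => nat" where
 "qx n X = quad n (xp n X) (xn n X)"

text \<open>The squared norm, multiplied by the square of \<open>NN n\<close> to make it an
  integer.\<close>

definition val :: "nat => nat => nat => nat" where
 "val n A X = NN n * NN n * qx n X + TT n * TT n * quad n (wp n A X) (wn n A X)"

text \<open>Vectors with first half 0 are left out: their second half is divisible by
  \<open>NN n\<close>, which makes them long anyway.\<close>

definition minval :: "nat => nat => nat" where
 "minval n A = min_over (%X. qx n X ~= 0) (val n A) (2 ^ Lx n)"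

definition best :: "nat => nat" where
 "best n = arg_max_below (minval n) (2 ^ (bb n * dim2 n))"

text \<open>Gram matrix of the lattice scaled by \<open>NN n\<close>, in the basis of all (0, T N
  e_j) followed by all (N e_j, T W_j). The scaling keeps it integral and does not affect the
  density.\<close>

definition entry :: "nat => nat => nat => nat => nat" where
 "entry n A i j = (if i < dim2 n then
    (if j < dim2 n then TT n * TT n * (NN n * NN n) * gram n i j
    else TT n * TT n * NN n * (\<Sum>k<dim2 n. gram n i k * WW n A (j - dim2 n) k))
   else
    (if j < dim2 n then TT n * TT n * NN n * (\<Sum>k<dim2 n. gram n j k * WW n A (i - dim2 n) k)
    else TT n * TT n * (\<Sum>k<dim2 n. \<Sum>l<dim2 n. gram n k l * (WW n A (i - dim2 n) k * WW n A (j - dim2 n) l)) +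
     NN n * NN n * gram n (i - dim2 n) (j - dim2 n)))"

lemma lg_eq:
 assumes "2 ^ k <= x" "x < 2 ^ Suc k"
 shows "lg x = Suc k"
proof -
 have "x div 2 ^ i ~= 0 \<longleftrightarrow> i < Suc k" for i
 proof
  assume "x div 2 ^ i ~= 0"
  hence "2 ^ i <= x" by (metis div_less not_le)
  hence "(2::nat) ^ i < 2 ^ Suc k" using assms(2) by linarith
  from power_less_imp_less_exp[OF _ this] show "i < Suc k" by simp
 next
  assume "i < Suc k"
  hence "(2::nat) ^ i <= 2 ^ k" by (intro power_increasing) auto
  hence "2 ^ i <= x" using assms(1) by linarith
  thus "x div 2 ^ i ~= 0" by (simp add: div_eq_0_iff not_less)
 qed
 hence "lg x = card ({..<x} \<inter> {..<Suc k})" by (simp add: lg_def Int_def lessThan_def)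
 moreover have "Suc k <= x" using assms(1) less_exp[of k] by linarith
 ultimately show ?thesis by (simp add: Int_absorb1 flip: lessThan_subset_iff)
qed

lemma lg_bounds:
 assumes "x > 0" shows "2 ^ lg x <= 2 * x" "x < 2 ^ lg x"
proof -
 from assms obtain k where "2 ^ k <= x" "x < 2 ^ (k + 1)" using ex_power_ivl1[of 2 x] by auto
 with lg_eq[of k x] show "2 ^ lg x <= 2 * x" "x < 2 ^ lg x" by auto
qed

lemma pow_half_lg: "2 ^ (lg x div 2 + 1) <= 2 + 4 * x"
proof (cases "x = 0")
 case False
 have "(2::nat) ^ (lg x div 2 + 1) <= 2 ^ (lg x + 1)" by (intro power_increasing) auto
 moreover have "(2::nat) ^ (lg x + 1) = 2 * 2 ^ lg x" by simp
 ultimately show ?thesis using lg_bounds(1)[of x] False by linarith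
qed (simp add: lg_def)

section \<open>Computability of the algorithm\<close>

text \<open>\<open>DD n\<close> is exponential in a number of primes, so its polynomial growth has
  to be a condition on the set \<open>S\<close> of admissible inputs.\<close>

definition gd :: "nat set => 'a set => ('a => nat) => ('a => nat) => ('a => nat) list => ('a => nat) => bool" where
 "gd S D sz w V n \<longleftrightarrow> sm D sz w V n & (ALL a:D. n a : S & n a <= sz a) & (EX c. ALL n:S. DD n <= n ^ c)"

lemma gd_sm: "gd S D sz w V n ==> sm D sz w V n"
 by (simp add: gd_def)

lemma gd_lift:
 assumes "gd S D sz w V n" "inner ctx D K sz w V"
 shows "inner (gd S) D K sz w V (%c. n (fst c))"
 using assms sm_lift[OF _ assms(2)] by (auto simp: gd_def xD_def)

lemma gd_ctx: "gd S D sz w V n ==> ctx D sz w V"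
 using gd_sm sm_ctx by blast

lemmas base_rules = sm_const sm_xvar sm_lift cmp_lift gd_lift
lemmas op_rules = sm_add sm_Suc sm_diff sm_mult sm_bit sm_mod sm_div sm_sum sm_ex sm_all sm_conj sm_disj sm_If
 sm_not sm_less sm_le sm_eq sm_dvd sm_lg sm_last_such

lemma sm_cop:
 assumes "sm D sz w V t" "sm D sz w V m"
 shows "sm D sz w V (%a. of_bool (cop (t a) (m a)))"
 unfolding cop_def by (assumption | rule base_rules assms sm_ctx[OF assms(1)] op_rules)+

lemma sm_tot:
 assumes "sm D sz w V m"
 shows "sm D sz w V (%a. tot (m a))"
 unfolding tot_def by (assumption | rule base_rules assms sm_ctx[OF assms(1)] sm_cop op_rules)+

lemma sm_sqf:
 assumes "sm D sz w V m"
 shows "sm D sz w V (%a. of_bool (sqf (m a)))"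
 unfolding sqf_def by (assumption | rule base_rules assms sm_ctx[OF assms(1)] sm_cop op_rules)+

lemma sm_md:
 assumes "sm D sz w V n"
 shows "sm D sz w V (%a. md (n a))"
 unfolding md_def by (assumption | rule base_rules assms sm_ctx[OF assms(1)] sm_sqf sm_tot op_rules)+

lemma sm_unit:
 assumes "sm D sz w V m" "sm D sz w V j"
 shows "sm D sz w V (%a. unit (m a) (j a))"
 unfolding unit_def by (assumption | rule base_rules assms sm_ctx[OF assms(1)] sm_cop op_rules)+

lemma sm_prm:
 assumes "sm D sz w V p"
 shows "sm D sz w V (%a. of_bool (prm (p a)))"
 unfolding prm_def by (assumption | rule base_rules assms sm_ctx[OF assms(1)] op_rules)+

lemma sm_om:
 assumes "sm D sz w V m" "sm D sz w V t"
 shows "sm D sz w V (%a. om (m a) (t a))"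
 unfolding om_def by (assumption | rule base_rules assms sm_ctx[OF assms(1)] sm_prm op_rules)+

lemma sm_DD:
 assumes "gd S D sz w V n"
 shows "sm D sz w V (%a. DD (n a))"
proof -
 from assms obtain c where c: "ALL n:S. DD n <= n ^ c" and n: "ALL a:D. n a : S & n a <= sz a"
  by (auto simp: gd_def)
 have "pbd D sz (%a. DD (n a))" unfolding pbd_def
  using c n by (meson order_trans power_mono zero_le)
 moreover have "cmp D sz w V (%a. DD (n a))" unfolding DD_def
  by (rule cmp_pow2) (assumption | rule base_rules gd_sm[OF assms] gd_ctx[OF assms] sm_om sm_md)+
 ultimately show ?thesis by (simp add: sm_def)
qed

lemma sm_TT:
 assumes "gd S D sz w V n"
 shows "sm D sz w V (%a. TT (n a))"
 unfolding TT_def by (assumption | rule gd_sm[OF assms] sm_DD[OF assms] op_rules)+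

lemma sm_pow2:
 assumes "sm D sz w V e" "pbd D sz (%a. 2 ^ e a)"
 shows "sm D sz w V (%a. 2 ^ e a)"
 using cmp_pow2[OF assms(1)] assms(2) by (simp add: sm_def)

lemma sm_half_lg:
 assumes "sm D sz w V x"
 shows "sm D sz w V (%a. 2 ^ (lg (x a) div 2 + 1))"
proof (rule sm_pow2)
 show "sm D sz w V (%a. lg (x a) div 2 + 1)"
  by (assumption | rule sm_const assms sm_ctx[OF assms(1)] op_rules)+
 have "sm D sz w V (%a. 2 + 4 * x a)"
  by (assumption | rule sm_const assms sm_ctx[OF assms(1)] op_rules)+
 from sm_pbd[OF this] show "pbd D sz (%a. 2 ^ (lg (x a) div 2 + 1))"
  by (rule pbd_mono) (rule pow_half_lg)
qed

lemma sm_bb: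
 assumes "gd S D sz w V n"
 shows "sm D sz w V (%a. bb (n a))"
 unfolding bb_def by (assumption | rule sm_const gd_ctx[OF assms] gd_sm[OF assms] sm_TT[OF assms] op_rules)+

lemma sm_NN:
 assumes "gd S D sz w V n"
 shows "sm D sz w V (%a. NN (n a))"
 unfolding NN_def bb_def
 by (assumption | rule sm_half_lg gd_sm[OF assms] sm_TT[OF assms] sm_mult sm_lg)+

lemma sm_bs:
 assumes "gd S D sz w V n"
 shows "sm D sz w V (%a. bs (n a))"
 unfolding bs_def by (assumption | rule sm_const gd_ctx[OF assms] gd_sm[OF assms] sm_DD[OF assms] op_rules)+

lemma sm_pow_bs:
 assumes "gd S D sz w V n"
 shows "sm D sz w V (%a. 2 ^ bs (n a))"
 unfolding bs_def
 by (assumption | rule sm_half_lg gd_sm[OF assms] sm_DD[OF assms] sm_mult sm_lg)+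

lemma sm_dim2:
 assumes "gd S D sz w V n"
 shows "sm D sz w V (%a. dim2 (n a))"
 unfolding dim2_def by (assumption | rule sm_const gd_ctx[OF assms] gd_sm[OF assms] op_rules)+

lemma sm_Lq:
 assumes "gd S D sz w V n"
 shows "sm D sz w V (%a. Lq (n a))"
 unfolding Lq_def by (assumption | rule sm_const gd_ctx[OF assms] gd_sm[OF assms] sm_dim2[OF assms] op_rules)+

lemma sm_Lx:
 assumes "gd S D sz w V n"
 shows "sm D sz w V (%a. Lx (n a))"
 unfolding Lx_def
 by (assumption | rule sm_const gd_ctx[OF assms] sm_Lq[OF assms] sm_bs[OF assms] sm_dim2[OF assms] op_rules)+

lemma sm_digit:
 assumes "sm D sz w V c" "sm D sz w V b" "cmp D sz w V A" "sm D sz w V i" "pbd D sz (%a. 2 ^ b a)"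
 shows "sm D sz w V (%a. digit (c a) (b a) (A a) (i a))"
 unfolding digit_def
proof (rule sm_sum[OF assms(2)])
 let ?sz = "%c. sz (fst c)" and ?w = "%c. w (fst c)"
 assume 1: "ctx (xD D b) ?sz ?w (xG V)" and 2: "sm (xD D b) ?sz ?w (xG V) (%c. snd c)"
 have "pbd (xD D b) ?sz (%c. 2 ^ snd c)"
  by (rule pbd_mono[OF pbd_comp[OF assms(5) xD_fst]]) (auto simp: xD_def intro: power_increasing)
 from sm_pow2[OF 2 this]
 have "sm (xD D b) ?sz ?w (xG V) (%c. 2 ^ snd c)" .
 with 1 2 show "sm (xD D b) ?sz ?w (xG V)
   (%d. A (fst d) div 2 ^ (c (fst d) + (b (fst d) * i (fst d) + snd d)) mod 2 * 2 ^ snd d)"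
  apply -
  apply (rule sm_mult)
  apply (rule sm_bit)
  apply (rule cmp_lift, rule assms, assumption)
  by (assumption | rule base_rules assms op_rules)+
qed

lemma sm_eps:
 assumes "gd S D sz w V n" "sm D sz w V t" "sm D sz w V j"
 shows "sm D sz w V (%a. eps (n a) (t a) (j a))"
 unfolding eps_def
 by (assumption | rule sm_const gd_ctx[OF assms(1)] assms gd_sm[OF assms(1)] sm_NN[OF assms(1)] sm_md sm_om op_rules)+

lemma sm_gram:
 assumes "gd S D sz w V n" "sm D sz w V j" "sm D sz w V k"
 shows "sm D sz w V (%a. gram (n a) (j a) (k a))"
 unfolding gram_def
 by (assumption | rule base_rules gd_ctx[OF assms(1)] assms gd_sm[OF assms(1)] sm_md sm_unit op_rules)+

lemma sm_WW:
 assumes "gd S D sz w V n" "cmp D sz w V A" "sm D sz w V j" "sm D sz w V k"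
 shows "sm D sz w V (%a. WW (n a) (A a) (j a) (k a))"
proof -
 have p: "pbd D sz (%a. 2 ^ bb (n a))" using sm_pbd[OF sm_NN[OF assms(1)]] by (simp add: NN_def)
 show ?thesis unfolding WW_def
  by (assumption | rule base_rules gd_ctx[OF assms(1)] assms gd_sm[OF assms(1)] sm_dim2[OF assms(1)] sm_NN[OF assms(1)]
    sm_bb[OF assms(1)] sm_md sm_unit sm_digit sm_eps pbd_comp[OF p xD_fst] op_rules)+
qed

lemma sm_runs:
 assumes "sm D sz w V c" "sm D sz w V L" "cmp D sz w V X" "sm D sz w V j"
 shows "sm D sz w V (%a. runs (c a) (L a) (X a) (j a))"
 unfolding runs_def
 by (assumption | rule base_rules sm_ctx[OF assms(1)] assms op_rules)+

lemma sm_xp: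
 assumes "gd S D sz w V n" "cmp D sz w V X" "sm D sz w V j"
 shows "sm D sz w V (%a. xp (n a) (X a) (j a))"
 unfolding xp_def
 by (assumption | rule sm_const gd_ctx[OF assms(1)] assms sm_runs sm_digit sm_Lq[OF assms(1)]
   sm_pow_bs[OF assms(1)] sm_pbd[OF sm_pow_bs[OF assms(1)]] sm_bs[OF assms(1)] op_rules)+

lemma sm_xn:
 assumes "gd S D sz w V n" "cmp D sz w V X" "sm D sz w V j"
 shows "sm D sz w V (%a. xn (n a) (X a) (j a))"
 unfolding xn_def
 by (assumption | rule assms sm_runs sm_Lq[OF assms(1)] sm_pow_bs[OF assms(1)] op_rules)+

lemma sm_quad:
 assumes n: "gd S D sz w V n"
  and p: "!!K K'. inner ctx D K sz w V ==>
    inner sm D K sz w V (%c. snd c) ==>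
    inner sm D K sz w V (%c. p (fst c) (snd c))"
  and q: "!!K. inner ctx D K sz w V ==>
    inner sm D K sz w V (%c. snd c) ==>
    inner sm D K sz w V (%c. q (fst c) (snd c))"
 shows "sm D sz w V (%a. quad (n a) (p a) (q a))"
proof -
 note d = sm_dim2[OF n]
 let ?K = "%a. dim2 (n a)"
 have cx: "ctx (xD D ?K) (up sz) (up w) (xG V)"
  by (rule ctx_x[OF gd_ctx[OF n] cmp_psz[OF sm_cmp[OF d]]])
 have s: "sm (xD D ?K) (up sz) (up w) (xG V) (%c. snd c)"
  by (rule sm_xvar[OF cx sm_pbd[OF d]])
 let ?K2 = "%c. dim2 (n (fst c))"
 let ?D2 = "xD (xD D ?K) ?K2"
 have cx2: "ctx ?D2 (%c. sz (fst (fst c))) (%c. w (fst (fst c))) (xG (xG V))"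
  by (rule ctx_x[OF cx cmp_psz[OF sm_cmp[OF sm_lift[OF d cx]]]])
 have sub: "(%c. (fst (fst c), snd c)) ` ?D2 \<subseteq> xD D ?K" by (auto simp: xD_def)
 \<comment> \<open>The inner sum stands under two binders, but \<open>p\<close> and \<open>q\<close>
   see one: the outer variable is dropped by reindexing the domain.\<close>
 have swap: "sm ?D2 (%c. sz (fst (fst c))) (%c. w (fst (fst c))) (xG (xG V)) (%c. f (fst (fst c)) (snd c))"
  if f: "sm (xD D ?K) (up sz) (up w) (xG V) (%c. f (fst c) (snd c))" for f
 proof -
  have "cmp ?D2 (%c. sz (fst (fst c))) (%c. w (fst (fst c)))
    (map (%g c. g (fst (fst c), snd c)) (xG V)) (%c. f (fst (fst c)) (snd c))"
   using cmp_comp[OF sm_cmp[OF f] sub] by simp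
  hence "cmp ?D2 (%c. sz (fst (fst c))) (%c. w (fst (fst c))) (xG (xG V)) (%c. f (fst (fst c)) (snd c))"
   by (rule cmp_mono[OF _ _ cx2]) (auto simp: xG_def)
  moreover have "pbd ?D2 (%c. sz (fst (fst c))) (%c. f (fst (fst c)) (snd c))"
   using pbd_comp[OF sm_pbd[OF f] sub] by simp
  ultimately show ?thesis by (simp add: sm_def)
 qed
 note p1 = p[OF cx s] and q1 = q[OF cx s]
 note r = sm_lift[OF p1 cx2] sm_lift[OF q1 cx2] swap[OF p1] swap[OF q1]
 have "sm D sz w V (%a. \<Sum>j<dim2 (n a). \<Sum>k<dim2 (n a). gram (n a) j k * (p a j * p a k + q a j * q a k))"
    "sm D sz w V (%a. \<Sum>j<dim2 (n a). \<Sum>k<dim2 (n a). gram (n a) j k * (p a j * q a k + q a j * p a k))"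
  by (rule sm_sum[OF d], rule sm_sum[OF sm_lift[OF d cx]], rule sm_mult, rule sm_gram,
    (rule gd_lift n cx2 cx sm_lift s | assumption)+, (rule sm_add sm_mult r)+)+
 thus ?thesis unfolding quad_def by (rule sm_diff)
qed

lemma sm_ww:
 assumes "gd S D sz w V n" "cmp D sz w V A" "cmp D sz w V X" "sm D sz w V k"
 shows "sm D sz w V (%a. ww (n a) (A a) (X a) (k a))"
 unfolding ww_def
 by (assumption | rule base_rules gd_ctx[OF assms(1)] assms sm_NN sm_dim2 sm_xp sm_xn sm_WW op_rules)+

lemma sm_wp:
 assumes "gd S D sz w V n" "cmp D sz w V A" "cmp D sz w V X" "sm D sz w V k"
 shows "sm D sz w V (%a. wp (n a) (A a) (X a) (k a))"
 unfolding wp_def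
 by (assumption | rule sm_const gd_ctx[OF assms(1)] assms sm_NN sm_ww op_rules)+

lemma sm_wn:
 assumes "gd S D sz w V n" "cmp D sz w V A" "cmp D sz w V X" "sm D sz w V k"
 shows "sm D sz w V (%a. wn (n a) (A a) (X a) (k a))"
 unfolding wn_def
 by (assumption | rule sm_const gd_ctx[OF assms(1)] assms sm_NN sm_ww op_rules)+

lemma sm_qx:
 assumes "gd S D sz w V n" "cmp D sz w V X"
 shows "sm D sz w V (%a. qx (n a) (X a))"
 unfolding qx_def
 by (rule sm_quad[OF assms(1)]; rule sm_xp sm_xn; (rule gd_lift cmp_lift assms | assumption)+)

lemma sm_val:
 assumes "gd S D sz w V n" "cmp D sz w V A" "cmp D sz w V X"
 shows "sm D sz w V (%a. val (n a) (A a) (X a))"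
proof -
 have "sm D sz w V (%a. quad (n a) (wp (n a) (A a) (X a)) (wn (n a) (A a) (X a)))"
  by (rule sm_quad[OF assms(1)]; rule sm_wp sm_wn; (rule gd_lift cmp_lift assms | assumption)+)
 thus ?thesis unfolding val_def
  by (intro sm_add sm_mult sm_NN[OF assms(1)] sm_TT[OF assms(1)] sm_qx[OF assms(1,3)])
qed

lemma sm_minval:
 assumes n: "gd S D sz (%_. 1) V n" and A: "cmp D sz (%_. 1) V A"
 shows "sm D sz (%a. 2 ^ Lx (n a)) V (%a. minval (n a) (A a))"
proof -
 let ?K = "%a. 2 ^ Lx (n a)"
 have "sm D sz (%a. ?K a * 1) V (%a. min_over (%X. qx (n a) X ~= 0) (val (n a) (A a)) (?K a))"
 proof (rule sm_min_over[where p = "%_. 1"])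
  show "cmp D sz (%_. 1) V ?K" by (rule cmp_pow2[OF sm_Lx[OF n]])
  show "pbd D sz (%_. 1)" by (rule pbd_const[OF gd_ctx[OF n]])
  assume cx: "ctx (xD D ?K) (up sz) (%c. 1) (xG V)"
  note x = cmp_xvar[OF cx] and n' = gd_lift[OF n cx] and A' = cmp_lift[OF A cx]
  show "sm (xD D ?K) (up sz) (%c. 1) (xG V) (%c. of_bool (qx (n (fst c)) (snd c) ~= 0))"
   by (rule sm_nonzero[OF sm_cmp[OF sm_qx[OF n' x]]])
  show "sm (xD D ?K) (up sz) (%c. 1) (xG V) (%c. val (n (fst c)) (A (fst c)) (snd c))"
   by (rule sm_val[OF n' A' x])
 qed auto
 thus ?thesis by (simp add: minval_def)
qed

text \<open>Two nested exhaustive searches. Everything inside them is polynomial, so the number of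
  multipliers and the number of codes make up the whole remaining cost.\<close>

lemma cmp_best:
 assumes n: "gd S D sz (%_. 1) V n"
 shows "cmp D sz (%a. 2 ^ (bb (n a) * dim2 (n a)) * 2 ^ Lx (n a)) V (%a. best (n a))"
 unfolding best_def
proof (rule cmp_arg_max_below[where p = "%_. 1"])
 let ?K = "%a. 2 ^ (bb (n a) * dim2 (n a))"
 have K: "cmp D sz (%_. 1) V ?K" by (rule cmp_pow2[OF sm_mult[OF sm_bb[OF n] sm_dim2[OF n]]])
 thus "cmp D sz (%a. 2 ^ Lx (n a)) V ?K" by (rule cmp_weaken_time) simp
 show "pbd D sz (%_. 1)" by (rule pbd_const[OF gd_ctx[OF n]])
 have cx: "ctx (xD D ?K) (up sz) (%c. 1) (xG V)"
  by (rule ctx_x[OF gd_ctx[OF n] cmp_psz[OF K]])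
 show "sm (xD D ?K) (up sz) (%c. 2 ^ Lx (n (fst c))) (xG V) (%c. minval (n (fst c)) (snd c))"
  by (rule sm_minval[OF gd_lift[OF n cx] cmp_xvar[OF cx]])
qed auto

lemma sm_entry:
 assumes "gd S D sz w V n" "cmp D sz w V A" "sm D sz w V i" "sm D sz w V j"
 shows "sm D sz w V (%a. entry (n a) (A a) (i a) (j a))"
 unfolding entry_def
 by (assumption | rule base_rules gd_ctx[OF assms(1)] assms sm_NN sm_TT sm_dim2 sm_gram sm_WW op_rules)+

section \<open>Printing the Gram matrix\<close>

definition print_bits :: "nat => program" where
 "print_bits u = While (Nonempty u) (Branch (Top u) (Seq (Pop u) (Seq (Push 1 True) (Push 1 True)))
   (Seq (Pop u) (Seq (Push 1 False) (Push 1 True))))"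

lemma exec_print_bits:
 assumes "u ~= 1"
 shows "exec (print_bits u) s (5 * length (s u) + 1)
  (s(u := [], 1 := concat (map (%b. [True, b]) (rev (s u))) @ s 1))"
 using assms
proof (induction "s u" arbitrary: s)
 case Nil
 hence e: "s(u := [], 1 := concat (map (%b. [True, b]) (rev (s u))) @ s 1) = s" by auto
 have "exec (print_bits u) s 1 s"
  unfolding print_bits_def by (rule exec.WhileF) (use Nil in simp)
 thus ?case unfolding e using Nil.hyps[symmetric] by simp
next
 case (Cons b xs)
 let ?s = "s(u := xs, 1 := True # b # s 1)"
 have 1: "exec (Pop u) s 1 (s(u := xs))" using exec.Pop[of u s] Cons.hyps(2)[symmetric] by simp
 have 2: "exec (Seq (Pop u) (Seq (Push 1 b) (Push 1 True))) s (1 + (1 + 1)) ?s"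
  using exec.Seq[OF 1 exec.Seq[OF exec.Push[of 1 b] exec.Push[of 1 True]]] Cons.prems by simp
 have 3: "exec (Branch (Top u) (Seq (Pop u) (Seq (Push 1 True) (Push 1 True)))
    (Seq (Pop u) (Seq (Push 1 False) (Push 1 True)))) s (1 + (1 + (1 + 1))) ?s"
 proof (cases b)
  case True
  hence "holds (Top u) s" using Cons.hyps(2)[symmetric] by simp
  from exec.BranchT[OF this 2[unfolded True]] show ?thesis by (simp add: True)
 next
  case False
  hence "\<not> holds (Top u) s" using Cons.hyps(2)[symmetric] by simp
  from exec.BranchF[OF this 2[unfolded False]] show ?thesis by (simp add: False)
 qed
 have 4: "exec (print_bits u) ?s (5 * length xs + 1)
   (s(u := [], 1 := concat (map (%b. [True, b]) (rev (s u))) @ s 1))"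
  using Cons.hyps(1)[of ?s] Cons.prems Cons.hyps(2)[symmetric] by (simp add: fun_upd_twist)
 show ?case
  using exec.WhileT[OF _ 3 4[unfolded print_bits_def]] Cons.hyps(2)[symmetric]
  by (simp add: print_bits_def eval_nat_numeral)
qed

text \<open>The output is a stack, so the code is written from its end: the denominator 1 backwards,
  the end mark of the numerator, its digits from the highest one down, and the sign.\<close>

definition print_nat :: "nat => nat => program" where
 "print_nat r u = Seq (Push 1 False) (Seq (Push 1 True) (Seq (Push 1 True) (Seq (Push 1 False)
   (Seq (move_rev r u) (Seq (print_bits u) (Push 1 False))))))"

lemma encode_rat_of_nat:
 "encode_rat (of_nat v) = False # concat (map (%b. [True, b]) (bits v)) @ [False, True, True, False]"
proof -
 have "quotient_of (of_nat v) = (int v, 1)" using quotient_of_int[of "int v"] by simp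
 moreover have "bits (nat 1) = [True]" by (simp add: bits_pos[of "Suc 0"] bits_0)
 ultimately show ?thesis by (simp add: encode_rat_def encode_int_def encode_nat_def)
qed

lemma exec_print_nat:
 assumes "r ~= 1" "u ~= 1" "r ~= u" "s r = bits v" "s u = []"
 shows "EX t. exec (print_nat r u) s t (s(r := [], 1 := encode_rat (of_nat v) @ s 1)) & t <= 9 * length (bits v) + 7"
proof -
 let ?s1 = "s(1 := [False, True, True, False] @ s 1)"
 let ?s2 = "?s1(r := [], u := rev (bits v))"
 let ?s3 = "s(r := [], 1 := concat (map (%b. [True, b]) (bits v)) @ [False, True, True, False] @ s 1)"
 have 2: "exec (move_rev r u) ?s1 (4 * length (bits v) + 1) ?s2"
  using exec_move_rev[of r u ?s1] assms by simp
 have 3: "exec (print_bits u) ?s2 (5 * length (bits v) + 1) ?s3"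
 proof -
  have "?s2(u := [], 1 := concat (map (%b. [True, b]) (rev (?s2 u))) @ ?s2 1) = ?s3"
   using assms by (auto simp: fun_eq_iff)
  thus ?thesis using exec_print_bits[of u ?s2] assms by simp
 qed
 have 4: "exec (Push 1 False) ?s3 1 (s(r := [], 1 := encode_rat (of_nat v) @ s 1))"
  using exec.Push[of 1 False ?s3] by (simp add: encode_rat_of_nat)
 have a: "exec (Push 1 False) s 1 (s(1 := [False] @ s 1))" using exec.Push[of 1 False s] by simp
 have b: "exec (Push 1 True) (s(1 := [False] @ s 1)) 1 (s(1 := [True, False] @ s 1))"
  using exec.Push[of 1 True "s(1 := [False] @ s 1)"] by simp
 have c: "exec (Push 1 True) (s(1 := [True, False] @ s 1)) 1 (s(1 := [True, True, False] @ s 1))"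
  using exec.Push[of 1 True "s(1 := [True, False] @ s 1)"] by simp
 have d: "exec (Push 1 False) (s(1 := [True, True, False] @ s 1)) 1 ?s1"
  using exec.Push[of 1 False "s(1 := [True, True, False] @ s 1)"] by simp
 have "exec (print_nat r u) s (1 + (1 + (1 + (1 + ((4 * length (bits v) + 1) + ((5 * length (bits v) + 1) + 1))))))
   (s(r := [], 1 := encode_rat (of_nat v) @ s 1))"
  unfolding print_nat_def
  by (intro exec.Seq[OF a] exec.Seq[OF b] exec.Seq[OF c] exec.Seq[OF d] exec.Seq[OF 2] exec.Seq[OF 3] 4)
 thus ?thesis by (intro exI conjI) auto
qed

lemma concat_map_drop:
 "i < k ==> concat (map f [i..<k]) = f i @ concat (map f [Suc i..<k])"
 by (simp add: upt_conv_Cons)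

lemma algorithm_program:
 assumes N2: "!!n. n : S ==> 2 <= n" and DDb: "EX c. ALL n:S. DD n <= n ^ c"
 shows "EX P c. ALL n:S. EX t s. exec P (input n) t s &
   s 1 = concat (map (%k. encode_rat (of_nat (entry n (best n) (k div n) (k mod n)))) [0..<n * n]) &
   t <= 2 ^ (bb n * dim2 n) * 2 ^ Lx n * n ^ c"
proof -
 let ?id = "%n::nat. n"
 have ctx1: "ctx S ?id (%_. 1) [?id]"
  unfolding ctx_def using N2 psz_of_pbd[OF pbd_sz[of S ?id]] by simp
 have sm1: "sm S ?id (%_. 1) [?id] ?id"
  unfolding sm_def using cmp_var[OF ctx1] pbd_sz[of S ?id] by simp
 have gd1: "gd S S ?id (%_. 1) [?id] ?id"
  unfolding gd_def using sm1 DDb by simp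
 define w :: "nat => nat" where "w n = 2 ^ (bb n * dim2 n) * 2 ^ Lx n" for n
 have w1: "1 <= w n" for n by (simp add: w_def)
 have best: "cmp S ?id w [?id] best" using cmp_best[OF gd1] by (simp add: w_def[abs_def])
 have sq: "sm S ?id (%_. 1) [?id] (%n. n * n)" by (rule sm_mult[OF sm1 sm1])
 define D3 where "D3 = {(n, A, c). n : S & A = best n & c < n * n}"
 let ?V = "[%c. fst c, %c. fst (snd c), %c. snd (snd c)] :: (nat \<times> nat \<times> nat => nat) list"
 let ?sz = "%c :: nat \<times> nat \<times> nat. fst c"
 have sub: "fst ` D3 \<subseteq> S" by (auto simp: D3_def)
 have pb: "pbd D3 ?sz (%c. snd (snd c))"
  by (rule pbd_mono[OF pbd_comp[OF sm_pbd[OF sq] sub]]) (auto simp: D3_def)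
 have ps: "psz D3 ?sz (%c. fst (snd c))"
  by (rule psz_mono[OF psz_comp[OF cmp_psz[OF best] sub]]) (auto simp: D3_def)
 have ctx3: "ctx D3 ?sz (%_. 1) ?V"
  unfolding ctx_def using N2 ps psz_of_pbd[OF pb] psz_of_pbd[OF pbd_sz[of D3 ?sz]] by (auto simp: D3_def)
 have n3: "sm D3 ?sz (%_. 1) ?V (%c. fst c)"
  unfolding sm_def using cmp_var[OF ctx3] pbd_sz[of D3 ?sz] by simp
 have c3: "sm D3 ?sz (%_. 1) ?V (%c. snd (snd c))"
  unfolding sm_def using cmp_var[OF ctx3] pb by simp
 have A3: "cmp D3 ?sz (%_. 1) ?V (%c. fst (snd c))" using cmp_var[OF ctx3] by simp
 have gd3: "gd S D3 ?sz (%_. 1) ?V (%c. fst c)"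
  unfolding gd_def using n3 DDb by (auto simp: D3_def)
 define E where "E c = entry (fst c) (fst (snd c)) (snd (snd c) div fst c) (snd (snd c) mod fst c)" for c :: "nat \<times> nat \<times> nat"
 have ent: "sm D3 ?sz (%_. 1) ?V E"
  unfolding E_def by (intro sm_entry[OF gd3 A3] sm_div[OF c3 n3] sm_mod[OF c3 n3])
 \<comment> \<open>Registers 0 and 1 belong to input and output, so the free ones begin at
   2.\<close>
 have "length [0::nat] = length [?id]" "ALL r:set [0::nat]. r < 2" by auto
 from cmpE[OF best this] obtain P1 q1 where q1: "pbd S ?id q1"
  and P1: "!!a s. a : S ==> loaded [?id] [0] 2 a s ==> EX t. exec P1 s t (s(2 := bits (best a))) & t <= w a * q1 a"
  by metis
 have "length [0::nat] = length [?id]" "ALL r:set [0::nat]. r < 3" by auto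
 from cmpE[OF sm_cmp[OF sq] this] obtain P2 q2 where q2: "pbd S ?id q2"
  and P2: "!!a s. a : S ==> loaded [?id] [0] 3 a s ==> EX t. exec P2 s t (s(3 := bits (a * a))) & t <= 1 * q2 a"
  by metis
 have "length [0::nat, 2, 3] = length ?V" "ALL r:set [0::nat, 2, 3]. r < 4" by auto
 with sm_cmp[OF ent] have "EX P q. pbd D3 ?sz q & (ALL a:D3. ALL s. loaded ?V [0, 2, 3] 4 a s -->
   (EX t. exec P s t (s(4 := bits (E a))) & t <= 1 * q a))"
  unfolding cmp_def by blast
 then obtain P3 q3 where q3: "pbd D3 ?sz q3"
  and P3: "ALL a:D3. ALL s. loaded ?V [0, 2, 3] 4 a s --> (EX t. exec P3 s t (s(4 := bits (E a))) & t <= 1 * q3 a)"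
  by (elim exE conjE) (rule that)
 from q3 obtain e3 where e3: "ALL a:D3. q3 a <= fst a ^ e3" by (auto simp: pbd_def)
 from sm_pbd[OF ent] obtain e4 where e4: "ALL a:D3. E a <= fst a ^ e4" by (auto simp: pbd_def)
 define Bd where "Bd = Seq (dec_stack 3 4 5) (Seq P3 (print_nat 4 5))"
 define P where "P = Seq P1 (Seq P2 (While (Nonempty 3) Bd))"
 define Tb where "Tb n = 9 * (n * n) + 10 + n ^ e3 + (9 * n ^ e4 + 7)" for n :: nat
 define q where "q n = q1 n + (q2 n + ((n * n) * (Tb n + 1) + 1))" for n
 have "pbd S ?id q" unfolding q_def Tb_def
  by (intro pbd_add[OF ctx1] pbd_mult pbd_const[OF ctx1] q1 q2 pbd_power[OF ctx1] pbd_sz)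
 then obtain c where c: "ALL n:S. q n <= n ^ c" by (auto simp: pbd_def)
 have "EX t s. exec P (input n) t s &
   s 1 = concat (map (%k. encode_rat (of_nat (entry n (best n) (k div n) (k mod n)))) [0..<n * n]) &
   t <= w n * n ^ c" if n: "n : S" for n
 proof -
  let ?f = "%k. encode_rat (of_nat (E (n, best n, k)))"
  define s0 where "s0 = input n"
  have s0: "s0 0 = bits n" "r ~= 0 ==> s0 r = []" for r by (simp_all add: s0_def input_def)
  have "loaded [?id] [0] 2 n s0" using s0 by (simp add: loaded_def)
  from P1[OF n this] obtain t1 where t1: "exec P1 s0 t1 (s0(2 := bits (best n)))" "t1 <= w n * q1 n" by blast
  have "loaded [?id] [0] 3 n (s0(2 := bits (best n)))" using s0 by (simp add: loaded_def)
  from P2[OF n this] obtain t2 where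
   t2: "exec P2 (s0(2 := bits (best n))) t2 (s0(2 := bits (best n), 3 := bits (n * n)))" "t2 <= 1 * q2 n" by blast
  \<comment> \<open>The entries are printed from the last to the first, since each one is pushed on
    top of stack 1.\<close>
  define Sq where "Sq i = s0(2 := bits (best n), 3 := bits (n * n - i), 1 := concat (map ?f [n * n - i..<n * n]))" for i
  have S0: "s0(2 := bits (best n), 3 := bits (n * n)) = Sq 0"
   using s0 by (auto simp: Sq_def fun_eq_iff)
  have "EX t. exec (While (Nonempty 3) Bd) (Sq 0) t (Sq (n * n)) & t <= (\<Sum>i<n * n. Tb n + 1) + 1"
  proof (rule exec_while_count)
   show "\<not> holds (Nonempty 3) (Sq (n * n))" by (simp add: Sq_def bits_0)
   fix i assume i: "i < n * n"
   define c where "c = n * n - Suc i"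
   have c: "n * n - i = Suc c" "c < n * n" using i by (auto simp: c_def)
   let ?s1 = "(Sq i)(3 := bits c)"
   have "dec_bits (bits (Suc c)) = bits c" using bits_pred[of "Suc c"] by simp
   with exec_dec_stack[of 3 4 5 "Sq i"] True_in_bits[of "Suc c"] s0 obtain u1 where
    u1: "exec (dec_stack 3 4 5) (Sq i) u1 ?s1" "u1 <= 9 * length (bits (Suc c)) + 10"
    by (auto simp: Sq_def c)
   have D3: "(n, best n, c) : D3" using n c by (simp add: D3_def)
   have "loaded ?V [0, 2, 3] 4 (n, best n, c) ?s1"
    using s0 by (auto simp: loaded_def Sq_def less_Suc_eq numeral_3_eq_3)
   with P3 D3 obtain u2 where u2: "exec P3 ?s1 u2 (?s1(4 := bits (E (n, best n, c))))" "u2 <= 1 * q3 (n, best n, c)"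
    by blast
   let ?s2 = "?s1(4 := bits (E (n, best n, c)))"
   have "EX t. exec (print_nat 4 5) ?s2 t (?s2(4 := [], 1 := ?f c @ ?s2 1)) & t <= 9 * length (bits (E (n, best n, c))) + 7"
    by (rule exec_print_nat) (use s0 in \<open>auto simp: Sq_def\<close>)
   moreover have "?s2(4 := [], 1 := ?f c @ ?s2 1) = Sq (Suc i)"
    using s0 c concat_map_drop[of c "n * n" ?f]
    by (auto simp: Sq_def fun_eq_iff c_def[symmetric])
   ultimately obtain u3 where u3: "exec (print_nat 4 5) ?s2 u3 (Sq (Suc i))"
    "u3 <= 9 * length (bits (E (n, best n, c))) + 7" by auto
   have "exec Bd (Sq i) (u1 + (u2 + u3)) (Sq (Suc i))"
    unfolding Bd_def by (intro exec.Seq[OF u1(1)] exec.Seq[OF u2(1)] u3(1))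
   moreover have "u1 + (u2 + u3) <= Tb n"
   proof -
    have len: "length (bits x) <= x" for x :: nat using length_bits_le[OF less_exp[of x]] .
    have "length (bits (Suc c)) <= n * n" using len[of "Suc c"] c by linarith
    moreover have "q3 (n, best n, c) <= n ^ e3" using e3 D3 by force
    moreover have "length (bits (E (n, best n, c))) <= n ^ e4" using e4 D3 len[of "E (n, best n, c)"] by force
    ultimately show ?thesis using u1(2) u2(2) u3(2) unfolding Tb_def by linarith
   qed
   ultimately show "holds (Nonempty 3) (Sq i) & (EX t. exec Bd (Sq i) t (Sq (Suc i)) & t <= Tb n)"
    using c by (auto simp: Sq_def)
  qed
  then obtain t3 where t3: "exec (While (Nonempty 3) Bd) (Sq 0) t3 (Sq (n * n))"
   "t3 <= (n * n) * (Tb n + 1) + 1" by auto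
  have ex: "exec P s0 (t1 + (t2 + t3)) (Sq (n * n))" unfolding P_def
   by (intro exec.Seq[OF t1(1)] exec.Seq[OF t2(1)[unfolded S0]] t3(1))
  have "t1 + (t2 + t3) <= w n * q1 n + 1 * (q2 n + ((n * n) * (Tb n + 1) + 1))"
   using t1(2) t2(2) t3(2) unfolding mult_1 by (intro add_mono)
  also have "... <= w n * q1 n + w n * (q2 n + ((n * n) * (Tb n + 1) + 1))"
   by (intro add_left_mono mult_le_mono1 w1)
  also have "... = w n * q n" by (simp only: q_def distrib_left)
  also have "... <= w n * n ^ c" using c n by simp
  finally have "t1 + (t2 + t3) <= w n * n ^ c" .
  moreover have "Sq (n * n) 1 = concat (map (%k. encode_rat (of_nat (entry n (best n) (k div n) (k mod n)))) [0..<n * n])"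
   by (simp add: Sq_def E_def)
  ultimately show ?thesis using ex unfolding s0_def by blast
 qed
 thus ?thesis unfolding w_def by blast
qed

section \<open>Meaning of the computed quantities\<close>

lemma sum_of_bool_card: "(\<Sum>t<k. of_bool (P t)) = card {t. t < k & P t}" for k :: nat
proof -
 have "{..<k} \<inter> {t. P t} = {t. t < k & P t}" by auto
 thus ?thesis by simp
qed

lemma cop_iff:
 assumes "m > 0" shows "cop t m \<longleftrightarrow> coprime t m"
proof
 assume c: "cop t m"
 show "coprime t m"
 proof (rule ccontr)
  assume "\<not> coprime t m"
  hence "gcd t m ~= 1" by (simp only: coprime_iff_gcd_eq_1 not_False_eq_True)
  moreover have "gcd t m > 0" "gcd t m <= m" using assms by (auto intro: dvd_imp_le)
  ultimately have "2 <= gcd t m" "gcd t m < Suc m" by linarith+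
  thus False using c unfolding cop_def by (meson gcd_dvd1 gcd_dvd2)
 qed
next
 assume "coprime t m"
 thus "cop t m" unfolding cop_def by (metis Suc_1 coprime_common_divisor_nat Suc_n_not_le_n)
qed

lemma tot_eq:
 assumes "m > 1" shows "tot m = totient m"
proof -
 have "{t. t < m & cop t m} = totatives m"
 proof (intro equalityI subsetI)
  fix t assume "t : {t. t < m & cop t m}"
  hence t: "t < m" "coprime t m" using cop_iff assms by auto
  hence "t ~= 0" using assms by (intro notI) simp
  thus "t : totatives m" using t by (simp add: totatives_def)
 next
  fix t assume "t : totatives m"
  hence t: "0 < t" "t <= m" "coprime t m" by (auto simp: totatives_def)
  hence "t ~= m" using assms by (intro notI) simp
  thus "t : {t. t < m & cop t m}" using t cop_iff assms by auto
 qed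
 thus ?thesis by (simp add: tot_def sum_of_bool_card totient_def)
qed

lemma sqf_iff:
 assumes "m > 0" shows "sqf m \<longleftrightarrow> squarefree m"
proof
 assume s: "sqf m"
 show "squarefree m"
 proof (rule squarefreeI)
  fix x assume x: "x\<^sup>2 dvd m"
  have "x ~= 0" using x assms by (intro notI) simp
  moreover have "x < Suc m"
  proof -
   have "x dvd m" using x by (metis dvd_mult_left power2_eq_square)
   thus ?thesis using assms by (simp add: dvd_imp_le le_imp_less_Suc)
  qed
  ultimately show "x dvd 1" using s x unfolding sqf_def power2_eq_square by (metis One_nat_def Suc_1 dvd_refl le_SucE not_less_eq_eq le_0_eq)
 qed
next
 assume "squarefree m"
 thus "sqf m" unfolding sqf_def using squarefreeD[of m] by (metis Suc_1 Suc_n_not_le_n nat_dvd_1_iff_1 power2_eq_square)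
qed

lemma prm_iff: "prm p \<longleftrightarrow> prime p"
proof
 assume p: "prm p"
 show "prime p" unfolding prime_nat_iff
 proof (intro conjI allI impI)
  show "1 < p" using p by (simp add: prm_def)
  fix e assume e: "e dvd p"
  hence "e <= p" "e > 0" using \<open>1 < p\<close> by (auto intro: dvd_imp_le Nat.gr0I)
  thus "e = 1 \<or> e = p" using p e unfolding prm_def by (metis One_nat_def Suc_1 Suc_leI le_neq_implies_less)
 qed
next
 assume p: "prime p"
 thus "prm p" unfolding prm_def using prime_ge_2_nat[OF p]
  by (metis One_nat_def Suc_1 Suc_n_not_le_n less_irrefl prime_nat_iff)
qed

lemma om_eq:
 assumes "m > 0" shows "om m t = card {p : prime_factors m. p dvd t}"
proof -
 have "{p. p < Suc m & prm p & p dvd m & p dvd t} = {p : prime_factors m. p dvd t}"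
  using assms by (auto simp: prm_iff in_prime_factors_iff dest: dvd_imp_le)
 thus ?thesis by (simp add: om_def sum_of_bool_card del: sum.lessThan_Suc)
qed

lemma unit_bij:
 assumes "m > 0"
 shows "bij_betw (unit m) {..<card {t. t < m & coprime t m}} {t. t < m & coprime t m}"
proof -
 define U where "U = {t. t < m & coprime t m}"
 define r where "r t = (\<Sum>s<t. of_bool (cop s m) :: nat)" for t
 have r_card: "r t = card {s. s < t & coprime s m}" for t
  by (simp add: r_def sum_of_bool_card cop_iff[OF assms])
 have finU: "finite U" by (simp add: U_def)
 have mono: "r s < r t" if "s : U" "s < t" for s t
  unfolding r_card by (rule psubset_card_mono) (use that in \<open>auto simp: U_def\<close>)
 have inj: "inj_on r U" by (rule inj_onI) (metis mono less_irrefl linorder_neqE_nat)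
 have lt: "r t < card U" if "t : U" for t
  unfolding r_card by (rule psubset_card_mono) (use that finU in \<open>auto simp: U_def\<close>)
 have img: "r ` U = {..<card U}"
  by (rule card_subset_eq) (use lt inj in \<open>auto simp: card_image\<close>)
 have ur: "unit m (r t) = t" if t: "t : U" for t
 proof -
  have "unit m (r t) = (\<Sum>s<m. if s = t then t else 0)"
   unfolding unit_def r_def[symmetric]
  proof (rule sum.cong[OF refl])
   fix s assume s: "s : {..<m}"
   show "(if cop s m & r s = r t then s else 0) = (if s = t then t else 0)"
   proof (cases "cop s m & r s = r t")
    case True
    hence "s : U" using s by (simp add: U_def cop_iff[OF assms])
    hence "s = t" using True t inj by (auto dest: inj_onD)
    thus ?thesis using True by simp
   next
    case False
    hence "s ~= t" using t by (auto simp: U_def cop_iff[OF assms])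
    thus ?thesis using False by auto
   qed
  qed
  also have "... = t" using t by (simp add: U_def)
  finally show ?thesis .
 qed
 have "bij_betw (unit m) {..<card U} U"
 proof (rule bij_betw_byWitness[where f' = r])
  show "ALL j:{..<card U}. r (unit m j) = j" unfolding img[symmetric] using ur by auto
  show "unit m ` {..<card U} \<subseteq> U" unfolding img[symmetric] using ur by auto
 qed (use ur lt in auto)
 thus ?thesis by (simp add: U_def)
qed

lemma last_such_props: "P i ==> i < k ==> P (last_such P k) & i <= last_such P k"
 by (induction k) (auto simp: less_Suc_eq)

lemma binary_sum: "(\<Sum>l<b. Y div 2 ^ l mod 2 * 2 ^ l) = Y mod 2 ^ b" for Y :: nat
proof (induction b)
 case (Suc b)
 have "Y mod 2 ^ Suc b = Y mod (2 ^ b * 2)" by (simp add: mult.commute)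
 also have "... = 2 ^ b * (Y div 2 ^ b mod 2) + Y mod 2 ^ b" by (rule mod_mult2_eq)
 finally show ?case using Suc by (simp add: mult.commute)
qed simp

lemma digit_eq: "digit c b A i = A div 2 ^ c div 2 ^ (b * i) mod 2 ^ b"
proof -
 have "A div 2 ^ (c + (b * i + l)) = A div 2 ^ c div 2 ^ (b * i) div 2 ^ l" for l
  by (simp add: power_add div_mult2_eq mult.assoc)
 thus ?thesis by (simp add: digit_def binary_sum)
qed

lemma ex_digits:
 assumes "!!i. i < d ==> a i < (2::nat) ^ b"
 shows "EX A<2 ^ (b * d). ALL i<d. A div 2 ^ (b * i) mod 2 ^ b = a i"
 using assms
proof (induction d)
 case (Suc d)
 then obtain A where A: "A < 2 ^ (b * d)" "!!i. i < d ==> A div 2 ^ (b * i) mod 2 ^ b = a i" by auto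
 define A' where "A' = A + a d * 2 ^ (b * d)"
 have "A' < 2 ^ (b * d) + a d * 2 ^ (b * d)" using A(1) by (simp add: A'_def)
 also have "... = (Suc (a d)) * 2 ^ (b * d)" by simp
 also have "... <= 2 ^ b * 2 ^ (b * d)" using Suc.prems[of d] by (intro mult_right_mono) auto
 finally have "A' < 2 ^ (b * Suc d)" by (simp add: power_add)
 moreover have "A' div 2 ^ (b * i) mod 2 ^ b = a i" if i: "i < Suc d" for i
 proof (cases "i = d")
  case True
  thus ?thesis using A(1) Suc.prems[of d] by (simp add: A'_def)
 next
  case False
  then obtain k where k: "d = Suc (i + k)" using i by (metis less_SucE less_imp_Suc_add)
  have "A' = A + 2 ^ (b * i) * (a d * 2 ^ (b * Suc k))"
   unfolding A'_def by (subst k) (simp add: power_add algebra_simps)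
  hence "A' div 2 ^ (b * i) = a d * 2 ^ (b * Suc k) + A div 2 ^ (b * i)" by simp
  also have "... = A div 2 ^ (b * i) + a d * 2 ^ (b * k) * 2 ^ b" by (simp add: power_add algebra_simps)
  finally show ?thesis using A(2)[of i] k by simp
 qed
 ultimately show ?case by blast
qed simp

lemma runs_double: "runs 0 (Suc L) (2 * Y) j = of_bool (j = 0) + runs 0 L Y j"
proof -
 have "(\<Sum>s<Suc t. 2 * Y div 2 ^ s mod 2) = (\<Sum>s<t. Y div 2 ^ s mod 2)" for t
  by (subst sum.lessThan_Suc_shift) simp
 thus ?thesis unfolding runs_def add_0 by (subst sum.lessThan_Suc_shift) (simp del: sum.lessThan_Suc)
qed

lemma runs_double_Suc: "runs 0 (Suc L) (Suc (2 * Y)) j = (if j = 0 then 0 else runs 0 L Y (j - 1))"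
proof -
 have d: "Suc (2 * Y) div 2 ^ Suc s = Y div 2 ^ s" for s
  by (simp only: power_Suc div_mult2_eq) simp
 have S: "(\<Sum>s<Suc t. Suc (2 * Y) div 2 ^ s mod 2) = Suc (\<Sum>s<t. Y div 2 ^ s mod 2)" for t
  by (subst sum.lessThan_Suc_shift) (simp add: d del: power_Suc)
 show ?thesis
  by (cases j; simp only: runs_def add_0 sum.lessThan_Suc_shift[of _ L] d S) simp_all
qed

text \<open>Written from the lowest bit: a zero uses up one unit of \<open>p 0\<close>, a one passes
  on to the next count. \<open>L\<close> has to hold all units and separators.\<close>

lemma ex_runs: "(\<Sum>j<d. p j) + d <= L ==> EX Y<2 ^ L. ALL j<d. runs 0 L Y j = p j"
proof (induction L arbitrary: d p)
 case 0
 thus ?case by auto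
next
 case (Suc L)
 show ?case
 proof (cases d)
  case 0
  thus ?thesis by (intro exI[of _ 0]) simp
 next
  case (Suc d')
  have sum: "(\<Sum>j<d. p j) = p 0 + (\<Sum>j<d'. p (Suc j))" unfolding Suc by (rule sum.lessThan_Suc_shift)
  show ?thesis
  proof (cases "p 0 = 0")
   case True
   hence "(\<Sum>j<d'. p (Suc j)) + d' <= L" using Suc.prems sum Suc by simp
   from Suc.IH[OF this] obtain Y where Y: "Y < 2 ^ L" "!!j. j < d' ==> runs 0 L Y j = p (Suc j)" by blast
   hence "runs 0 (Suc L) (Suc (2 * Y)) j = p j" if "j < d" for j
    using that True Suc unfolding runs_double_Suc by (cases j) auto
   moreover have "Suc (2 * Y) < 2 ^ Suc L" using Y(1) by simp
   ultimately show ?thesis by blast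
  next
   case False
   have "(\<Sum>j<d. (p(0 := p 0 - 1)) j) = (p 0 - 1) + (\<Sum>j<d'. p (Suc j))"
    unfolding Suc by (subst sum.lessThan_Suc_shift) simp
   hence "(\<Sum>j<d. (p(0 := p 0 - 1)) j) + d <= L" using Suc.prems sum False by simp
   from Suc.IH[OF this] obtain Y where Y: "Y < 2 ^ L" "!!j. j < d ==> runs 0 L Y j = (p(0 := p 0 - 1)) j" by blast
   hence "runs 0 (Suc L) (2 * Y) j = p j" if "j < d" for j
    using that False unfolding runs_double by simp
   moreover have "2 * Y < 2 ^ Suc L" using Y(1) by simp
   ultimately show ?thesis by blast
  qed
 qed
qed

lemma div_mod_bit:
 fixes X :: nat assumes "t < L" shows "X div 2 ^ c mod 2 ^ L div 2 ^ t mod 2 = X div 2 ^ (c + t) mod 2"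
proof -
 obtain k where k: "L = t + Suc k" using assms by (metis less_imp_Suc_add add_Suc_right)
 define Y where "Y = X div 2 ^ c"
 have "Y mod 2 ^ L = 2 ^ t * (Y div 2 ^ t mod 2 ^ Suc k) + Y mod 2 ^ t"
  unfolding k power_add by (rule mod_mult2_eq)
 hence "Y mod 2 ^ L div 2 ^ t = Y div 2 ^ t mod 2 ^ Suc k" by simp
 hence "Y mod 2 ^ L div 2 ^ t mod 2 = Y div 2 ^ t mod 2"
  by (simp add: mod_mod_cancel)
 thus ?thesis by (simp add: Y_def power_add div_mult2_eq)
qed

lemma runs_shift: "runs c L X j = runs 0 L (X div 2 ^ c mod 2 ^ L) j"
proof -
 have "(\<Sum>s<t. X div 2 ^ (c + s) mod 2) = (\<Sum>s<t. X div 2 ^ c mod 2 ^ L div 2 ^ (0 + s) mod 2)" if "t < L" for t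
  by (rule sum.cong) (use that div_mod_bit in auto)
 thus ?thesis unfolding runs_def using div_mod_bit by (intro sum.cong) auto
qed

lemma half_lg_power: "Z < (2 ^ (lg Z div 2 + 1))\<^sup>2"
proof (cases "Z = 0")
 case False
 have "Z < 2 ^ lg Z" using False by (simp add: lg_bounds)
 also have "... <= (2::nat) ^ ((lg Z div 2 + 1) * 2)" by (intro power_increasing) presburger+
 finally show ?thesis by (simp only: power_mult)
qed simp

lemma half_lg_power_le:
 assumes "Z > 0" shows "(2 ^ (lg Z div 2 + 1))\<^sup>2 <= 8 * Z"
proof -
 have "(2 ^ (lg Z div 2 + 1))\<^sup>2 = (2::nat) ^ ((lg Z div 2 + 1) * 2)" by (simp only: power_mult)
 also have "... <= 2 ^ (lg Z + 2)" by (intro power_increasing) auto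
 also have "... <= 8 * Z" using lg_bounds(1)[OF assms] by (simp add: power_add)
 finally show ?thesis .
qed

lemma last_such_less: "0 < k ==> last_such P k < k"
 by (induction k) (auto simp: less_Suc_eq)

locale algorithm_input =
 fixes n :: nat
 assumes n4: "n >= 4" and ex: "EX m. squarefree m & 2 * totient m = n & m <= n * n"
begin

lemma md_ge: "squarefree m ==> 2 * totient m = n ==> m <= n * n ==> m > 1 & sqf (md n) & 2 * tot (md n) = n & m <= md n"
proof -
 assume m: "squarefree m" "2 * totient m = n" "m <= n * n"
 have m1: "m > 1" using m(2) n4 by (cases "m = 0"; cases "m = 1") auto
 thus ?thesis unfolding md_def
  using last_such_props[of "%m. sqf m & 2 * tot m = n" m "Suc (n * n)"] m sqf_iff[of m] tot_eq[of m] by simp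
qed

lemma md_props: "squarefree (md n)" "2 * totient (md n) = n" "md n > 1" "md n <= n * n" "dim2 n = totient (md n)" "n = 2 * dim2 n"
proof -
 from ex obtain m where m: "squarefree m" "2 * totient m = n" "m <= n * n" by blast
 from md_ge[OF m] have *: "md n > 1" "sqf (md n)" "2 * tot (md n) = n" by auto
 thus "squarefree (md n)" "2 * totient (md n) = n" "md n > 1" using sqf_iff[of "md n"] tot_eq[of "md n"] by auto
 thus "dim2 n = totient (md n)" by (simp add: dim2_def)
 thus "n = 2 * dim2 n" using \<open>2 * totient (md n) = n\<close> by simp
 show "md n <= n * n" unfolding md_def by (rule less_Suc_eq_le[THEN iffD1], rule last_such_less) simp
qed

sublocale cyclotomic "md n" "dim2 n" "unit (md n)"
proof
 have "card {t. t < md n & coprime t (md n)} = dim2 n"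
 proof -
  have "{t. t < md n & cop t (md n)} = {t. t < md n & coprime t (md n)}" using cop_iff md_props(3) by auto
  hence "card {t. t < md n & coprime t (md n)} = tot (md n)" by (simp add: tot_def sum_of_bool_card)
  thus ?thesis using md_props tot_eq by simp
 qed
 thus "bij_betw (unit (md n)) {..<dim2 n} {t. t < md n & coprime t (md n)}"
  using unit_bij[of "md n"] md_props(3) by simp
qed (use md_props in auto)

lemma d0: "dim2 n > 0" "dim2 n <= md n" "NN n > 0"
 using md_props totient_le[of "md n"] n4 by (auto simp: NN_def)

lemma divides_iff:
 assumes "j < dim2 n"
 shows "md n dvd t * (t + md n - unit (md n) j) \<longleftrightarrow> int (md n) dvd int t * (int t - int (unit (md n) j))"
proof -
 have "int (t * (t + md n - unit (md n) j)) = int t * (int t - int (unit (md n) j)) + int t * int (md n)"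
 proof -
  have "int (t + md n - unit (md n) j) = int t + int (md n) - int (unit (md n) j)"
   using u_props(1)[OF assms] by (simp add: of_nat_diff)
  thus ?thesis by (simp only: of_nat_mult) (simp add: algebra_simps)
 qed
 hence "int (md n) dvd int (t * (t + md n - unit (md n) j)) \<longleftrightarrow> int (md n) dvd int t * (int t - int (unit (md n) j))"
  by (simp only: dvd_add_left_iff dvd_triv_right)
 thus ?thesis by (simp only: int_dvd_int_iff)
qed

lemma eps_cong:
 assumes "j < dim2 n"
 shows "[int (eps n t (unit (md n) j)) = e (int t) (unit (md n) j)] (mod int (NN n))"
proof -
 have om: "om (md n) t = card {p : prime_factors (md n). int p dvd int t}"
  using om_eq[of "md n" t] md_props(3) by simp
 have "int (NN n - 1) = - 1 + int (NN n)" using d0(3) by (simp add: of_nat_diff)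
 hence neg: "[int (NN n - 1) = - 1] (mod int (NN n))" by (simp only: cong_def mod_add_self2)
 show ?thesis
  unfolding e_eq eps_def divides_iff[OF assms] om[symmetric]
  using neg by (auto simp: even_iff_mod_2_eq_zero[symmetric] cong_def)
qed

lemma e_mod: "e (t mod int (md n)) j = e t j"
 using periodic_int[of "%t. e t j" "int (md n)" "t mod int (md n)" "t div int (md n)", OF e_periodic]
 by (simp add: mult.commute)

lemma WW_cong:
 assumes "j < dim2 n" "k < dim2 n"
 shows "[int (WW n A j k) = (\<Sum>i<dim2 n. int (digit 0 (bb n) A i) * e (int (unit (md n) k) - int i) (unit (md n) j))] (mod int (NN n))"
proof -
 have "[int (WW n A j k) = (\<Sum>i<dim2 n. int (digit 0 (bb n) A i) * int (eps n ((unit (md n) k + md n - i) mod md n) (unit (md n) j)))] (mod int (NN n))"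
  unfolding WW_def by (simp add: zmod_int cong_def)
 also have "[(\<Sum>i<dim2 n. int (digit 0 (bb n) A i) * int (eps n ((unit (md n) k + md n - i) mod md n) (unit (md n) j))) =
  (\<Sum>i<dim2 n. int (digit 0 (bb n) A i) * e (int (unit (md n) k) - int i) (unit (md n) j))] (mod int (NN n))"
 proof (intro cong_sum cong_mult cong_refl)
  fix i assume "i : {..<dim2 n}"
  hence i: "i <= unit (md n) k + md n" using d0(2) by simp
  have "int ((unit (md n) k + md n - i) mod md n) = (int (unit (md n) k) - int i) mod int (md n)"
   using i by (simp add: zmod_int of_nat_diff mod_simps) (metis diff_add_eq mod_add_self2)
  thus "[int (eps n ((unit (md n) k + md n - i) mod md n) (unit (md n) j)) = e (int (unit (md n) k) - int i) (unit (md n) j)] (mod int (NN n))"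
   using eps_cong[OF assms(1), of "(unit (md n) k + md n - i) mod md n"] by (simp only: e_mod)
 qed
 finally show ?thesis .
qed

lemma WW_shift:
 assumes "k < dim2 n"
 shows "[(\<Sum>j<dim2 n. x j * int (WW n A j k)) = (\<Sum>i<dim2 n. int (digit 0 (bb n) A i) * shift i x k)] (mod int (NN n))"
proof -
 have "[(\<Sum>j<dim2 n. x j * int (WW n A j k)) =
  (\<Sum>j<dim2 n. x j * (\<Sum>i<dim2 n. int (digit 0 (bb n) A i) * e (int (unit (md n) k) - int i) (unit (md n) j)))] (mod int (NN n))"
  by (intro cong_sum cong_mult cong_refl WW_cong assms) auto
 also have "(\<Sum>j<dim2 n. x j * (\<Sum>i<dim2 n. int (digit 0 (bb n) A i) * e (int (unit (md n) k) - int i) (unit (md n) j))) =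
  (\<Sum>i<dim2 n. int (digit 0 (bb n) A i) * shift i x k)"
  unfolding shift_def ext_def sum_distrib_left by (subst sum.swap) (simp add: mult_ac)
 finally show ?thesis .
qed

lemma gram_eq:
 assumes "j < dim2 n" "k < dim2 n" shows "gram n j k = Gm j k"
proof -
 let ?P = "%t. int (md n) dvd t * (t - int (unit (md n) j)) & int (md n) dvd t * (t - int (unit (md n) k))"
 have "gram n j k = card {t. t < md n & ?P (int t)}"
  unfolding gram_def divides_iff[OF assms(1)] divides_iff[OF assms(2)] by (rule sum_of_bool_card)
 also have "... = card (int ` {t. t < md n & ?P (int t)})" by (rule card_image[symmetric]) simp
 also have "int ` {t. t < md n & ?P (int t)} = {t : {0..<int (md n)}. ?P t}"
 proof (intro equalityI subsetI)
  fix t assume t: "t : {t : {0..<int (md n)}. ?P t}"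
  thus "t : int ` {t. t < md n & ?P (int t)}" by (intro image_eqI[of _ _ "nat t"]) auto
 qed auto
 finally show ?thesis by (simp add: Gm_def)
qed

text \<open>By positivity of the form, the natural subtraction in \<open>quad\<close> does not
  truncate.\<close>

lemma quad_eq: "int (quad n p r) = q (%j. int (p j) - int (r j))"
proof -
 let ?a = "\<Sum>j<dim2 n. \<Sum>k<dim2 n. gram n j k * (p j * p k + r j * r k)"
 let ?b = "\<Sum>j<dim2 n. \<Sum>k<dim2 n. gram n j k * (p j * r k + r j * p k)"
 have eq: "q (%j. int (p j) - int (r j)) = int ?a - int ?b"
  unfolding q_def of_nat_sum sum_subtractf[symmetric]
  by (intro sum.cong refl) (simp add: gram_eq algebra_simps)
 have "0 <= (\<Sum>j<dim2 n. (int (p j) - int (r j))\<^sup>2)" by (intro sum_nonneg) auto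
 also have "... <= int ?a - int ?b" unfolding eq[symmetric] by (rule q_ge)
 finally show ?thesis unfolding eq quad_def by (simp only: of_nat_diff of_nat_le_iff diff_ge_0_iff_ge)
qed

definition xx :: "nat => nat => int" where "xx X j = int (xp n X j) - int (xn n X j)"

definition cc :: "nat => nat => nat => int" where "cc A X k = int (wp n A X k) - int (wn n A X k)"

lemma val_eq: "int (val n A X) = (int (NN n))\<^sup>2 * q (xx X) + (int (TT n))\<^sup>2 * q (cc A X)"
proof -
 have "xx X = (%j. int (xp n X j) - int (xn n X j))" "cc A X = (%k. int (wp n A X k) - int (wn n A X k))"
  by (auto simp: xx_def cc_def)
 thus ?thesis by (simp add: val_def qx_def quad_eq power2_eq_square)
qed

lemma qx_eq: "int (qx n X) = q (xx X)"
proof -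
 have "xx X = (%j. int (xp n X j) - int (xn n X j))" by (auto simp: xx_def)
 thus ?thesis by (simp add: qx_def quad_eq)
qed

lemma cc_cong: "[cc A X k = (\<Sum>j<dim2 n. xx X j * int (WW n A j k))] (mod int (NN n))"
 and cc_bound: "- int (NN n) <= 2 * cc A X k" "2 * cc A X k < int (NN n)"
proof -
 have lt: "ww n A X k < NN n" using d0(3) by (simp add: ww_def)
 thus "- int (NN n) <= 2 * cc A X k" "2 * cc A X k < int (NN n)"
  by (auto simp: cc_def wp_def wn_def of_nat_diff)
 have "cc A X k = int (ww n A X k) \<or> cc A X k = int (ww n A X k) - int (NN n)"
  using lt by (auto simp: cc_def wp_def wn_def of_nat_diff)
 hence "[cc A X k = int (ww n A X k)] (mod int (NN n))" by (auto simp: cong_def)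
 also have "[int (ww n A X k) = (\<Sum>j<dim2 n. int (xp n X j + (NN n - 1) * xn n X j) * int (WW n A j k))] (mod int (NN n))"
 proof -
  have "[ww n A X k = (\<Sum>j<dim2 n. (xp n X j + (NN n - 1) * xn n X j) mod NN n * WW n A j k)] (mod NN n)"
   by (simp add: ww_def cong_def)
  also have "[(\<Sum>j<dim2 n. (xp n X j + (NN n - 1) * xn n X j) mod NN n * WW n A j k) =
    (\<Sum>j<dim2 n. (xp n X j + (NN n - 1) * xn n X j) * WW n A j k)] (mod NN n)"
   by (intro cong_sum cong_mult cong_refl) (simp add: cong_def)
  finally have "[int (ww n A X k) = int (\<Sum>j<dim2 n. (xp n X j + (NN n - 1) * xn n X j) * WW n A j k)] (mod int (NN n))"
   by (simp only: cong_int_iff)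
  thus ?thesis by simp
 qed
 also have "[(\<Sum>j<dim2 n. int (xp n X j + (NN n - 1) * xn n X j) * int (WW n A j k)) = (\<Sum>j<dim2 n. xx X j * int (WW n A j k))] (mod int (NN n))"
 proof (intro cong_sum cong_mult cong_refl)
  fix j
  have "int (xp n X j + (NN n - 1) * xn n X j) = xx X j + int (xn n X j) * int (NN n)"
  proof -
   have "int (NN n - 1) = int (NN n) - 1" using d0(3) by (simp add: of_nat_diff)
   thus ?thesis by (simp only: of_nat_add of_nat_mult xx_def) (simp add: algebra_simps)
  qed
  thus "[int (xp n X j + (NN n - 1) * xn n X j) = xx X j] (mod int (NN n))" by (simp add: cong_def)
 qed
 finally show "[cc A X k = (\<Sum>j<dim2 n. xx X j * int (WW n A j k))] (mod int (NN n))" .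
qed

text \<open>By Cauchy-Schwarz the absolute values of the coordinates sum to less than
  \<open>n * B / 2\<close>, so their quotients by \<open>B\<close> sum to less than \<open>n\<close>
  and fit into unary codes of O(n) bits. The remainders cost about half a logarithm of
  \<open>n\<close> per coordinate, where a plain box would cost a full one.\<close>

lemma decode:
 assumes x: "2 * (\<Sum>j<dim2 n. (x j)\<^sup>2) <= int (n * n * (DD n * DD n) * lg n)"
 shows "EX X<2 ^ Lx n. ALL j<dim2 n. xx X j = x j"
proof -
 define B where "B = int (2 ^ bs n)"
 have B0: "B > 0" by (simp add: B_def)
 have B2: "int (n * (DD n * DD n) * lg n) < B\<^sup>2"
  using half_lg_power[of "n * (DD n * DD n) * lg n"] unfolding B_def bs_def by (simp only: of_nat_power[symmetric] of_nat_less_iff)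
 define f where "f j = x j div B" for j
 define s where "s j = nat (x j mod B)" for j
 have xj: "x j = B * f j + int (s j)" and sB: "s j < 2 ^ bs n" for j
  using B0 by (auto simp: f_def s_def B_def nat_less_iff)
 have int_n: "int n = 2 * int (dim2 n)" using md_props(6) by (metis of_nat_mult of_nat_numeral)
 have sumx: "2 * (\<Sum>j<dim2 n. \<bar>x j\<bar>) < int n * B"
 proof -
  have "(real_of_int (\<Sum>j<dim2 n. \<bar>x j\<bar>))\<^sup>2 = (\<Sum>j<dim2 n. 1 * \<bar>real_of_int (x j)\<bar>)\<^sup>2" by simp
  also have "... <= (\<Sum>j<dim2 n. 1\<^sup>2) * (\<Sum>j<dim2 n. \<bar>real_of_int (x j)\<bar>\<^sup>2)" by (rule Cauchy_Schwarz_ineq_sum)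
  also have "... = real_of_int (int (dim2 n) * (\<Sum>j<dim2 n. (x j)\<^sup>2))" by simp
  finally have "(\<Sum>j<dim2 n. \<bar>x j\<bar>)\<^sup>2 <= int (dim2 n) * (\<Sum>j<dim2 n. (x j)\<^sup>2)"
   by (simp only: of_int_power[symmetric] of_int_le_iff)
  hence "4 * (\<Sum>j<dim2 n. \<bar>x j\<bar>)\<^sup>2 <= int n * (2 * (\<Sum>j<dim2 n. (x j)\<^sup>2))" unfolding int_n by simp
  also have "... <= int n * int (n * n * (DD n * DD n) * lg n)" by (intro mult_left_mono x) auto
  also have "... = (int n)\<^sup>2 * int (n * (DD n * DD n) * lg n)" by (simp add: power2_eq_square)
  also have "... < (int n)\<^sup>2 * B\<^sup>2" using B2 n4 by (intro mult_strict_left_mono) auto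
  finally have "(2 * (\<Sum>j<dim2 n. \<bar>x j\<bar>))\<^sup>2 < (int n * B)\<^sup>2" by (simp add: power_mult_distrib)
  thus ?thesis by (rule power2_less_imp_less) (use B0 in simp)
 qed
 have "B * (\<Sum>j<dim2 n. \<bar>f j\<bar>) <= (\<Sum>j<dim2 n. \<bar>x j\<bar> + B)" unfolding sum_distrib_left
 proof (rule sum_mono)
  fix j
  have "int (s j) < B" using sB[of j] by (simp add: B_def)
  hence "\<bar>B * f j\<bar> <= \<bar>x j\<bar> + B" using xj[of j] by linarith
  thus "B * \<bar>f j\<bar> <= \<bar>x j\<bar> + B" using B0 by (simp add: abs_mult)
 qed
 hence "2 * (B * (\<Sum>j<dim2 n. \<bar>f j\<bar>)) <= 2 * (\<Sum>j<dim2 n. \<bar>x j\<bar>) + int n * B"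
  unfolding int_n by (simp add: sum.distrib)
 hence "2 * (B * (\<Sum>j<dim2 n. \<bar>f j\<bar>)) < 2 * (B * int n)" using sumx by (simp add: mult.commute)
 hence "(\<Sum>j<dim2 n. \<bar>f j\<bar>) < int n" using B0 by (simp add: mult_less_cancel_left_pos)
 moreover have "int (\<Sum>j<dim2 n. nat \<bar>f j\<bar>) = (\<Sum>j<dim2 n. \<bar>f j\<bar>)" by simp
 ultimately have fn: "(\<Sum>j<dim2 n. nat \<bar>f j\<bar>) < n" by linarith
 have le: "(\<Sum>j<dim2 n. g j) + dim2 n <= Lq n" if "!!j. g j <= nat \<bar>f j\<bar>" for g
  using sum_mono[of "{..<dim2 n}" g "%j. nat \<bar>f j\<bar>"] that fn unfolding Lq_def by fastforce
 obtain Y1 where Y1: "Y1 < 2 ^ Lq n" "!!j. j < dim2 n ==> runs 0 (Lq n) Y1 j = nat (f j)"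
  using ex_runs[OF le[of "%j. nat (f j)", OF nat_mono[OF abs_ge_self]]] by blast
 obtain Y2 where Y2: "Y2 < 2 ^ Lq n" "!!j. j < dim2 n ==> runs 0 (Lq n) Y2 j = nat (- f j)"
  using ex_runs[OF le[of "%j. nat (- f j)", OF nat_mono[OF abs_ge_minus_self]]] by blast
 obtain Y3 where Y3: "Y3 < 2 ^ (bs n * dim2 n)" "!!j. j < dim2 n ==> Y3 div 2 ^ (bs n * j) mod 2 ^ bs n = s j"
  using ex_digits[of "dim2 n" s "bs n"] sB by blast
 define X where "X = Y1 + 2 ^ Lq n * (Y2 + 2 ^ Lq n * Y3)"
 have X1: "X mod 2 ^ Lq n = Y1" "X div 2 ^ Lq n = Y2 + 2 ^ Lq n * Y3" using Y1(1) by (simp_all add: X_def)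
 have X2: "X div 2 ^ Lq n mod 2 ^ Lq n = Y2" "X div 2 ^ (2 * Lq n) = Y3"
  using Y2(1) X1(2) by (simp_all add: mult_2 power_add div_mult2_eq)
 have "X < 2 ^ Lx n"
 proof -
  have "Y2 + 2 ^ Lq n * Y3 < 2 ^ Lq n * (1 + Y3)" using Y2(1) by simp
  also have "... <= 2 ^ Lq n * 2 ^ (bs n * dim2 n)" using Y3(1) by (intro mult_left_mono) auto
  finally have *: "Y2 + 2 ^ Lq n * Y3 + 1 <= 2 ^ Lq n * 2 ^ (bs n * dim2 n)" by simp
  have "X < 2 ^ Lq n * (Y2 + 2 ^ Lq n * Y3 + 1)" using Y1(1) by (simp add: X_def)
  also have "... <= 2 ^ Lq n * (2 ^ Lq n * 2 ^ (bs n * dim2 n))" by (intro mult_left_mono *) auto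
  finally show ?thesis by (simp add: Lx_def mult_2 power_add mult.assoc)
 qed
 moreover have "xx X j = x j" if j: "j < dim2 n" for j
 proof -
  have R1: "runs 0 (Lq n) X j = runs 0 (Lq n) Y1 j" by (rule trans[OF runs_shift]) (simp only: power_0 div_by_1 X1(1))
  have R2: "runs (Lq n) (Lq n) X j = runs 0 (Lq n) Y2 j" by (rule trans[OF runs_shift]) (simp only: X2(1))
  have "xp n X j = 2 ^ bs n * nat (f j) + s j"
   unfolding xp_def digit_eq R1 Y1(2)[OF j] X2(2) Y3(2)[OF j] ..
  moreover have "xn n X j = 2 ^ bs n * nat (- f j)"
   unfolding xn_def R2 Y2(2)[OF j] ..
  ultimately have "xx X j = B * (int (nat (f j)) - int (nat (- f j))) + int (s j)"
   by (simp add: xx_def B_def algebra_simps)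
  also have "int (nat (f j)) - int (nat (- f j)) = f j" by simp
  finally show ?thesis using xj by simp
 qed
 ultimately show ?thesis by blast
qed

lemma q_zero: "q x = 0 ==> j < dim2 n ==> x j = 0"
proof -
 assume x: "q x = 0" "j < dim2 n"
 have "(x j)\<^sup>2 <= (\<Sum>j<dim2 n. (x j)\<^sup>2)" using x(2) member_le_sum[of j "{..<dim2 n}" "%j. (x j)\<^sup>2"] by simp
 hence "(x j)\<^sup>2 <= 0" using q_ge[of x] x(1) by linarith
 thus ?thesis by simp
qed

lemma q_coord: "j < dim2 n ==> (x j)\<^sup>2 <= q x"
 using q_ge[of x] member_le_sum[of j "{..<dim2 n}" "%j. (x j)\<^sup>2"] by fastforce

lemma q_nonneg: "0 <= q x"
 using q_ge[of x] sum_nonneg[of "{..<dim2 n}" "%j. (x j)\<^sup>2"] by fastforce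

text \<open>The search finds a multiplier at least as good as the one assumed in
  \<open>good\<close>. Vectors outside the search are long for other reasons: by \<open>r1\<close>
  it is enough that some coordinate of \<open>w\<close> is at least N / 2 in absolute value, which
  covers \<open>x = 0\<close> and every \<open>w\<close> that is not a centred residue; and
  \<open>decode\<close> reaches every \<open>x\<close> with \<open>q x < r\<^sup>2\<close>.\<close>

lemma best_lattice:
 fixes r :: real and x w :: "nat => int"
 assumes r1: "4 * r\<^sup>2 <= (real (TT n))\<^sup>2" and r2: "2 * r\<^sup>2 <= real (n * n * (DD n * DD n) * lg n)" and r3: "1 <= r\<^sup>2"
  and good: "EX a:{..<dim2 n} \<rightarrow>\<^sub>E {..<NN n}. ALL x w. (EX j<dim2 n. x j ~= 0) -->
   (ALL i<dim2 n. [w i = (\<Sum>k<dim2 n. int (a k) * shift k x i)] (mod int (NN n))) -->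
   r\<^sup>2 < real_of_int (q x) + (real (TT n) / real (NN n))\<^sup>2 * real_of_int (q w)"
  and xw: "(EX j<dim2 n. x j ~= 0) \<or> (EX j<dim2 n. w j ~= 0)"
  and cong: "!!k. k < dim2 n ==> [w k = (\<Sum>j<dim2 n. x j * int (WW n (best n) j k))] (mod int (NN n))"
 shows "(real (NN n))\<^sup>2 * r\<^sup>2 <= (real (NN n))\<^sup>2 * real_of_int (q x) + (real (TT n))\<^sup>2 * real_of_int (q w)"
proof -
 define N T where "N = real (NN n)" and "T = real (TT n)"
 have N0: "N > 0" using d0(3) by (simp add: N_def)
 have real_val: "real (val n A X) = N\<^sup>2 * real_of_int (q (xx X)) + T\<^sup>2 * real_of_int (q (cc A X))" for A X
  using arg_cong[OF val_eq[of A X], of real_of_int] by (simp add: N_def T_def)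
 have val_pos: "val n A X > 0" if "qx n X ~= 0" for A X
  using that d0(3) by (simp add: val_def)
 obtain a where a: "a : {..<dim2 n} \<rightarrow>\<^sub>E {..<NN n}" "!!x w. EX j<dim2 n. x j ~= 0 ==>
   ALL i<dim2 n. [w i = (\<Sum>k<dim2 n. int (a k) * shift k x i)] (mod int (NN n)) ==>
   r\<^sup>2 < real_of_int (q x) + (T / N)\<^sup>2 * real_of_int (q w)" using good unfolding N_def T_def by blast
 have "a i < 2 ^ bb n" if "i < dim2 n" for i using a(1) that by (auto simp: NN_def PiE_def Pi_def)
 then obtain A0 where A0: "A0 < 2 ^ (bb n * dim2 n)" "!!i. i < dim2 n ==> digit 0 (bb n) A0 i = a i"
  using ex_digits[of "dim2 n" a "bb n"] by (auto simp: digit_eq)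
 have val0: "N\<^sup>2 * r\<^sup>2 < real (val n A0 X)" if X: "qx n X ~= 0" for X
 proof -
  have "EX j<dim2 n. xx X j ~= 0"
  proof (rule ccontr)
   assume "\<not> (EX j<dim2 n. xx X j ~= 0)"
   hence "q (xx X) = 0" by (simp add: q_def)
   thus False using X qx_eq[of X] by simp
  qed
  moreover have "ALL i<dim2 n. [cc A0 X i = (\<Sum>k<dim2 n. int (a k) * shift k (xx X) i)] (mod int (NN n))"
  proof (intro allI impI)
   fix i assume i: "i < dim2 n"
   have "[cc A0 X i = (\<Sum>k<dim2 n. int (digit 0 (bb n) A0 k) * shift k (xx X) i)] (mod int (NN n))"
    using cong_trans[OF cc_cong WW_shift[OF i]] .
   thus "[cc A0 X i = (\<Sum>k<dim2 n. int (a k) * shift k (xx X) i)] (mod int (NN n))" using A0(2) by simp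
  qed
  ultimately have "r\<^sup>2 < real_of_int (q (xx X)) + (T / N)\<^sup>2 * real_of_int (q (cc A0 X))" by (rule a(2))
  hence "N\<^sup>2 * r\<^sup>2 < N\<^sup>2 * (real_of_int (q (xx X)) + (T / N)\<^sup>2 * real_of_int (q (cc A0 X)))"
   using N0 by (intro mult_strict_left_mono) auto
  also have "... = real (val n A0 X)" unfolding real_val using N0 by (simp add: distrib_left power_divide)
  finally show ?thesis .
 qed
 \<comment> \<open>The code of one nonzero vector shows that the minimum is not taken over the empty
   set: a \<open>minval\<close> of 0 would mean infinity and yet lose every comparison in
   \<open>arg_max_below\<close>.\<close>
 obtain X1 where X1: "X1 < 2 ^ Lx n" "!!j. j < dim2 n ==> xx X1 j = of_bool (j = 0)"
 proof -
  have s: "(\<Sum>j<dim2 n. (of_bool (j = 0) :: int)\<^sup>2) = 1"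
  proof -
   have "(\<Sum>j<dim2 n. (of_bool (j = 0) :: int)\<^sup>2) = (\<Sum>j<dim2 n. if j = 0 then 1 else 0)" by (intro sum.cong) auto
   thus ?thesis using d0(1) by simp
  qed
  have Z2: "int Z >= 2" if "2 <= real Z" for Z using that by linarith
  have "2 <= real (n * n * (DD n * DD n) * lg n)" using r2 r3 by linarith
  hence "2 * (\<Sum>j<dim2 n. (of_bool (j = 0) :: int)\<^sup>2) <= int (n * n * (DD n * DD n) * lg n)"
   unfolding s mult_1_right by (rule Z2)
  from decode[OF this] that show ?thesis by blast
 qed
 have qX1: "qx n X1 ~= 0"
 proof
  assume "qx n X1 = 0"
  hence "q (xx X1) = 0" using qx_eq[of X1] by simp
  from q_zero[OF this d0(1)] show False using X1(2)[OF d0(1)] by simp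
 qed
 have minA0: "N\<^sup>2 * r\<^sup>2 < real (minval n A0)"
 proof -
  have "minval n A0 > 0" unfolding minval_def
   using min_over_le[of X1 "2 ^ Lx n" "%X. qx n X ~= 0" "val n A0"] X1(1) qX1 val_pos by blast
  then obtain X where "qx n X ~= 0" "minval n A0 = val n A0 X"
   using min_over_cases[of "%X. qx n X ~= 0" "val n A0" "2 ^ Lx n"] unfolding minval_def by auto
  thus ?thesis using val0 by simp
 qed
 have "minval n A0 <= minval n (best n)" unfolding best_def by (rule arg_max_below_max[OF A0(1)])
 hence best: "N\<^sup>2 * r\<^sup>2 < real (minval n (best n))" using minA0 by linarith
 have val_best: "N\<^sup>2 * r\<^sup>2 < real (val n (best n) X)" if X: "X < 2 ^ Lx n" "qx n X ~= 0" for X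
 proof -
  have "minval n (best n) <= val n (best n) X" unfolding minval_def
   using min_over_le[of X "2 ^ Lx n" "%X. qx n X ~= 0" "val n (best n)"] X val_pos by blast
  thus ?thesis using best by linarith
 qed
 have large: "N\<^sup>2 * r\<^sup>2 <= T\<^sup>2 * real_of_int (q w)" if k: "k < dim2 n" "int (NN n) <= 2 * \<bar>w k\<bar>" for k
 proof -
  have "N <= 2 * \<bar>real_of_int (w k)\<bar>" using k(2) unfolding N_def by linarith
  hence "N\<^sup>2 <= (2 * \<bar>real_of_int (w k)\<bar>)\<^sup>2" using N0 by (intro power_mono) auto
  also have "... = 4 * real_of_int ((w k)\<^sup>2)" by (simp add: power_mult_distrib)
  also have "... <= 4 * real_of_int (q w)" using q_coord[OF k(1)] by (simp only: of_int_le_iff mult_le_cancel_left_pos zero_less_numeral)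
  finally have "N\<^sup>2 * r\<^sup>2 <= 4 * real_of_int (q w) * r\<^sup>2" by (intro mult_right_mono) auto
  also have "... <= T\<^sup>2 * real_of_int (q w)" using mult_right_mono[OF r1, of "real_of_int (q w)"] q_nonneg[of w] by (simp add: T_def mult_ac)
  finally show ?thesis .
 qed
 have qn: "0 <= T\<^sup>2 * real_of_int (q w)" "0 <= N\<^sup>2 * real_of_int (q x)" using q_nonneg[of w] q_nonneg[of x] by simp_all
 show ?thesis
 proof (cases "EX j<dim2 n. x j ~= 0")
  case False
  then obtain k where k: "k < dim2 n" "w k ~= 0" using xw by blast
  have "[w k = 0] (mod int (NN n))" using cong[OF k(1)] False by simp
  hence "int (NN n) dvd w k" by (simp add: cong_0_iff)
  hence "int (NN n) <= \<bar>w k\<bar>" using k(2) dvd_imp_le_int[of "w k" "int (NN n)"] by simp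
  thus ?thesis using large[OF k(1)] qn unfolding N_def[symmetric] T_def[symmetric] by linarith
 next
  case True
  show ?thesis
  proof (cases "r\<^sup>2 <= real_of_int (q x)")
   case True
   hence "N\<^sup>2 * r\<^sup>2 <= N\<^sup>2 * real_of_int (q x)" by (intro mult_left_mono) auto
   thus ?thesis using qn unfolding N_def[symmetric] T_def[symmetric] by linarith
  next
   case False
   have ZZ: "a <= int Z" if "real_of_int a <= real Z" for a Z using that by linarith
   have "real_of_int (2 * (\<Sum>j<dim2 n. (x j)\<^sup>2)) <= 2 * real_of_int (q x)"
    using q_ge[of x] by (simp only: of_int_le_iff of_int_mult of_int_numeral mult_le_cancel_left_pos zero_less_numeral)
   also have "... <= real (n * n * (DD n * DD n) * lg n)" using False r2 by linarith
   finally have "2 * (\<Sum>j<dim2 n. (x j)\<^sup>2) <= int (n * n * (DD n * DD n) * lg n)"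
    by (rule ZZ)
   from decode[OF this] obtain X where X: "X < 2 ^ Lx n" "!!j. j < dim2 n ==> xx X j = x j" by blast
   have qX: "q (xx X) = q x" by (rule q_cong) (rule X(2))
   have "qx n X ~= 0"
   proof
    assume "qx n X = 0"
    hence "q x = 0" using qx_eq[of X] qX by simp
    thus False using q_zero[of x] \<open> EX j<dim2 n. x j ~= 0\<close> by blast
   qed
   from val_best[OF X(1) this] have vb: "N\<^sup>2 * r\<^sup>2 < N\<^sup>2 * real_of_int (q x) + T\<^sup>2 * real_of_int (q (cc (best n) X))"
    unfolding real_val qX .
   show ?thesis
   proof (cases "EX k<dim2 n. int (NN n) <= 2 * \<bar>w k\<bar>")
    case True
    thus ?thesis using large qn unfolding N_def[symmetric] T_def[symmetric] by force
   next
    case False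
    \<comment> \<open>Two centred residues of the same class differ by less than
      \<open>NN n\<close>.\<close>
    have "cc (best n) X k = w k" if k: "k < dim2 n" for k
    proof -
     have "[cc (best n) X k = (\<Sum>j<dim2 n. x j * int (WW n (best n) j k))] (mod int (NN n))"
      using cc_cong[of "best n" X k] X(2) by simp
     hence "[cc (best n) X k = w k] (mod int (NN n))" using cong[OF k] cong_sym cong_trans by blast
     hence "int (NN n) dvd cc (best n) X k - w k" by (simp add: cong_iff_dvd_diff)
     moreover have "\<bar>cc (best n) X k - w k\<bar> < int (NN n)"
      using cc_bound[where A = "best n" and X = X and k = k] False k by (simp add: not_le abs_less_iff) (smt (verit))
     ultimately show ?thesis using dvd_imp_le_int[of "cc (best n) X k - w k" "int (NN n)"] by fastforce
    qed
    hence "q (cc (best n) X) = q w" by (rule q_cong)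
    thus ?thesis using vb unfolding N_def[symmetric] T_def[symmetric] by simp
   qed
  qed
 qed
qed

end

section \<open>The lattice found by the algorithm\<close>

lemma lin_sum: "lin d C (%k. \<Sum>j<n. a j k * z j) i = (\<Sum>j<n. lin d C (a j) i * z j)"
 unfolding lin_def sum_distrib_left sum_distrib_right by (subst sum.swap) (simp add: mult.assoc)

lemma lin_unit: "j < d ==> lin d C (%k. s * of_bool (k = j)) i = s * C i j"
proof -
 assume j: "j < d"
 have "lin d C (%k. s * of_bool (k = j)) i = (\<Sum>k<d. if k = j then s * C i k else 0)"
  unfolding lin_def by (intro sum.cong) auto
 thus ?thesis using j by simp
qed

lemma polarization:
 assumes form: "!!v. (\<Sum>i<d. (lin d C v i)\<^sup>2) = (\<Sum>j<d. \<Sum>k<d. G j k * (v j * v k))"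
  and sym: "!!j k. G j k = G k j"
 shows "(\<Sum>i<d. lin d C v i * lin d C w i) = (\<Sum>j<d. \<Sum>k<d. G j k * (v j * w k))"
proof -
 have add: "lin d C (%k. v k + w k) i = lin d C v i + lin d C w i" for i
  by (simp add: lin_def distrib_left sum.distrib)
 have "(\<Sum>i<d. (lin d C v i + lin d C w i)\<^sup>2) = (\<Sum>i<d. (lin d C v i)\<^sup>2) + (\<Sum>i<d. (lin d C w i)\<^sup>2) + 2 * (\<Sum>i<d. lin d C v i * lin d C w i)"
  by (simp add: power2_sum sum.distrib sum_distrib_left mult.assoc)
 moreover have "(\<Sum>i<d. (lin d C v i + lin d C w i)\<^sup>2) = (\<Sum>j<d. \<Sum>k<d. G j k * ((v j + w j) * (v k + w k)))"
  using form[of "%k. v k + w k"] unfolding add .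
 moreover have "(\<Sum>j<d. \<Sum>k<d. G j k * ((v j + w j) * (v k + w k))) =
  (\<Sum>j<d. \<Sum>k<d. G j k * (v j * v k)) + (\<Sum>j<d. \<Sum>k<d. G j k * (w j * w k)) +
  ((\<Sum>j<d. \<Sum>k<d. G j k * (v j * w k)) + (\<Sum>j<d. \<Sum>k<d. G j k * (w j * v k)))"
  by (simp add: sum.distrib[symmetric] algebra_simps)
 moreover have "(\<Sum>j<d. \<Sum>k<d. G j k * (w j * v k)) = (\<Sum>j<d. \<Sum>k<d. G j k * (v j * w k))"
  by (subst sum.swap) (intro sum.cong refl, subst sym, simp)
 ultimately show ?thesis using form[of v] form[of w] by linarith
qed

lemma sum_double: "(\<Sum>i<2 * d. f i) = (\<Sum>i<d. f i) + (\<Sum>i<d. f (d + i))" for f :: "nat => 'a :: comm_monoid_add"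
proof -
 have U: "{..<2 * d} = {..<d} \<union> {d..<d + d}" by auto
 have "(\<Sum>i<2 * d. f i) = (\<Sum>i<d. f i) + (\<Sum>i\<in>{d..<d + d}. f i)"
  unfolding U by (rule sum.union_disjoint) auto
 also have "(\<Sum>i\<in>{d..<d + d}. f i) = (\<Sum>i<d. f (d + i))"
  by (rule sum.reindex_bij_witness[of _ "%i. d + i" "%i. i - d"]) auto
 finally show ?thesis .
qed

lemma prod_double: "(\<Prod>i<2 * d. f i) = (\<Prod>i<d. f i) * (\<Prod>i<d. f (d + i))" for f :: "nat => 'a :: comm_monoid_mult"
proof -
 have U: "{..<2 * d} = {..<d} \<union> {d..<d + d}" by auto
 have "(\<Prod>i<2 * d. f i) = (\<Prod>i<d. f i) * (\<Prod>i\<in>{d..<d + d}. f i)"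
  unfolding U by (rule prod.union_disjoint) auto
 also have "(\<Prod>i\<in>{d..<d + d}. f i) = (\<Prod>i<d. f (d + i))"
  by (rule prod.reindex_bij_witness[of _ "%i. d + i" "%i. i - d"]) auto
 finally show ?thesis .
qed

lemma concat_rows: "concat (map (%i. concat (map (f i) [0..<n])) [0..<k]) = concat (map (%t. f (t div n) (t mod n)) [0..<k * n])"
proof (induction k)
 case (Suc k)
 have "[0..<Suc k * n] = [0..<k * n] @ [k * n..<k * n + n]"
  by (metis add.commute mult_Suc upt_add_eq_append zero_le)
 moreover have "map (%t. f (t div n) (t mod n)) [k * n..<k * n + n] = map (f k) [0..<n]"
  by (rule nth_equalityI) auto
 ultimately show ?case using Suc by simp
qed simp

context algorithm_input
begin

text \<open>The triangular real basis \<open>D\<close> serves to verify the lattice whose Gram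
  matrix the program computes from integers. The scaling by \<open>NN n\<close> puts the same factor
  \<open>N ^ n\<close> into the volume of the ball and into the covolume.\<close>

lemma best_density:
 fixes r :: real and C :: "nat => nat => real"
 assumes C: "upper_tri (dim2 n) C"
  and form: "!!v. (\<Sum>i<dim2 n. (lin (dim2 n) C v i)\<^sup>2) = (\<Sum>j<dim2 n. \<Sum>k<dim2 n. real (Gm j k) * (v j * v k))"
  and r: "r > 0" and bound: "!!x w. (EX j<dim2 n. x j ~= 0) \<or> (EX j<dim2 n. w j ~= 0) ==>
   (!!k. k < dim2 n ==> [w k = (\<Sum>j<dim2 n. x j * int (WW n A j k))] (mod int (NN n))) ==>
   (real (NN n))\<^sup>2 * r\<^sup>2 <= (real (NN n))\<^sup>2 * real_of_int (q x) + (real (TT n))\<^sup>2 * real_of_int (q w)"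
  and T0: "TT n > 0"
 shows "EX L B G. is_zbasis n L B & is_lattice n L & map_mat real_of_rat G = transpose_mat B * B &
  encode_mat G = concat (map (%k. encode_rat (of_nat (entry n A (k div n) (k mod n)))) [0..<n * n]) &
  packing_density n L >= unit_ball_vol n * r ^ n / (2 ^ n * (real (TT n) ^ dim2 n * (\<Prod>i<dim2 n. C i i)\<^sup>2))"
proof -
 define d where "d = dim2 n"
 have n: "n = 2 * d" using md_props(6) by (simp add: d_def)
 have sd: "(\<Sum>i<n. f i) = (\<Sum>i<d. f i) + (\<Sum>i<d. f (d + i))" for f :: "nat => real"
  by (subst n) (rule sum_double)
 note C = C[folded d_def] and form = form[folded d_def]
 define N T where "N = real (NN n)" and "T = real (TT n)"
 have N0: "N > 0" using d0(3) by (simp add: N_def)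
 have T0: "T > 0" using T0 by (simp add: T_def)
 define W where "W j k = real (WW n A j k)" for j k
 \<comment> \<open>The coordinates of the second half come first: its \<open>d\<close> generators
   have no part in \<open>x\<close>, which makes the basis block triangular.\<close>
 define a where "a j = (if j < d then (%k. T * N * of_bool (k = j)) else (%k. T * W (j - d) k))" for j
 define b where "b j = (if j < d then (%k. 0) else (%k. N * of_bool (k = j - d)))" for j
 define D where "D i j = (if i < d then lin d C (a j) i else lin d C (b j) (i - d))" for i j
 have ut: "upper_tri n D" unfolding upper_tri_def
 proof (intro conjI allI impI)
  fix i assume i: "i < n"
  show "0 < D i i"
  proof (cases "i < d")
   case True
   thus ?thesis using C N0 T0 by (simp add: D_def a_def lin_unit upper_tri_def)
  next
   case False
   hence "i - d < d" using i n by simp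
   thus ?thesis using False C N0 by (simp add: D_def b_def lin_unit upper_tri_def)
  qed
  fix j assume j: "j < i"
  show "D i j = 0"
  proof (cases "i < d")
   case True
   thus ?thesis using C j by (simp add: D_def a_def lin_unit upper_tri_def)
  next
   case False
   hence "i - d < d" using i n by simp
   show ?thesis
   proof (cases "j < d")
    case True
    thus ?thesis using False by (simp add: D_def b_def lin_def)
   next
    case jd: False
    hence "D i j = N * C (i - d) (j - d)" using False j \<open>i - d < d\<close> by (simp add: D_def b_def lin_unit)
    thus ?thesis using C j jd \<open>i - d < d\<close> by (simp add: upper_tri_def)
   qed
  qed
 qed
 have norm: "(\<Sum>i<n. (lin n D (%j. real_of_int (z j)) i)\<^sup>2) =
   N\<^sup>2 * real_of_int (q (%j. z (d + j))) + T\<^sup>2 * real_of_int (q (%k. int (NN n) * z k + (\<Sum>j<d. z (d + j) * int (WW n A j k))))"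
  for z :: "nat => int"
 proof -
  let ?w = "%k. int (NN n) * z k + (\<Sum>j<d. z (d + j) * int (WW n A j k))"
  have scale: "lin d C (%k. s * v k) i = s * lin d C v i" for s v i by (simp add: lin_def sum_distrib_left mult_ac)
  have cg: "lin d C v i = lin d C v' i" if "!!k. k < d ==> v k = v' k" for v v' i using that by (simp add: lin_def)
  have qf: "(\<Sum>i<d. (lin d C (%j. real_of_int (v j)) i)\<^sup>2) = real_of_int (q v)" for v
   unfolding form by (simp add: q_def d_def)
  have D1: "lin n D (%j. real_of_int (z j)) i = T * lin d C (%k. real_of_int (?w k)) i" if i: "i < d" for i
  proof -
   have "lin n D (%j. real_of_int (z j)) i = lin d C (%k. \<Sum>j<n. a j k * real_of_int (z j)) i"
    unfolding lin_sum using i by (simp add: lin_def[of n] D_def)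
   also have "... = lin d C (%k. T * real_of_int (?w k)) i"
   proof (rule cg)
    fix k assume k: "k < d"
    have "(\<Sum>j<d. a j k * real_of_int (z j)) = (\<Sum>j<d. if j = k then T * N * real_of_int (z j) else 0)"
     by (intro sum.cong) (auto simp: a_def)
    thus "(\<Sum>j<n. a j k * real_of_int (z j)) = T * real_of_int (?w k)"
     unfolding sd using k by (simp add: a_def W_def N_def distrib_left sum_distrib_left mult_ac)
   qed
   finally show ?thesis unfolding scale .
  qed
  have D2: "lin n D (%j. real_of_int (z j)) (d + i) = N * lin d C (%k. real_of_int (z (d + k))) i" if i: "i < d" for i
  proof -
   have "lin n D (%j. real_of_int (z j)) (d + i) = lin d C (%k. \<Sum>j<n. b j k * real_of_int (z j)) i"
    unfolding lin_sum using i by (simp add: lin_def[of n] D_def)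
   also have "... = lin d C (%k. N * real_of_int (z (d + k))) i"
   proof (rule cg)
    fix k assume k: "k < d"
    have "(\<Sum>j<d. b (d + j) k * real_of_int (z (d + j))) = (\<Sum>j<d. if j = k then N * real_of_int (z (d + j)) else 0)"
     by (intro sum.cong) (auto simp: b_def)
    thus "(\<Sum>j<n. b j k * real_of_int (z j)) = N * real_of_int (z (d + k))"
     unfolding sd using k by (simp add: b_def)
   qed
   finally show ?thesis unfolding scale .
  qed
  have "(\<Sum>i<n. (lin n D (%j. real_of_int (z j)) i)\<^sup>2) =
   (\<Sum>i<d. (lin n D (%j. real_of_int (z j)) i)\<^sup>2) + (\<Sum>i<d. (lin n D (%j. real_of_int (z j)) (d + i))\<^sup>2)"
   by (rule sd)
  also have "(\<Sum>i<d. (lin n D (%j. real_of_int (z j)) i)\<^sup>2) = (\<Sum>i<d. T\<^sup>2 * (lin d C (%k. real_of_int (?w k)) i)\<^sup>2)"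
   by (intro sum.cong refl) (simp only: lessThan_iff D1 power_mult_distrib)
  also have "(\<Sum>i<d. (lin n D (%j. real_of_int (z j)) (d + i))\<^sup>2) = (\<Sum>i<d. N\<^sup>2 * (lin d C (%k. real_of_int (z (d + k))) i)\<^sup>2)"
   by (intro sum.cong refl) (simp only: lessThan_iff D2 power_mult_distrib)
  finally show ?thesis unfolding sum_distrib_left[symmetric] qf by simp
 qed
 have int: "EX k::nat. (\<Sum>i<n. (lin n D (%j. real_of_int (z j)) i)\<^sup>2) = real k" for z :: "nat => int"
 proof -
  let ?v = "(int (NN n))\<^sup>2 * q (%j. z (d + j)) + (int (TT n))\<^sup>2 * q (%k. int (NN n) * z k + (\<Sum>j<d. z (d + j) * int (WW n A j k)))"
  have "0 <= ?v" by (intro add_nonneg_nonneg mult_nonneg_nonneg q_nonneg) auto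
  hence "(\<Sum>i<n. (lin n D (%j. real_of_int (z j)) i)\<^sup>2) = real (nat ?v)"
   unfolding norm N_def T_def by simp
  thus ?thesis by blast
 qed
 have lb: "(N * r)\<^sup>2 <= (\<Sum>i<n. (lin n D (%j. real_of_int (z j)) i)\<^sup>2)" if z: "EX j<n. z j ~= 0" for z :: "nat => int"
 proof -
  have B: "(real (NN n))\<^sup>2 * r\<^sup>2 <= (real (NN n))\<^sup>2 * real_of_int (q (%j. z (d + j))) +
    (real (TT n))\<^sup>2 * real_of_int (q (%k. int (NN n) * z k + (\<Sum>j<d. z (d + j) * int (WW n A j k))))"
 proof (rule bound[of "%j. z (d + j)" "%k. int (NN n) * z k + (\<Sum>j<d. z (d + j) * int (WW n A j k))"], fold d_def)
  show "(EX j<d. z (d + j) ~= 0) \<or> (EX j<d. int (NN n) * z j + (\<Sum>i<d. z (d + i) * int (WW n A i j)) ~= 0)"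
  proof (cases "EX j<d. z (d + j) ~= 0")
   case False
   from z obtain j where j: "j < n" "z j ~= 0" by blast
   have "j < d"
   proof (rule ccontr)
    assume "\<not> j < d"
    hence "z (d + (j - d)) ~= 0" "j - d < d" using j n by auto
    thus False using False by blast
   qed
   moreover have "int (NN n) * z j + (\<Sum>i<d. z (d + i) * int (WW n A i j)) ~= 0" using False j(2) d0(3) by simp
   ultimately show ?thesis by blast
  qed simp
  show "[int (NN n) * z k + (\<Sum>j<d. z (d + j) * int (WW n A j k)) = (\<Sum>j<d. z (d + j) * int (WW n A j k))] (mod int (NN n))" for k
   by (simp add: cong_def)
 qed
  show ?thesis unfolding norm power_mult_distrib using B by (simp only: N_def T_def)
 qed
 define B where "B = mat n n (%(i, j). D i j)"
 define L where "L = {B *\<^sub>v map_vec real_of_int z | z. z : carrier_vec n}"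
 have Nr: "N * r > 0" using N0 r by simp
 have n0: "n > 0" using n4 by simp
 note lat = upper_tri_lattice[OF ut n0 Nr int lb, folded B_def, folded L_def]
 have Nn: "N ^ n = N ^ d * N ^ d" unfolding n by (simp add: mult_2 power_add)
 have "(\<Prod>i<n. D i i) = (\<Prod>i<d. T * N * C i i) * (\<Prod>i<d. N * C i i)"
 proof -
  have "(\<Prod>i<n. D i i) = (\<Prod>i<d. D i i) * (\<Prod>i<d. D (d + i) (d + i))" by (subst n) (rule prod_double)
  also have "(\<Prod>i<d. D i i) = (\<Prod>i<d. T * N * C i i)" by (intro prod.cong) (auto simp: D_def a_def lin_unit)
  also have "(\<Prod>i<d. D (d + i) (d + i)) = (\<Prod>i<d. N * C i i)" by (intro prod.cong) (auto simp: D_def b_def lin_unit)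
  finally show ?thesis .
 qed
 also have "... = N ^ n * (T ^ d * (\<Prod>i<d. C i i)\<^sup>2)"
  unfolding Nn by (simp add: prod.distrib power_mult_distrib power2_eq_square mult_ac)
 finally have det: "(\<Prod>i<n. D i i) = N ^ n * (T ^ d * (\<Prod>i<d. C i i)\<^sup>2)" .
 have "packing_density n L >= unit_ball_vol n * (N * r) ^ n / (2 ^ n * (\<Prod>i<n. D i i))" by (rule lat(3))
 moreover have "unit_ball_vol n * (N * r) ^ n / (2 ^ n * (\<Prod>i<n. D i i)) = unit_ball_vol n * r ^ n / (2 ^ n * (T ^ d * (\<Prod>i<d. C i i)\<^sup>2))"
  unfolding det using N0 by (simp add: power_mult_distrib field_simps)
 ultimately have dens: "packing_density n L >= unit_ball_vol n * r ^ n / (2 ^ n * (T ^ d * (\<Prod>i<d. C i i)\<^sup>2))" by simp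
 define G :: "rat mat" where "G = mat n n (%(i, j). of_nat (entry n A i j))"
 have pol: "(\<Sum>i<d. lin d C v i * lin d C w i) = (\<Sum>j<d. \<Sum>k<d. real (Gm j k) * (v j * w k))" for v w
  by (rule polarization[OF form]) (simp add: Gm_commute)
 have ub: "(\<Sum>k<d. f k * (s * of_bool (k = j))) = s * f j" if "j < d" for f :: "nat => real" and s j
 proof -
  have "(\<Sum>k<d. f k * (s * of_bool (k = j))) = (\<Sum>k<d. if k = j then s * f k else 0)" by (intro sum.cong) auto
  thus ?thesis using that by simp
 qed
 have pol1: "(\<Sum>i<d. lin d C (%k. s * of_bool (k = j)) i * lin d C w i) = s * (\<Sum>k<d. real (Gm j k) * w k)" if "j < d" for s j w
 proof -
  have "(\<Sum>j'<d. \<Sum>k<d. real (Gm j' k) * (s * of_bool (j' = j) * w k)) = (\<Sum>j'<d. (\<Sum>k<d. real (Gm j' k) * w k) * (s * of_bool (j' = j)))"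
   unfolding sum_distrib_right by (intro sum.cong refl) (simp only: mult_ac)
  thus ?thesis unfolding pol using ub[OF that] by simp
 qed
 have gr: "real (gram n j k) = real (Gm j k)" if "j < d" "k < d" for j k using gram_eq[of j k] that by (simp add: d_def)
 have grs: "(\<Sum>k<d. real (gram n j k) * f k) = (\<Sum>k<d. real (Gm j k) * f k)" if "j < d" for j and f :: "nat => real"
  using that gr by (intro sum.cong) auto
 have S: "(\<Sum>k<d. real (Gm i k) * (T * f k)) = T * (\<Sum>k<d. real (Gm i k) * f k)" for i f
  by (simp add: sum_distrib_left mult_ac)
 have ent: "(\<Sum>k<n. D k i * D k j) = real (entry n A i j)" if ij: "i < n" "j < n" for i j
 proof -
  have "(\<Sum>k<n. D k i * D k j) = (\<Sum>k<d. lin d C (a i) k * lin d C (a j) k) + (\<Sum>k<d. lin d C (b i) k * lin d C (b j) k)"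
   unfolding sd by (intro arg_cong2[where f = "(+)"] sum.cong) (auto simp: D_def)
  also have "... = real (entry n A i j)"
  proof (cases "i < d"; cases "j < d")
   assume i: "i < d" and j: "j < d"
   have "(\<Sum>k<d. lin d C (b i) k * lin d C (b j) k) = 0" using i by (simp add: b_def lin_def)
   moreover have "(\<Sum>k<d. lin d C (a i) k * lin d C (a j) k) = T * N * (T * N * real (Gm i j))"
    using pol1[OF i, of "T * N" "a j"] ub[OF j] i j by (simp add: a_def)
   ultimately show ?thesis using i j gr[OF i j]
    by (simp add: entry_def d_def[symmetric] T_def N_def power2_eq_square mult_ac)
  next
   assume i: "i < d" and j: "\<not> j < d"
   have "(\<Sum>k<d. lin d C (b i) k * lin d C (b j) k) = 0" using i by (simp add: b_def lin_def)
   moreover have "(\<Sum>k<d. lin d C (a i) k * lin d C (a j) k) = T * N * (\<Sum>k<d. real (Gm i k) * (T * W (j - d) k))"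
    using pol1[OF i, of "T * N" "a j"] i j by (simp add: a_def)
   moreover have "real (entry n A i j) = T * T * N * (\<Sum>k<d. real (gram n i k) * W (j - d) k)"
    using i j by (simp add: entry_def d_def[symmetric] T_def N_def W_def)
   ultimately show ?thesis unfolding S grs[OF i] by simp
  next
   assume i: "\<not> i < d" and j: "j < d"
   have "(\<Sum>k<d. lin d C (b i) k * lin d C (b j) k) = 0" using j by (simp add: b_def lin_def)
   moreover have "(\<Sum>k<d. lin d C (a i) k * lin d C (a j) k) = T * N * (\<Sum>k<d. real (Gm j k) * (T * W (i - d) k))"
    using pol1[OF j, of "T * N" "a i"] i j by (simp add: a_def mult.commute)
   moreover have "real (entry n A i j) = T * T * N * (\<Sum>k<d. real (gram n j k) * W (i - d) k)"
    using i j by (simp add: entry_def d_def[symmetric] T_def N_def W_def)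
   ultimately show ?thesis unfolding S grs[OF j] by simp
  next
   assume i: "\<not> i < d" and j: "\<not> j < d"
   hence i': "i - d < d" and j': "j - d < d" using ij n by auto
   have "(\<Sum>k<d. lin d C (b i) k * lin d C (b j) k) = N * (N * real (Gm (i - d) (j - d)))"
    using pol1[OF i', of N "b j"] ub[OF j'] i j by (simp add: b_def)
   moreover have "(\<Sum>k<d. lin d C (a i) k * lin d C (a j) k) =
     (\<Sum>k<d. \<Sum>l<d. real (gram n k l) * (T * W (i - d) k * (T * W (j - d) l)))"
    unfolding pol using i j gr by (intro sum.cong) (auto simp: a_def)
   moreover have "(\<Sum>k<d. \<Sum>l<d. real (gram n k l) * (T * W (i - d) k * (T * W (j - d) l))) =
     T * T * (\<Sum>k<d. \<Sum>l<d. real (gram n k l) * (W (i - d) k * W (j - d) l))"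
    by (simp add: sum_distrib_left mult_ac)
   moreover have "real (entry n A i j) = T * T * (\<Sum>k<d. \<Sum>l<d. real (gram n k l) * (W (i - d) k * W (j - d) l)) +
     N * N * real (gram n (i - d) (j - d))"
    using i j by (simp add: entry_def d_def[symmetric] T_def N_def W_def)
   ultimately show ?thesis using gr[OF i' j'] by simp
  qed
  finally show ?thesis .
 qed
 have "map_mat real_of_rat G = transpose_mat B * B"
 proof (rule eq_matI)
  fix i j assume "i < dim_row (transpose_mat B * B)" "j < dim_col (transpose_mat B * B)"
  hence ij: "i < n" "j < n" by (auto simp: B_def)
  have "(transpose_mat B * B) $$ (i, j) = (\<Sum>k<n. D k i * D k j)"
   using ij by (simp add: B_def scalar_prod_def lessThan_atLeast0)
  thus "map_mat real_of_rat G $$ (i, j) = (transpose_mat B * B) $$ (i, j)"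
   using ij ent by (simp add: G_def)
 qed (simp_all add: G_def B_def)
 moreover have "encode_mat G = concat (map (%k. encode_rat (of_nat (entry n A (k div n) (k mod n)))) [0..<n * n])"
 proof -
  have "encode_mat G = concat (map (%i. concat (map (%j. encode_rat (of_nat (entry n A i j))) [0..<n])) [0..<n])"
   unfolding encode_mat_def by (intro arg_cong[where f = concat] map_cong) (auto simp: G_def)
  thus ?thesis unfolding concat_rows[of "%i j. encode_rat (of_nat (entry n A i j))"] .
 qed
 ultimately show ?thesis using lat(1,2) dens unfolding T_def d_def by blast
qed

end

section \<open>The critical radius\<close>

text \<open>Absorbs the bound \<open>n * n\<close> on \<open>md n\<close> into the power of \<pi> in
  the volume of the ball.\<close>

lemma four_square_le_power: "8 <= d ==> 4 * (real d)\<^sup>2 <= pi ^ d"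
proof (induction d rule: dec_induct)
 case base
 have "(2::real) ^ 8 <= pi ^ 8" using pi_ge_two by (intro power_mono) auto
 thus ?case by simp
next
 case (step d)
 have "(real (Suc d))\<^sup>2 <= 2 * (real d)\<^sup>2"
 proof -
  have "8 * real d <= real d * real d" using step.hyps(1) by (intro mult_right_mono) auto
  moreover have "(real (Suc d))\<^sup>2 = real d * real d + 2 * real d + 1" by (simp add: power2_eq_square algebra_simps)
  moreover have "real d >= 8" using step.hyps(1) by simp
  ultimately show ?thesis unfolding power2_eq_square by linarith
 qed
 hence "4 * (real (Suc d))\<^sup>2 <= 2 * (4 * (real d)\<^sup>2)" by simp
 also have "... <= pi * pi ^ d" using step.IH pi_ge_two by (intro mult_mono) auto
 finally show ?case by simp
qed

context algorithm_input
begin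

lemma DD_eq: "DD n = 2 ^ card (prime_factors (md n))"
 using om_eq[of "md n" 0] md_props(3) by (simp add: DD_def)

lemma ex_radius:
 fixes C :: "nat => nat => real"
 assumes n16: "n >= 16" and K: "10 ^ 17 <= real (lg n)"
  and C: "upper_tri (dim2 n) C" "!!i. i < dim2 n ==> 1 <= C i i" "!!i. i < dim2 n ==> (C i i)\<^sup>2 <= DD n"
  and form: "!!v. (\<Sum>i<dim2 n. (lin (dim2 n) C v i)\<^sup>2) = (\<Sum>j<dim2 n. \<Sum>k<dim2 n. real (Gm j k) * (v j * v k))"
 shows "EX r>0. unit_ball_vol n * r ^ n / (real (TT n) ^ dim2 n * (\<Prod>i<dim2 n. C i i)\<^sup>2) = 0.9999 * md n &
  4 * r\<^sup>2 <= (real (TT n))\<^sup>2 & 2 * r\<^sup>2 <= real (n * n * (DD n * DD n) * lg n) & 1 <= r\<^sup>2 &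
  (EX a:{..<dim2 n} \<rightarrow>\<^sub>E {..<NN n}. ALL x w. (EX j<dim2 n. x j ~= 0) -->
   (ALL i<dim2 n. [w i = (\<Sum>k<dim2 n. int (a k) * shift k x i)] (mod int (NN n))) -->
   r\<^sup>2 < real_of_int (q x) + (real (TT n) / real (NN n))\<^sup>2 * real_of_int (q w))"
proof -
 define d where "d = dim2 n"
 have n2: "n = 2 * d" using md_props(6) by (simp add: d_def)
 have rn: "real n = 2 * real d" using n2 by (metis of_nat_mult of_nat_numeral)
 have d8: "d >= 8" using n16 n2 by linarith
 define \<beta> T N k where "\<beta> = real (DD n)" and "T = real (TT n)" and "N = real (NN n)" and "k = real (lg n)"
 have \<beta>1: "\<beta> >= 1" by (simp add: \<beta>_def DD_eq)
 have k0: "k >= 10 ^ 17" using K by (simp add: k_def)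
 hence kp: "k > 0" by (rule less_le_trans[rotated]) simp
 have T: "T = real n * \<beta> * k" by (simp add: T_def TT_def \<beta>_def k_def)
 have Tp: "T > 0" using \<beta>1 kp n16 by (simp add: T)
 have Np: "N > 0" using d0(3) by (simp add: N_def)
 have N2: "real n ^ 3 * T\<^sup>2 * k < N\<^sup>2"
 proof -
  have "real (n * n * n * (TT n * TT n) * lg n) < real ((2 ^ (lg (n * n * n * (TT n * TT n) * lg n) div 2 + 1))\<^sup>2)"
   using half_lg_power by (simp only: of_nat_less_iff)
  thus ?thesis by (simp add: N_def NN_def bb_def T_def k_def power2_eq_square power3_eq_cube)
 qed
 define \<kappa> where "\<kappa> = (\<Prod>i<d. C i i)"
 have C1: "1 <= C i i" "(C i i)\<^sup>2 <= \<beta>" if "i < d" for i using C(2,3) that by (simp_all add: d_def \<beta>_def)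
 have \<kappa>1: "1 <= \<kappa>" unfolding \<kappa>_def using C1 by (intro prod_ge_1) auto
 have \<kappa>2: "\<kappa>\<^sup>2 <= \<beta> ^ d"
 proof -
  have "\<kappa>\<^sup>2 = (\<Prod>i<d. (C i i)\<^sup>2)" by (simp add: \<kappa>_def prod_power_distrib)
  also have "... <= (\<Prod>i<d. \<beta>)" using C1 by (intro prod_mono) auto
  finally show ?thesis by simp
 qed
 have m2: "real (md n) >= 2" using md_props(3) by simp
 define V where "V = unit_ball_vol (real n)"
 have V: "V = pi ^ d / fact d" unfolding V_def rn using unit_ball_vol_even[of d] by simp
 have Vp: "V > 0" unfolding V by simp
 define Q where "Q = 0.9999 * real (md n) * (T ^ d * \<kappa>\<^sup>2) / V"
 have Qp: "Q > 0" unfolding Q_def using m2 Tp \<kappa>1 Vp by simp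
 define r where "r = root n Q"
 have rp: "r > 0" unfolding r_def using Qp n16 by simp
 have rQ: "r ^ n = Q" unfolding r_def using Qp n16 by (intro real_root_pow_pos2) auto
 have r2Q: "(r\<^sup>2) ^ d = Q" using rQ n2 by (simp add: power_mult[symmetric])
 have Vr: "V * r ^ n = 0.9999 * real (md n) * (T ^ d * \<kappa>\<^sup>2)" unfolding rQ Q_def using Vp by simp
 \<comment> \<open>The factor 12 comes from d^d <= e^d d! with e replaced by 3, and from \<pi> <
   4.\<close>
 have lower: "T * d / 12 <= r\<^sup>2"
 proof -
  have "real d ^ d <= exp (real d) * fact d" by (rule power_div_fact_le_exp) simp
  also have "exp (real d) = exp 1 ^ d" by (simp add: exp_of_nat_mult[symmetric])
  also have "exp 1 ^ d * fact d <= (3::real) ^ d * fact d" using exp_le by (intro mult_right_mono power_mono) auto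
  finally have df: "real d ^ d <= 3 ^ d * fact d" .
  have "(T * d / 12) ^ d = T ^ d * real d ^ d / 12 ^ d" by (simp add: power_divide power_mult_distrib)
  also have "... <= T ^ d * (3 ^ d * fact d) / 12 ^ d" using df Tp by (intro divide_right_mono mult_left_mono) auto
  also have "... = T ^ d * fact d / 4 ^ d"
  proof -
   have "(12::real) ^ d = 3 ^ d * 4 ^ d" by (simp flip: power_mult_distrib)
   thus ?thesis by simp
  qed
  also have "... <= T ^ d * fact d / pi ^ d"
   using pi_less_4 Tp pi_gt_zero by (intro divide_left_mono power_mono) auto
  also have "... = 1 * (T ^ d * 1) / V" by (simp add: V)
  also have "... <= Q" unfolding Q_def
  proof (intro divide_right_mono mult_mono)
   show "1 <= 0.9999 * real (md n)" using m2 by simp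
   show "1 <= \<kappa>\<^sup>2" using \<kappa>1 by simp
  qed (use Tp Vp \<kappa>1 in auto)
  finally have "(T * d / 12) ^ d <= (r\<^sup>2) ^ d" unfolding r2Q .
  thus ?thesis using d8 by (subst (asm) power_mono_iff) (use Tp in auto)
 qed
 \<comment> \<open>\<open>md n\<close> is at most \<open>pi ^ d\<close>, which cancels against the
   numerator of \<open>V\<close>.\<close>
 have upper: "r\<^sup>2 <= T * \<beta> * d"
 proof -
  have m: "real (md n) <= pi ^ d"
  proof -
   have "real (md n) <= real (n * n)" using md_props(4) by (simp only: of_nat_le_iff)
   also have "... = 4 * (real d)\<^sup>2" by (simp add: rn power2_eq_square)
   finally show ?thesis using four_square_le_power[OF d8] by linarith
  qed
  have "Q <= pi ^ d * (T ^ d * \<beta> ^ d) / V" unfolding Q_def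
   by (intro divide_right_mono mult_mono) (use m m2 Tp Vp \<kappa>2 in auto)
  also have "... = T ^ d * \<beta> ^ d * fact d" by (simp add: V)
  also have "... <= T ^ d * \<beta> ^ d * real d ^ d"
  proof (rule mult_left_mono)
   have "fact d <= real (d ^ d)" by (rule fact_le_power)
   thus "fact d <= real d ^ d" by simp
  qed (use Tp \<beta>1 in auto)
  finally have "(r\<^sup>2) ^ d <= (T * \<beta> * d) ^ d" unfolding r2Q by (simp add: power_mult_distrib)
  thus ?thesis using d8 by (subst (asm) power_mono_iff) (use Tp \<beta>1 in auto)
 qed
 have c1: "4 * r\<^sup>2 <= T\<^sup>2"
 proof -
  have "4 * r\<^sup>2 <= 2 * (T * \<beta> * (2 * d))" using upper by simp
  also have "... = 2 * (T * (\<beta> * real n))" by (simp add: rn)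
  also have "... <= k * (T * (\<beta> * real n))" using k0 Tp \<beta>1 by (intro mult_right_mono) auto
  also have "... = T\<^sup>2" by (simp add: T power2_eq_square mult_ac)
  finally show ?thesis .
 qed
 have c2: "2 * r\<^sup>2 <= real (n * n * (DD n * DD n) * lg n)"
 proof -
  have "2 * r\<^sup>2 <= T * \<beta> * (2 * d)" using upper by simp
  also have "... = real (n * n * (DD n * DD n) * lg n)" by (simp add: T \<beta>_def k_def rn mult_ac)
  finally show ?thesis .
 qed
 have dT: "T >= 12"
 proof -
  have "12 * 1 * 1 <= real n * \<beta> * k" using n16 \<beta>1 k0 by (intro mult_mono) auto
  thus ?thesis by (simp add: T)
 qed
 have c3: "1 <= r\<^sup>2"
 proof -
  have "12 * 1 <= T * real d" using dT d8 by (intro mult_mono) auto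
  thus ?thesis using lower by simp
 qed
 have c4: "EX a:{..<d} \<rightarrow>\<^sub>E {..<NN n}. ALL x w. (EX j<d. x j ~= 0) -->
   (ALL i<d. [w i = (\<Sum>k<d. int (a k) * shift k x i)] (mod int (NN n))) -->
   r\<^sup>2 < real_of_int (q x) + (T / real (NN n))\<^sup>2 * real_of_int (q w)"
 proof (rule ccontr)
  assume neg: "\<not> ?thesis"
  \<comment> \<open>Of relative size 1 / n, so that passing from \<open>r\<^sup>2\<close> to
    \<open>r\<^sup>2 + 3 * \<theta>\<close> multiplies the \<open>n\<close>-th power of the radius
    by at most exp (1.5 * 10^-5).\<close>
  define \<theta> where "\<theta> = r\<^sup>2 / (10 ^ 5 * real n)"
  define v where "v = \<beta> * r\<^sup>2 / 3 + T\<^sup>2 * d * r ^ 4 / (12 * N\<^sup>2)"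
  define r1 where "r1 = r * sqrt (1 + 3 / (10 ^ 5 * real n))"
  have np: "real n > 0" using n16 by simp
  have dn: "real d <= real n" by (simp add: rn)
  have r2p: "r\<^sup>2 > 0" using rp by simp
  have \<theta>p: "\<theta> > 0" unfolding \<theta>_def using r2p np by simp
  have \<beta>n: "\<beta> * (real n)\<^sup>2 <= 24 / k * r\<^sup>2"
  proof -
   have "\<beta> * (real n)\<^sup>2 = T * real n / k" using kp by (simp add: T power2_eq_square)
   also have "... = 24 / k * (T * d / 12)" by (simp add: rn)
   also have "... <= 24 / k * r\<^sup>2" using lower kp by (intro mult_left_mono) auto
   finally show ?thesis .
  qed
  have TN: "T\<^sup>2 * real n ^ 3 <= N\<^sup>2 / k" using N2 kp by (simp add: field_simps)
  have kk: "24 / k <= 24 / 10 ^ 17" "1 / k <= 1 / 10 ^ 17" using k0 kp by (simp_all add: pos_divide_le_eq)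
  \<comment> \<open>Both parts of the variance are at most a constant times r^4 / (n^2 lg n). The
    requirement 10^17 on \<open>lg n\<close> pushes them below 10^-15 r^4 / n^2, which is 10^-5
    times the square of \<open>\<theta>\<close>.\<close>
  have v\<theta>: "v <= 1 / 10 ^ 5 * \<theta>\<^sup>2"
  proof -
   have v1: "\<beta> * r\<^sup>2 / 3 <= 8 / 10 ^ 17 * (r\<^sup>2 * r\<^sup>2 / (real n)\<^sup>2)"
   proof -
    have "\<beta> * (real n)\<^sup>2 <= 24 / 10 ^ 17 * r\<^sup>2" using \<beta>n mult_right_mono[OF kk(1), of "r\<^sup>2"] r2p by linarith
    hence "\<beta> <= 24 / 10 ^ 17 * r\<^sup>2 / (real n)\<^sup>2" using np by (simp add: pos_le_divide_eq)
    from mult_right_mono[OF this, of "r\<^sup>2 / 3"] show ?thesis using r2p by (simp add: field_simps)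
   qed
   have v2: "T\<^sup>2 * d * r ^ 4 / (12 * N\<^sup>2) <= 1 / 10 ^ 17 * (r\<^sup>2 * r\<^sup>2 / (real n)\<^sup>2)"
   proof -
    have "T\<^sup>2 * (real d * (real n)\<^sup>2) <= T\<^sup>2 * (real n * (real n)\<^sup>2)" by (intro mult_left_mono mult_right_mono dn) auto
    moreover have "real n * (real n)\<^sup>2 = real n ^ 3" by (simp add: power2_eq_square power3_eq_cube)
    ultimately have "T\<^sup>2 * d * (real n)\<^sup>2 <= T\<^sup>2 * real n ^ 3" by (simp only: mult.assoc)
    also have "... <= N\<^sup>2 * (1 / k)" using TN by simp
    also have "... <= N\<^sup>2 * (1 / 10 ^ 17)" by (intro mult_left_mono kk(2)) simp
    finally have "T\<^sup>2 * d <= N\<^sup>2 * (1 / 10 ^ 17) / (real n)\<^sup>2" using np by (simp add: pos_le_divide_eq)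
    hence "T\<^sup>2 * d * (r ^ 4 / (12 * N\<^sup>2)) <= N\<^sup>2 * (1 / 10 ^ 17) / (real n)\<^sup>2 * (r ^ 4 / (12 * N\<^sup>2))"
     by (rule mult_right_mono) simp
    also have "... = 1 / 12 * (1 / 10 ^ 17 * (r\<^sup>2 * r\<^sup>2 / (real n)\<^sup>2))"
     using Np by (simp add: field_simps power2_eq_square power4_eq_xxxx)
    also have "... <= 1 * (1 / 10 ^ 17 * (r\<^sup>2 * r\<^sup>2 / (real n)\<^sup>2))" by (intro mult_right_mono) auto
    finally show ?thesis by simp
   qed
   have "v <= (8 / 10 ^ 17 + 1 / 10 ^ 17) * (r\<^sup>2 * r\<^sup>2 / (real n)\<^sup>2)" unfolding v_def distrib_right using v1 v2 by linarith
   also have "... <= 1 / 10 ^ 15 * (r\<^sup>2 * r\<^sup>2 / (real n)\<^sup>2)" by (intro mult_right_mono) auto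
   also have "... = 1 / 10 ^ 5 * \<theta>\<^sup>2" unfolding \<theta>_def by (simp add: power_divide power_mult_distrib power2_eq_square)
   finally show ?thesis .
  qed
  have \<theta>2: "\<theta>\<^sup>2 > 0" using \<theta>p by simp
  have r1p: "r1 > 0" unfolding r1_def using rp np by (simp add: add_pos_nonneg)
  have r1sq: "r1\<^sup>2 = r\<^sup>2 + 3 * \<theta>"
   unfolding r1_def \<theta>_def power_mult_distrib using np by (simp add: distrib_left)
  have r1b: "r\<^sup>2 + d * \<beta> / 4 + T\<^sup>2 * (real d)\<^sup>2 * r\<^sup>2 / (4 * N\<^sup>2) + \<theta> <= r1\<^sup>2"
  proof -
   have s1: "d * \<beta> / 4 <= \<theta>"
   proof -
    have "\<beta> * (real n)\<^sup>2 <= 24 / 10 ^ 17 * r\<^sup>2" using \<beta>n mult_right_mono[OF kk(1), of "r\<^sup>2"] r2p by linarith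
    also have "... <= 8 / 10 ^ 5 * r\<^sup>2" by (intro mult_right_mono) auto
    finally have "\<beta> * real n * real n / 8 <= r\<^sup>2 / 10 ^ 5" by (simp add: power2_eq_square)
    hence "\<beta> * real n / 8 <= r\<^sup>2 / 10 ^ 5 / real n" using np by (simp add: pos_le_divide_eq)
    thus ?thesis by (simp add: \<theta>_def rn mult_ac)
   qed
   have s2: "T\<^sup>2 * (real d)\<^sup>2 * r\<^sup>2 / (4 * N\<^sup>2) <= \<theta>"
   proof -
    have "T\<^sup>2 * ((real d)\<^sup>2 * real n) <= T\<^sup>2 * ((real n)\<^sup>2 * real n)" by (intro mult_left_mono mult_right_mono power_mono dn) auto
    moreover have "(real n)\<^sup>2 * real n = real n ^ 3" by (simp add: power2_eq_square power3_eq_cube)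
    ultimately have "T\<^sup>2 * (real d)\<^sup>2 * real n <= T\<^sup>2 * real n ^ 3" by (simp only: mult.assoc)
    also have "... <= N\<^sup>2 * (1 / k)" using TN by simp
    also have "... <= N\<^sup>2 * (1 / 10 ^ 17)" by (intro mult_left_mono kk(2)) simp
    also have "... <= N\<^sup>2 * (4 / 10 ^ 5)" by (intro mult_left_mono) auto
    finally have "T\<^sup>2 * (real d)\<^sup>2 <= N\<^sup>2 * (4 / 10 ^ 5) / real n" using np by (simp add: pos_le_divide_eq)
    hence "T\<^sup>2 * (real d)\<^sup>2 * (r\<^sup>2 / (4 * N\<^sup>2)) <= N\<^sup>2 * (4 / 10 ^ 5) / real n * (r\<^sup>2 / (4 * N\<^sup>2))"
     by (rule mult_right_mono) simp
    also have "... = \<theta>" using Np np by (simp add: \<theta>_def field_simps)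
    finally show ?thesis by simp
   qed
   show ?thesis unfolding r1sq using s1 s2 by linarith
  qed
  have "real (md n) * (1 - v / \<theta>\<^sup>2) * (\<Prod>i<dim2 n. C i i)\<^sup>2 * T ^ dim2 n <= unit_ball_vol (2 * real (dim2 n)) * r1 ^ (2 * dim2 n)"
  proof (rule averaging_shifts[where C = C and \<beta> = \<beta> and N = "NN n" and r = r])
   show "EX x w. (EX j<dim2 n. x j ~= 0) &
    (ALL i<dim2 n. [w i = (\<Sum>k<dim2 n. int (A k) * shift k x i)] (mod int (NN n))) &
    real_of_int (q x) + (T / real (NN n))\<^sup>2 * real_of_int (q w) <= r\<^sup>2"
    if "A : {..<dim2 n} \<rightarrow>\<^sub>E {..<NN n}" for A
    using neg that unfolding d_def by (meson not_less)
   have "1 / 10 ^ 5 * \<theta>\<^sup>2 <= 1 * \<theta>\<^sup>2" by (intro mult_right_mono) auto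
   also have "1 * \<theta>\<^sup>2 = \<theta>\<^sup>2" by simp
   finally show "v <= \<theta>\<^sup>2" by (rule order_trans[OF v\<theta>])
   show "v = \<beta> * r\<^sup>2 / 3 + T\<^sup>2 * real (dim2 n) * r ^ 4 / (12 * (real (NN n))\<^sup>2)" by (simp add: v_def d_def N_def)
   show "r\<^sup>2 + real (dim2 n) * \<beta> / 4 + T\<^sup>2 * (real (dim2 n))\<^sup>2 * r\<^sup>2 / (4 * (real (NN n))\<^sup>2) + \<theta> <= r1\<^sup>2"
    using r1b by (simp only: d_def N_def)
  qed (use C form Tp d0(3) \<theta>p r1p in \<open>auto simp: \<beta>_def\<close>)
  hence avg: "real (md n) * (1 - v / \<theta>\<^sup>2) * (T ^ d * \<kappa>\<^sup>2) <= V * r1 ^ n"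
   unfolding d_def[symmetric] \<kappa>_def[symmetric] V_def rn n2[symmetric] by (simp add: mult_ac)
  have "r1 ^ n = (r1\<^sup>2) ^ d" by (simp add: n2 power_mult[symmetric])
  also have "... = (r\<^sup>2) ^ d * (1 + 3 / (10 ^ 5 * real n)) ^ d"
  proof -
   have "r1\<^sup>2 = r\<^sup>2 * (1 + 3 / (10 ^ 5 * real n))" unfolding r1sq \<theta>_def by (simp add: distrib_left)
   thus ?thesis by (simp add: power_mult_distrib)
  qed
  also have "(1 + 3 / (10 ^ 5 * real n)) ^ d <= exp (3 / (10 ^ 5 * real n)) ^ d"
   using np by (intro power_mono exp_ge_add_one_self) (auto intro: add_nonneg_nonneg)
  also have "exp (3 / (10 ^ 5 * real n)) ^ d = exp (1.5 / 10 ^ 5)"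
  proof -
   have "real d * (3 / (10 ^ 5 * real n)) = 1.5 / 10 ^ 5" using np by (simp add: rn field_simps)
   thus ?thesis by (simp only: exp_of_nat_mult[symmetric])
  qed
  finally have "r1 ^ n <= r ^ n * exp (1.5 / 10 ^ 5)" unfolding r2Q rQ using Qp by simp
  hence "V * r1 ^ n <= V * r ^ n * exp (1.5 / 10 ^ 5)" using Vp by (simp add: mult.assoc)
  also have "V * r ^ n * exp (1.5 / 10 ^ 5) = real (md n) * (0.9999 * exp (1.5 / 10 ^ 5)) * (T ^ d * \<kappa>\<^sup>2)" unfolding Vr by simp
  finally have "real (md n) * (1 - v / \<theta>\<^sup>2) * (T ^ d * \<kappa>\<^sup>2) <= real (md n) * (0.9999 * exp (1.5 / 10 ^ 5)) * (T ^ d * \<kappa>\<^sup>2)"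
   using avg by linarith
  moreover have "T ^ d * \<kappa>\<^sup>2 > 0" "real (md n) > 0" using Tp \<kappa>1 m2 by auto
  ultimately have fin: "1 - v / \<theta>\<^sup>2 <= 0.9999 * exp (1.5 / 10 ^ 5)"
   by (simp only: mult_le_cancel_right_pos mult_le_cancel_left_pos)
  have "v / \<theta>\<^sup>2 <= 1 / 10 ^ 5" using v\<theta> \<theta>2 by (simp add: pos_divide_le_eq)
  moreover have "exp (1.5 / 10 ^ 5) <= 1 + 1.5 / 10 ^ 5 + (1.5 / 10 ^ 5 :: real)\<^sup>2" by (rule exp_bound) auto
  ultimately show False using fin by (simp add: power2_eq_square)
 qed
 have "unit_ball_vol n * r ^ n / (real (TT n) ^ dim2 n * (\<Prod>i<dim2 n. C i i)\<^sup>2) = 0.9999 * md n"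
 proof -
  have "T ^ d * \<kappa>\<^sup>2 ~= 0" using Tp \<kappa>1 by auto
  hence "V * r ^ n / (T ^ d * \<kappa>\<^sup>2) = 0.9999 * md n" unfolding Vr by (rule nonzero_mult_div_cancel_right)
  thus ?thesis by (simp only: V_def T_def d_def \<kappa>_def)
 qed
 thus ?thesis using rp c1 c2 c3 c4 unfolding d_def T_def by blast
qed

end

section \<open>Running time and conclusion\<close>

lemma ln_half_lg_power:
 assumes "Z > 0" shows "ln (2 ^ (lg Z div 2 + 1)) <= (ln 8 + ln (real Z)) / 2"
proof -
 define X where "X = (2::real) ^ (lg Z div 2 + 1)"
 have "real ((2 ^ (lg Z div 2 + 1))\<^sup>2) <= real (8 * Z)" using half_lg_power_le[OF assms] by (simp only: of_nat_le_iff)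
 hence "X\<^sup>2 <= 8 * real Z" by (simp add: X_def)
 moreover have "X > 0" by (simp add: X_def)
 ultimately have "ln (X\<^sup>2) <= ln (8 * real Z)" using assms by (subst ln_le_cancel_iff) auto
 thus ?thesis using assms \<open>X > 0\<close> unfolding X_def[symmetric] by (simp add: ln_mult ln_realpow)
qed

context algorithm_input
begin

text \<open>\<open>j\<close> is free: dividing by it shows that the logarithm of \<open>DD n\<close>
  is o(ln n).\<close>

lemma omega_DD: "real j * ln (real (DD n)) <= 2 ^ j + ln (real n)"
proof -
 have "real (DD n) ^ j = (2 ^ j) ^ card (prime_factors (md n))" by (simp add: DD_eq power_mult[symmetric] mult.commute)
 also have "... <= exp (2 ^ j) * totient (md n)" by (rule omega_bound) (use md_props in auto)
 also have "... <= exp (2 ^ j) * real n"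
 proof (rule mult_left_mono)
  have "totient (md n) <= n" using md_props(2) by linarith
  thus "real (totient (md n)) <= real n" by simp
 qed simp
 finally have "real (DD n) ^ j <= exp (2 ^ j) * real n" .
 moreover have "real (DD n) > 0" by (simp add: DD_eq)
 ultimately have "ln (real (DD n) ^ j) <= ln (exp (2 ^ j) * real n)" using n4 by (subst ln_le_cancel_iff) auto
 thus ?thesis using n4 \<open>real (DD n) > 0\<close> by (simp add: ln_realpow ln_mult)
qed

lemma DD_le: "DD n <= n ^ 4"
proof -
 have "ln (real (DD n)) <= 2 + ln (real n)" using omega_DD[of 1] by simp
 also have "2 <= 3 * ln (real n)"
 proof -
  have "ln (4::real) <= ln (real n)" using n4 by (subst ln_le_cancel_iff) auto
  moreover have "ln (4::real) = 2 * ln 2" using ln_realpow[of "2::real" 2] by simp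
  ultimately show ?thesis using ln2_ge_two_thirds by linarith
 qed
 finally have "ln (real (DD n)) <= ln (real n ^ 4)" using n4 by (simp add: ln_realpow)
 hence "real (DD n) <= real n ^ 4" using n4 by (subst (asm) ln_le_cancel_iff) (auto simp: DD_eq)
 hence "real (DD n) <= real (n ^ 4)" by simp
 thus ?thesis by (simp only: of_nat_le_iff)
qed

text \<open>To leading order each of the \<open>d\<close> coordinates costs 5/2 ln n for the
  multiplier and 1/2 ln n for the remainder in the code of \<open>x\<close>, together 3 d ln n = 1.5
  n ln n.\<close>

lemma ln_time:
 "ln (real (2 ^ (bb n * dim2 n) * 2 ^ Lx n * n ^ c)) \<le>
  1.5 * real n * ln (real n) + real n * (ln (real (DD n)) + ln (real (lg n)) + 7) + c * ln (real n)"
proof -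
 define d where "d = dim2 n"
 have rn: "real n = 2 * real d" using md_props(6) unfolding d_def by (metis of_nat_mult of_nat_numeral)
 define l b k where "l = ln (real n)" and "b = ln (real (DD n))" and "k = ln (real (lg n))"
 have np: "n > 0" "DD n > 0" using n4 by (auto simp: DD_eq)
 have lp: "lg n > 0" using lg_bounds(2)[OF np(1)] np(1) by (cases "lg n") auto
 have ln8: "ln (8::real) = 3 * ln 2" using ln_realpow[of "2::real" 3] by simp
 have T: "TT n > 0" "ln (real (TT n)) = l + b + k" using np lp by (simp_all add: TT_def ln_mult l_def b_def k_def)
 have Z1: "n * n * n * (TT n * TT n) * lg n > 0" using np lp T by simp
 have "ln (real (n * n * n * (TT n * TT n) * lg n)) = 3 * l + 2 * (l + b + k) + k"
  using np lp T by (simp add: ln_mult l_def k_def)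
 hence B: "ln (2 ^ bb n) <= (3 * ln 2 + 5 * l + 2 * b + 3 * k) / 2"
  using ln_half_lg_power[OF Z1] unfolding bb_def[symmetric] ln8 by (simp add: algebra_simps)
 have Z2: "n * (DD n * DD n) * lg n > 0" using np lp by simp
 have "ln (real (n * (DD n * DD n) * lg n)) = l + 2 * b + k"
  using np lp by (simp add: ln_mult l_def b_def k_def)
 hence S: "ln (2 ^ bs n) <= (3 * ln 2 + l + 2 * b + k) / 2"
  using ln_half_lg_power[OF Z2] unfolding bs_def[symmetric] ln8 by (simp add: algebra_simps)
 have l2: "ln (2::real) <= 1" using ln_2_less_1 by simp
 have "ln (real (2 ^ (bb n * dim2 n) * 2 ^ Lx n * n ^ c)) = real d * ln (2 ^ bb n) + (real (2 * Lq n) * ln 2 + real d * ln (2 ^ bs n)) + c * l"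
  using np by (simp add: ln_mult ln_realpow Lx_def d_def l_def algebra_simps)
 also have "... <= real d * ((3 * ln 2 + 5 * l + 2 * b + 3 * k) / 2) + (real (2 * Lq n) * 1 + real d * ((3 * ln 2 + l + 2 * b + k) / 2)) + c * l"
  by (intro add_mono mult_left_mono B S l2) auto
 also have "... = real d * (3 * ln 2 + 3 * l + 2 * b + 2 * k) + 5 * real n + c * l"
  by (simp add: Lq_def d_def[symmetric] rn algebra_simps add_divide_distrib)
 also have "... <= real d * (3 * 1 + 3 * l + 2 * b + 2 * k) + 5 * real n + c * l"
  by (intro add_right_mono mult_left_mono add_mono l2) auto
 also have "... = 1.5 * real n * l + real n * (b + k + 6.5) + c * l" by (simp add: rn algebra_simps)
 also have "... <= 1.5 * real n * l + real n * (b + k + 7) + c * l" by (simp add: mult_left_mono)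
 finally show ?thesis unfolding l_def b_def k_def .
qed

lemma ln_lg_le: "ln (real (lg n)) <= ln (2 * ln (real n) + 2)"
proof -
 have np: "n > 0" using n4 by simp
 have lp: "lg n > 0" using lg_bounds(2)[OF np] np by (cases "lg n") auto
 have "real (2 ^ lg n) <= real (2 * n)" using lg_bounds(1)[OF np] by (simp only: of_nat_le_iff)
 hence "ln (2 ^ lg n) <= ln (2 * real n)" using np by (subst ln_le_cancel_iff) auto
 hence le: "real (lg n) * ln 2 <= ln 2 + ln (real n)" using np by (simp add: ln_realpow ln_mult)
 have "real (lg n) * (2 / 3) <= real (lg n) * ln 2" using ln2_ge_two_thirds by (intro mult_left_mono) auto
 hence "real (lg n) * (2 / 3) <= 1 + ln (real n)" using le ln_2_less_1 by linarith
 moreover have "0 <= ln (real n)" using np by simp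
 ultimately have "real (lg n) <= 2 * ln (real n) + 2" by linarith
 thus ?thesis using lp by (subst ln_le_cancel_iff) auto
qed

lemma constructs:
 assumes "n >= 16" "10 ^ 17 <= real (lg n)"
  and ex: "exec P (input n) t s" "s 1 = concat (map (%k. encode_rat (of_nat (entry n (best n) (k div n) (k mod n)))) [0..<n * n])"
 shows "EX L. constructs_lattice P n t L & packing_density n L >= 0.9999 * real (md n) / 2 ^ n"
proof -
 obtain C where C: "upper_tri (dim2 n) C" "!!i. i < dim2 n ==> 1 <= C i i" "!!i. i < dim2 n ==> (C i i)\<^sup>2 <= DD n"
  and form: "!!v. (\<Sum>i<dim2 n. (lin (dim2 n) C v i)\<^sup>2) = (\<Sum>j<dim2 n. \<Sum>k<dim2 n. real (Gm j k) * (v j * v k))"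
  using gram_factor unfolding DD_eq by (auto simp only: of_nat_power of_nat_numeral)
 obtain r where r: "r > 0" "unit_ball_vol n * r ^ n / (real (TT n) ^ dim2 n * (\<Prod>i<dim2 n. C i i)\<^sup>2) = 0.9999 * md n"
  "4 * r\<^sup>2 <= (real (TT n))\<^sup>2" "2 * r\<^sup>2 <= real (n * n * (DD n * DD n) * lg n)" "1 <= r\<^sup>2"
  "EX a:{..<dim2 n} \<rightarrow>\<^sub>E {..<NN n}. ALL x w. (EX j<dim2 n. x j ~= 0) -->
   (ALL i<dim2 n. [w i = (\<Sum>k<dim2 n. int (a k) * shift k x i)] (mod int (NN n))) -->
   r\<^sup>2 < real_of_int (q x) + (real (TT n) / real (NN n))\<^sup>2 * real_of_int (q w)"
  using ex_radius[OF assms(1,2) C form] by blast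
 have T0: "TT n > 0"
 proof (rule ccontr)
  assume "\<not> TT n > 0"
  thus False using r(1,3) by simp
 qed
 obtain L B G where L: "is_zbasis n L B" "is_lattice n L" "map_mat real_of_rat G = transpose_mat B * B"
  "encode_mat G = concat (map (%k. encode_rat (of_nat (entry n (best n) (k div n) (k mod n)))) [0..<n * n])"
  "packing_density n L >= unit_ball_vol n * r ^ n / (2 ^ n * (real (TT n) ^ dim2 n * (\<Prod>i<dim2 n. C i i)\<^sup>2))"
  using best_density[OF C(1) form r(1) best_lattice[OF r(3,4,5,6)] T0] by blast
 have "constructs_lattice P n t L" unfolding constructs_lattice_def using L ex by metis
 moreover have "unit_ball_vol n * r ^ n / (2 ^ n * (real (TT n) ^ dim2 n * (\<Prod>i<dim2 n. C i i)\<^sup>2)) =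
   unit_ball_vol n * r ^ n / (real (TT n) ^ dim2 n * (\<Prod>i<dim2 n. C i i)\<^sup>2) / 2 ^ n" by simp
 ultimately show ?thesis using L(5) unfolding r(2) by auto
qed

end

theorem theorem1:
  shows "\<exists>(N :: nat set) (P :: program) (\<eta> :: nat \<Rightarrow> real).
    infinite N \<and> (\<forall>n\<in>N. n > 0) \<and> (\<eta> \<longlongrightarrow> 0) (inf sequentially (principal N)) \<and>
    (\<forall>n\<in>N. \<exists>L t. constructs_lattice P n t L \<and>
       packing_density n L \<ge> 0.89 * real n * ln (ln (real n)) / 2 ^ n \<and>
       real t \<le> exp (1.5 * real n * ln (real n) * (1 + \<eta> n)))"
proof -
 obtain M :: nat where M: "10 ^ 17 <= real M" using real_arch_simple by blast
 \<comment> \<open>\<open>2 ^ M <= n\<close> makes \<open>lg n\<close> exceed 10^17. The modulus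
   \<open>m\<close> has to exist only; \<open>md n\<close> is at least as large.\<close>
 define N where "N = {n. n >= 16 & 2 ^ M <= n & (EX m. squarefree m & 2 * totient m = n & m <= n * n &
  0.8901 * real n * ln (ln (real n)) <= real m)}"
 have inN: "algorithm_input n" "n >= 16" "10 ^ 17 <= real (lg n)" "0.8901 * real n * ln (ln (real n)) <= real (md n)" if "n : N" for n
 proof -
  from that obtain m where n: "n >= 16" "2 ^ M <= n"
   and m: "squarefree m" "2 * totient m = n" "m <= n * n" "0.8901 * real n * ln (ln (real n)) <= real m"
   by (auto simp: N_def)
  show ai: "algorithm_input n" using n(1) m by unfold_locales auto
  show "n >= 16" by (rule n(1))
  have "(2::nat) ^ M < 2 ^ lg n" using lg_bounds(2)[of n] n by linarith
  hence "M < lg n" by (rule power_less_imp_less_exp[rotated]) simp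
  thus "10 ^ 17 <= real (lg n)" using M by (meson less_imp_le of_nat_le_iff order_trans)
  have "m <= md n" using algorithm_input.md_ge[OF ai m(1,2,3)] by blast
  thus "0.8901 * real n * ln (ln (real n)) <= real (md n)" using m(4) by (meson of_nat_le_iff order_trans)
 qed
 have inf: "infinite N" unfolding infinite_nat_iff_unbounded
 proof
  fix B :: nat
  obtain m where m: "squarefree m" "2 * totient m > max B (max 16 (2 ^ M))"
   "0.8901 * real (2 * totient m) * ln (ln (real (2 * totient m))) <= real m"
   using many_good_moduli[of "max B (max 16 (2 ^ M))"] by blast
  have "m <= 2 * totient m * (2 * totient m)" using squarefree_le_totient[OF m(1)] by (simp add: power2_eq_square)
  hence "2 * totient m : N" using m unfolding N_def by (intro CollectI conjI exI[of _ m]) auto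
  thus "EX n>B. n : N" using m(2) by (intro exI[of _ "2 * totient m"]) auto
 qed
 have DDc: "EX c. ALL n:N. DD n <= n ^ c" using algorithm_input.DD_le inN(1) by blast
 have N2: "2 <= n" if "n : N" for n using inN(2)[OF that] by linarith
 have "EX P c. ALL n:N. EX t s. exec P (input n) t s &
   s 1 = concat (map (%k. encode_rat (of_nat (entry n (best n) (k div n) (k mod n)))) [0..<n * n]) &
   t <= 2 ^ (bb n * dim2 n) * 2 ^ Lx n * n ^ c"
  by (rule algorithm_program[OF N2 DDc])
 then obtain P c where P: "ALL n:N. EX t s. exec P (input n) t s &
   s 1 = concat (map (%k. encode_rat (of_nat (entry n (best n) (k div n) (k mod n)))) [0..<n * n]) &
   t <= 2 ^ (bb n * dim2 n) * 2 ^ Lx n * n ^ c"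
  by (elim exE) (rule that)
 define W where "W n = real (2 ^ (bb n * dim2 n) * 2 ^ Lx n * n ^ c)" for n
 \<comment> \<open>The exact relative excess of the time bound, cut off at 0, so that only its limit
   remains to be estimated.\<close>
 define \<eta> where "\<eta> n = max 0 (ln (W n) / (1.5 * real n * ln (real n)) - 1)" for n
 \<comment> \<open>For each fixed \<open>j\<close> the right side tends to
   \<open>1 / j\<close>.\<close>
 have \<eta>_le: "\<eta> n <= 1 / real j + (2 ^ j / real j / ln (real n) + ((ln (2 * ln (real n) + 2) + 7) / ln (real n) + real c / real n))"
  if n: "n : N" and j: "j > 0" for n j
 proof -
  interpret algorithm_input n by (rule inN(1)[OF n])
  have l: "ln (real n) > 1"
  proof -
   have "exp 1 < real n" using exp_le inN(2)[OF n] by linarith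
   hence "ln (exp 1) < ln (real n)" using inN(2)[OF n] by (subst ln_less_cancel_iff) auto
   thus ?thesis by simp
  qed
  define l where "l = ln (real n)"
  have l1: "l > 1" using l by (simp add: l_def)
  have np: "real n > 0" using inN(2)[OF n] by simp
  define D where "D = 1.5 * real n * l"
  have Dp: "D > 0" using l1 np by (simp add: D_def)
  define R where "R = ln (real (DD n)) + ln (real (lg n)) + 7"
  have R: "R <= (2 ^ j + l) / real j + ln (2 * l + 2) + 7"
  proof -
   have "ln (real (DD n)) <= (2 ^ j + l) / real j"
    using omega_DD[of j] j by (simp add: pos_le_divide_eq mult.commute l_def)
   thus ?thesis using ln_lg_le unfolding R_def l_def by linarith
  qed
  have Rn: "0 <= R"
  proof -
   have "0 <= ln (real (DD n))" by (simp add: DD_eq)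
   moreover have "0 <= ln (real (lg n))" using inN(3)[OF n] by (intro ln_ge_zero) (rule order_trans[rotated], assumption, simp)
   ultimately show ?thesis by (simp add: R_def)
  qed
  have "ln (W n) <= D + real n * R + real c * l" using ln_time[of c] unfolding W_def D_def l_def R_def by simp
  hence "ln (W n) / D <= (D + (real n * R + real c * l)) / D" using Dp by (intro divide_right_mono) auto
  also have "... = 1 + (real n * R + real c * l) / D" unfolding add_divide_distrib[of D] using Dp by simp
  finally have "ln (W n) / D - 1 <= (real n * R + real c * l) / D" by linarith
  also have "... <= (real n * R + real c * l) / (real n * l)"
   using Rn l1 np by (intro divide_left_mono) (auto simp: D_def)
  also have "... = R / l + real c / real n" using l1 np by (simp add: field_simps)
  also have "... <= ((2 ^ j + l) / real j + ln (2 * l + 2) + 7) / l + real c / real n"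
   using R l1 by (intro add_right_mono divide_right_mono) auto
  also have "... = 1 / real j + (2 ^ j / real j / l + ((ln (2 * l + 2) + 7) / l + real c / real n))"
   using l1 j by (simp add: field_simps)
  finally have "ln (W n) / D - 1 <= 1 / real j + (2 ^ j / real j / l + ((ln (2 * l + 2) + 7) / l + real c / real n))" .
  moreover have "0 <= 1 / real j + (2 ^ j / real j / l + ((ln (2 * l + 2) + 7) / l + real c / real n))"
   using l1 by (intro add_nonneg_nonneg divide_nonneg_nonneg ln_ge_zero) auto
  ultimately show ?thesis unfolding \<eta>_def D_def l_def by simp
 qed
 have lim: "(\<eta> \<longlongrightarrow> 0) (inf sequentially (principal N))"
 proof (rule tendstoI)
  fix \<epsilon> :: real assume \<epsilon>: "\<epsilon> > 0"
  obtain j :: nat where j: "2 / \<epsilon> < real j" using reals_Archimedean2 by blast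
  hence j0: "j > 0" using \<epsilon> by (cases j) (auto simp: field_simps)
  have j1: "1 / real j < \<epsilon> / 2" using j \<epsilon> j0 by (simp add: field_simps)
  define a where "a = (2::real) ^ j / real j"
  define c' where "c' = real c"
  have "((%n::nat. a / ln (real n) + ((ln (2 * ln (real n) + 2) + 7) / ln (real n) + c' / real n)) \<longlongrightarrow> 0) sequentially"
  proof -
   have 1: "((%n::nat. 1 / ln (real n)) \<longlongrightarrow> 0) sequentially" by real_asymp
   have 2: "((%n::nat. (ln (2 * ln (real n) + 2) + 7) / ln (real n)) \<longlongrightarrow> 0) sequentially" by real_asymp
   have 3: "((%n::nat. 1 / real n) \<longlongrightarrow> 0) sequentially" by real_asymp
   have "((%n::nat. a * (1 / ln (real n)) + ((ln (2 * ln (real n) + 2) + 7) / ln (real n) + c' * (1 / real n))) \<longlongrightarrow> a * 0 + (0 + c' * 0)) sequentially"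
    by (intro tendsto_intros 1 2 3)
   thus ?thesis by simp
  qed
  hence "eventually (%n::nat. a / ln (real n) + ((ln (2 * ln (real n) + 2) + 7) / ln (real n) + c' / real n) < \<epsilon> / 2) sequentially"
   using \<epsilon> by (intro order_tendstoD(2)) auto
  hence "eventually (%n. n : N --> dist (\<eta> n) 0 < \<epsilon>) sequentially"
  proof eventually_elim
   case (elim n)
   show ?case
   proof
    assume n: "n : N"
    have "0 <= \<eta> n" by (simp add: \<eta>_def)
    moreover have "\<eta> n < \<epsilon>" using \<eta>_le[OF n j0] elim j1 unfolding a_def[symmetric] c'_def by linarith
    ultimately show "dist (\<eta> n) 0 < \<epsilon>" by simp
   qed
  qed
  thus "eventually (%n. dist (\<eta> n) 0 < \<epsilon>) (inf sequentially (principal N))"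
   by (simp add: eventually_inf_principal)
 qed
 have main: "EX L t. constructs_lattice P n t L &
    packing_density n L >= 0.89 * real n * ln (ln (real n)) / 2 ^ n &
    real t <= exp (1.5 * real n * ln (real n) * (1 + \<eta> n))" if n: "n : N" for n
 proof -
  interpret algorithm_input n by (rule inN(1)[OF n])
  obtain t s where ts: "exec P (input n) t s"
   "s 1 = concat (map (%k. encode_rat (of_nat (entry n (best n) (k div n) (k mod n)))) [0..<n * n])"
   "t <= 2 ^ (bb n * dim2 n) * 2 ^ Lx n * n ^ c" using bspec[OF P n] by (elim exE conjE) (rule that)
  obtain L where L: "constructs_lattice P n t L" "packing_density n L >= 0.9999 * real (md n) / 2 ^ n"
   using constructs[OF inN(2)[OF n] inN(3)[OF n] ts(1,2)] by blast
  have l1: "ln (real n) > 1"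
  proof -
   have "exp 1 < real n" using exp_le inN(2)[OF n] by linarith
   hence "ln (exp 1) < ln (real n)" using inN(2)[OF n] by (subst ln_less_cancel_iff) auto
   thus ?thesis by simp
  qed
  hence X: "0 <= real n * ln (ln (real n))" by simp
  \<comment> \<open>0.9999 * 0.8901 = 0.89001..., so both losses are covered.\<close>
  have "0.89 * (real n * ln (ln (real n))) <= 0.9999 * 0.8901 * (real n * ln (ln (real n)))"
   using X by (intro mult_right_mono) auto
  also have "... = 0.9999 * (0.8901 * real n * ln (ln (real n)))" by simp
  also have "... <= 0.9999 * real (md n)" using inN(4)[OF n] by (intro mult_left_mono) auto
  finally have "0.89 * real n * ln (ln (real n)) / 2 ^ n <= 0.9999 * real (md n) / 2 ^ n"
   by (intro divide_right_mono) (simp_all only: mult.assoc zero_le_power zero_le_numeral)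
  hence dens: "packing_density n L >= 0.89 * real n * ln (ln (real n)) / 2 ^ n" using L(2) by linarith
  have Wp: "W n > 0" using n4 by (simp add: W_def)
  have Dp: "1.5 * real n * ln (real n) > 0" using l1 n4 by simp
  have "ln (W n) / (1.5 * real n * ln (real n)) <= 1 + \<eta> n" unfolding \<eta>_def by simp
  hence "ln (W n) <= (1 + \<eta> n) * (1.5 * real n * ln (real n))" using Dp by (simp only: pos_divide_le_eq)
  hence "exp (ln (W n)) <= exp (1.5 * real n * ln (real n) * (1 + \<eta> n))" by (simp only: exp_le_cancel_iff mult.commute)
  moreover have "real t <= W n" unfolding W_def using ts(3) by (simp only: of_nat_le_iff)
  ultimately have "real t <= exp (1.5 * real n * ln (real n) * (1 + \<eta> n))" using Wp by simp
  thus ?thesis using L(1) dens by blast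
 qed
 show ?thesis
 proof (rule exI[of _ N], rule exI[of _ P], rule exI[of _ \<eta>], intro conjI)
  show "ALL n:N. n > 0" using inN(2) by fastforce
  show "ALL n:N. EX L t. constructs_lattice P n t L &
    packing_density n L >= 0.89 * real n * ln (ln (real n)) / 2 ^ n &
    real t <= exp (1.5 * real n * ln (real n) * (1 + \<eta> n))" using main by (rule ballI)
 qed (rule inf, rule lim)
qed

end
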